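(* Let $n$ be a positive integer, let $N$ be a unitary invariant norm which is not a constant multiple of the Frobenius norm, and let $f\colon \mathbb{T}\to\mathbb{C}$ be a bounded function such that: (f1) $f(z)=0$ if and only if $z=1$; (f2) $f$ is conformal in a neighbourhood of $1$; (f3) $f$ is continuous on $\mathbb{T}\setminus\{-1\}$; (f4) $f(-1)=\lim_{t\uparrow\pi}f(e^{\mathrm{i}t})$; (f5) the limit $\lim_{t\downarrow-\pi}f(e^{\mathrm{i}t})$ is different from $0$. For $A,B\in SO(n)$ put $d_{N,f}(A,B)=N(f(A^{-1}B))$. Then a map $\phi\colon SO(n)\to SO(n)$ satisfies $$d_{N,f}(\phi(A),\phi(B))=d_{N,f}(A,B)\qquad\text{for all } A,B\in SO(n)$$ if and only if there exists an orthogonal matrix $Q\in O(n)$ such that $\phi$ is of one of the following forms: (a) $\phi(A)=\phi(I)QAQ^{-1}$ for all $A\in SO(n)$; (b) $\phi(A)=\phi(I)QA^{-1}Q^{-1}$ for all $A\in SO(n)$; (c) $n=4$ and $\phi(A)=\phi(I)Q\exp(\widetilde{X})Q^{-1}$ for all $A\in SO(4)$ and $X\in\mathbb{K}_4(\mathbb{R})$ such that $\exp(X)=A$; (d) $n=4$ and $\phi(A)=\phi(I)Q\exp(-\widetilde{X})Q^{-1}$ for all $A\in SO(4)$ and $X\in\mathbb{K}_4(\mathbb{R})$ such that $\exp(X)=A$.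
   Context: $\mathbb{T}$ is the unit circle in $\mathbb{C}$. $O(n)$ and $SO(n)$ are the groups of real orthogonal $n\times n$ matrices and of those with determinant $1$; $I$ is the identity matrix; $\mathbb{K}_n(\mathbb{R})$ is the space of real skew-symmetric $n\times n$ matrices, and $\exp\colon\mathbb{K}_n(\mathbb{R})\to SO(n)$ is the (surjective) matrix exponential. For $X\in\mathbb{K}_4(\mathbb{R})$, $\widetilde{X}$ is the matrix obtained from $X$ by interchanging its $(1,4)$ and $(2,3)$ entries and interchanging its $(4,1)$ and $(3,2)$ entries. A unitary invariant norm is a norm $N$ on the complex $n\times n$ matrices with $N(UXV)=N(X)$ for all matrices $X$ and all unitary $U,V$. For $A\in SO(n)$, which is a normal matrix with spectrum in $\mathbb{T}$, $f(A)$ is defined by the usual Borel function calculus: if $A=U\,\mathrm{diag}(z_1,\dots,z_n)U^{*}$ with $U$ unitary, then $f(A)=U\,\mathrm{diag}(f(z_1),\dots,f(z_n))U^{*}$. "Conformal in a neighbourhood of $1$" means that near $1$ the function $f$ is given by a convergent power series in $z-1$ with nonzero first-order coefficient; since $f(1)=0$, this reads $f(z)=\sum_{k\ge1}a_k(z-1)^k$ with $a_1\neq0$, for $z\in\mathbb{T}$ near $1$. *)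

theory Defs
  imports
    "Jordan_Normal_Form.Schur_Decomposition"
    "Jordan_Normal_Form.Determinant"
    "Jordan_Normal_Form.Gauss_Jordan_Elimination"
    "HOL-Analysis.Elementary_Metric_Spaces"
begin

section \<open>Matrix groups\<close>

text \<open>
  Orthogonality is spelled out, because the library's \<^const>\<open>orthogonal_mat\<close> only requires
  pairwise orthogonal nonzero columns, not normalised ones.
\<close>

definition O_group :: "nat \<Rightarrow> real mat set" where
  "O_group n = {A \<in> carrier_mat n n.
     A * transpose_mat A = 1\<^sub>m n \<and> transpose_mat A * A = 1\<^sub>m n}"

definition SO_group :: "nat \<Rightarrow> real mat set" where
  "SO_group n = {A \<in> O_group n. det A = 1}"

definition unitary_group :: "nat \<Rightarrow> complex mat set" where
  "unitary_group n = {U \<in> carrier_mat n n.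
     U * mat_adjoint U = 1\<^sub>m n \<and> mat_adjoint U * U = 1\<^sub>m n}"

definition skew_mats :: "nat \<Rightarrow> real mat set" where
  "skew_mats n = {X \<in> carrier_mat n n. transpose_mat X = - X}"

text \<open>The inverse matrix; the value is meaningful for invertible square matrices only.\<close>

definition inv_mat :: "'a :: field mat \<Rightarrow> 'a mat" where
  "inv_mat A = the (mat_inverse A)"

definition exp_mat :: "real mat \<Rightarrow> real mat" where
  "exp_mat X = mat (dim_row X) (dim_row X) (\<lambda>(i, j). \<Sum>k. (X ^\<^sub>m k) $$ (i, j) / fact k)"

text \<open>
  Indices start at 0, so the entries (1,4), (2,3), (4,1), (3,2) of the usual numbering are
  (0,3), (1,2), (3,0), (2,1) here.
\<close>

definition tilde_mat :: "real mat \<Rightarrow> real mat" where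
  "tilde_mat X = mat 4 4 (\<lambda>p.
     if p = (0, 3) then X $$ (1, 2)
     else if p = (1, 2) then X $$ (0, 3)
     else if p = (3, 0) then X $$ (2, 1)
     else if p = (2, 1) then X $$ (3, 0)
     else X $$ p)"

section \<open>Norms on complex matrices\<close>

definition matrix_norm_on :: "nat \<Rightarrow> (complex mat \<Rightarrow> real) \<Rightarrow> bool" where
  "matrix_norm_on n N \<longleftrightarrow>
     (\<forall>X \<in> carrier_mat n n. 0 \<le> N X) \<and>
     (\<forall>X \<in> carrier_mat n n. N X = 0 \<longleftrightarrow> X = 0\<^sub>m n n) \<and>
     (\<forall>X \<in> carrier_mat n n. \<forall>c. N (c \<cdot>\<^sub>m X) = norm c * N X) \<and>
     (\<forall>X \<in> carrier_mat n n. \<forall>Y \<in> carrier_mat n n. N (X + Y) \<le> N X + N Y)"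

definition unitary_invariant_norm :: "nat \<Rightarrow> (complex mat \<Rightarrow> real) \<Rightarrow> bool" where
  "unitary_invariant_norm n N \<longleftrightarrow> matrix_norm_on n N \<and>
     (\<forall>X \<in> carrier_mat n n. \<forall>U \<in> unitary_group n. \<forall>V \<in> unitary_group n. N (U * X * V) = N X)"

definition frobenius_norm :: "complex mat \<Rightarrow> real" where
  "frobenius_norm X = sqrt (\<Sum>i<dim_row X. \<Sum>j<dim_col X. (norm (X $$ (i, j)))\<^sup>2)"

definition multiple_of_frobenius :: "nat \<Rightarrow> (complex mat \<Rightarrow> real) \<Rightarrow> bool" where
  "multiple_of_frobenius n N \<longleftrightarrow> (\<exists>c. \<forall>X \<in> carrier_mat n n. N X = c * frobenius_norm X)"

section \<open>Function calculus on the unit circle\<close>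

text \<open>
  If \<open>A = U diag(z\<^sub>1, \<dots>, z\<^sub>n) U\<^sup>*\<close> with \<open>U\<close> unitary, then
  \<open>f(A) = U diag(f(z\<^sub>1), \<dots>, f(z\<^sub>n)) U\<^sup>*\<close>. This does not depend on the
  diagonalisation; see \<open>fun_calc_eq\<close> below.
\<close>

definition fun_calc :: "(complex \<Rightarrow> complex) \<Rightarrow> complex mat \<Rightarrow> complex mat" where
  "fun_calc f A = (THE B. \<exists>U \<in> unitary_group (dim_row A). \<exists>z.
     A = U * mat_diag (dim_row A) z * mat_adjoint U \<and>
     B = U * mat_diag (dim_row A) (\<lambda>i. f (z i)) * mat_adjoint U)"

lemma mat_adjoint_carrier:
  fixes U :: "complex mat"
  assumes "U \<in> carrier_mat n n"
  shows "mat_adjoint U \<in> carrier_mat n n"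
  using assms by (auto simp: mat_adjoint_def)

lemma fun_calc_eq:
  assumes U: "U \<in> unitary_group n"
    and A: "A = U * mat_diag n z * mat_adjoint U"
  shows "fun_calc f A = U * mat_diag n (\<lambda>i. f (z i)) * mat_adjoint U"
proof -
  have dim: "dim_row A = n"
    using U A by (auto simp: unitary_group_def)
  have uniq: "V * mat_diag n (\<lambda>i. f (w i)) * mat_adjoint V =
      U * mat_diag n (\<lambda>i. f (z i)) * mat_adjoint U"
    if V: "V \<in> unitary_group n" and AV: "A = V * mat_diag n w * mat_adjoint V" for V w
  proof -
    let ?U = "mat_adjoint U" and ?V = "mat_adjoint V"
    define W where "W = ?V * U"
    have c: "U \<in> carrier_mat n n" "V \<in> carrier_mat n n"
        "?U \<in> carrier_mat n n" "?V \<in> carrier_mat n n"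
      using U V mat_adjoint_carrier by (auto simp: unitary_group_def)
    have d: "mat_diag n g \<in> carrier_mat n n" for g :: "nat \<Rightarrow> complex"
      by (simp add: mat_diag_def)
    have mc: "X * Y \<in> carrier_mat n n" if "X \<in> carrier_mat n n" "Y \<in> carrier_mat n n"
      for X Y :: "complex mat"
      using that by simp
    have u: "U * ?U = 1\<^sub>m n" "?U * U = 1\<^sub>m n" "V * ?V = 1\<^sub>m n" "?V * V = 1\<^sub>m n"
      using U V by (auto simp: unitary_group_def)
    have W: "W \<in> carrier_mat n n"
      using c by (auto simp: W_def)
    have VW: "V * W = U"
    proof -
      have "V * W = V * ?V * U"
        unfolding W_def using c by (simp add: mc assoc_mult_mat[of _ n n _ n _ n])
      then show ?thesis using u c by simp
    qed
    have WU: "W * ?U = ?V"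
    proof -
      have "W * ?U = ?V * (U * ?U)"
        unfolding W_def using c by (simp add: mc assoc_mult_mat[of _ n n _ n _ n])
      then show ?thesis using u c by simp
    qed
    have 1: "?V * A * U = W * mat_diag n z"
    proof -
      have "?V * A * U = (?V * U) * mat_diag n z * (?U * U)"
        unfolding A using c d[of z] by (simp add: mc assoc_mult_mat[of _ n n _ n _ n])
      then show ?thesis using u W d[of z] by (simp add: W_def)
    qed
    have 2: "?V * A * U = mat_diag n w * W"
    proof -
      have "?V * A * U = (?V * V) * (mat_diag n w * W)"
        unfolding AV W_def using c d[of w] by (simp add: mc assoc_mult_mat[of _ n n _ n _ n])
      then show ?thesis using u W d[of w] by simp
    qed
    have e: "W * mat_diag n z = mat_diag n w * W"
      using 1 2 by simp
    have ent: "W $$ (i, j) * z j = w i * W $$ (i, j)" if "i < n" "j < n" for i j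
    proof -
      have "(W * mat_diag n z) $$ (i, j) = (mat_diag n w * W) $$ (i, j)"
        using e by simp
      then show ?thesis
        using that by (simp add: mat_diag_mult_right[OF W] mat_diag_mult_left[OF W])
    qed
    have ent': "W $$ (i, j) * f (z j) = f (w i) * W $$ (i, j)" if "i < n" "j < n" for i j
      using ent[OF that] by (cases "W $$ (i, j) = 0") auto
    have f: "W * mat_diag n (\<lambda>i. f (z i)) = mat_diag n (\<lambda>i. f (w i)) * W"
      using ent' by (auto simp: mat_diag_mult_right[OF W] mat_diag_mult_left[OF W])
    let ?F = "mat_diag n (\<lambda>i. f (z i))" and ?G = "mat_diag n (\<lambda>i. f (w i))"
    have cF: "?F \<in> carrier_mat n n" "?G \<in> carrier_mat n n"
      using d by auto
    have "U * ?F * ?U = V * W * ?F * ?U"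
      by (simp only: VW)
    also have "\<dots> = V * (W * ?F) * ?U"
      using c W cF by (simp add: assoc_mult_mat[of _ n n _ n _ n])
    also have "\<dots> = V * ?G * (W * ?U)"
      unfolding f using c W cF by (simp add: mc assoc_mult_mat[of _ n n _ n _ n])
    finally show ?thesis
      by (simp add: WU)
  qed
  show ?thesis
    unfolding fun_calc_def dim using U A uniq by (intro the_equality) blast+
qed

text \<open>Near 1 the function is a convergent power series in \<open>z - 1\<close> with nonzero linear term.\<close>

definition conformal_at_one :: "(complex \<Rightarrow> complex) \<Rightarrow> bool" where
  "conformal_at_one f \<longleftrightarrow> (\<exists>a r. 0 < r \<and> a (1 :: nat) \<noteq> 0 \<and>
     (\<forall>z \<in> sphere 0 1. dist z 1 < r \<longrightarrow> (\<lambda>k. a k * (z - 1) ^ k) sums f z))"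

definition d_Nf :: "(complex mat \<Rightarrow> real) \<Rightarrow> (complex \<Rightarrow> complex) \<Rightarrow> real mat \<Rightarrow> real mat \<Rightarrow> real" where
  "d_Nf N f A B = N (fun_calc f (map_mat complex_of_real (inv_mat A * B)))"

end

theory Submission
  imports
    "HOL-Analysis.Bounded_Continuous_Function"
    "HOL-Analysis.Bounded_Linear_Function"
    "HOL-Analysis.Complex_Transcendental"
    "Jordan_Normal_Form.Spectral_Radius"
    Defs
begin

text \<open>
  Replacing \<open>\<phi>\<close> by \<open>\<psi> A = (\<phi> I)\<inverse> \<phi> A\<close>, one may assume that the identity is fixed. The metric is bi-invariant and
  comparable to the Frobenius metric, and near the identity squaring expands it by a factor close to 2; so the
  Mazur--Ulam argument shows that \<open>\<psi>\<close> locally preserves \<open>b a\<inverse> b\<close>. Hence \<open>\<psi>\<close> maps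
  one-parameter groups to one-parameter groups, and comparing Taylor expansions gives \<open>\<psi> \<circ> exp = exp \<circ> L\<close>
  with a linear bijection \<open>L\<close> that preserves the double commutators \<open>[X, [X, Y]]\<close>.

  The unit bivectors \<open>X = a b\<^sup>T - b a\<^sup>T\<close> (with \<open>a, b\<close> orthonormal) are, for \<open>n \<ge> 3\<close>, the nonzero skew matrices such that
  \<open>exp (2 \<pi> X) = I\<close> and \<open>(ad X)\<^sup>4 = -(ad X)\<^sup>2\<close>, so \<open>L\<close> permutes them. Two orthogonal ones share a vector if and only
  if the circle that they span consists of unit bivectors. Therefore \<open>L\<close> preserves this incidence relation, which forces it to be
  a conjugation up to sign, except that in dimension 4 it may first interchange pencils with triangles, as the map \<^const>\<open>tilde_mat\<close> does.

  Conversely, in dimension 4 write \<open>exp X = p q\<close> with commuting quaternion factors. The exceptional map is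
  conjugate to \<open>p q \<mapsto> p q\<inverse>\<close>, and \<open>p\<inverse> p' q q'\<inverse>\<close> is orthogonally similar to \<open>p\<inverse> p' q\<inverse> q'\<close>.
\<close>

section \<open>Isometries of exponential groups\<close>

text \<open>Midpoints exist only locally and the doubling inequality holds only near the identity.
  Hence reflections are preserved only for nearby points, and large times are reached by taking
  powers. Inversion is an isometry, so brackets can be preserved only up to signs; the double
  bracket does not see them. It is read off from e^(tx) e^(ty) e^(tx), a product that local
  reflections control and whose logarithm has no t^2 term. Of the two conditions that single out
  unit bivectors, the one on \<open>ad\<close> restricts sums of two eigenvalues and the one on the
  exponential makes the eigenvalues integers. Both survive \<open>L\<close>: the first because
  \<open>L\<close> is onto and respects double brackets, the second because the isometry is
  injective and fixes the identity.\<close>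

lemma half_pos: "0 < (1 / 2 :: real)"
  by simp

section \<open>Lipschitz estimates for the exponential series\<close>

lemma norm_power_diff_le:
  fixes x y :: "'a::real_normed_algebra_1"
  assumes "norm x \<le> r" "norm y \<le> r"
  shows "norm (x ^ Suc n - y ^ Suc n) \<le> real (Suc n) * r ^ n * norm (x - y)"
proof (induction n)
  case (Suc n)
  have r: "0 \<le> r" using assms(1) norm_ge_zero order_trans by blast
  have "x ^ Suc (Suc n) - y ^ Suc (Suc n) = x * (x ^ Suc n - y ^ Suc n) + (x - y) * y ^ Suc n"
    by (simp add: algebra_simps)
  also have "norm \<dots> \<le> norm x * norm (x ^ Suc n - y ^ Suc n) + norm (x - y) * norm (y ^ Suc n)"
    by (meson add_mono norm_mult_ineq norm_triangle_le)
  also have "\<dots> \<le> r * (real (Suc n) * r ^ n * norm (x - y)) + norm (x - y) * r ^ Suc n"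
  proof (intro add_mono mult_mono)
    show "norm (y ^ Suc n) \<le> r ^ Suc n"
      using norm_power_ineq[of y "Suc n"] power_mono[OF assms(2) norm_ge_zero, of "Suc n"] by linarith
  qed (use Suc.IH assms r in auto)
  finally show ?case by (simp add: algebra_simps)
qed simp

text \<open>The terms of degree at least two are compared one by one with the series of
  \<open>exp r - 1\<close>: the factor \<open>n + 2\<close> from \<open>norm_power_diff_le\<close>
  lowers the factorial by one.\<close>

lemma norm_exp_diff_le:
  fixes x y :: "'a::{real_normed_algebra_1, banach}"
  assumes "norm x \<le> r" "norm y \<le> r"
  shows "norm (exp x - exp y - (x - y)) \<le> (exp r - 1) * norm (x - y)"
proof -
  have s: "(\<lambda>n. x ^ (n + 2) /\<^sub>R fact (n + 2) - y ^ (n + 2) /\<^sub>R fact (n + 2)) sums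
      (exp x - (\<Sum>n<2. x ^ n /\<^sub>R fact n) - (exp y - (\<Sum>n<2. y ^ n /\<^sub>R fact n)))"
    by (intro sums_diff; rule sums_iff_shift'[THEN iffD2], simp add: exp_converges)
  have "(\<lambda>n. x ^ (n + 2) /\<^sub>R fact (n + 2) - y ^ (n + 2) /\<^sub>R fact (n + 2)) sums (exp x - exp y - (x - y))"
    using s by (simp add: numeral_2_eq_2 algebra_simps)
  moreover have "(\<lambda>n. r ^ (n + 1) /\<^sub>R fact (n + 1)) sums (exp r - (\<Sum>n<1. r ^ n /\<^sub>R fact n))"
    using exp_converges[of r] by (subst sums_iff_shift') (simp add: divide_inverse_commute)
  then have t: "(\<lambda>n. r ^ (n + 1) /\<^sub>R fact (n + 1) * norm (x - y)) sums ((exp r - 1) * norm (x - y))"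
    by (intro sums_mult2) simp
  moreover have "norm (x ^ (n + 2) /\<^sub>R fact (n + 2) - y ^ (n + 2) /\<^sub>R fact (n + 2))
      \<le> r ^ (n + 1) /\<^sub>R fact (n + 1) * norm (x - y)" for n
  proof -
    have "norm (x ^ (n + 2) /\<^sub>R fact (n + 2) - y ^ (n + 2) /\<^sub>R fact (n + 2))
      = norm (x ^ Suc (n + 1) - y ^ Suc (n + 1)) / fact (n + 2)"
      by (simp flip: scaleR_diff_right add: divide_inverse_commute)
    also have "\<dots> \<le> (real (Suc (n + 1)) * r ^ (n + 1) * norm (x - y)) / fact (n + 2)"
      by (intro divide_right_mono norm_power_diff_le assms) auto
    also have "\<dots> = r ^ (n + 1) /\<^sub>R fact (n + 1) * norm (x - y)"
      by (simp add: field_simps del: of_nat_Suc)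
    finally show ?thesis .
  qed
  ultimately show ?thesis
    by (metis (no_types, lifting) norm_suminf_le sums_iff)
qed

lemma exp_half_le: "exp (1/2::real) \<le> 7/4"
  using exp_bound[of "1/2"] by (simp add: power2_eq_square)

text \<open>On the ball of radius 1/2 the exponential differs from a translation by at most 3/4 of
  the distance, which leaves the factors 1/4 and 7/4, the latter rounded up to 2. The first bound
  makes the exponential injective on this ball; it is the source of all uniqueness statements about
  small logarithms below.\<close>

lemma norm_exp_diff_bounds:
  fixes x y :: "'a::{real_normed_algebra_1, banach}"
  assumes "norm x \<le> 1/2" "norm y \<le> 1/2"
  shows "norm (x - y) \<le> 4 * norm (exp x - exp y)" "norm (exp x - exp y) \<le> 2 * norm (x - y)"
proof -
  have *: "norm (exp x - exp y - (x - y)) \<le> 3/4 * norm (x - y)"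
  proof -
    have "(exp (1/2::real) - 1) * norm (x - y) \<le> 3/4 * norm (x - y)"
      using exp_half_le by (intro mult_right_mono) auto
    then show ?thesis using norm_exp_diff_le[OF assms] by linarith
  qed
  show "norm (x - y) \<le> 4 * norm (exp x - exp y)"
    using * norm_triangle_ineq2[of "x - y" "exp x - exp y"] by (simp add: norm_minus_commute)
  show "norm (exp x - exp y) \<le> 2 * norm (x - y)"
    using * norm_triangle_ineq2[of "exp x - exp y" "x - y"] norm_ge_zero[of "x - y"] by linarith
qed

section \<open>Expansions modulo fourth order\<close>

text \<open>Agreement up to O(t^4) from the right of 0; the unit interval is enough because only the
  times 1/m will be inserted.\<close>

definition eq_upto4 :: "(real \<Rightarrow> 'a::real_normed_algebra_1) \<Rightarrow> (real \<Rightarrow> 'a) \<Rightarrow> bool" where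
  "eq_upto4 F G \<longleftrightarrow> (\<exists>C. \<forall>t\<in>{0..1}. norm (F t - G t) \<le> C * t ^ 4)"

lemma eq_upto4_trans: "eq_upto4 F G ==> eq_upto4 G H ==> eq_upto4 F H"
proof -
  assume "eq_upto4 F G" "eq_upto4 G H"
  then obtain C D where "\<forall>t\<in>{0..1}. norm (F t - G t) \<le> C * t ^ 4" "\<forall>t\<in>{0..1}. norm (G t - H t) \<le> D * t ^ 4"
    by (auto simp: eq_upto4_def)
  then have "\<forall>t\<in>{0..1}. norm (F t - H t) \<le> (C + D) * t ^ 4"
    by (smt (verit) distrib_right norm_triangle_ineq diff_add_cancel add_diff_eq)
  then show ?thesis by (auto simp: eq_upto4_def)
qed

lemma eq_upto4_sym: "eq_upto4 F G ==> eq_upto4 G F"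
  by (simp add: eq_upto4_def norm_minus_commute)

lemma eq_upto4_mult:
  assumes "eq_upto4 F F'" "eq_upto4 G G'"
    and F: "bounded (F ` {0..1})" and G: "bounded (G' ` {0..1})"
  shows "eq_upto4 (\<lambda>t. F t * G t) (\<lambda>t. F' t * G' t)"
proof -
  obtain C D where C: "\<forall>t\<in>{0..1}. norm (F t - F' t) \<le> C * t ^ 4"
    and D: "\<forall>t\<in>{0..1}. norm (G t - G' t) \<le> D * t ^ 4"
    using assms by (auto simp: eq_upto4_def)
  obtain B where B: "\<forall>t\<in>{0..1}. norm (F t) \<le> B" using F by (auto simp: bounded_iff)
  obtain B' where B': "\<forall>t\<in>{0..1}. norm (G' t) \<le> B'" using G by (auto simp: bounded_iff)
  have "norm (F t * G t - F' t * G' t) \<le> (B * D + C * B') * t ^ 4" if t: "t \<in> {0..1}" for t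
  proof -
    have "F t * G t - F' t * G' t = F t * (G t - G' t) + (F t - F' t) * G' t"
      by (simp add: algebra_simps)
    also have "norm \<dots> \<le> norm (F t) * norm (G t - G' t) + norm (F t - F' t) * norm (G' t)"
      by (meson add_mono norm_mult_ineq norm_triangle_le)
    also have "\<dots> \<le> B * (D * t ^ 4) + (C * t ^ 4) * B'"
      using B B' C D t by (intro add_mono mult_mono) (auto intro: order_trans[OF norm_ge_zero])
    finally show ?thesis by (simp add: algebra_simps)
  qed
  then show ?thesis unfolding eq_upto4_def by blast
qed

definition cubic :: "'a::real_normed_algebra_1 \<Rightarrow> 'a \<Rightarrow> 'a \<Rightarrow> 'a \<Rightarrow> real \<Rightarrow> 'a" where
  "cubic a b c d t = a + t *\<^sub>R b + t ^ 2 *\<^sub>R c + t ^ 3 *\<^sub>R d"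

lemma bounded_cubic: "bounded (cubic a b c d ` {0..1})"
  by (intro compact_imp_bounded compact_continuous_image)
     (auto simp: cubic_def[abs_def] intro!: continuous_intros)

lemma eq_upto4_I:
  fixes F G H :: "real \<Rightarrow> 'a::real_normed_algebra_1"
  assumes "continuous_on {0..1} H" "\<And>t. F t - G t = t ^ 4 *\<^sub>R H t"
  shows "eq_upto4 F G"
proof -
  have "bounded (H ` {0..1})"
    by (intro compact_imp_bounded compact_continuous_image assms) auto
  then obtain C where "\<forall>t\<in>{0..1}. norm (H t) \<le> C" by (auto simp: bounded_iff)
  then have "\<forall>t\<in>{0..1}. norm (F t - G t) \<le> C * t ^ 4"
    unfolding assms(2) by (auto simp: mult.commute[of C] intro!: mult_left_mono)
  then show ?thesis by (auto simp: eq_upto4_def)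
qed

lemma eq_upto4_cubic_mult:
  "eq_upto4 (\<lambda>t. cubic a b c d t * cubic a' b' c' d' t)
     (cubic (a * a') (a * b' + b * a') (a * c' + b * b' + c * a') (a * d' + b * c' + c * b' + d * a'))"
proof (rule eq_upto4_I)
  show "continuous_on {0..1} (\<lambda>t. (b * d' + c * c' + d * b') + t *\<^sub>R (c * d' + d * c') + t^2 *\<^sub>R (d * d'))"
    by (intro continuous_intros)
qed (simp add: cubic_def algebra_simps power2_eq_square power3_eq_cube power4_eq_xxxx)

text \<open>The Taylor polynomial appears as \<open>cubic\<close> evaluated at time 1. For the tail
  it is enough to replace \<open>fact (n + 4)\<close> by \<open>fact n\<close>.\<close>

lemma norm_exp_taylor3_le:
  fixes x :: "'a::{real_normed_algebra_1, banach}"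
  shows "norm (exp x - cubic 1 x (x^2 /\<^sub>R 2) (x^3 /\<^sub>R 6) 1) \<le> norm x ^ 4 * exp (norm x)"
proof -
  have "(\<lambda>n. x ^ (n + 4) /\<^sub>R fact (n + 4)) sums (exp x - (\<Sum>n<4. x ^ n /\<^sub>R fact n))"
    by (rule sums_iff_shift'[THEN iffD2], simp add: exp_converges)
  moreover have "(\<Sum>n<4. x ^ n /\<^sub>R fact n) = cubic 1 x (x^2 /\<^sub>R 2) (x^3 /\<^sub>R 6) 1"
    by (simp add: cubic_def eval_nat_numeral fact_numeral)
  ultimately have s: "(\<lambda>n. x ^ (n + 4) /\<^sub>R fact (n + 4)) sums (exp x - cubic 1 x (x^2 /\<^sub>R 2) (x^3 /\<^sub>R 6) 1)"
    by simp
  have t: "(\<lambda>n. norm x ^ 4 * (norm x ^ n /\<^sub>R fact n)) sums (norm x ^ 4 * exp (norm x))"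
    by (intro sums_mult exp_converges)
  have "norm (x ^ (n + 4) /\<^sub>R fact (n + 4)) \<le> norm x ^ 4 * (norm x ^ n /\<^sub>R fact n)" for n
  proof -
    have "norm (x ^ (n + 4)) / fact (n + 4) \<le> norm x ^ (n + 4) / fact n"
      by (intro frac_le norm_power_ineq fact_mono) auto
    then show ?thesis by (simp add: divide_inverse_commute power_add mult_ac)
  qed
  then show ?thesis using s t
    by (metis (no_types, lifting) norm_suminf_le sums_iff)
qed

text \<open>As the exponent has no t^2 term, \<open>p\<close> enters the expansion below order four
  only as a plain summand of the cubic coefficient. This is why cubic terms of logarithms can be
  compared directly.\<close>

lemma eq_upto4_exp:
  fixes s p :: "'a::{real_normed_algebra_1, banach}"
  shows "eq_upto4 (\<lambda>t. exp (t *\<^sub>R s + t ^ 3 *\<^sub>R p)) (cubic 1 s (s^2 /\<^sub>R 2) (s^3 /\<^sub>R 6 + p))"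
proof -
  define z where "z t = t *\<^sub>R s + t ^ 3 *\<^sub>R p" for t
  define R where "R = norm s + norm p"
  have z: "norm (z t) \<le> R * t" if "t \<in> {0..1}" for t
  proof -
    have "norm (z t) \<le> t * norm s + t ^ 3 * norm p"
      unfolding z_def using that by (intro norm_triangle_le) auto
    also have "t ^ 3 \<le> t" using that power_decreasing[of 1 3 t] by simp
    then have "t ^ 3 * norm p \<le> t * norm p" by (intro mult_right_mono) auto
    finally show ?thesis by (simp add: R_def algebra_simps)
  qed
  have "eq_upto4 (\<lambda>t. exp (z t)) (\<lambda>t. cubic 1 (z t) ((z t)^2 /\<^sub>R 2) ((z t)^3 /\<^sub>R 6) 1)"
    unfolding eq_upto4_def
  proof (intro exI ballI)
    fix t :: real assume t: "t \<in> {0..1}"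
    have "norm (z t) ^ 4 * exp (norm (z t)) \<le> (R * t) ^ 4 * exp R"
    proof (intro mult_mono power_mono z t)
      have "R * t \<le> R * 1" using t by (intro mult_left_mono) (auto simp: R_def)
      then show "exp (norm (z t)) \<le> exp R" using z[OF t] by simp
    qed (use t in \<open>auto simp: R_def\<close>)
    then show "norm (exp (z t) - cubic 1 (z t) ((z t)^2 /\<^sub>R 2) ((z t)^3 /\<^sub>R 6) 1) \<le> (R ^ 4 * exp R) * t ^ 4"
      using norm_exp_taylor3_le[of "z t"] by (simp add: power_mult_distrib mult_ac)
  qed
  moreover have "eq_upto4 (\<lambda>t. cubic 1 (z t) ((z t)^2 /\<^sub>R 2) ((z t)^3 /\<^sub>R 6) 1) (cubic 1 s (s^2 /\<^sub>R 2) (s^3 /\<^sub>R 6 + p))"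
  proof (rule eq_upto4_I)
    \<comment> \<open>The witness collects the terms of degree at least four in the square and the
      cube of \<open>z t\<close>, divided by t^4.\<close>
    show "continuous_on {0..1} (\<lambda>t. ((s * p + p * s) + t^2 *\<^sub>R (p * p)) /\<^sub>R 2 +
       (t *\<^sub>R (s * s * p + s * p * s + p * s * s) + t^3 *\<^sub>R (s * p * p + p * s * p + p * p * s) + t^5 *\<^sub>R (p * p * p)) /\<^sub>R 6)"
      by (intro continuous_intros)
  qed (simp add: cubic_def z_def algebra_simps eval_nat_numeral)
  ultimately show ?thesis unfolding z_def by (rule eq_upto4_trans)
qed

text \<open>The t^3 term of the logarithm of e^(tx) e^(ty) e^(tx), that is -([x,[x,y]] +
  [y,[x,y]])/6 by the Baker-Campbell-Hausdorff formula. The product is symmetric, so its logarithm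
  is odd in t and the t^2 term is absent.\<close>

definition sym_bch3 :: "'a::real_normed_algebra_1 \<Rightarrow> 'a \<Rightarrow> 'a" where
  "sym_bch3 x y = - ((x * (x * y - y * x) - (x * y - y * x) * x
      + (y * (x * y - y * x) - (x * y - y * x) * y)) /\<^sub>R 6)"

lemma bounded_exp_image:
  fixes x :: "'a::{real_normed_algebra_1, banach}"
  shows "bounded ((\<lambda>t. exp (t *\<^sub>R x)) ` {0..1})"
proof -
  have "norm (exp (t *\<^sub>R x)) \<le> exp (norm x)" if "t \<in> {0..1}" for t
  proof -
    have "norm (t *\<^sub>R x) \<le> norm x" using that by (simp add: mult_left_le_one_le)
    then show ?thesis using norm_exp[of "t *\<^sub>R x"] by (meson exp_le_cancel_iff order_trans)
  qed
  then show ?thesis unfolding bounded_iff by blast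
qed

lemma eq_upto4_sym_product:
  fixes x y :: "'a::{real_normed_algebra_1, banach}"
  shows "eq_upto4 (\<lambda>t. exp (t *\<^sub>R x) * exp (t *\<^sub>R y) * exp (t *\<^sub>R x))
      (\<lambda>t. exp (t *\<^sub>R (x + y + x) + t ^ 3 *\<^sub>R sym_bch3 x y))"
proof -
  define T where "T x = cubic 1 x (x^2 /\<^sub>R 2) (x^3 /\<^sub>R 6)" for x :: 'a
  have e: "eq_upto4 (\<lambda>t. exp (t *\<^sub>R x)) (T x)" for x :: 'a
    using eq_upto4_exp[of x 0] by (simp add: T_def)
  have bT: "bounded (T x ` {0..1})" for x by (simp add: T_def bounded_cubic)
  have "eq_upto4 (\<lambda>t. exp (t *\<^sub>R x) * exp (t *\<^sub>R y)) (\<lambda>t. T x t * T y t)"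
    by (intro eq_upto4_mult e bT bounded_exp_image)
  note 1 = eq_upto4_trans[OF this eq_upto4_cubic_mult[of 1 x "x^2 /\<^sub>R 2" "x^3 /\<^sub>R 6" 1 y "y^2 /\<^sub>R 2" "y^3 /\<^sub>R 6", folded T_def]]
  have b: "bounded ((\<lambda>t. exp (t *\<^sub>R x) * exp (t *\<^sub>R y)) ` {0..1})"
  proof -
    obtain B B' where "\<And>t. t \<in> {0..1} ==> norm (exp (t *\<^sub>R x)) \<le> B" "\<And>t. t \<in> {0..1} ==> norm (exp (t *\<^sub>R y)) \<le> B'"
      using bounded_exp_image[of x] bounded_exp_image[of y] unfolding bounded_iff by blast
    then have "norm (exp (t *\<^sub>R x) * exp (t *\<^sub>R y)) \<le> B * B'" if "t \<in> {0..1}" for t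
      using that by (meson mult_mono' norm_ge_zero norm_mult_ineq order_trans)
    then show ?thesis unfolding bounded_iff by blast
  qed
  note 2 = eq_upto4_mult[OF 1 e[of x] b bT]
  note 3 = eq_upto4_trans[OF 2[unfolded T_def] eq_upto4_cubic_mult]
  \<comment> \<open>Multiplication by 6 clears the denominators of the cubic coefficients, after
    which both sides are sums of words in \<open>x\<close> and \<open>y\<close>.\<close>
  have sc: "6 *\<^sub>R u = 6 *\<^sub>R v ==> u = v" for u v :: 'a by simp
  have sn: "2 *\<^sub>R u = u + u" "3 *\<^sub>R u = u + u + u" "6 *\<^sub>R u = u + u + u + u + u + u" for u :: 'a
    by (simp_all add: scaleR_2 flip: scaleR_add_left)
       (metis (no_types, opaque_lifting) one_add_one numeral_Bit1 numeral_One scaleR_add_left scaleR_one is_num_normalize(1) numeral_Bit0)+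
  have cong: "eq_upto4 F (cubic a b c d) ==> a = a' ==> b = b' ==> c = c' ==> d = d'
      ==> eq_upto4 F (cubic a' b' c' d')" for F and a b c d a' b' c' d' :: 'a
    by simp
  show ?thesis
    by (rule eq_upto4_trans[OF cong[OF 3] eq_upto4_sym[OF eq_upto4_exp]]; (rule sc)?)
       (simp_all add: algebra_simps power2_eq_square power3_eq_cube sn sym_bch3_def)
qed

section \<open>Groups with a logarithm and a conjugation-invariant gauge\<close>

text \<open>The gauge \<open>\<delta>\<close> plays the role of the distance to 1, with two-sided
  comparison to the norm and expansion under squaring in place of a triangle inequality. The axiom
  \<open>log_G\<close> combines surjectivity of the exponential with control of one logarithm near
  1. The inverse is a separate parameter because the ambient type is only a normed algebra.\<close>

locale exponential_metric_group =
  fixes G K :: "'a::{real_normed_algebra_1, banach} set"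
    and ginv :: "'a \<Rightarrow> 'a" and \<delta> :: "'a \<Rightarrow> real"
    and M B c C r \<kappa> :: real
  assumes K_subspace: "Real_Vector_Spaces.subspace K"
    and K_bracket: "\<And>x y. x \<in> K ==> y \<in> K ==> x * y - y * x \<in> K"
    and exp_K: "\<And>x. x \<in> K ==> exp x \<in> G"
    and log_G: "\<And>g. g \<in> G ==> \<exists>x\<in>K. exp x = g \<and> norm x \<le> M * norm (g - 1)"
    and mult_G: "\<And>g h. g \<in> G ==> h \<in> G ==> g * h \<in> G"
    and inv_G: "\<And>g. g \<in> G ==> ginv g \<in> G"
    and inv_left: "\<And>g. g \<in> G ==> ginv g * g = 1"
    and compact_G: "compact G"
    and norm_G: "\<And>g. g \<in> G ==> norm g \<le> B"
    and \<delta>_inv: "\<And>g. g \<in> G ==> \<delta> (ginv g) = \<delta> g"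
    and \<delta>_conj: "\<And>g h. g \<in> G ==> h \<in> G ==> \<delta> (h * g * ginv h) = \<delta> g"
    and \<delta>_lower: "\<And>g. g \<in> G ==> c * norm (g - 1) \<le> \<delta> g"
    and \<delta>_upper: "\<And>g. g \<in> G ==> \<delta> g \<le> C * norm (g - 1)"
    and \<delta>_double: "\<And>g. g \<in> G ==> norm (g - 1) < r ==> \<kappa> * \<delta> g \<le> \<delta> (g * g)"
    and pos: "c > 0" "C > 0" "r > 0" "\<kappa> > 1" "M > 0" "B \<ge> 1"
begin

definition d :: "'a \<Rightarrow> 'a \<Rightarrow> real" where "d g h = \<delta> (ginv g * h)"

definition isometry :: "('a \<Rightarrow> 'a) \<Rightarrow> bool" where
  "isometry \<phi> \<longleftrightarrow> \<phi> \<in> G \<rightarrow> G \<and> (\<forall>g\<in>G. \<forall>h\<in>G. d (\<phi> g) (\<phi> h) = d g h)"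

text \<open>The symmetry of the group at \<open>b\<close>: it reverses time along each one-parameter
  group translated to \<open>b\<close>, so \<open>b\<close> is a midpoint of \<open>g\<close> and
  its image.\<close>

definition reflect :: "'a \<Rightarrow> 'a \<Rightarrow> 'a" where "reflect b g = b * ginv g * b"

lemma one_G: "1 \<in> G"
  using exp_K[of 0] K_subspace by (simp add: subspace_0)

lemma inv_right: "g \<in> G ==> g * ginv g = 1"
  by (metis inv_G inv_left mult.assoc mult_1 mult_1_right)

lemma inv_unique: "g \<in> G ==> h \<in> G ==> h * g = 1 ==> ginv g = h"
  by (metis inv_right mult.assoc mult_1 mult_1_right)

lemma inv_inv [simp]: "g \<in> G ==> ginv (ginv g) = g"
  by (simp add: inv_G inv_right inv_unique)

lemma inv_one [simp]: "ginv 1 = 1"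
  by (simp add: inv_unique one_G)

lemma inv_mult: "g \<in> G ==> h \<in> G ==> ginv (g * h) = ginv h * ginv g"
  by (rule inv_unique) (auto simp: mult_G inv_G mult.assoc inv_left,
      metis inv_left mult.assoc mult_1)

lemma cancel [simp]:
  "g \<in> G ==> ginv g * (g * h) = h" "g \<in> G ==> g * (ginv g * h) = h"
  by (metis inv_left inv_right mult.assoc mult_1)+

lemma inv_exp: "x \<in> K ==> ginv (exp x) = exp (- x)"
  by (intro inv_unique exp_K) (auto simp: K_subspace subspace_neg exp_minus_inverse simp flip: exp_add_commuting)

lemma norm_le_quotient: "g \<in> G ==> h \<in> G ==> norm (g - h) \<le> B * norm (ginv g * h - 1)"
proof -
  assume g: "g \<in> G" and h: "h \<in> G"
  have "h - g = g * (ginv g * h - 1)" using g by (simp add: right_diff_distrib)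
  then have "norm (h - g) \<le> norm g * norm (ginv g * h - 1)" using norm_mult_ineq[of g "ginv g * h - 1"] by simp
  also have "\<dots> \<le> B * norm (ginv g * h - 1)" by (intro mult_right_mono norm_G g) auto
  finally show ?thesis by (simp add: norm_minus_commute)
qed

lemma norm_quotient_le: "g \<in> G ==> h \<in> G ==> norm (ginv g * h - 1) \<le> B * norm (g - h)"
proof -
  assume g: "g \<in> G" and h: "h \<in> G"
  have "ginv g * h - 1 = ginv g * (h - g)" using g by (simp add: right_diff_distrib inv_left)
  then have "norm (ginv g * h - 1) \<le> norm (ginv g) * norm (h - g)" using norm_mult_ineq[of "ginv g" "h - g"] by simp
  also have "\<dots> \<le> B * norm (h - g)" by (intro mult_right_mono norm_G inv_G g) auto
  finally show ?thesis by (simp add: norm_minus_commute)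
qed

lemma d_lower: "g \<in> G ==> h \<in> G ==> c / B * norm (g - h) \<le> d g h"
proof -
  assume g: "g \<in> G" and h: "h \<in> G"
  have "c / B * norm (g - h) \<le> c / B * (B * norm (ginv g * h - 1))"
    using pos by (intro mult_left_mono norm_le_quotient g h) auto
  also have "\<dots> \<le> d g h" using \<delta>_lower[of "ginv g * h"] g h pos by (simp add: d_def mult_G inv_G)
  finally show ?thesis .
qed

lemma d_upper: "g \<in> G ==> h \<in> G ==> d g h \<le> C * B * norm (g - h)"
proof -
  assume g: "g \<in> G" and h: "h \<in> G"
  have "d g h \<le> C * norm (ginv g * h - 1)" unfolding d_def by (intro \<delta>_upper mult_G inv_G g h)
  also have "\<dots> \<le> C * (B * norm (g - h))"
    using pos by (intro mult_left_mono norm_quotient_le g h) auto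
  finally show ?thesis by simp
qed

lemma d_sym: "g \<in> G ==> h \<in> G ==> d g h = d h g"
  using \<delta>_inv[of "ginv g * h"] by (simp add: d_def inv_mult mult_G inv_G)

lemma \<delta>_one: "\<delta> 1 = 0"
  using \<delta>_lower[OF one_G] \<delta>_upper[OF one_G] by simp

lemma d_refl [simp]: "g \<in> G ==> d g g = 0"
  by (simp add: d_def inv_left \<delta>_one)

lemma d_eq_0: "g \<in> G ==> h \<in> G ==> d g h \<le> 0 ==> g = h"
proof -
  assume g: "g \<in> G" "h \<in> G" "d g h \<le> 0"
  then have "c / B * norm (g - h) \<le> 0" using d_lower[of g h] by linarith
  moreover have "c / B > 0" using pos by simp
  ultimately show ?thesis by (metis mult_le_0_iff not_le norm_le_zero_iff right_minus_eq)
qed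

lemma reflect_G: "b \<in> G ==> g \<in> G ==> reflect b g \<in> G"
  by (simp add: reflect_def mult_G inv_G)

lemma reflect_reflect: "b \<in> G ==> g \<in> G ==> reflect b (reflect b g) = g"
  by (simp add: reflect_def mult_G inv_G inv_mult mult.assoc inv_left)

lemma reflect_self: "b \<in> G ==> reflect b b = b"
  by (simp add: reflect_def inv_right)

text \<open>The quotient of the two images is conjugate to g h^-1, whose inverse h g^-1 is conjugate
  to g^-1 h; the gauge ignores conjugation and inversion.\<close>

lemma isometry_reflect: "b \<in> G ==> isometry (reflect b)"
proof -
  assume b: "b \<in> G"
  have "d (reflect b g) (reflect b h) = d g h" if g: "g \<in> G" and h: "h \<in> G" for g h
  proof -
    have "ginv (reflect b g) * reflect b h = ginv b * (g * ginv h) * ginv (ginv b)"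
      using b g h by (simp add: reflect_def mult_G inv_G inv_mult mult.assoc)
    then have "d (reflect b g) (reflect b h) = \<delta> (g * ginv h)"
      unfolding d_def using \<delta>_conj[of "g * ginv h" "ginv b"] b g h by (simp add: mult_G inv_G)
    also have "\<dots> = \<delta> (h * (ginv g * h) * ginv h)"
      using \<delta>_inv[of "g * ginv h"] g h by (simp add: mult_G inv_G inv_mult mult.assoc inv_right)
    also have "\<dots> = d g h" unfolding d_def using g h by (intro \<delta>_conj mult_G inv_G)
    finally show ?thesis .
  qed
  then show ?thesis using b by (auto simp: isometry_def reflect_G)
qed

definition lip :: real where "lip = C * B / (c / B)"

lemma lip_pos: "lip > 0" using pos by (simp add: lip_def)

lemma isometry_lipschitz:
  assumes "isometry \<phi>" "g \<in> G" "h \<in> G"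
  shows "norm (\<phi> g - \<phi> h) \<le> lip * norm (g - h)"
proof -
  have "c / B * norm (\<phi> g - \<phi> h) \<le> d (\<phi> g) (\<phi> h)"
    using assms by (intro d_lower) (auto simp: isometry_def)
  also have "\<dots> = d g h" using assms by (simp add: isometry_def)
  also have "\<dots> \<le> C * B * norm (g - h)" using assms by (intro d_upper)
  finally have "c / B * norm (\<phi> g - \<phi> h) \<le> C * B * norm (g - h)" .
  moreover have "c / B > 0" using pos by simp
  ultimately have "norm (\<phi> g - \<phi> h) \<le> C * B * norm (g - h) / (c / B)"
    by (simp only: pos_le_divide_eq mult.commute)
  then show ?thesis by (simp add: lip_def mult_ac)
qed

lemma isometry_comp: "isometry \<phi> ==> isometry \<psi> ==> isometry (\<phi> \<circ> \<psi>)"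
  by (auto simp: isometry_def Pi_iff)

lemma isometry_funpow: "isometry \<phi> ==> isometry (\<phi> ^^ k)"
  by (induction k) (auto simp: isometry_comp, auto simp: isometry_def)

lemma isometry_inj_on: "isometry \<phi> ==> inj_on \<phi> G"
  by (rule inj_onI, rule d_eq_0, auto simp: isometry_def)
     (metis d_refl funcset_mem order_refl)

text \<open>A distance-preserving self-map of a compact space is onto: if \<open>y\<close> stays at
  distance \<open>e\<close> from the closed image, then the points of its orbit are uniformly
  separated, since iterates carry \<open>y\<close> and a point of the image to any two of them. This
  contradicts the existence of a convergent subsequence.\<close>

lemma isometry_bij_betw:
  assumes \<phi>: "isometry \<phi>"
  shows "bij_betw \<phi> G G"
proof -
  have "y \<in> \<phi> ` G" if y: "y \<in> G" for y
  proof (rule ccontr)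
    assume n: "y \<notin> \<phi> ` G"
    have "continuous_on G \<phi>"
      unfolding continuous_on_iff
    proof (intro ballI allI impI)
      fix g and e :: real assume g: "g \<in> G" "e > 0"
      have "dist (\<phi> h) (\<phi> g) < e" if "h \<in> G" "dist h g < e / lip" for h
        using isometry_lipschitz[OF \<phi> that(1) g(1)] that(2) lip_pos
        by (simp add: dist_norm field_simps)
      then show "\<exists>d>0. \<forall>h\<in>G. dist h g < d --> dist (\<phi> h) (\<phi> g) < e"
        using g lip_pos by (intro exI[of _ "e / lip"]) auto
    qed
    then have "compact (\<phi> ` G)"
      by (intro compact_continuous_image compact_G)
    then obtain e where e: "e > 0" "\<And>x. x \<in> \<phi> ` G ==> e \<le> dist y x"
      using n compact_imp_closed[of "\<phi> ` G"] open_contains_ball[of "- (\<phi> ` G)"]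
      by (force simp: open_closed[symmetric] open_Compl subset_eq not_less[symmetric])
    define s where "s k = (\<phi> ^^ k) y" for k
    have sG: "s k \<in> G" for k
      using isometry_funpow[OF \<phi>] y by (auto simp: s_def isometry_def)
    obtain l \<sigma> where "strict_mono \<sigma>" "(s \<circ> \<sigma>) \<longlonglongrightarrow> l"
      using compact_G sG unfolding compact_def by metis
    then have "Cauchy (s \<circ> \<sigma>)" by (simp add: LIMSEQ_imp_Cauchy)
    \<comment> \<open>Chosen so that points closer than \<open>\<eta>\<close> in norm have
      \<open>d\<close> less than \<open>c / B * e\<close>, the lower bound for the distance of
      \<open>y\<close> to the image.\<close>
    define \<eta> where "\<eta> = c / B * e / (C * B)"
    have "\<eta> > 0" using pos e by (simp add: \<eta>_def)
    then obtain N where "\<And>m n. m \<ge> N ==> n \<ge> N ==> dist (s (\<sigma> m)) (s (\<sigma> n)) < \<eta>"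
      using \<open>Cauchy (s \<circ> \<sigma>)\<close> unfolding Cauchy_def comp_def by meson
    then have "dist (s (\<sigma> N)) (s (\<sigma> (Suc N))) < \<eta>" by simp
    moreover have "\<sigma> N < \<sigma> (Suc N)" using \<open>strict_mono \<sigma>\<close> by (simp add: strict_mono_def)
    ultimately obtain i j where ij: "i < j" "dist (s i) (s j) < \<eta>" by blast
    define k where "k = j - i - 1"
    have "s j = (\<phi> ^^ i) (\<phi> (s k))"
      using ij funpow_add[of i "Suc k" \<phi>] by (simp add: s_def k_def)
    then have "d (s i) (s j) = d y (\<phi> (s k))"
      using isometry_funpow[OF \<phi>, of i] y sG[of "Suc k"] by (auto simp: s_def isometry_def)
    also have "\<dots> \<ge> c / B * norm (y - \<phi> (s k))"
      using y sG[of "Suc k"] by (intro d_lower) (auto simp: s_def)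
    finally have "c / B * norm (y - \<phi> (s k)) \<le> d (s i) (s j)" .
    moreover have "c / B * e \<le> c / B * norm (y - \<phi> (s k))"
      using e(2)[of "\<phi> (s k)"] sG pos by (intro mult_left_mono) (auto simp: dist_norm)
    moreover have "d (s i) (s j) \<le> C * B * norm (s i - s j)" by (intro d_upper sG)
    moreover have "C * B * norm (s i - s j) < C * B * \<eta>"
      using ij pos by (intro mult_strict_left_mono) (auto simp: dist_norm)
    moreover have "C * B * \<eta> = c / B * e" using pos by (simp add: \<eta>_def)
    ultimately show False by linarith
  qed
  moreover have "\<phi> ` G \<subseteq> G" using \<phi> by (auto simp: isometry_def)
  ultimately show ?thesis
    using isometry_inj_on[OF \<phi>] by (auto simp: bij_betw_def)
qed

lemma isometry_inv:
  assumes "isometry \<phi>"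
  shows "isometry (inv_into G \<phi>)"
  unfolding isometry_def
proof (intro conjI ballI)
  have b: "\<phi> ` G = G" using isometry_bij_betw[OF assms] by (simp add: bij_betw_def)
  show "inv_into G \<phi> \<in> G \<rightarrow> G" using b by (metis Pi_I inv_into_into)
  show "d (inv_into G \<phi> g) (inv_into G \<phi> h) = d g h" if "g \<in> G" "h \<in> G" for g h
  proof -
    have "inv_into G \<phi> g \<in> G" "inv_into G \<phi> h \<in> G" using that b by (auto intro: inv_into_into)
    then have "d (inv_into G \<phi> g) (inv_into G \<phi> h) = d (\<phi> (inv_into G \<phi> g)) (\<phi> (inv_into G \<phi> h))"
      using assms by (simp add: isometry_def)
    then show ?thesis using that b by (simp add: f_inv_into_f)
  qed
qed

lemma inv_isometry:
  assumes "isometry \<phi>" "g \<in> G"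
  shows "\<phi> (inv_into G \<phi> g) = g" "inv_into G \<phi> (\<phi> g) = g"
  using isometry_bij_betw[OF assms(1)] assms(2) by (auto simp: bij_betw_def f_inv_into_f)

section \<open>The local Mazur-Ulam argument\<close>

text \<open>The quotient of \<open>x\<close> and its mirror image is the square of x^-1 b, so the
  doubling axiom applies.\<close>

lemma d_reflect:
  assumes "x \<in> G" "b \<in> G" "norm (x - b) * B < r"
  shows "\<kappa> * d x b \<le> d x (reflect b x)"
proof -
  have "norm (ginv x * b - 1) < r"
    using norm_quotient_le[OF assms(1,2)] assms(3) by (simp add: mult.commute)
  then have "\<kappa> * \<delta> (ginv x * b) \<le> \<delta> (ginv x * b * (ginv x * b))"
    by (intro \<delta>_double) (auto simp: mult_G inv_G assms)
  then show ?thesis by (simp add: d_def reflect_def mult.assoc)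
qed

text \<open>An isometry that fixes \<open>a\<close> moves \<open>b\<close> by at most
  \<open>lip + 1\<close> times the distance of \<open>a\<close> and \<open>b\<close>. Below this
  radius the displacement remains within reach of \<open>d_reflect\<close>, however often the
  construction is iterated.\<close>

definition \<rho> :: real where "\<rho> = r / (B * (lip + 1))"

text \<open>Vaisala's proof of the Mazur--Ulam theorem: composing an isometry that fixes \<open>a\<close> and its
  mirror image with the reflection in the midpoint \<open>b\<close> multiplies the displacement of \<open>b\<close>
  by at least \<open>\<kappa>\<close>, whereas displacements are bounded.\<close>

lemma isometry_fixes_midpoint:
  assumes ab: "a \<in> G" "b \<in> G" "norm (a - b) < \<rho>"
    and "isometry \<theta>" "\<theta> a = a" "\<theta> (reflect b a) = reflect b a"
  shows "\<theta> b = b"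
proof -
  have r: "reflect b a \<in> G" using ab by (simp add: reflect_G)
  have bound: "d (\<theta> b) b \<le> C * B * (2 * B)" if "isometry \<theta>" for \<theta>
  proof -
    have t: "\<theta> b \<in> G" using that ab by (auto simp: isometry_def)
    have "d (\<theta> b) b \<le> C * B * norm (\<theta> b - b)" using t ab by (intro d_upper)
    also have "\<dots> \<le> C * B * (2 * B)"
      using norm_triangle_ineq4[of "\<theta> b" b] norm_G[OF t] norm_G[OF ab(2)] pos
      by (intro mult_left_mono) auto
    finally show ?thesis .
  qed
  have "\<kappa> ^ m * d (\<theta> b) b \<le> C * B * (2 * B)"
    if "isometry \<theta>" "\<theta> a = a" "\<theta> (reflect b a) = reflect b a" for \<theta> and m :: nat
    using that
  proof (induction m arbitrary: \<theta>)
    case (Suc m)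
    \<comment> \<open>Again an isometry that fixes \<open>a\<close> and its mirror image, so the
      induction hypothesis applies to it.\<close>
    define \<theta>' where "\<theta>' = reflect b \<circ> (inv_into G \<theta> \<circ> (reflect b \<circ> \<theta>))"
    have t: "\<theta> b \<in> G" using Suc.prems ab by (auto simp: isometry_def)
    have "norm (\<theta> b - \<theta> a) \<le> lip * norm (b - a)"
      using Suc.prems ab by (intro isometry_lipschitz)
    then have "norm (\<theta> b - b) \<le> (lip + 1) * norm (a - b)"
      using Suc.prems(2) norm_triangle_ineq[of "\<theta> b - a" "a - b"]
      by (simp add: algebra_simps norm_minus_commute)
    then have "norm (\<theta> b - b) * B \<le> (lip + 1) * norm (a - b) * B"
      using pos by (intro mult_right_mono) auto
    also have "\<dots> < (lip + 1) * \<rho> * B"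
      using ab pos lip_pos by (intro mult_strict_right_mono mult_strict_left_mono) auto
    also have "\<dots> = r" using pos lip_pos by (simp add: \<rho>_def)
    finally have "\<kappa> * d (\<theta> b) b \<le> d (\<theta> b) (reflect b (\<theta> b))"
      by (intro d_reflect t ab)
    also have "\<dots> = d (reflect b (\<theta> b)) (\<theta> b)"
      using t ab by (intro d_sym) (auto simp: reflect_G)
    also have "\<dots> = d (inv_into G \<theta> (reflect b (\<theta> b))) (inv_into G \<theta> (\<theta> b))"
      using isometry_inv[OF Suc.prems(1)] t ab by (simp add: isometry_def reflect_G)
    also have "\<dots> = d (reflect b (inv_into G \<theta> (reflect b (\<theta> b)))) (reflect b (inv_into G \<theta> (\<theta> b)))"
      using isometry_reflect[OF ab(2)] isometry_inv[OF Suc.prems(1)] t ab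
      unfolding isometry_def by (smt (verit, best) PiE reflect_G)
    also have "\<dots> = d (\<theta>' b) b"
      using inv_isometry[OF Suc.prems(1) ab(2)] reflect_self[OF ab(2)] by (simp add: \<theta>'_def)
    finally have k: "\<kappa> * d (\<theta> b) b \<le> d (\<theta>' b) b" .
    have i: "inv_into G \<theta> a = a" "inv_into G \<theta> (reflect b a) = reflect b a"
      using inv_isometry(2)[OF Suc.prems(1) ab(1)] inv_isometry(2)[OF Suc.prems(1) r] Suc.prems by auto
    have "\<kappa> ^ m * d (\<theta>' b) b \<le> C * B * (2 * B)"
    proof (rule Suc.IH)
      show "isometry \<theta>'" unfolding \<theta>'_def
        using isometry_reflect[OF ab(2)] isometry_inv[OF Suc.prems(1)] Suc.prems(1)
        by (intro isometry_comp)
    qed (use i Suc.prems ab in \<open>simp_all add: \<theta>'_def reflect_reflect\<close>)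
    moreover have "\<kappa> ^ Suc m * d (\<theta> b) b \<le> \<kappa> ^ m * d (\<theta>' b) b"
      using mult_left_mono[OF k, of "\<kappa> ^ m"] pos by (simp add: mult_ac)
    ultimately show ?case by linarith
  qed (simp add: bound)
  note * = this[OF assms(4-6)]
  have "d (\<theta> b) b \<le> 0"
  proof (rule ccontr)
    assume "\<not> d (\<theta> b) b \<le> 0"
    moreover obtain m where "C * B * (2 * B) / d (\<theta> b) b < \<kappa> ^ m"
      using real_arch_pow pos by blast
    ultimately show False using *[of m] by (simp add: field_simps)
  qed
  then show ?thesis using assms(4) ab by (intro d_eq_0) (auto simp: isometry_def)
qed

end

context exponential_metric_group begin

lemma exp_scale_nat: "exp (of_nat k *\<^sub>R x) = exp x ^ k" for x :: 'a
proof (induction k)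
  case (Suc k)
  have "exp (of_nat (Suc k) *\<^sub>R x) = exp (x + of_nat k *\<^sub>R x)" by (simp add: scaleR_add_left)
  also have "\<dots> = exp x * exp (of_nat k *\<^sub>R x)" by (rule exp_add_commuting) simp
  finally show ?case using Suc by simp
qed simp

lemma K_scale: "x \<in> K ==> t *\<^sub>R x \<in> K" and K_add: "x \<in> K ==> y \<in> K ==> x + y \<in> K"
  and K_neg: "x \<in> K ==> - x \<in> K" and K_diff: "x \<in> K ==> y \<in> K ==> x - y \<in> K" and K_0: "0 \<in> K"
  using K_subspace by (auto simp: subspace_scale subspace_add subspace_neg subspace_diff subspace_0)

lemma small_ex:
  fixes b e :: real
  assumes "e > 0" "b \<ge> 0"
  shows "\<exists>\<eta>>0. \<forall>t. t < \<eta> --> b * t < e"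
proof (intro exI[of _ "e / (b + 1)"] conjI allI impI)
  show "b * t < e" if t: "t < e / (b + 1)" for t
  proof (cases "t \<le> 0")
    case True
    then have "b * t \<le> 0" using assms by (simp add: mult_nonneg_nonpos)
    then show ?thesis using assms by simp
  next
    case False
    have "t * (b + 1) < e" using t assms by (simp add: pos_less_divide_eq)
    then show ?thesis using False by (simp add: algebra_simps)
  qed
qed (use assms in simp)

lemma norm_reflect_diff_le:
  assumes "a \<in> G" "b \<in> G"
  shows "norm (reflect b a - a) \<le> (B * B + 1) * norm (a - b)"
proof -
  have "reflect b a - a = b * ginv a * (b - a) + (b - a)"
    using assms by (simp add: reflect_def right_diff_distrib mult.assoc inv_left)
  also have "norm \<dots> \<le> norm (b * ginv a) * norm (b - a) + norm (b - a)"
    by (meson add_right_mono norm_mult_ineq norm_triangle_le)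
  also have "norm (b * ginv a) \<le> B * B"
    using norm_mult_ineq[of b "ginv a"] mult_mono[OF norm_G[OF assms(2)] norm_G[OF inv_G[OF assms(1)]]] pos
    by simp
  then have "norm (b * ginv a) * norm (b - a) + norm (b - a) \<le> B * B * norm (b - a) + norm (b - a)"
    by (intro add_mono mult_right_mono) auto
  finally show ?thesis by (simp add: algebra_simps norm_minus_commute)
qed

text \<open>With \<open>exp z\<close> equal to a^-1 g, the midpoint is
  \<open>a * exp (z /\<^sub>R 2)\<close>. The smallness hypothesis keeps the norm of
  \<open>z\<close> below 1, hence half of \<open>z\<close> in the ball of the exponential
  estimates.\<close>

lemma square_root_near:
  assumes "a \<in> G" "g \<in> G" "M * B * norm (a - g) \<le> 1"
  shows "\<exists>e\<in>G. reflect e a = g \<and> norm (e - a) \<le> B * M * B * norm (a - g)"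
proof -
  obtain z where z: "z \<in> K" "exp z = ginv a * g" "norm z \<le> M * norm (ginv a * g - 1)"
    using log_G[of "ginv a * g"] assms by (auto simp: mult_G inv_G)
  have "norm z \<le> M * (B * norm (a - g))"
    using z(3) norm_quotient_le[OF assms(1,2)] pos by (meson mult_left_mono order_less_imp_le order_trans)
  then have nz: "norm z \<le> M * B * norm (a - g)" by simp
  define e where "e = a * exp (z /\<^sub>R 2)"
  have eG: "e \<in> G" using assms z by (simp add: e_def mult_G exp_K K_scale)
  have "reflect e a = a * (exp (z /\<^sub>R 2) * exp (z /\<^sub>R 2))"
    using assms by (simp add: reflect_def e_def mult.assoc)
  also have "exp (z /\<^sub>R 2) * exp (z /\<^sub>R 2) = exp z"
    by (simp flip: exp_add_commuting scaleR_add_left)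
  finally have "reflect e a = g" using z assms by simp
  moreover have "norm (e - a) \<le> B * M * B * norm (a - g)"
  proof -
    have "e - a = a * (exp (z /\<^sub>R 2) - exp 0)" by (simp add: e_def right_diff_distrib)
    then have "norm (e - a) \<le> norm a * norm (exp (z /\<^sub>R 2) - exp 0)"
      using norm_mult_ineq[of a "exp (z /\<^sub>R 2) - exp 0"] by simp
    also have "\<dots> \<le> B * (2 * norm (z /\<^sub>R 2 - 0))"
      using nz assms pos by (intro mult_mono norm_G norm_exp_diff_bounds) auto
    also have "\<dots> = B * norm z" by simp
    also have "\<dots> \<le> B * (M * B * norm (a - g))" using nz pos by (intro mult_left_mono) auto
    finally show ?thesis by (simp add: mult.assoc)
  qed
  ultimately show ?thesis using eG by blast
qed

text \<open>Let \<open>e\<close> be a midpoint of the images of \<open>a\<close> and of its mirror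
  image. Pulled back by \<open>\<phi>\<close>, the reflection in \<open>e\<close> exchanges
  \<open>a\<close> and its mirror image; followed by the reflection in \<open>b\<close> it fixes
  both, hence also \<open>b\<close>. So the reflection in \<open>e\<close> fixes
  \<open>\<phi> b\<close>, and doubling leaves only \<open>\<phi> b = e\<close>.\<close>

lemma isometry_reflection_local:
  assumes \<phi>: "isometry \<phi>"
  shows "\<exists>\<eta>>0. \<forall>a\<in>G. \<forall>b\<in>G. norm (a - b) < \<eta> --> \<phi> (reflect b a) = reflect (\<phi> b) (\<phi> a)"
proof -
  \<comment> \<open>Bounds the distance of the images of \<open>a\<close> and of its mirror image by
    \<open>D\<close> times that of \<open>a\<close> and \<open>b\<close>. The three radii below
    serve the midpoint lemma, the choice of the square root, and the final doubling at
    \<open>\<phi> b\<close>.\<close>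
  define D where "D = lip * (B * B + 1)"
  have D0: "D \<ge> 0" using lip_pos pos by (simp add: D_def)
  have "\<rho> > 0" using pos lip_pos by (simp add: \<rho>_def)
  then obtain \<eta>1 where \<eta>1: "\<eta>1 > 0" "\<And>t. t < \<eta>1 ==> 1 * t < \<rho>" using small_ex[of \<rho> 1] by auto
  obtain \<eta>2 where \<eta>2: "\<eta>2 > 0" "\<And>t. t < \<eta>2 ==> M * B * D * t < 1"
    using small_ex[of 1 "M * B * D"] pos D0 by auto
  obtain \<eta>3 where \<eta>3: "\<eta>3 > 0" "\<And>t. t < \<eta>3 ==> (lip + B * M * B * D) * B * t < r"
    using small_ex[of r "(lip + B * M * B * D) * B"] pos D0 lip_pos by auto
  have "\<phi> (reflect b a) = reflect (\<phi> b) (\<phi> a)"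
    if a: "a \<in> G" and b: "b \<in> G" and ab: "norm (a - b) < min \<eta>1 (min \<eta>2 \<eta>3)" for a b
  proof -
    define a' b' g where "a' = \<phi> a" and "b' = \<phi> b" and "g = \<phi> (reflect b a)"
    have rG: "reflect b a \<in> G" by (simp add: reflect_G a b)
    have G': "a' \<in> G" "b' \<in> G" "g \<in> G"
      using \<phi> a b rG by (auto simp: a'_def b'_def g_def isometry_def)
    have "norm (a' - g) \<le> lip * norm (a - reflect b a)"
      unfolding a'_def g_def by (intro isometry_lipschitz \<phi> a rG)
    also have "\<dots> \<le> lip * ((B * B + 1) * norm (a - b))"
      using norm_reflect_diff_le[OF a b] lip_pos by (intro mult_left_mono) (auto simp: norm_minus_commute)
    finally have ag: "norm (a' - g) \<le> D * norm (a - b)" by (simp add: D_def)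
    then have "M * B * norm (a' - g) \<le> M * B * (D * norm (a - b))"
      using pos by (intro mult_left_mono) auto
    also have "\<dots> \<le> 1" using \<eta>2(2)[of "norm (a - b)"] ab by (simp add: mult.assoc)
    finally obtain e where e: "e \<in> G" "reflect e a' = g" "norm (e - a') \<le> B * M * B * norm (a' - g)"
      using square_root_near[OF G'(1,3)] by blast
    have "B * M * B * norm (a' - g) \<le> B * M * B * (D * norm (a - b))"
      using pos ag by (intro mult_left_mono) auto
    then have ea: "norm (e - a') \<le> B * M * B * D * norm (a - b)" using e(3) by (simp add: mult.assoc)
    define \<tau> where "\<tau> = inv_into G \<phi> \<circ> (reflect e \<circ> \<phi>)"
    have \<tau>: "isometry \<tau>" unfolding \<tau>_def by (intro isometry_comp isometry_inv isometry_reflect \<phi> e)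
    have "\<tau> a = reflect b a"
      using e inv_isometry(2)[OF \<phi> rG] by (simp add: \<tau>_def a'_def g_def)
    moreover have "reflect e g = a'" using e G' reflect_reflect[of e a'] by auto
    then have "\<tau> (reflect b a) = a"
      using inv_isometry(2)[OF \<phi> a] by (simp add: \<tau>_def a'_def g_def)
    ultimately have "(reflect b \<circ> \<tau>) b = b"
      using ab \<eta>1(2)[of "norm (a - b)"] a b
      by (intro isometry_fixes_midpoint[OF a b _ isometry_comp[OF isometry_reflect[OF b] \<tau>]])
         (simp_all add: reflect_reflect)
    then have "\<tau> b = b"
      using reflect_reflect[OF b, of "\<tau> b"] \<tau> b reflect_self[OF b]
      by (simp add: isometry_def Pi_iff)
    then have eb: "reflect e b' = b'"
      using inv_isometry(1)[OF \<phi>, of "reflect e b'"] e G' reflect_G by (simp add: \<tau>_def b'_def)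
    have "norm (b' - a') \<le> lip * norm (b - a)"
      unfolding a'_def b'_def by (intro isometry_lipschitz \<phi> a b)
    then have "norm (b' - e) \<le> (lip + B * M * B * D) * norm (a - b)"
      using ea norm_triangle_ineq[of "b' - a'" "a' - e"] by (simp add: algebra_simps norm_minus_commute)
    then have "norm (b' - e) * B \<le> (lip + B * M * B * D) * norm (a - b) * B"
      using pos by (intro mult_right_mono) auto
    also have "\<dots> < r" using \<eta>3(2)[of "norm (a - b)"] ab by (simp add: mult_ac)
    finally have "\<kappa> * d b' e \<le> d b' (reflect e b')" by (intro d_reflect G' e)
    then have "\<kappa> * d b' e \<le> 0" using eb G' by simp
    then have "d b' e \<le> 0" using pos by (simp add: mult_le_0_iff)
    then have "b' = e" using d_eq_0 G' e by blast
    then show ?thesis using e by (simp add: a'_def b'_def g_def)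
  qed
  then show ?thesis using \<eta>1 \<eta>2 \<eta>3 by (intro exI[of _ "min \<eta>1 (min \<eta>2 \<eta>3)"]) auto
qed

end

section \<open>One-parameter groups under an isometry that fixes 1\<close>

locale based_isometry = exponential_metric_group +
  fixes \<psi> :: "'a \<Rightarrow> 'a"
  assumes isometry_\<psi>: "isometry \<psi>" and \<psi>_one: "\<psi> 1 = 1"
begin

lemma \<psi>_G: "g \<in> G ==> \<psi> g \<in> G"
  using isometry_\<psi> by (auto simp: isometry_def)

lemma \<psi>_lip: "g \<in> G ==> h \<in> G ==> norm (\<psi> g - \<psi> h) \<le> lip * norm (g - h)"
  using isometry_\<psi> by (rule isometry_lipschitz)

definition \<eta> :: real where
  "\<eta> = (SOME e. e > 0 \<and> (\<forall>a\<in>G. \<forall>b\<in>G. norm (a - b) < e --> \<psi> (reflect b a) = reflect (\<psi> b) (\<psi> a)))"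

lemma \<eta>_pos: "\<eta> > 0"
  and \<psi>_reflect: "a \<in> G ==> b \<in> G ==> norm (a - b) < \<eta> ==> \<psi> (reflect b a) = reflect (\<psi> b) (\<psi> a)"
  using someI_ex[OF isometry_reflection_local[OF isometry_\<psi>]] by (auto simp: \<eta>_def)

lemma \<psi>_inv: "g \<in> G ==> norm (g - 1) < \<eta> ==> \<psi> (ginv g) = ginv (\<psi> g)"
  using \<psi>_reflect[of g 1] by (simp add: reflect_def one_G \<psi>_one)

text \<open>The product \<open>h * g * h\<close> is the mirror image of g^-1 with respect to
  \<open>h\<close>, and inversion is the reflection in 1.\<close>

lemma \<psi>_triple:
  assumes "g \<in> G" "h \<in> G" "norm (g - 1) < \<eta>" "norm (ginv g - h) < \<eta>"
  shows "\<psi> (h * g * h) = \<psi> h * \<psi> g * \<psi> h"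
  using \<psi>_reflect[of "ginv g" h] \<psi>_inv[of g] assms by (simp add: reflect_def inv_G \<psi>_G)

text \<open>Each power is the mirror image of the power two steps earlier with respect to the one in
  between, so two consecutive exponents are carried through the induction. Neighbouring powers stay
  close although the powers themselves may wander far from 1.\<close>

lemma \<psi>_power:
  assumes g: "g \<in> G" "norm (g - 1) * B < \<eta>"
  shows "\<psi> (g ^ k) = \<psi> g ^ k"
proof -
  have pG: "g ^ k \<in> G" for k by (induction k) (auto simp: one_G mult_G g)
  have "\<psi> (g ^ k) = \<psi> g ^ k \<and> \<psi> (g ^ Suc k) = \<psi> g ^ Suc k"
  proof (induction k)
    case (Suc k)
    have "norm (g ^ k - g ^ Suc k) = norm (g ^ k * (1 - g))"
      by (simp add: right_diff_distrib power_commutes)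
    also have "\<dots> \<le> norm (g ^ k) * norm (1 - g)" by (rule norm_mult_ineq)
    also have "\<dots> \<le> B * norm (1 - g)" by (intro mult_right_mono norm_G pG) auto
    finally have n: "norm (g ^ k - g ^ Suc k) < \<eta>" using g(2) by (simp add: mult.commute norm_minus_commute)
    have r: "reflect (h ^ Suc k) (h ^ k) = h ^ Suc (Suc k)" if "h ^ k \<in> G" for h
      using that unfolding reflect_def by (simp add: power_Suc2 mult.assoc inv_right del: power_Suc)
    have "\<psi> (g ^ Suc (Suc k)) = \<psi> (reflect (g ^ Suc k) (g ^ k))" using r[OF pG] by simp
    also have "\<dots> = reflect (\<psi> g ^ Suc k) (\<psi> g ^ k)"
      using \<psi>_reflect[OF pG pG n] Suc.IH by simp
    also have "\<dots> = \<psi> g ^ Suc (Suc k)"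
      using r[of "\<psi> g"] \<psi>_G[OF pG[of k]] Suc.IH by simp
    finally show ?case using Suc.IH by simp
  qed (simp add: \<psi>_one)
  then show ?thesis by blast
qed

definition \<Lambda> :: real where "\<Lambda> = 2 * M * lip"

lemma \<Lambda>_pos: "\<Lambda> > 0" using pos lip_pos by (simp add: \<Lambda>_def)

lemma small_log:
  assumes "x \<in> K" "norm x \<le> 1/2"
  shows "\<exists>y\<in>K. \<psi> (exp x) = exp y \<and> norm y \<le> \<Lambda> * norm x"
proof -
  obtain y where y: "y \<in> K" "exp y = \<psi> (exp x)" "norm y \<le> M * norm (\<psi> (exp x) - 1)"
    using log_G[OF \<psi>_G[OF exp_K[OF assms(1)]]] by blast
  have "norm (\<psi> (exp x) - \<psi> 1) \<le> lip * norm (exp x - 1)" by (intro \<psi>_lip exp_K assms one_G)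
  also have "\<dots> \<le> lip * (2 * norm (x - 0))"
    using norm_exp_diff_bounds(2)[of x 0] assms lip_pos by (intro mult_left_mono) auto
  finally have "M * norm (\<psi> (exp x) - 1) \<le> M * (lip * (2 * norm x))"
    using pos by (intro mult_left_mono) (auto simp: \<psi>_one)
  then show ?thesis using y by (intro bexI[of _ y]) (auto simp: \<Lambda>_def)
qed

text \<open>The generator of the one-parameter group that \<open>\<psi>\<close> makes of \<open>t \<mapsto> exp (t x)\<close>;
  it is characterised by the times \<open>1 / m\<close> alone.\<close>

definition generator :: "'a \<Rightarrow> 'a \<Rightarrow> bool" where
  "generator x y \<longleftrightarrow> y \<in> K \<and> norm y \<le> \<Lambda> * norm x \<and>
     (\<exists>m0. \<forall>m\<ge>m0. \<psi> (exp (x /\<^sub>R of_nat m)) = exp (y /\<^sub>R of_nat m))"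

lemma eventually_small:
  fixes x :: "'b::real_normed_vector"
  assumes "e > 0"
  shows "\<exists>m0>0. \<forall>m\<ge>m0. norm (x /\<^sub>R of_nat m) < e"
proof -
  obtain m0 where m0: "norm x / e < real m0" using reals_Archimedean2 by blast
  show ?thesis
  proof (intro exI[of _ "Suc m0"] conjI allI impI)
    fix m assume "Suc m0 \<le> m"
    then have "norm x / e < real m" "real m > 0" using m0 by linarith+
    then show "norm (x /\<^sub>R of_nat m) < e" using assms by (simp add: field_simps)
  qed simp
qed

text \<open>Small logarithms \<open>Y m\<close> of the images at time 1/m satisfy
  \<open>Y m = of_nat k *\<^sub>R Y (m * k)\<close>, because both sides have the same exponential
  and lie in the ball where it is injective. Comparing \<open>Y m\<close> and \<open>Y m0\<close>
  through \<open>Y (m * m0)\<close> shows that m times \<open>Y m\<close> does not depend on m; this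
  vector is the generator.\<close>

lemma generator_ex: "x \<in> K ==> \<exists>y. generator x y"
proof -
  assume x: "x \<in> K"
  obtain \<epsilon> where \<epsilon>: "\<epsilon> > 0" "\<And>t. t < \<epsilon> ==> (1 + \<Lambda>) * t < 1/2" using small_ex[of "1/2" "1 + \<Lambda>"] \<Lambda>_pos by auto
  obtain \<epsilon>2 where \<epsilon>2: "\<epsilon>2 > 0" "\<And>t. t < \<epsilon>2 ==> (2 * B) * t < \<eta>" using small_ex[of \<eta> "2 * B"] pos \<eta>_pos by auto
  obtain m0 where m0: "m0 > 0" "\<And>m. m \<ge> m0 ==> norm (x /\<^sub>R of_nat m) < min \<epsilon> \<epsilon>2"
    using eventually_small[of "min \<epsilon> \<epsilon>2" x] \<epsilon> \<epsilon>2 by auto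
  have small: "norm (x /\<^sub>R of_nat m) \<le> 1/2 \<and> \<Lambda> * norm (x /\<^sub>R of_nat m) \<le> 1/2 \<and> norm (exp (x /\<^sub>R of_nat m) - 1) * B < \<eta>" if "m \<ge> m0" for m
  proof -
    define n where "n = norm (x /\<^sub>R of_nat m)"
    have n0: "n \<ge> 0" by (simp add: n_def)
    have 1: "(1 + \<Lambda>) * n < 1/2" "2 * B * n < \<eta>" using \<epsilon>(2)[of n] \<epsilon>2(2)[of n] m0(2)[OF that] by (auto simp: n_def)
    moreover have "0 \<le> \<Lambda> * n" using \<Lambda>_pos n0 by simp
    ultimately have 2: "n \<le> 1/2" "\<Lambda> * n \<le> 1/2" using n0 by (auto simp: distrib_right)
    then have "norm (exp (x /\<^sub>R of_nat m) - 1) \<le> 2 * n" using norm_exp_diff_bounds(2)[of "x /\<^sub>R of_nat m" 0] by (simp add: n_def)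
    then have "norm (exp (x /\<^sub>R of_nat m) - 1) * B \<le> 2 * n * B" using pos by (intro mult_right_mono) auto
    then show ?thesis using 1 2 unfolding n_def[symmetric] by (simp add: mult_ac)
  qed
  define Y where "Y m = (SOME y. y \<in> K \<and> \<psi> (exp (x /\<^sub>R of_nat m)) = exp y \<and> norm y \<le> \<Lambda> * norm (x /\<^sub>R of_nat m))" for m :: nat
  have Y: "Y m \<in> K \<and> \<psi> (exp (x /\<^sub>R of_nat m)) = exp (Y m) \<and> norm (Y m) \<le> \<Lambda> * norm (x /\<^sub>R of_nat m)" if "m \<ge> m0" for m
  proof -
    have "\<exists>y. y \<in> K \<and> \<psi> (exp (x /\<^sub>R of_nat m)) = exp y \<and> norm y \<le> \<Lambda> * norm (x /\<^sub>R of_nat m)"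
      using small_log[OF K_scale[OF x]] small[OF that] by blast
    then show ?thesis unfolding Y_def by (rule someI_ex)
  qed
  have step: "Y m = of_nat k *\<^sub>R Y (m * k)" if m: "m \<ge> m0" and k: "k > 0" for m k
  proof -
    have mk: "m * k \<ge> m0" using m k by (simp add: le_trans[of m0 m])
    have "x /\<^sub>R of_nat m = of_nat k *\<^sub>R (x /\<^sub>R of_nat (m * k))" using k m0(1) m by (simp add: field_simps)
    then have "exp (x /\<^sub>R of_nat m) = exp (x /\<^sub>R of_nat (m * k)) ^ k" by (simp only: exp_scale_nat)
    then have "\<psi> (exp (x /\<^sub>R of_nat m)) = \<psi> (exp (x /\<^sub>R of_nat (m * k))) ^ k"
      using \<psi>_power[of "exp (x /\<^sub>R of_nat (m * k))" k] small[OF mk] x by (simp add: exp_K K_scale)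
    then have e: "exp (Y m) = exp (of_nat k *\<^sub>R Y (m * k))"
      using Y[OF m] Y[OF mk] by (simp add: exp_scale_nat)
    have "norm (of_nat k *\<^sub>R Y (m * k)) \<le> of_nat k * (\<Lambda> * norm (x /\<^sub>R of_nat (m * k)))"
      using Y[OF mk] by (simp add: mult_left_mono)
    also have "\<dots> = \<Lambda> * norm (x /\<^sub>R of_nat m)" using k by simp
    finally have "norm (Y m - of_nat k *\<^sub>R Y (m * k)) \<le> 4 * norm (exp (Y m) - exp (of_nat k *\<^sub>R Y (m * k)))"
      using Y[OF m] small[OF m] by (intro norm_exp_diff_bounds) linarith+
    then show ?thesis using e by simp
  qed
  have "Y m = (of_nat m0 *\<^sub>R Y m0) /\<^sub>R of_nat m" if m: "m \<ge> m0" for m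
  proof -
    have m0m: "m > 0" using m m0 by linarith
    have "of_nat m *\<^sub>R Y m = of_nat m *\<^sub>R (of_nat m0 *\<^sub>R Y (m * m0))" using step[OF m m0(1)] by simp
    also have "\<dots> = of_nat m0 *\<^sub>R Y m0" using step[OF order_refl m0m] by (simp add: mult.commute)
    finally have "of_nat m *\<^sub>R Y m = of_nat m0 *\<^sub>R Y m0" .
    then have "(of_nat m *\<^sub>R Y m) /\<^sub>R of_nat m = (of_nat m0 *\<^sub>R Y m0) /\<^sub>R of_nat m" by simp
    then show ?thesis using m0m by simp
  qed
  then have "\<psi> (exp (x /\<^sub>R of_nat m)) = exp ((of_nat m0 *\<^sub>R Y m0) /\<^sub>R of_nat m)" if "m \<ge> m0" for m
    using Y[OF that] that by metis
  moreover have "norm (of_nat m0 *\<^sub>R Y m0) \<le> of_nat m0 * (\<Lambda> * norm (x /\<^sub>R of_nat m0))"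
    using Y[OF order_refl] by (simp only: norm_scaleR abs_of_nat) (simp add: mult_left_mono)
  moreover have "of_nat m0 * (\<Lambda> * norm (x /\<^sub>R of_nat m0)) = \<Lambda> * norm x" using m0(1) by simp
  ultimately have "generator x (of_nat m0 *\<^sub>R Y m0)"
    unfolding generator_def using K_scale[of "Y m0"] Y[OF order_refl] by (metis (no_types, lifting))
  then show ?thesis by blast
qed

definition L :: "'a \<Rightarrow> 'a" where "L x = (SOME y. generator x y)"

lemma generator_L: "x \<in> K ==> generator x (L x)"
  unfolding L_def by (rule someI_ex, rule generator_ex)

lemma L_K: "x \<in> K ==> L x \<in> K" and norm_L: "x \<in> K ==> norm (L x) \<le> \<Lambda> * norm x"
  using generator_L by (auto simp: generator_def)

lemma \<psi>_exp_div:
  assumes "x \<in> K"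
  shows "\<exists>m0. \<forall>m\<ge>m0. \<psi> (exp (x /\<^sub>R of_nat m)) = exp (L x /\<^sub>R of_nat m)"
  using generator_L[OF assms] by (auto simp: generator_def)

text \<open>Writing \<open>exp x\<close> as the m-th power of an element close to 1 carries the
  statement from short times to time 1, whatever the size of \<open>x\<close>.\<close>

lemma \<psi>_exp:
  assumes "x \<in> K"
  shows "\<psi> (exp x) = exp (L x)"
proof -
  obtain m0 where m0: "\<And>m. m \<ge> m0 ==> \<psi> (exp (x /\<^sub>R of_nat m)) = exp (L x /\<^sub>R of_nat m)"
    using \<psi>_exp_div[OF assms] by blast
  obtain \<epsilon> where \<epsilon>: "\<epsilon> > 0" "\<And>t. t < \<epsilon> ==> (2 * B) * t < \<eta>" using small_ex[of \<eta> "2 * B"] pos \<eta>_pos by auto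
  obtain m1 where m1: "m1 > 0" "\<And>m. m \<ge> m1 ==> norm (x /\<^sub>R of_nat m) < min \<epsilon> (1/2)"
    using eventually_small[of "min \<epsilon> (1/2)" x] \<epsilon> by auto
  define m where "m = max m0 m1"
  have m: "m > 0" "m \<ge> m0" "m \<ge> m1" using m1 by (auto simp: m_def)
  let ?x = "x /\<^sub>R of_nat m"
  have "norm (exp ?x - 1) \<le> 2 * norm ?x" using norm_exp_diff_bounds(2)[of ?x 0] m1(2)[OF m(3)] by simp
  then have "norm (exp ?x - 1) * B \<le> 2 * norm ?x * B" using pos by (intro mult_right_mono) auto
  also have "\<dots> < \<eta>" using \<epsilon>(2)[of "norm ?x"] m1(2)[OF m(3)] by (simp add: mult_ac)
  finally have "\<psi> (exp ?x ^ m) = \<psi> (exp ?x) ^ m" using assms by (intro \<psi>_power exp_K K_scale)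
  then have "\<psi> (exp (of_nat m *\<^sub>R ?x)) = exp (of_nat m *\<^sub>R (L x /\<^sub>R of_nat m))"
    using m0[OF m(2)] by (simp only: exp_scale_nat)
  moreover have "of_nat m *\<^sub>R (z /\<^sub>R of_nat m) = z" for z :: 'a using m by simp
  ultimately show ?thesis by simp
qed

end

section \<open>Linearity of the generator map and its double brackets\<close>

lemma zero_if_norm_le_inverse:
  fixes w :: "'a::real_normed_vector"
  assumes "\<And>m. m \<ge> m0 ==> norm w \<le> D * inverse (real m)"
  shows "w = 0"
proof -
  have "(\<lambda>m. D * inverse (real m)) \<longlonglongrightarrow> D * 0"
    by (intro tendsto_mult tendsto_const lim_inverse_n)
  then have "(\<lambda>m. D * inverse (real m)) \<longlonglongrightarrow> 0" by simp
  moreover have "\<forall>\<^sub>F m in sequentially. norm w \<le> D * inverse (real m)"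
    using assms by (auto simp: eventually_sequentially)
  ultimately have "norm w \<le> 0" by (intro tendsto_lowerbound) auto
  then show ?thesis by simp
qed

context based_isometry begin

definition sym_prod :: "'a \<Rightarrow> 'a \<Rightarrow> real \<Rightarrow> 'a" where
  "sym_prod x y t = exp (t *\<^sub>R x) * exp (t *\<^sub>R y) * exp (t *\<^sub>R x)"

lemma sym_prod_G: "x \<in> K ==> y \<in> K ==> sym_prod x y t \<in> G"
  unfolding sym_prod_def by (intro mult_G exp_K K_scale)

lemma sym_bch3_K: "x \<in> K ==> y \<in> K ==> sym_bch3 x y \<in> K"
  unfolding sym_bch3_def by (intro K_neg K_scale K_add K_bracket)

lemma inverse_small: "e > 0 ==> \<exists>m0>0. \<forall>m\<ge>m0. inverse (real m) * b < e"
proof -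
  assume e: "e > 0"
  obtain m0 where "m0 > 0" "\<forall>m\<ge>m0. norm (b /\<^sub>R real m) < e" using eventually_small[OF e, of b] by blast
  then show ?thesis by (intro exI[of _ m0]) (auto simp: abs_less_iff)
qed

lemma \<psi>_sym_prod:
  assumes "x \<in> K" "y \<in> K"
  shows "\<exists>m0>0. \<forall>m\<ge>m0. \<psi> (sym_prod x y (inverse (real m))) = sym_prod (L x) (L y) (inverse (real m))"
proof -
  obtain m1 where m1: "\<And>m. m \<ge> m1 ==> \<psi> (exp (x /\<^sub>R real m)) = exp (L x /\<^sub>R real m)"
    using \<psi>_exp_div[OF assms(1)] by blast
  obtain m2 where m2: "\<And>m. m \<ge> m2 ==> \<psi> (exp (y /\<^sub>R real m)) = exp (L y /\<^sub>R real m)"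
    using \<psi>_exp_div[OF assms(2)] by blast
  define \<epsilon> where "\<epsilon> = min (1/2) (\<eta> / 8)"
  have \<epsilon>: "\<epsilon> > 0" using \<eta>_pos by (simp add: \<epsilon>_def)
  obtain m3 where m3: "m3 > 0" "\<And>m. m \<ge> m3 ==> norm (x /\<^sub>R real m) < \<epsilon>" using eventually_small[OF \<epsilon>] by blast
  obtain m4 where m4: "m4 > 0" "\<And>m. m \<ge> m4 ==> norm (y /\<^sub>R real m) < \<epsilon>" using eventually_small[OF \<epsilon>] by blast
  have "\<psi> (sym_prod x y (inverse (real m))) = sym_prod (L x) (L y) (inverse (real m))"
    if m: "m \<ge> max m1 (max m2 (max m3 m4))" for m
  proof -
    define u v where "u = x /\<^sub>R real m" and "v = y /\<^sub>R real m"
    have uv: "u \<in> K" "v \<in> K" using assms by (auto simp: u_def v_def K_scale)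
    have n: "norm u < \<epsilon>" "norm v < \<epsilon>" using m3(2)[of m] m4(2)[of m] m by (auto simp: u_def v_def)
    then have h: "norm u \<le> 1/2" "norm v \<le> 1/2" "norm u < \<eta> / 8" "norm v < \<eta> / 8" by (auto simp: \<epsilon>_def)
    have "norm (exp v - exp 0) \<le> 2 * norm (v - 0)" using h by (intro norm_exp_diff_bounds) auto
    then have 1: "norm (exp v - 1) < \<eta>" using h \<eta>_pos by simp
    have "norm (exp (- v) - exp u) \<le> 2 * norm (- v - u)" using h by (intro norm_exp_diff_bounds) auto
    also have "norm (- v - u) \<le> norm v + norm u" using norm_triangle_ineq4[of "- v" u] by simp
    finally have 2: "norm (ginv (exp v) - exp u) < \<eta>" using h \<eta>_pos uv by (simp add: inv_exp)
    have "\<psi> (exp u * exp v * exp u) = \<psi> (exp u) * \<psi> (exp v) * \<psi> (exp u)"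
      using 1 2 uv by (intro \<psi>_triple exp_K)
    then show ?thesis using m1[of m] m2[of m] m by (simp add: sym_prod_def u_def v_def)
  qed
  then show ?thesis using m3 by (intro exI[of _ "max m1 (max m2 (max m3 m4))"]) auto
qed

lemma sym_prod_approx4:
  "\<exists>D\<ge>0. \<forall>m>0. norm (sym_prod x y (inverse (real m)) -
     exp (inverse (real m) *\<^sub>R (x + y + x) + inverse (real m) ^ 3 *\<^sub>R sym_bch3 x y)) \<le> D * inverse (real m) ^ 4"
proof -
  obtain D where D: "\<And>t. t \<in> {0..1} ==> norm (sym_prod x y t - exp (t *\<^sub>R (x + y + x) + t ^ 3 *\<^sub>R sym_bch3 x y)) \<le> D * t ^ 4"
    using eq_upto4_sym_product[of x y] unfolding eq_upto4_def sym_prod_def by blast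
  have "0 \<le> D" using order_trans[OF norm_ge_zero D[of 1]] by simp
  moreover have "inverse (real m) \<in> {0..1}" if "m > 0" for m using that by (simp add: inverse_le_1_iff)
  ultimately show ?thesis using D by blast
qed

text \<open>The cubic correction is absorbed into the error; order t^2 is precise enough to
  determine the linear term of the logarithm.\<close>

lemma sym_prod_approx2:
  "\<exists>D\<ge>0. \<exists>m0>0. \<forall>m\<ge>m0. norm (sym_prod x y (inverse (real m)) - exp (inverse (real m) *\<^sub>R (x + y + x)))
     \<le> D * inverse (real m) ^ 2"
proof -
  obtain D where D: "D \<ge> 0" "\<And>m. m > 0 ==> norm (sym_prod x y (inverse (real m)) -
     exp (inverse (real m) *\<^sub>R (x + y + x) + inverse (real m) ^ 3 *\<^sub>R sym_bch3 x y)) \<le> D * inverse (real m) ^ 4"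
    using sym_prod_approx4[of x y] by blast
  let ?s = "x + y + x" and ?p = "sym_bch3 x y"
  obtain m0 where m0: "m0 > 0" "\<And>m. m \<ge> m0 ==> inverse (real m) * (norm ?s + norm ?p) < 1/2"
    using inverse_small[of "1/2"] by (metis half_pos)
  have "norm (sym_prod x y (inverse (real m)) - exp (inverse (real m) *\<^sub>R ?s)) \<le> (D + 2 * norm ?p) * inverse (real m) ^ 2"
    if m: "m \<ge> m0" for m
  proof -
    define t where "t = inverse (real m)"
    have t: "0 \<le> t" "t \<le> 1" using m m0(1) by (auto simp: t_def inverse_le_1_iff)
    have t3: "t ^ 3 \<le> t" "t ^ 3 \<le> t ^ 2" "t ^ 4 \<le> t ^ 2"
      using t power_decreasing[of 1 3 t] power_decreasing[of 2 3 t] power_decreasing[of 2 4 t] by auto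
    have "t * norm ?s \<ge> 0" "t * norm ?p \<ge> 0" using t by auto
    moreover have ts: "t * norm ?s + t * norm ?p < 1/2" using m0(2)[OF m] by (simp add: t_def distrib_left)
    ultimately have "t * norm ?s \<le> 1/2" by linarith
    then have a: "norm (t *\<^sub>R ?s) \<le> 1/2" using t by simp
    have p3: "t ^ 3 * norm ?p \<le> t * norm ?p" using t3 by (intro mult_right_mono) auto
    have "norm (t *\<^sub>R ?s + t ^ 3 *\<^sub>R ?p) \<le> t * norm ?s + t ^ 3 * norm ?p"
      using norm_triangle_ineq[of "t *\<^sub>R ?s" "t ^ 3 *\<^sub>R ?p"] t by simp
    then have b: "norm (t *\<^sub>R ?s + t ^ 3 *\<^sub>R ?p) \<le> 1/2" using ts p3 by linarith
    have "norm (exp (t *\<^sub>R ?s + t ^ 3 *\<^sub>R ?p) - exp (t *\<^sub>R ?s)) \<le> 2 * norm (t *\<^sub>R ?s + t ^ 3 *\<^sub>R ?p - t *\<^sub>R ?s)"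
      by (intro norm_exp_diff_bounds a b)
    also have "\<dots> = 2 * (t ^ 3 * norm ?p)" using t by simp
    also have "\<dots> \<le> 2 * (t ^ 2 * norm ?p)" using t3 by (intro mult_left_mono mult_right_mono) auto
    also have "\<dots> = 2 * norm ?p * t ^ 2" by simp
    finally have 1: "norm (exp (t *\<^sub>R ?s + t ^ 3 *\<^sub>R ?p) - exp (t *\<^sub>R ?s)) \<le> 2 * norm ?p * t ^ 2" .
    have "norm (sym_prod x y t - exp (t *\<^sub>R ?s + t ^ 3 *\<^sub>R ?p)) \<le> D * t ^ 4"
      using D(2)[of m] m m0(1) by (simp add: t_def)
    also have "\<dots> \<le> D * t ^ 2" using t3 D(1) by (intro mult_left_mono) auto
    finally have 2: "norm (sym_prod x y t - exp (t *\<^sub>R ?s + t ^ 3 *\<^sub>R ?p)) \<le> D * t ^ 2" .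
    have "norm (sym_prod x y t - exp (t *\<^sub>R ?s)) \<le> D * t ^ 2 + 2 * norm ?p * t ^ 2"
      using norm_triangle_mono[OF 2 1] by simp
    then show ?thesis by (simp add: t_def distrib_right)
  qed
  then show ?thesis using D(1) m0(1) by (intro exI[of _ "D + 2 * norm ?p"] conjI exI[of _ m0]) auto
qed

text \<open>At t = 1/m the exponentials of both candidates are within O(t^2) of the image of the
  symmetric product, one by the Lipschitz property of \<open>\<psi>\<close>, the other by expanding
  after \<open>\<psi>\<close>. Taking logarithms and dividing by t leaves a difference of order
  1/m.\<close>

lemma L_sym_sum:
  assumes x: "x \<in> K" and y: "y \<in> K"
  shows "L (x + y + x) = L x + L y + L x"
proof -
  let ?s = "x + y + x" and ?s' = "L x + L y + L x"
  have sK: "?s \<in> K" "?s' \<in> K" using x y by (auto intro!: K_add L_K)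
  obtain D m1 where D: "D \<ge> 0" "m1 > 0" "\<And>m. m \<ge> m1 ==> norm (sym_prod x y (inverse (real m)) - exp (inverse (real m) *\<^sub>R ?s)) \<le> D * inverse (real m) ^ 2"
    using sym_prod_approx2[of x y] by blast
  obtain D' m2 where D': "D' \<ge> 0" "m2 > 0" "\<And>m. m \<ge> m2 ==> norm (sym_prod (L x) (L y) (inverse (real m)) - exp (inverse (real m) *\<^sub>R ?s')) \<le> D' * inverse (real m) ^ 2"
    using sym_prod_approx2[of "L x" "L y"] by blast
  obtain m3 where m3: "\<And>m. m \<ge> m3 ==> \<psi> (exp (?s /\<^sub>R real m)) = exp (L ?s /\<^sub>R real m)"
    using \<psi>_exp_div[OF sK(1)] by blast
  obtain m4 where m4: "m4 > 0" "\<And>m. m \<ge> m4 ==> \<psi> (sym_prod x y (inverse (real m))) = sym_prod (L x) (L y) (inverse (real m))"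
    using \<psi>_sym_prod[OF x y] by blast
  obtain m5 where m5: "m5 > 0" "\<And>m. m \<ge> m5 ==> norm (L ?s /\<^sub>R real m) < 1/2" using eventually_small[of "1/2"] by (metis half_pos)
  obtain m6 where m6: "m6 > 0" "\<And>m. m \<ge> m6 ==> norm (?s' /\<^sub>R real m) < 1/2" using eventually_small[of "1/2"] by (metis half_pos)
  have "norm (L ?s - ?s') \<le> (4 * (lip * D + D')) * inverse (real m)"
    if m: "m \<ge> max m1 (max m2 (max m3 (max m4 (max m5 m6))))" for m
  proof -
    define t where "t = inverse (real m)"
    have t: "t > 0" using m D(2) by (auto simp: t_def)
    have 1: "norm (\<psi> (exp (t *\<^sub>R ?s)) - \<psi> (sym_prod x y t)) \<le> lip * (D * t ^ 2)"
      using \<psi>_lip[of "exp (t *\<^sub>R ?s)" "sym_prod x y t"] D(3)[of m] m lip_pos sK sym_prod_G[OF x y]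
      by (simp add: t_def exp_K K_scale norm_minus_commute) (smt (verit, best) mult_left_mono norm_minus_commute)
    have 2: "norm (sym_prod (L x) (L y) t - exp (t *\<^sub>R ?s')) \<le> D' * t ^ 2"
      using D'(3)[of m] m by (simp add: t_def)
    have "norm (exp (t *\<^sub>R L ?s) - exp (t *\<^sub>R ?s')) \<le> lip * (D * t ^ 2) + D' * t ^ 2"
      using norm_triangle_mono[OF 1 2] m3[of m] m4(2)[of m] m by (simp add: t_def)
    moreover have "norm (t *\<^sub>R L ?s - t *\<^sub>R ?s') \<le> 4 * norm (exp (t *\<^sub>R L ?s) - exp (t *\<^sub>R ?s'))"
      using m5(2)[of m] m6(2)[of m] m by (intro norm_exp_diff_bounds) (auto simp: t_def)
    moreover have "norm (t *\<^sub>R L ?s - t *\<^sub>R ?s') = t * norm (L ?s - ?s')"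
      using t by (simp flip: scaleR_diff_right)
    ultimately have "t * norm (L ?s - ?s') \<le> t * (4 * (lip * D + D') * t)"
      by (simp add: algebra_simps power2_eq_square)
    then show ?thesis using t by (simp add: t_def)
  qed
  then have "L ?s - ?s' = 0" by (rule zero_if_norm_le_inverse)
  then show ?thesis by simp
qed

lemma L_0: "L 0 = 0"
  using norm_L[OF K_0] by simp

text \<open>Symmetrisation: x + y is x/2 + y + x/2, and the same formula with 0 in the place of
  \<open>y\<close> puts the two halves together again.\<close>

lemma L_add:
  assumes "x \<in> K" "y \<in> K"
  shows "L (x + y) = L x + L y"
proof -
  have h: "x /\<^sub>R 2 \<in> K" using assms by (simp add: K_scale)
  have hh: "x /\<^sub>R 2 + x /\<^sub>R 2 = x" by (simp flip: scaleR_add_left)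
  have "x /\<^sub>R 2 + 0 + x /\<^sub>R 2 = x" using hh by simp
  moreover have "x /\<^sub>R 2 + y + x /\<^sub>R 2 = x + y" using hh by (metis add.assoc add.commute)
  ultimately have "L x = L (x /\<^sub>R 2) + L 0 + L (x /\<^sub>R 2)" "L (x + y) = L (x /\<^sub>R 2) + L y + L (x /\<^sub>R 2)"
    using L_sym_sum[OF h K_0] L_sym_sum[OF h assms(2)] by metis+
  then show ?thesis by (simp add: L_0 add_ac)
qed

lemma L_neg: "x \<in> K ==> L (- x) = - L x"
  using L_add[of x "- x"] K_neg[of x] by (simp add: L_0 eq_neg_iff_add_eq_0 add.commute)

lemma L_scale_nat: "x \<in> K ==> L (real k *\<^sub>R x) = real k *\<^sub>R L x"
  by (induction k) (auto simp: L_0 L_add K_scale scaleR_add_left)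

lemma L_scale_int:
  assumes "x \<in> K"
  shows "L (real_of_int k *\<^sub>R x) = real_of_int k *\<^sub>R L x"
proof (cases "k \<ge> 0")
  case True
  then show ?thesis using L_scale_nat[OF assms, of "nat k"] by simp
next
  case False
  then have "real_of_int k *\<^sub>R x = - (real (nat (- k)) *\<^sub>R x)" by simp
  then show ?thesis using L_scale_nat[OF assms, of "nat (- k)"] L_neg[OF K_scale[OF assms]] False by simp
qed

text \<open>Integer multiples follow from additivity. For real \<open>s\<close> the fractional part
  \<open>e\<close> of m s contributes a bounded amount by \<open>norm_L\<close>, and division by m
  makes it disappear.\<close>

lemma L_scale:
  assumes x: "x \<in> K"
  shows "L (s *\<^sub>R x) = s *\<^sub>R L x"
proof -
  have "norm (L (s *\<^sub>R x) - s *\<^sub>R L x) \<le> 2 * \<Lambda> * norm x * inverse (real m)" if m: "m \<ge> 1" for m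
  proof -
    define k e where "k = \<lfloor>real m * s\<rfloor>" and "e = real m * s - real_of_int k"
    have e: "\<bar>e\<bar> \<le> 1" unfolding e_def k_def by linarith
    have eq: "real m *\<^sub>R (s *\<^sub>R x) = real_of_int k *\<^sub>R x + e *\<^sub>R x" by (simp add: e_def flip: scaleR_add_left)
    have "real m *\<^sub>R L (s *\<^sub>R x) = L (real_of_int k *\<^sub>R x + e *\<^sub>R x)"
      using L_scale_nat[OF K_scale[OF x], of m s] eq by simp
    also have "\<dots> = real_of_int k *\<^sub>R L x + L (e *\<^sub>R x)" using x by (simp add: L_add K_scale L_scale_int)
    finally have "real m *\<^sub>R (L (s *\<^sub>R x) - s *\<^sub>R L x) = L (e *\<^sub>R x) - e *\<^sub>R L x"
      by (simp add: e_def algebra_simps)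
    moreover have "norm (L (e *\<^sub>R x) - e *\<^sub>R L x) \<le> norm (L (e *\<^sub>R x)) + norm (e *\<^sub>R L x)"
      by (rule norm_triangle_ineq4)
    moreover have "norm (L (e *\<^sub>R x)) \<le> \<Lambda> * norm x"
    proof -
      have "norm (L (e *\<^sub>R x)) \<le> \<Lambda> * norm (e *\<^sub>R x)" using x by (intro norm_L K_scale)
      also have "norm (e *\<^sub>R x) \<le> norm x" using e by (simp add: mult_left_le_one_le)
      finally show ?thesis using \<Lambda>_pos by simp
    qed
    moreover have "norm (e *\<^sub>R L x) \<le> \<Lambda> * norm x"
      using norm_L[OF x] mult_left_le_one_le[of "norm (L x)" "\<bar>e\<bar>"] e by simp
    ultimately have "norm (real m *\<^sub>R (L (s *\<^sub>R x) - s *\<^sub>R L x)) \<le> 2 * \<Lambda> * norm x" by simp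
    then have "real m * norm (L (s *\<^sub>R x) - s *\<^sub>R L x) \<le> 2 * \<Lambda> * norm x" by simp
    then show ?thesis using m by (simp add: field_simps)
  qed
  then have "L (s *\<^sub>R x) - s *\<^sub>R L x = 0" by (rule zero_if_norm_le_inverse)
  then show ?thesis by simp
qed

lemma L_diff: "x \<in> K ==> y \<in> K ==> L (x - y) = L x - L y"
  using L_add[of x "- y"] K_neg[of y] L_neg[of y] by simp

text \<open>With linearity at hand, the image of the exponential approximating the symmetric product
  has the exact logarithm \<open>?u\<close>, while expanding after \<open>\<psi>\<close> gives
  \<open>?v\<close>. Their linear terms agree, and an error O(t^4) forces the coefficients of t^3 to
  agree as well.\<close>

lemma L_sym_bch3:
  assumes x: "x \<in> K" and y: "y \<in> K"
  shows "L (sym_bch3 x y) = sym_bch3 (L x) (L y)"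
proof -
  let ?s = "x + y + x" and ?s' = "L x + L y + L x" and ?p = "sym_bch3 x y" and ?p' = "sym_bch3 (L x) (L y)"
  have K: "?s \<in> K" "?s' \<in> K" "?p \<in> K" using x y by (auto intro!: K_add L_K sym_bch3_K)
  obtain D where D: "D \<ge> 0" "\<And>m. m > 0 ==> norm (sym_prod x y (inverse (real m)) -
     exp (inverse (real m) *\<^sub>R ?s + inverse (real m) ^ 3 *\<^sub>R ?p)) \<le> D * inverse (real m) ^ 4"
    using sym_prod_approx4[of x y] by blast
  obtain D' where D': "D' \<ge> 0" "\<And>m. m > 0 ==> norm (sym_prod (L x) (L y) (inverse (real m)) -
     exp (inverse (real m) *\<^sub>R ?s' + inverse (real m) ^ 3 *\<^sub>R ?p')) \<le> D' * inverse (real m) ^ 4"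
    using sym_prod_approx4[of "L x" "L y"] by blast
  obtain m1 where m1: "m1 > 0" "\<And>m. m \<ge> m1 ==> \<psi> (sym_prod x y (inverse (real m))) = sym_prod (L x) (L y) (inverse (real m))"
    using \<psi>_sym_prod[OF x y] by blast
  obtain m2 where m2: "m2 > 0" "\<And>m. m \<ge> m2 ==> inverse (real m) * (norm ?s' + norm (L ?p) + norm ?p') < 1/2"
    using inverse_small[of "1/2"] by (metis half_pos)
  have "norm (L ?p - ?p') \<le> (4 * (lip * D + D')) * inverse (real m)" if m: "m \<ge> max m1 m2" for m
  proof -
    define t where "t = inverse (real m)"
    have m0: "m > 0" using m m1(1) by auto
    have t: "t > 0" "t \<le> 1" using m0 by (auto simp: t_def inverse_le_1_iff)
    have t3: "t ^ 3 \<le> t" using t power_decreasing[of 1 3 t] by auto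
    have sm: "norm (t *\<^sub>R ?s' + t ^ 3 *\<^sub>R q) \<le> 1/2" if "norm q \<le> norm (L ?p) + norm ?p'" for q
    proof -
      have "norm (t *\<^sub>R ?s' + t ^ 3 *\<^sub>R q) \<le> t * norm ?s' + t ^ 3 * norm q"
        using norm_triangle_ineq[of "t *\<^sub>R ?s'" "t ^ 3 *\<^sub>R q"] t by simp
      also have "\<dots> \<le> t * norm ?s' + t * (norm (L ?p) + norm ?p')"
        using t3 t that by (intro add_mono mult_mono) auto
      also have "\<dots> < 1/2" using m2(2)[of m] m by (simp add: t_def distrib_left add.assoc)
      finally show ?thesis by simp
    qed
    let ?u = "t *\<^sub>R ?s' + t ^ 3 *\<^sub>R L ?p" and ?v = "t *\<^sub>R ?s' + t ^ 3 *\<^sub>R ?p'"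
    have Lu: "L (t *\<^sub>R ?s + t ^ 3 *\<^sub>R ?p) = ?u"
      using K by (simp only: L_add[of "t *\<^sub>R ?s"] K_scale L_scale L_sym_sum[OF x y] x y)
    have zK: "t *\<^sub>R ?s + t ^ 3 *\<^sub>R ?p \<in> K" by (rule K_add[OF K_scale[OF K(1)] K_scale[OF K(3)]])
    have "norm (\<psi> (exp (t *\<^sub>R ?s + t ^ 3 *\<^sub>R ?p)) - \<psi> (sym_prod x y t)) \<le>
        lip * norm (exp (t *\<^sub>R ?s + t ^ 3 *\<^sub>R ?p) - sym_prod x y t)"
      by (intro \<psi>_lip exp_K zK sym_prod_G x y)
    also have "\<dots> \<le> lip * (D * t ^ 4)"
      using D(2)[OF m0] lip_pos by (intro mult_left_mono) (auto simp: t_def norm_minus_commute)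
    finally have 1: "norm (exp ?u - sym_prod (L x) (L y) t) \<le> lip * (D * t ^ 4)"
      using \<psi>_exp[OF zK] m1(2)[of m] m Lu by (simp add: t_def)
    have 2: "norm (sym_prod (L x) (L y) t - exp ?v) \<le> D' * t ^ 4"
      using D'(2)[OF m0] by (simp add: t_def)
    have "norm (exp ?u - exp ?v) \<le> lip * (D * t ^ 4) + D' * t ^ 4"
      using norm_triangle_mono[OF 1 2] by simp
    moreover have "norm (?u - ?v) \<le> 4 * norm (exp ?u - exp ?v)"
      by (intro norm_exp_diff_bounds sm) auto
    moreover have "norm (?u - ?v) = t ^ 3 * norm (L ?p - ?p')"
      using t by (simp flip: scaleR_diff_right)
    ultimately have "t ^ 3 * norm (L ?p - ?p') \<le> t ^ 3 * (4 * (lip * D + D') * t)"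
      by (simp add: algebra_simps eval_nat_numeral)
    then show ?thesis using t by (simp add: t_def)
  qed
  then have "L ?p - ?p' = 0" by (rule zero_if_norm_le_inverse)
  then show ?thesis by simp
qed

text \<open>The summand [x,[x,y]] is odd in \<open>y\<close> and [y,[x,y]] is even, so the odd part
  isolates the double bracket.\<close>

lemma sym_bch3_odd_part:
  "sym_bch3 x y - sym_bch3 x (- y) = - ((x * (x * y - y * x) - (x * y - y * x) * x) /\<^sub>R 3)" for x y :: 'a
proof -
  have "3 *\<^sub>R (sym_bch3 x y - sym_bch3 x (- y)) = - (x * (x * y - y * x) - (x * y - y * x) * x)"
    unfolding sym_bch3_def by (simp add: algebra_simps scaleR_2 flip: scaleR_add_left)
  then have e: "3 *\<^sub>R (sym_bch3 x y - sym_bch3 x (- y)) = 3 *\<^sub>R - ((x * (x * y - y * x) - (x * y - y * x) * x) /\<^sub>R 3)"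
    by simp
  have "u = v" if "3 *\<^sub>R u = 3 *\<^sub>R v" for u v :: 'a
    using that by simp
  from this[OF e] show ?thesis .
qed

lemma L_double_bracket:
  assumes x: "x \<in> K" and y: "y \<in> K"
  shows "L (x * (x * y - y * x) - (x * y - y * x) * x) =
    L x * (L x * L y - L y * L x) - (L x * L y - L y * L x) * L x"
proof -
  let ?b = "x * (x * y - y * x) - (x * y - y * x) * x"
  let ?b' = "L x * (L x * L y - L y * L x) - (L x * L y - L y * L x) * L x"
  have b: "?b \<in> K" using x y by (intro K_bracket)
  have "L (- (?b /\<^sub>R 3)) = L (sym_bch3 x y) - L (sym_bch3 x (- y))"
    using x y by (simp only: L_diff K_neg sym_bch3_K sym_bch3_odd_part[symmetric])
  also have "\<dots> = - (?b' /\<^sub>R 3)"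
    using x y by (simp only: L_neg L_sym_bch3 K_neg sym_bch3_odd_part)
  finally have "L (- (?b /\<^sub>R 3)) = - (?b' /\<^sub>R 3)" .
  then show ?thesis using b by (simp add: L_neg K_scale L_scale)
qed

lemma L_inj: "x \<in> K ==> L x = 0 ==> x = 0"
proof -
  assume x: "x \<in> K" "L x = 0"
  obtain m1 where m1: "\<And>m. m \<ge> m1 ==> \<psi> (exp (x /\<^sub>R real m)) = exp (L x /\<^sub>R real m)"
    using \<psi>_exp_div[OF x(1)] by blast
  obtain m2 where m2: "m2 > 0" "\<And>m. m \<ge> m2 ==> norm (x /\<^sub>R real m) < 1/2" using eventually_small[of "1/2"] by (metis half_pos)
  define m where "m = max m1 m2"
  have m: "m > 0" "m \<ge> m1" "m \<ge> m2" using m2 by (auto simp: m_def)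
  have "\<psi> (exp (x /\<^sub>R real m)) = \<psi> 1" using m1[OF m(2)] x by (simp add: \<psi>_one)
  then have "exp (x /\<^sub>R real m) = 1"
    using isometry_inj_on[OF isometry_\<psi>] x by (auto simp: inj_on_def one_G exp_K K_scale)
  moreover have "norm (x /\<^sub>R real m - 0) \<le> 4 * norm (exp (x /\<^sub>R real m) - exp 0)"
    using m2(2)[OF m(3)] by (intro norm_exp_diff_bounds) auto
  ultimately have "norm (x /\<^sub>R real m) \<le> 0" by simp
  then show "x = 0" using m by (simp only: norm_le_zero_iff) simp
qed

end

theorem (in based_isometry) isometry_exp_linear:
  shows "\<exists>L. (\<forall>x\<in>K. L x \<in> K \<and> \<psi> (exp x) = exp (L x)) \<and>
    (\<forall>x\<in>K. \<forall>y\<in>K. L (x + y) = L x + L y) \<and> (\<forall>x\<in>K. \<forall>s. L (s *\<^sub>R x) = s *\<^sub>R L x) \<and>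
    (\<forall>x\<in>K. L x = 0 --> x = 0) \<and> (\<forall>y\<in>K. \<exists>x\<in>K. L x = y) \<and>
    (\<forall>x\<in>K. \<forall>y\<in>K. L (x * (x * y - y * x) - (x * y - y * x) * x) =
       L x * (L x * L y - L y * L x) - (L x * L y - L y * L x) * L x)"
proof (intro exI[of _ L] conjI ballI allI impI)
  fix y assume y: "y \<in> K"
  \<comment> \<open>For surjectivity the whole construction is applied to the inverse isometry: its
    generator \<open>I.L y\<close> is the preimage, as comparison at a short time shows.\<close>
  have bi: "based_isometry G K ginv \<delta> M B c C r \<kappa> (inv_into G \<psi>)"
  proof (unfold_locales)
    show "isometry (inv_into G \<psi>)" by (rule isometry_inv[OF isometry_\<psi>])
    show "inv_into G \<psi> 1 = 1" using inv_isometry(2)[OF isometry_\<psi> one_G] by (simp add: \<psi>_one)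
  qed
  interpret I: based_isometry G K ginv \<delta> M B c C r \<kappa> "inv_into G \<psi>" by (rule bi)
  have IK: "I.L y \<in> K" using y by (rule I.L_K)
  let ?z = "L (I.L y)"
  have zK: "?z \<in> K" using IK by (rule L_K)
  obtain m1 where m1: "\<And>m. m \<ge> m1 ==> inv_into G \<psi> (exp (y /\<^sub>R real m)) = exp (I.L y /\<^sub>R real m)"
    using I.\<psi>_exp_div[OF y] by blast
  obtain m2 where m2: "\<And>m. m \<ge> m2 ==> \<psi> (exp (I.L y /\<^sub>R real m)) = exp (?z /\<^sub>R real m)"
    using \<psi>_exp_div[OF IK] by blast
  obtain m3 where m3: "m3 > 0" "\<And>m. m \<ge> m3 ==> norm (y /\<^sub>R real m) < 1/2" using eventually_small[of "1/2"] by (metis half_pos)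
  obtain m4 where m4: "m4 > 0" "\<And>m. m \<ge> m4 ==> norm (?z /\<^sub>R real m) < 1/2" using eventually_small[of "1/2"] by (metis half_pos)
  define m where "m = max (max m1 m2) (max m3 m4)"
  have m: "m > 0" "m \<ge> m1" "m \<ge> m2" "m \<ge> m3" "m \<ge> m4" using m3 by (auto simp: m_def)
  have "exp (?z /\<^sub>R real m) = exp (y /\<^sub>R real m)"
    using m1[OF m(2)] m2[OF m(3)] inv_isometry(1)[OF isometry_\<psi>, of "exp (y /\<^sub>R real m)"] y
    by (simp add: exp_K K_scale)
  moreover have "norm (?z /\<^sub>R real m - y /\<^sub>R real m) \<le> 4 * norm (exp (?z /\<^sub>R real m) - exp (y /\<^sub>R real m))"
    using m3(2)[OF m(4)] m4(2)[OF m(5)] by (intro norm_exp_diff_bounds) auto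
  ultimately have "?z /\<^sub>R real m = y /\<^sub>R real m" by simp
  then show "\<exists>x\<in>K. L x = y" using IK m by (intro bexI[of _ "I.L y"]) auto
qed (simp_all add: L_K \<psi>_exp L_add L_scale L_inj L_double_bracket)

section \<open>Matrices as bounded operators\<close>

text \<open>Bounded operators on bounded continuous functions form one Banach algebra containing the
  \<open>n \<times> n\<close> matrices for every \<open>n\<close>, so that the exponential of the library applies to them: a matrix acts on the values at the
  integers \<open>0, \<dots>, n - 1\<close>.\<close>

typedef endo = "UNIV :: ((real \<Rightarrow>\<^sub>C real) \<Rightarrow>\<^sub>L (real \<Rightarrow>\<^sub>C real)) set"
  morphisms op_of Endo by simp

setup_lifting type_definition_endo

instantiation endo :: real_normed_vector
begin

lift_definition plus_endo :: "endo \<Rightarrow> endo \<Rightarrow> endo" is "(+)" .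
lift_definition minus_endo :: "endo \<Rightarrow> endo \<Rightarrow> endo" is "(-)" .
lift_definition uminus_endo :: "endo \<Rightarrow> endo" is "uminus" .
lift_definition zero_endo :: "endo" is "0" .
lift_definition scaleR_endo :: "real \<Rightarrow> endo \<Rightarrow> endo" is "scaleR" .
lift_definition norm_endo :: "endo \<Rightarrow> real" is "norm" .
definition dist_endo :: "endo \<Rightarrow> endo \<Rightarrow> real" where "dist_endo a b = norm (a - b)"
definition sgn_endo :: "endo \<Rightarrow> endo" where "sgn_endo x = inverse (norm x) *\<^sub>R x"
definition uniformity_endo :: "(endo \<times> endo) filter" where
  "uniformity_endo = (INF e\<in>{0<..}. principal {(x, y). dist x y < e})"
definition open_endo :: "endo set \<Rightarrow> bool" where
  "open_endo U = (\<forall>x\<in>U. \<forall>\<^sub>F (x', y) in uniformity. x' = x --> y \<in> U)"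

instance
  by standard
     (simp_all add: dist_endo_def sgn_endo_def divide_inverse_commute uniformity_endo_def open_endo_def,
      (transfer, simp add: algebra_simps norm_triangle_ineq)+)

end

instantiation endo :: real_normed_algebra_1
begin

lift_definition times_endo :: "endo \<Rightarrow> endo \<Rightarrow> endo" is "(o\<^sub>L)" .
lift_definition one_endo :: "endo" is "id_blinfun" .

instance
proof
  have b: "bounded_bilinear ((o\<^sub>L) :: ((real \<Rightarrow>\<^sub>C real) \<Rightarrow>\<^sub>L (real \<Rightarrow>\<^sub>C real)) \<Rightarrow> _ \<Rightarrow> ((real \<Rightarrow>\<^sub>C real) \<Rightarrow>\<^sub>L _))"
    by (rule bounded_bilinear_blinfun_compose)
  fix a b c :: endo and r :: real
  show "a * b * c = a * (b * c)" by transfer (rule blinfun_eqI, simp)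
  show "(a + b) * c = a * c + b * c" by transfer (rule bounded_bilinear.add_left[OF b])
  show "a * (b + c) = a * b + a * c" by transfer (rule bounded_bilinear.add_right[OF b])
  show "1 * a = a" by transfer (rule blinfun_eqI, simp)
  show "a * 1 = a" by transfer (rule blinfun_eqI, simp)
  show "r *\<^sub>R a * b = r *\<^sub>R (a * b)" by transfer (rule bounded_bilinear.scaleR_left[OF b])
  show "a * r *\<^sub>R b = r *\<^sub>R (a * b)" by transfer (rule bounded_bilinear.scaleR_right[OF b])
  show "norm (a * b) \<le> norm a * norm b" by transfer (rule norm_blinfun_compose)
  have c1: "norm (const_bcontfun 1 :: real \<Rightarrow>\<^sub>C real) \<ge> 1"
    using norm_bounded[of "const_bcontfun 1 :: real \<Rightarrow>\<^sub>C real" 0] by simp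
  then have c0: "norm (const_bcontfun 1 :: real \<Rightarrow>\<^sub>C real) > 0" by linarith
  show n1: "norm (1 :: endo) = 1"
  proof transfer
    have "norm (blinfun_apply id_blinfun (const_bcontfun 1 :: real \<Rightarrow>\<^sub>C real)) \<le>
        norm (id_blinfun :: (real \<Rightarrow>\<^sub>C real) \<Rightarrow>\<^sub>L _) * norm (const_bcontfun 1 :: real \<Rightarrow>\<^sub>C real)"
      by (rule norm_blinfun)
    then have "1 \<le> norm (id_blinfun :: (real \<Rightarrow>\<^sub>C real) \<Rightarrow>\<^sub>L _)" using c0 by simp
    then show "norm (id_blinfun :: (real \<Rightarrow>\<^sub>C real) \<Rightarrow>\<^sub>L (real \<Rightarrow>\<^sub>C real)) = 1"
      using norm_blinfun_id_le[where 'a = "real \<Rightarrow>\<^sub>C real"] by simp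
  qed
  then show "(0 :: endo) \<noteq> 1" by (metis norm_zero zero_neq_one)
qed

end

instance bcontfun :: (metric_space, banach) banach ..

instance endo :: banach
proof
  fix X :: "nat \<Rightarrow> endo" assume X: "Cauchy X"
  have d: "dist (op_of a) (op_of b) = dist a b" for a b
    by (simp add: dist_norm norm_endo.rep_eq minus_endo.rep_eq)
  have "Cauchy (\<lambda>k. op_of (X k))" using X by (simp only: Cauchy_def d)
  then have "convergent (\<lambda>k. op_of (X k))" by (rule Cauchy_convergent)
  then obtain l where "(\<lambda>k. op_of (X k)) \<longlonglongrightarrow> l" unfolding convergent_def by blast
  then have "\<forall>e>0. \<forall>\<^sub>F k in sequentially. dist (op_of (X k)) l < e" by (rule tendsto_iff[THEN iffD1])
  moreover have "dist (X k) (Endo l) = dist (op_of (X k)) l" for k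
    using d[of "X k" "Endo l"] by (simp add: Endo_inverse)
  ultimately have "X \<longlonglongrightarrow> Endo l" by (simp only: tendsto_iff)
  then show "convergent X" by (auto simp: convergent_def)
qed

section \<open>Matrices as operators on tent functions\<close>

setup_lifting type_definition_bcontfun

text \<open>Tents of half-width one are dual to the evaluations at the integers, so they take the
  role of the standard basis vectors.\<close>

lift_definition hat_fun :: "nat \<Rightarrow> (real \<Rightarrow>\<^sub>C real)" is "\<lambda>j x. max 0 (1 - \<bar>x - real j\<bar>)"
  by (rule bcontfun_normI[of _ 1]) (auto intro!: continuous_intros)

lemma apply_hat_fun_nat: "apply_bcontfun (hat_fun j) (real i) = (if i = j then 1 else 0)"
  by (auto simp: hat_fun.rep_eq max_def)

lemma norm_hat_fun: "norm (hat_fun j) \<le> 1"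
  by (rule norm_bound) (simp add: hat_fun.rep_eq)

lemma abs_apply_bcontfun_le: "\<bar>apply_bcontfun x i\<bar> \<le> norm x" for x :: "real \<Rightarrow>\<^sub>C real"
  using norm_bounded[of x i] by simp

lemma apply_bcontfun_sum: "apply_bcontfun (\<Sum>j\<in>S. f j) i = (\<Sum>j\<in>S. apply_bcontfun (f j) i)"
  for f :: "'i \<Rightarrow> (real \<Rightarrow>\<^sub>C real)"
  by (induction S rule: infinite_finite_induct) auto

definition entry_op :: "nat \<Rightarrow> nat \<Rightarrow> endo \<Rightarrow> real" where
  "entry_op i j T = apply_bcontfun (blinfun_apply (op_of T) (hat_fun j)) (real i)"

lemma abs_entry_op_le: "\<bar>entry_op i j T\<bar> \<le> norm T"
proof -
  have "\<bar>entry_op i j T\<bar> \<le> norm (blinfun_apply (op_of T) (hat_fun j))"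
    unfolding entry_op_def by (rule abs_apply_bcontfun_le)
  also have "\<dots> \<le> norm (op_of T) * norm (hat_fun j)" by (rule norm_blinfun)
  also have "\<dots> \<le> norm (op_of T) * 1" by (intro mult_left_mono norm_hat_fun) auto
  finally show ?thesis by (simp add: norm_endo.rep_eq)
qed

lemma bounded_linear_entry_op: "bounded_linear (entry_op i j)"
proof (rule bounded_linear_intro[of _ 1])
  show "entry_op i j (S + T) = entry_op i j S + entry_op i j T" for S T
    by (simp add: entry_op_def plus_endo.rep_eq plus_blinfun.rep_eq)
  show "entry_op i j (r *\<^sub>R T) = r *\<^sub>R entry_op i j T" for r T
    by (simp add: entry_op_def scaleR_endo.rep_eq scaleR_blinfun.rep_eq)
qed (simp add: abs_entry_op_le)

lemmas entry_op_linear = bounded_linear.linear[OF bounded_linear_entry_op]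

lemma entry_op_one: "entry_op i j 1 = (if i = j then 1 else 0)"
  by (simp add: entry_op_def one_endo.rep_eq apply_hat_fun_nat)

definition mat_op :: "real mat \<Rightarrow> (real \<Rightarrow>\<^sub>C real) \<Rightarrow> (real \<Rightarrow>\<^sub>C real)" where
  "mat_op A x = (\<Sum>i<dim_row A. (\<Sum>j<dim_col A. A $$ (i, j) * apply_bcontfun x (real j)) *\<^sub>R hat_fun i)"

definition mat_abs_sum :: "real mat \<Rightarrow> real" where
  "mat_abs_sum A = (\<Sum>i<dim_row A. \<Sum>j<dim_col A. \<bar>A $$ (i, j)\<bar>)"

lemma norm_mat_op_le: "norm (mat_op A x) \<le> norm x * mat_abs_sum A"
proof -
  have "norm ((\<Sum>j<dim_col A. A $$ (i, j) * apply_bcontfun x (real j)) *\<^sub>R hat_fun i)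
      \<le> (\<Sum>j<dim_col A. \<bar>A $$ (i, j)\<bar> * norm x) * 1" for i
    unfolding norm_scaleR
  proof (intro mult_mono norm_hat_fun)
    have "\<bar>\<Sum>j<dim_col A. A $$ (i, j) * apply_bcontfun x (real j)\<bar> \<le> (\<Sum>j<dim_col A. \<bar>A $$ (i, j) * apply_bcontfun x (real j)\<bar>)"
      by (rule sum_abs)
    also have "\<dots> \<le> (\<Sum>j<dim_col A. \<bar>A $$ (i, j)\<bar> * norm x)"
      unfolding abs_mult by (intro sum_mono mult_left_mono abs_apply_bcontfun_le) simp
    finally show "\<bar>\<Sum>j<dim_col A. A $$ (i, j) * apply_bcontfun x (real j)\<bar> \<le> (\<Sum>j<dim_col A. \<bar>A $$ (i, j)\<bar> * norm x)" .
  qed (simp_all add: sum_nonneg)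
  then have "norm (mat_op A x) \<le> (\<Sum>i<dim_row A. (\<Sum>j<dim_col A. \<bar>A $$ (i, j)\<bar> * norm x) * 1)"
    unfolding mat_op_def by (intro sum_norm_le)
  then show ?thesis by (simp add: mat_abs_sum_def sum_distrib_left mult.commute)
qed

lemma bounded_linear_mat_op: "bounded_linear (mat_op A)"
proof (rule bounded_linear_intro)
  show "mat_op A (x + y) = mat_op A x + mat_op A y" for x y
    by (simp add: mat_op_def algebra_simps sum.distrib scaleR_add_left)
  show "mat_op A (r *\<^sub>R x) = r *\<^sub>R mat_op A x" for r x
    by (simp add: mat_op_def scaleR_sum_right sum_distrib_left mult.left_commute)
qed (rule norm_mat_op_le)

lemma apply_mat_op: "apply_bcontfun (mat_op A x) (real i) =
    (if i < dim_row A then \<Sum>j<dim_col A. A $$ (i, j) * apply_bcontfun x (real j) else 0)"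
  by (simp add: mat_op_def apply_bcontfun_sum apply_hat_fun_nat if_distrib cong: if_cong)

definition emb :: "real mat \<Rightarrow> endo" where "emb A = Endo (Blinfun (mat_op A))"

lemma op_of_emb: "blinfun_apply (op_of (emb A)) = mat_op A"
  by (simp add: emb_def Endo_inverse bounded_linear_Blinfun_apply bounded_linear_mat_op)

lemma endo_eqI: "(\<And>x. blinfun_apply (op_of S) x = blinfun_apply (op_of T) x) ==> S = T"
  by (metis blinfun_eqI op_of_inject)

lemma emb_add: "A \<in> carrier_mat n m ==> B \<in> carrier_mat n m ==> emb (A + B) = emb A + emb B"
  by (rule endo_eqI)
     (simp add: op_of_emb mat_op_def plus_endo.rep_eq plus_blinfun.rep_eq distrib_right sum.distrib scaleR_add_left)

lemma emb_smult: "emb (c \<cdot>\<^sub>m A) = c *\<^sub>R emb A"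
  by (rule endo_eqI)
     (simp add: op_of_emb mat_op_def scaleR_endo.rep_eq scaleR_blinfun.rep_eq scaleR_sum_right sum_distrib_left mult.assoc)

lemma emb_mult:
  assumes "A \<in> carrier_mat n m" "B \<in> carrier_mat m k"
  shows "emb (A * B) = emb A * emb B"
proof (rule endo_eqI)
  fix x
  have "(\<Sum>j<k. (\<Sum>l<m. A $$ (i, l) * B $$ (l, j)) * apply_bcontfun x (real j)) =
     (\<Sum>l<m. A $$ (i, l) * (\<Sum>j<k. B $$ (l, j) * apply_bcontfun x (real j)))" for i
    unfolding sum_distrib_left sum_distrib_right by (subst sum.swap) (simp add: mult.assoc)
  then show "blinfun_apply (op_of (emb (A * B))) x = blinfun_apply (op_of (emb A * emb B)) x"
    using assms by (simp add: op_of_emb times_endo.rep_eq mat_op_def[of A] apply_mat_op)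
      (simp add: mat_op_def scalar_prod_def lessThan_atLeast0)
qed

lemma entry_emb: "i < dim_row A ==> j < dim_col A ==> entry_op i j (emb A) = A $$ (i, j)"
  by (simp add: entry_op_def op_of_emb apply_mat_op apply_hat_fun_nat if_distrib cong: if_cong)

lemma norm_emb_le: "norm (emb A) \<le> mat_abs_sum A"
  unfolding norm_endo.rep_eq
proof (rule norm_blinfun_bound)
  show "0 \<le> mat_abs_sum A" by (simp add: mat_abs_sum_def sum_nonneg)
  show "norm (blinfun_apply (op_of (emb A)) x) \<le> mat_abs_sum A * norm x" for x
    using norm_mat_op_le[of A x] by (simp add: op_of_emb mult.commute)
qed

text \<open>The operator \<open>emb (1\<^sub>m n)\<close> is a projection onto the span of the first
  \<open>n\<close> tents. An operator that it fixes from both sides is determined by its values on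
  these tents at the first \<open>n\<close> integers.\<close>

lemma emb_entries:
  fixes T :: endo
  assumes "emb (1\<^sub>m n) * T = T" "T * emb (1\<^sub>m n) = T"
  shows "T = emb (mat n n (\<lambda>(i, j). entry_op i j T))"
proof (rule endo_eqI)
  fix x
  let ?T = "blinfun_apply (op_of T)"
  have p: "mat_op (1\<^sub>m n) y = (\<Sum>j<n. apply_bcontfun y (real j) *\<^sub>R hat_fun j)" for y
    unfolding mat_op_def
  proof (rule sum.cong)
    fix i assume "i \<in> {..<n}"
    then have "(\<Sum>j<n. 1\<^sub>m n $$ (i, j) * apply_bcontfun y (real j)) = (\<Sum>j<n. if i = j then apply_bcontfun y (real j) else 0)"
      by (intro sum.cong) auto
    then show "(\<Sum>j<dim_col (1\<^sub>m n). 1\<^sub>m n $$ (i, j) * apply_bcontfun y (real j)) *\<^sub>R hat_fun i = apply_bcontfun y (real i) *\<^sub>R hat_fun i"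
      using \<open>i \<in> {..<n}\<close> by simp
  qed simp
  have r: "?T x = ?T (mat_op (1\<^sub>m n) x)" for x
    by (metis assms(2) blinfun_apply_blinfun_compose op_of_emb times_endo.rep_eq)
  have l: "mat_op (1\<^sub>m n) (?T x) = ?T x" for x
    by (metis assms(1) blinfun_apply_blinfun_compose op_of_emb times_endo.rep_eq)
  have 1: "apply_bcontfun (?T x) (real i) = (\<Sum>j<n. entry_op i j T * apply_bcontfun x (real j))" for i
    by (subst r) (simp add: p blinfun.sum_right blinfun.scaleR_right apply_bcontfun_sum entry_op_def mult.commute)
  have "?T x = (\<Sum>i<n. (\<Sum>j<n. entry_op i j T * apply_bcontfun x (real j)) *\<^sub>R hat_fun i)"
    by (subst l[symmetric]) (simp only: p 1)
  then show "?T x = blinfun_apply (op_of (emb (mat n n (\<lambda>(i, j). entry_op i j T)))) x"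
    by (simp add: op_of_emb mat_op_def)
qed

text \<open>The map \<open>emb\<close> sends the identity matrix to a projection only. Adding the
  complementary projection gives an embedding that respects units, under which matrix groups become
  groups with the neutral element 1 of the algebra.\<close>

definition unital :: "nat \<Rightarrow> real mat \<Rightarrow> endo" where "unital n A = emb A + (1 - emb (1\<^sub>m n))"

lemma emb_one_mult: "A \<in> carrier_mat n n ==> emb (1\<^sub>m n) * emb A = emb A"
  and emb_mult_one: "A \<in> carrier_mat n n ==> emb A * emb (1\<^sub>m n) = emb A"
  by (metis emb_mult left_mult_one_mat one_carrier_mat, metis emb_mult right_mult_one_mat one_carrier_mat)

lemma unital_one: "unital n (1\<^sub>m n) = 1"
  by (simp add: unital_def)

lemma unital_mult:
  "A \<in> carrier_mat n n ==> B \<in> carrier_mat n n ==> unital n (A * B) = unital n A * unital n B"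
  using emb_one_mult[of "1\<^sub>m n" n]
  by (simp add: unital_def algebra_simps emb_mult[of A n n B n] emb_one_mult emb_mult_one)

lemma entry_unital:
  assumes "A \<in> carrier_mat n n" "i < n" "j < n"
  shows "entry_op i j (unital n A) = A $$ (i, j)"
proof -
  have "entry_op i j (emb (1\<^sub>m n)) = (if i = j then 1 else 0)" "entry_op i j (emb A) = A $$ (i, j)"
    using assms by (simp_all add: entry_emb)
  then show ?thesis
    by (simp add: unital_def linear_add[OF entry_op_linear] linear_diff[OF entry_op_linear] entry_op_one)
qed

definition of_unital :: "nat \<Rightarrow> endo \<Rightarrow> real mat" where
  "of_unital n T = mat n n (\<lambda>(i, j). entry_op i j T)"

lemma of_unital_unital: "A \<in> carrier_mat n n ==> of_unital n (unital n A) = A"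
  by (rule eq_matI) (auto simp: of_unital_def entry_unital)

lemma emb_power: "A \<in> carrier_mat n n ==> emb (A ^\<^sub>m Suc k) = emb A ^ Suc k"
proof (induction k)
  case 0
  then show ?case by (simp add: emb_mult left_mult_one_mat)
next
  case (Suc k)
  have "A ^\<^sub>m Suc k \<in> carrier_mat n n" using Suc.prems by (intro pow_carrier_mat)
  then have "emb (A ^\<^sub>m Suc (Suc k)) = emb (A ^\<^sub>m Suc k) * emb A"
    using Suc.prems by (simp only: pow_mat.simps emb_mult)
  then show ?case using Suc by (simp only: power_Suc2)
qed

lemma exp_mat_carrier: "X \<in> carrier_mat n n ==> exp_mat X \<in> carrier_mat n n"
  by (simp add: exp_mat_def)

text \<open>All terms of the series after the first are fixed by the projection on both sides, so up
  to the complementary projection the exponential is again a matrix. Its entries come from the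
  series because \<open>entry_op\<close> is a bounded linear functional.\<close>

lemma exp_emb:
  assumes X: "X \<in> carrier_mat n n"
  shows "exp (emb X) = unital n (exp_mat X)"
proof -
  let ?p = "emb (1\<^sub>m n)" and ?T = "exp (emb X) - (1 - emb (1\<^sub>m n))"
  have pp: "?p * ?p = ?p" using emb_one_mult[of "1\<^sub>m n" n] by simp
  have s: "(\<lambda>k. emb X ^ Suc k /\<^sub>R fact (Suc k)) sums (exp (emb X) - 1)"
    using sums_iff_shift'[of "\<lambda>k. emb X ^ k /\<^sub>R fact k" 1 "exp (emb X)"] exp_converges[of "emb X"]
    by simp
  have "(\<lambda>k. ?p * (emb X ^ Suc k /\<^sub>R fact (Suc k))) sums (?p * (exp (emb X) - 1))"
    by (intro sums_mult s)
  moreover have "?p * (emb X ^ Suc k /\<^sub>R fact (Suc k)) = emb X ^ Suc k /\<^sub>R fact (Suc k)" for k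
    using emb_one_mult[OF X] by (simp flip: mult.assoc)
  ultimately have l: "?p * (exp (emb X) - 1) = exp (emb X) - 1" using s sums_unique2 by fastforce
  have "(\<lambda>k. (emb X ^ Suc k /\<^sub>R fact (Suc k)) * ?p) sums ((exp (emb X) - 1) * ?p)"
    by (intro sums_mult2 s)
  moreover have "(emb X ^ Suc k /\<^sub>R fact (Suc k)) * ?p = emb X ^ Suc k /\<^sub>R fact (Suc k)" for k
    using emb_mult_one[OF X] by (simp only: power_Suc2 mult_scaleR_left mult.assoc)
  ultimately have r: "(exp (emb X) - 1) * ?p = exp (emb X) - 1" using s sums_unique2 by fastforce
  have e: "entry_op i j ?T = exp_mat X $$ (i, j)" if ij: "i < n" "j < n" for i j
  proof -
    have 1: "entry_op i j (exp (emb X)) = entry_op i j ?T"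
      using ij by (simp add: linear_diff[OF entry_op_linear] entry_emb entry_op_one)
    have "(\<lambda>k. entry_op i j (emb X ^ k /\<^sub>R fact k)) sums entry_op i j (exp (emb X))"
      by (intro bounded_linear.sums[OF bounded_linear_entry_op] exp_converges)
    moreover have "entry_op i j (emb X ^ k /\<^sub>R fact k) = (X ^\<^sub>m k) $$ (i, j) / fact k" for k
    proof (cases k)
      case 0
      then show ?thesis using ij X by (simp add: entry_op_one)
    next
      case (Suc k')
      then have "emb X ^ k = emb (X ^\<^sub>m k)" using emb_power[OF X, of k'] by simp
      moreover have "dim_row (X ^\<^sub>m k) = n" "dim_col (X ^\<^sub>m k) = n"
        using pow_carrier_mat[OF X, of k] by (rule carrier_matD)+
      ultimately show ?thesis using ij
        by (simp add: linear_scale[OF entry_op_linear] entry_emb divide_inverse_commute)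
    qed
    ultimately have "(\<lambda>k. (X ^\<^sub>m k) $$ (i, j) / fact k) sums entry_op i j ?T" using 1 by simp
    then show ?thesis using ij X by (simp add: exp_mat_def sums_iff)
  qed
  have "?T = emb (mat n n (\<lambda>(i, j). entry_op i j ?T))"
    using l r pp by (intro emb_entries) (simp_all add: algebra_simps)
  also have "mat n n (\<lambda>(i, j). entry_op i j ?T) = exp_mat X"
    using e exp_mat_carrier[OF X] by (intro eq_matI) auto
  finally show ?thesis by (simp add: unital_def algebra_simps)
qed

section \<open>Unitary diagonalisation and the exponential map\<close>

lemma mat_adjoint_index [simp]:
  assumes "i < dim_col A" "j < dim_row A"
  shows "mat_adjoint A $$ (i, j) = conjugate (A $$ (j, i))"
  using assms by (simp add: mat_adjoint_def mat_of_rows_index cols_def)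

lemma mat_adjoint_dim [simp]: "dim_row (mat_adjoint A) = dim_col A" "dim_col (mat_adjoint A) = dim_row A"
  by (simp_all add: mat_adjoint_def)

lemma mat_adjoint_adjoint [simp]: "mat_adjoint (mat_adjoint A) = (A :: complex mat)"
  by (rule eq_matI) auto

lemma eq_squareI:
  assumes "\<And>i j. i < n ==> j < n ==> A $$ (i, j) = B $$ (i, j)"
    and "dim_row A = n" "dim_col A = n" "dim_row B = n" "dim_col B = n"
  shows "A = B"
  using assms by (intro eq_matI) auto

lemma index_mult_sum:
  "A \<in> carrier_mat n m ==> B \<in> carrier_mat m k ==> i < n ==> j < k ==>
    (A * B) $$ (i, j) = (\<Sum>l<m. A $$ (i, l) * B $$ (l, j))"
  by (simp add: scalar_prod_def lessThan_atLeast0)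

lemma mat_adjoint_mult:
  fixes A B :: "complex mat"
  assumes "A \<in> carrier_mat n m" "B \<in> carrier_mat m k"
  shows "mat_adjoint (A * B) = mat_adjoint B * mat_adjoint A"
proof (rule eq_matI)
  fix i j assume "i < dim_row (mat_adjoint B * mat_adjoint A)" "j < dim_col (mat_adjoint B * mat_adjoint A)"
  then show "mat_adjoint (A * B) $$ (i, j) = (mat_adjoint B * mat_adjoint A) $$ (i, j)"
    using assms by (simp add: scalar_prod_def mult.commute conjugate_complex_def)
qed (use assms in auto)

lemma unitary_group_mult:
  assumes U: "U \<in> unitary_group n" and V: "V \<in> unitary_group n"
  shows "U * V \<in> unitary_group n"
proof -
  let ?U = "mat_adjoint U" and ?V = "mat_adjoint V"
  have c: "U \<in> carrier_mat n n" "V \<in> carrier_mat n n" "?U \<in> carrier_mat n n" "?V \<in> carrier_mat n n"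
    using U V by (auto simp: unitary_group_def)
  note a = assoc_mult_mat[of _ n n _ n _ n]
  have "U * V * (?V * ?U) = U * (V * ?V) * ?U" using c by (simp add: a)
  also have "\<dots> = 1\<^sub>m n" using U V c by (simp add: unitary_group_def)
  finally have 1: "U * V * (?V * ?U) = 1\<^sub>m n" .
  have "?V * ?U * (U * V) = ?V * (?U * U) * V" using c by (simp add: a)
  also have "\<dots> = 1\<^sub>m n" using U V c by (simp add: unitary_group_def)
  finally show ?thesis using 1 c by (simp add: unitary_group_def mat_adjoint_mult[of _ n n _ n])
qed

lemma unitary_group_adjoint: "U \<in> unitary_group n ==> mat_adjoint U \<in> unitary_group n"
  by (auto simp: unitary_group_def)

section \<open>The spectral theorem for normal matrices\<close>

definition corner_mat :: "complex \<Rightarrow> complex mat \<Rightarrow> complex mat" where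
  "corner_mat c B = mat (Suc (dim_row B)) (Suc (dim_col B))
     (\<lambda>(i, j). case i of 0 \<Rightarrow> (case j of 0 \<Rightarrow> c | Suc _ \<Rightarrow> 0) | Suc i' \<Rightarrow> (case j of 0 \<Rightarrow> 0 | Suc j' \<Rightarrow> B $$ (i', j')))"

lemma corner_mat_carrier: "B \<in> carrier_mat m m ==> corner_mat c B \<in> carrier_mat (Suc m) (Suc m)"
  by (simp add: corner_mat_def)

lemma corner_mat_mult:
  assumes "B \<in> carrier_mat m m" "C \<in> carrier_mat m m"
  shows "corner_mat c B * corner_mat d C = corner_mat (c * d) (B * C)"
proof (rule eq_matI)
  fix i j assume "i < dim_row (corner_mat (c * d) (B * C))" "j < dim_col (corner_mat (c * d) (B * C))"
  then have ij: "i < Suc m" "j < Suc m" using assms by (auto simp: corner_mat_def)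
  have "(corner_mat c B * corner_mat d C) $$ (i, j) = (\<Sum>k<Suc m. corner_mat c B $$ (i, k) * corner_mat d C $$ (k, j))"
    using assms ij by (intro index_mult_sum[of _ "Suc m" "Suc m" _ "Suc m"] corner_mat_carrier)
  also have "\<dots> = corner_mat (c * d) (B * C) $$ (i, j)"
    unfolding sum.lessThan_Suc_shift using assms ij
    by (simp add: corner_mat_def scalar_prod_def lessThan_atLeast0 split: nat.splits)
  finally show "(corner_mat c B * corner_mat d C) $$ (i, j) = corner_mat (c * d) (B * C) $$ (i, j)" .
qed (use assms in \<open>auto simp: corner_mat_def\<close>)

lemma corner_mat_adjoint: "B \<in> carrier_mat m m ==> mat_adjoint (corner_mat c B) = corner_mat (cnj c) (mat_adjoint B)"
  by (rule eq_matI) (auto simp: corner_mat_def conjugate_complex_def split: nat.splits)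

lemma corner_mat_one: "corner_mat 1 (1\<^sub>m m) = 1\<^sub>m (Suc m)"
  by (rule eq_matI) (auto simp: corner_mat_def split: nat.splits)

lemma corner_mat_diag: "corner_mat c (mat_diag m z) = mat_diag (Suc m) (\<lambda>i. case i of 0 \<Rightarrow> c | Suc i' \<Rightarrow> z i')"
  by (rule eq_matI) (auto simp: corner_mat_def mat_diag_def split: nat.splits)

lemma corner_mat_unitary: "U \<in> unitary_group m ==> corner_mat 1 U \<in> unitary_group (Suc m)"
  using corner_mat_mult[of U m "mat_adjoint U" 1 1] corner_mat_mult[of "mat_adjoint U" m U 1 1] mat_adjoint_carrier[of U m]
  by (auto simp: unitary_group_def corner_mat_carrier corner_mat_adjoint corner_mat_one)

text \<open>A Householder reflection, with a sign chosen such that no denominator vanishes.\<close>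

lemma unitary_with_first_column:
  fixes y :: "nat \<Rightarrow> complex" and r :: real
  assumes n: "n > 0" and norm1: "(\<Sum>i<n. y i * cnj (y i)) = 1" and y0: "y 0 = of_real r" "r \<ge> 0"
  shows "\<exists>W \<in> unitary_group n. mat_adjoint W = W \<and> (\<forall>i<n. W $$ (i, 0) = y i)"
proof -
  define s :: complex where "s = 1 + of_real r"
  have s: "s \<noteq> 0" "cnj s = s"
  proof -
    have "s = of_real (1 + r)" by (simp add: s_def)
    then show "s \<noteq> 0" "cnj s = s" using y0(2) by (simp_all only: of_real_eq_0_iff complex_cnj_complex_of_real)
  qed
  \<comment> \<open>Here \<open>w\<close> is y + e_0, of squared norm \<open>2 * s\<close>. The
    matrix \<open>W\<close> below fixes \<open>w\<close> and negates its orthogonal complement; it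
    exchanges e_0 and \<open>y\<close>.\<close>
  define w where "w i = y i + (if i = 0 then 1 else 0)" for i
  have w0: "w 0 = s" by (simp add: w_def y0 s_def)
  have delta: "(\<Sum>i<n. f i * (if i = k then 1 else 0)) = f k" "(\<Sum>i<n. (if i = k then 1 else 0) * f i) = f k"
    if "k < n" for f :: "nat \<Rightarrow> complex" and k
    using that by (simp_all add: if_distrib if_distribR cong: if_cong)
  have split: "(\<Sum>i<n. f i * (if i = 0 then 1 else 0)) = f 0" "(\<Sum>i<n. (if i = 0 then 1 else 0) * f i) = f 0" for f :: "nat \<Rightarrow> complex"
    using delta[OF n] by simp_all
  have "(\<Sum>i<n. w i * cnj (w i)) = (\<Sum>i<n. y i * cnj (y i) + y i * (if i = 0 then 1 else 0) +
      (if i = 0 then 1 else 0) * cnj (y i) + (if i = 0 then 1 else 0) * (if i = 0 then 1 else 0))"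
    by (intro sum.cong) (auto simp: w_def algebra_simps)
  also have "\<dots> = 2 * s"
    unfolding sum.distrib split using norm1 y0 by (simp add: s_def)
  finally have ww: "(\<Sum>i<n. w i * cnj (w i)) = 2 * s" .
  define W where "W = mat n n (\<lambda>(i, j). w i * cnj (w j) / s - (if i = j then 1 else 0))"
  have Wc: "W \<in> carrier_mat n n" by (simp add: W_def)
  have adj: "mat_adjoint W = W"
    by (rule eq_matI) (auto simp: W_def conjugate_complex_def s mult.commute)
  have "W * W = 1\<^sub>m n"
  proof (rule eq_squareI[where n = n])
    fix i j :: nat assume ij: "i < n" "j < n"
    have "(W * W) $$ (i, j) = (\<Sum>k<n. W $$ (i, k) * W $$ (k, j))" using ij by (intro index_mult_sum[OF Wc Wc])
    also have "\<dots> = (\<Sum>k<n. (w i * cnj (w j) / s ^ 2) * (w k * cnj (w k)) - w i * cnj (w k) / s * (if k = j then 1 else 0)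
        - (if k = i then 1 else 0) * (w k * cnj (w j) / s) + (if k = i then 1 else 0) * (if i = j then 1 else 0))"
      using ij by (intro sum.cong) (auto simp: W_def algebra_simps power2_eq_square)
    also have "\<dots> = (w i * cnj (w j) / s ^ 2) * (2 * s) - w i * cnj (w j) / s - w i * cnj (w j) / s + (if i = j then 1 else 0)"
      unfolding sum.distrib sum_subtractf sum_distrib_left[symmetric] ww delta[OF ij(1)] delta[OF ij(2)] by simp
    also have "\<dots> = (if i = j then 1 else 0)" using s by (simp add: field_simps power2_eq_square)
    finally show "(W * W) $$ (i, j) = 1\<^sub>m n $$ (i, j)" using ij by simp
  qed (use Wc in auto)
  then have "W \<in> unitary_group n" using Wc adj by (simp add: unitary_group_def)
  moreover have "W $$ (i, 0) = y i" if "i < n" for i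
  proof -
    have "W $$ (i, 0) = w i * cnj s / s - (if i = 0 then 1 else 0)" using that n by (simp add: W_def w0)
    then show ?thesis using s by (simp add: w_def)
  qed
  ultimately show ?thesis using adj by blast
qed

lemma complex_matrix_has_eigenvector:
  fixes A :: "complex mat"
  assumes A: "A \<in> carrier_mat n n" and n: "n > 0"
  shows "\<exists>c y r. y 0 = of_real r \<and> r \<ge> 0 \<and> (\<Sum>i<n. y i * cnj (y i)) = 1 \<and>
    (\<forall>i<n. (\<Sum>j<n. A $$ (i, j) * y j) = c * y i)"
proof -
  obtain c where "eigenvalue A c"
    using spectrum_non_empty[OF A] n by (auto simp: spectrum_def)
  then obtain v where v: "v \<in> carrier_vec n" "v \<noteq> 0\<^sub>v n" "A *\<^sub>v v = c \<cdot>\<^sub>v v"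
    using A by (auto simp: eigenvalue_def eigenvector_def)
  define x where "x i = v $ i" for i
  have ev: "(\<Sum>j<n. A $$ (i, j) * x j) = c * x i" if i: "i < n" for i
  proof -
    have "(A *\<^sub>v v) $ i = (c \<cdot>\<^sub>v v) $ i" by (simp only: v(3))
    then show ?thesis using i A v(1) by (simp add: scalar_prod_def x_def lessThan_atLeast0)
  qed
  have "\<exists>i<n. x i \<noteq> 0"
    using v(1,2) by (metis (no_types, lifting) carrier_vecD eq_vecI index_zero_vec x_def)
  then obtain k where k: "k < n" "x k \<noteq> 0" by blast
  define q where "q = (\<Sum>i<n. (norm (x i))\<^sup>2)"
  have "0 < (norm (x k))\<^sup>2" using k by simp
  also have "\<dots> \<le> q" unfolding q_def using k by (intro member_le_sum) auto
  finally have q: "q > 0" .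
  \<comment> \<open>A phase that makes the first coordinate a nonnegative real number, as
    \<open>unitary_with_first_column\<close> requires.\<close>
  define u where "u = (if x 0 = 0 then 1 else cnj (x 0) / of_real (norm (x 0)))"
  have u: "norm u = 1" by (simp add: u_def norm_divide)
  have ux: "u * x 0 = of_real (norm (x 0))"
    by (simp add: u_def complex_norm_square[symmetric] power2_eq_square mult.commute[of "cnj _"])
  define \<alpha> where "\<alpha> = u / of_real (sqrt q)"
  define y where "y i = \<alpha> * x i" for i
  have "y 0 = of_real (norm (x 0) / sqrt q)" using ux by (simp add: y_def \<alpha>_def)
  moreover have "norm (x 0) / sqrt q \<ge> 0" using q by simp
  moreover have "(\<Sum>i<n. y i * cnj (y i)) = 1"
  proof -
    have "y i * cnj (y i) = of_real ((norm (x i))\<^sup>2 / q)" for i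
    proof -
      have "y i * cnj (y i) = of_real ((norm (y i))\<^sup>2)" by (rule complex_norm_square[symmetric])
      also have "norm (y i) = norm (x i) / sqrt q" using q u by (simp add: y_def \<alpha>_def norm_mult norm_divide)
      finally show ?thesis using q by (simp add: power_divide)
    qed
    then have "(\<Sum>i<n. y i * cnj (y i)) = of_real (\<Sum>i<n. (norm (x i))\<^sup>2 / q)"
      by (simp only: of_real_sum)
    also have "\<dots> = of_real (q / q)" by (simp only: q_def sum_divide_distrib)
    finally have "(\<Sum>i<n. y i * cnj (y i)) = of_real (q / q)" .
    then show ?thesis using q by simp
  qed
  moreover have "(\<Sum>j<n. A $$ (i, j) * y j) = c * y i" if "i < n" for i
    using ev[OF that] unfolding y_def by (simp add: mult.left_commute[of _ \<alpha>] flip: sum_distrib_left)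
  ultimately show ?thesis by blast
qed

text \<open>After conjugation the first column is a multiple of e_0. Normality gives the first row
  and the first column the same norm, so the rest of the row vanishes too, and the remaining block
  is again normal.\<close>

theorem normal_mat_unitary_diag:
  fixes A :: "complex mat"
  assumes "A \<in> carrier_mat n n" "A * mat_adjoint A = mat_adjoint A * A"
  shows "\<exists>U \<in> unitary_group n. \<exists>z. A = U * mat_diag n z * mat_adjoint U"
  using assms
proof (induction n arbitrary: A)
  case 0
  then show ?case by (intro bexI[of _ "1\<^sub>m 0"]) (auto simp: unitary_group_def intro!: eq_matI)
next
  case (Suc m A)
  let ?n = "Suc m"
  note a = assoc_mult_mat[of _ ?n ?n _ ?n _ ?n]
  have mc: "X * Y \<in> carrier_mat ?n ?n" if "X \<in> carrier_mat ?n ?n" "Y \<in> carrier_mat ?n ?n" for X Y :: "complex mat"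
    using that by simp
  have A: "A \<in> carrier_mat ?n ?n" by (rule Suc.prems)
  obtain c y r where y: "y 0 = of_real r" "r \<ge> 0" "(\<Sum>i<?n. y i * cnj (y i)) = 1"
    and ev: "\<And>i. i < ?n ==> (\<Sum>j<?n. A $$ (i, j) * y j) = c * y i"
    using complex_matrix_has_eigenvector[OF A] by blast
  obtain W where W: "W \<in> unitary_group ?n" "mat_adjoint W = W" "\<And>i. i < ?n ==> W $$ (i, 0) = y i"
    using unitary_with_first_column[OF _ y(3,1,2)] by auto
  have Wc: "W \<in> carrier_mat ?n ?n" and WW: "W * W = 1\<^sub>m ?n" using W by (auto simp: unitary_group_def)
  have WW': "W * (W * X) = X" if "X \<in> carrier_mat ?n ?n" for X
    using that Wc WW by (simp flip: a)
  define B where "B = W * A * W"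
  have Bc: "B \<in> carrier_mat ?n ?n" using Wc A by (simp add: B_def)
  have AdC: "mat_adjoint A \<in> carrier_mat ?n ?n" using A by (rule mat_adjoint_carrier)
  have Badj: "mat_adjoint B = W * mat_adjoint A * W"
    unfolding B_def using A Wc AdC W(2) by (simp add: mat_adjoint_mult[of _ ?n ?n _ ?n] mc a)
  have BadjC: "mat_adjoint B \<in> carrier_mat ?n ?n" using Bc by (rule mat_adjoint_carrier)
  have "B * mat_adjoint B = W * (A * mat_adjoint A) * W"
    unfolding Badj unfolding B_def using A Wc AdC by (simp add: a mc WW')
  also have "\<dots> = mat_adjoint B * B"
    unfolding Badj Suc.prems(2) unfolding B_def using A Wc AdC by (simp add: a mc WW')
  finally have Bn: "B * mat_adjoint B = mat_adjoint B * B" .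
  have BB: "(\<Sum>k<?n. B $$ (i, k) * cnj (B $$ (j, k))) = (\<Sum>k<?n. cnj (B $$ (k, i)) * B $$ (k, j))" if "i < ?n" "j < ?n" for i j
  proof -
    have "(\<Sum>k<?n. B $$ (i, k) * cnj (B $$ (j, k))) = (B * mat_adjoint B) $$ (i, j)"
      unfolding index_mult_sum[OF Bc BadjC that] using that Bc by (intro sum.cong) (auto simp: conjugate_complex_def)
    also have "\<dots> = (\<Sum>k<?n. cnj (B $$ (k, i)) * B $$ (k, j))"
      unfolding Bn index_mult_sum[OF BadjC Bc that] using that Bc by (intro sum.cong) (auto simp: conjugate_complex_def)
    finally show ?thesis .
  qed
  have AW: "(A * W) $$ (i, 0) = c * W $$ (i, 0)" if "i < ?n" for i
    using index_mult_sum[OF A Wc that, of 0] W(3) ev[OF that] that by simp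
  have col0: "B $$ (i, 0) = (if i = 0 then c else 0)" if "i < ?n" for i
  proof -
    have "B $$ (i, 0) = (\<Sum>k<?n. W $$ (i, k) * (A * W) $$ (k, 0))"
      unfolding B_def a[OF Wc A Wc] using that by (intro index_mult_sum[OF Wc mc[OF A Wc]]) auto
    also have "\<dots> = c * (\<Sum>k<?n. W $$ (i, k) * W $$ (k, 0))"
      unfolding sum_distrib_left using AW by (intro sum.cong) (auto simp: mult_ac)
    also have "(\<Sum>k<?n. W $$ (i, k) * W $$ (k, 0)) = 1\<^sub>m ?n $$ (i, 0)"
      using index_mult_sum[OF Wc Wc that, of 0] WW by simp
    finally show ?thesis using that by simp
  qed
  have "(\<Sum>k<?n. B $$ (0, k) * cnj (B $$ (0, k))) = cnj c * c"
    using BB[of 0 0] col0 by (simp add: if_distrib if_distribR sum.lessThan_Suc_shift del: sum.lessThan_Suc)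
  then have "(\<Sum>k<m. B $$ (0, Suc k) * cnj (B $$ (0, Suc k))) = 0"
    using col0[of 0] by (simp add: sum.lessThan_Suc_shift del: sum.lessThan_Suc)
  then have "complex_of_real (\<Sum>k<m. (norm (B $$ (0, Suc k)))\<^sup>2) = 0"
    by (simp only: of_real_sum complex_norm_square)
  then have "(\<Sum>k<m. (norm (B $$ (0, Suc k)))\<^sup>2) = 0" by (simp only: of_real_eq_0_iff)
  then have row0: "B $$ (0, Suc k) = 0" if "k < m" for k
    using that by (subst (asm) sum_nonneg_eq_0_iff) auto
  define B' where "B' = mat m m (\<lambda>(i, j). B $$ (Suc i, Suc j))"
  have B'c: "B' \<in> carrier_mat m m" by (simp add: B'_def)
  have BdB': "B = corner_mat c B'"
    using Bc col0 row0 by (intro eq_matI) (auto simp: corner_mat_def B'_def split: nat.splits)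
  have B'adC: "mat_adjoint B' \<in> carrier_mat m m" using B'c by (rule mat_adjoint_carrier)
  have "B' * mat_adjoint B' = mat_adjoint B' * B'"
  proof (rule eq_matI)
    fix i j assume "i < dim_row (mat_adjoint B' * B')" "j < dim_col (mat_adjoint B' * B')"
    then have ij: "i < m" "j < m" using B'c by auto
    have "(B' * mat_adjoint B') $$ (i, j) = (\<Sum>k<m. B $$ (Suc i, Suc k) * cnj (B $$ (Suc j, Suc k)))"
      unfolding index_mult_sum[OF B'c B'adC ij] using ij B'c by (intro sum.cong) (auto simp: conjugate_complex_def B'_def)
    also have "\<dots> = (\<Sum>k<m. cnj (B $$ (Suc k, Suc i)) * B $$ (Suc k, Suc j))"
      using BB[of "Suc i" "Suc j"] ij row0 col0 by (simp add: sum.lessThan_Suc_shift del: sum.lessThan_Suc)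
    also have "\<dots> = (mat_adjoint B' * B') $$ (i, j)"
      unfolding index_mult_sum[OF B'adC B'c ij] using ij B'c by (intro sum.cong) (auto simp: conjugate_complex_def B'_def)
    finally show "(B' * mat_adjoint B') $$ (i, j) = (mat_adjoint B' * B') $$ (i, j)" .
  qed (use B'c in auto)
  then obtain U z where U: "U \<in> unitary_group m" and B'eq: "B' = U * mat_diag m z * mat_adjoint U"
    using Suc.IH[OF B'c] by blast
  have Uc: "U \<in> carrier_mat m m" "mat_adjoint U \<in> carrier_mat m m" using U by (auto simp: unitary_group_def)
  define V where "V = corner_mat 1 U"
  define z' where "z' = (\<lambda>i. case i of 0 \<Rightarrow> c | Suc i' \<Rightarrow> z i')"
  have V: "V \<in> unitary_group ?n" using U by (simp add: V_def corner_mat_unitary)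
  have "V * mat_diag ?n z' * mat_adjoint V = corner_mat 1 U * corner_mat c (mat_diag m z) * corner_mat 1 (mat_adjoint U)"
    by (simp add: V_def z'_def corner_mat_diag corner_mat_adjoint[OF Uc(1)])
  also have "\<dots> = corner_mat c B'"
    using Uc by (simp add: corner_mat_mult[of _ m] B'eq)
  finally have BV: "B = V * mat_diag ?n z' * mat_adjoint V" using BdB' by simp
  have Vc: "V \<in> carrier_mat ?n ?n" "mat_adjoint V \<in> carrier_mat ?n ?n" using V by (auto simp: unitary_group_def)
  have "A = W * B * W" unfolding B_def using A Wc WW by (simp add: a mc WW')
  also have "\<dots> = (W * V) * mat_diag ?n z' * mat_adjoint (W * V)"
    unfolding BV using Wc Vc by (simp add: a mc mat_adjoint_mult[of _ ?n ?n _ ?n] W(2))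
  finally show ?case using unitary_group_mult[OF W(1) V] by blast
qed

section \<open>Arithmetic of unitarily diagonalised matrices\<close>

abbreviation cmat :: "real mat \<Rightarrow> complex mat" where "cmat \<equiv> map_mat complex_of_real"

definition udiag :: "complex mat \<Rightarrow> (nat \<Rightarrow> complex) \<Rightarrow> complex mat" where
  "udiag U z = U * mat_diag (dim_row U) z * mat_adjoint U"

lemma cmat_eq_iff [simp]: "cmat A = cmat B \<longleftrightarrow> A = B"
  by (auto simp: mat_eq_iff)

lemma cmat_mult: "A \<in> carrier_mat n m ==> B \<in> carrier_mat m k ==> cmat (A * B) = cmat A * cmat B"
  by (rule eq_matI) (auto simp: scalar_prod_def)

lemma cmat_one [simp]: "cmat (1\<^sub>m n) = 1\<^sub>m n"
  by (rule eq_matI) auto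

lemma cmat_transpose: "cmat (A\<^sup>T) = mat_adjoint (cmat A)"
  by (rule eq_matI) (auto simp: conjugate_complex_def)

lemma udiag_carrier: "U \<in> unitary_group n ==> udiag U z \<in> carrier_mat n n"
  by (auto simp: udiag_def unitary_group_def)

lemma udiag_dims [simp]: "dim_row (udiag U z) = dim_row U" "dim_col (udiag U z) = dim_row U"
  by (simp_all add: udiag_def)

lemma unitary_dims: "U \<in> unitary_group n ==> dim_row U = n" "U \<in> unitary_group n ==> dim_col U = n"
  by (auto simp: unitary_group_def)

lemma udiag_index:
  assumes "U \<in> unitary_group n" "i < n" "j < n"
  shows "udiag U z $$ (i, j) = (\<Sum>k<n. U $$ (i, k) * z k * cnj (U $$ (j, k)))"
proof -
  have U: "U \<in> carrier_mat n n" using assms by (simp add: unitary_group_def)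
  have c: "U * mat_diag n z \<in> carrier_mat n n" "mat_adjoint U \<in> carrier_mat n n" using U mat_adjoint_carrier by auto
  have "udiag U z $$ (i, j) = (\<Sum>k<n. (U * mat_diag n z) $$ (i, k) * mat_adjoint U $$ (k, j))"
    unfolding udiag_def using U assms c by (subst index_mult_sum[of _ n n _ n]) auto
  also have "\<dots> = (\<Sum>k<n. U $$ (i, k) * z k * cnj (U $$ (j, k)))"
    using U assms by (intro sum.cong) (auto simp: mat_diag_mult_right[OF U] conjugate_complex_def)
  finally show ?thesis .
qed

lemma udiag_cong:
  assumes "U \<in> unitary_group n" "\<And>k. k < n ==> z k = w k"
  shows "udiag U z = udiag U w"
  using assms by (intro eq_matI) (simp_all add: udiag_index[OF assms(1)] unitary_dims[OF assms(1)])

lemma udiag_mult: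
  assumes U: "U \<in> unitary_group n"
  shows "udiag U z * udiag U w = udiag U (\<lambda>k. z k * w k)"
proof -
  let ?A = "mat_adjoint U"
  have c: "U \<in> carrier_mat n n" "?A \<in> carrier_mat n n" and AU: "?A * U = 1\<^sub>m n"
    using U mat_adjoint_carrier by (auto simp: unitary_group_def)
  note a = assoc_mult_mat[of _ n n _ n _ n]
  have AU': "?A * (U * X) = X" if "X \<in> carrier_mat n n" for X
    using that c AU by (simp flip: a)
  have mc: "X * Y \<in> carrier_mat n n" if "X \<in> carrier_mat n n" "Y \<in> carrier_mat n n" for X Y :: "complex mat"
    using that by simp
  have "udiag U z * udiag U w = U * (mat_diag n z * mat_diag n w) * ?A"
    unfolding udiag_def using c by (simp add: a mc AU' del: mat_diag_diag)
  then show ?thesis using c by (simp add: udiag_def)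
qed

lemma udiag_one: "U \<in> unitary_group n ==> udiag U (\<lambda>_. 1) = 1\<^sub>m n"
  by (auto simp: udiag_def unitary_group_def)

lemma udiag_adjoint:
  assumes "U \<in> unitary_group n"
  shows "mat_adjoint (udiag U z) = udiag U (\<lambda>k. cnj (z k))"
  by (intro eq_matI) (auto simp: udiag_index[OF assms] unitary_dims[OF assms] conjugate_complex_def mult_ac)

lemma udiag_add:
  assumes "U \<in> unitary_group n"
  shows "udiag U z + udiag U w = udiag U (\<lambda>k. z k + w k)"
  by (intro eq_matI) (auto simp: udiag_index[OF assms] unitary_dims[OF assms] algebra_simps sum.distrib)

lemma udiag_diff:
  assumes "U \<in> unitary_group n"
  shows "udiag U z - udiag U w = udiag U (\<lambda>k. z k - w k)"
  by (intro eq_matI) (auto simp: udiag_index[OF assms] unitary_dims[OF assms] algebra_simps sum_subtractf)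

lemma udiag_smult:
  assumes "U \<in> unitary_group n"
  shows "c \<cdot>\<^sub>m udiag U z = udiag U (\<lambda>k. c * z k)"
  by (intro eq_matI) (auto simp: udiag_index[OF assms] unitary_dims[OF assms] sum_distrib_left mult_ac)

lemma udiag_inj:
  assumes U: "U \<in> unitary_group n" and e: "udiag U z = udiag U w" and k: "k < n"
  shows "z k = w k"
proof -
  let ?A = "mat_adjoint U"
  have c: "U \<in> carrier_mat n n" "?A \<in> carrier_mat n n" and AU: "?A * U = 1\<^sub>m n"
    using U mat_adjoint_carrier by (auto simp: unitary_group_def)
  note a = assoc_mult_mat[of _ n n _ n _ n]
  have mc: "X * Y \<in> carrier_mat n n" if "X \<in> carrier_mat n n" "Y \<in> carrier_mat n n" for X Y :: "complex mat"
    using that by simp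
  have "?A * udiag U x * U = mat_diag n x" for x
  proof -
    have "?A * udiag U x * U = (?A * U) * (mat_diag n x * (?A * U))"
      unfolding udiag_def using c by (simp add: a mc)
    then show ?thesis unfolding AU
      using right_mult_one_mat[OF mat_diag_dim[of n x]] left_mult_one_mat[OF mat_diag_dim[of n x]] by simp
  qed
  then have "mat_diag n z = mat_diag n w" using e by metis
  then have "mat_diag n z $$ (k, k) = mat_diag n w $$ (k, k)" by simp
  then show ?thesis using k by (simp add: mat_diag_def)
qed

lemma unitary_columns:
  assumes U: "U \<in> unitary_group n" and k: "k < n"
  shows "(\<Sum>i<n. U $$ (i, k) * cnj (U $$ (i, k))) = 1"
proof -
  have c: "U \<in> carrier_mat n n" "mat_adjoint U \<in> carrier_mat n n"
    using U mat_adjoint_carrier by (auto simp: unitary_group_def)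
  have "(mat_adjoint U * U) $$ (k, k) = 1" using U k by (simp add: unitary_group_def)
  then show ?thesis unfolding index_mult_sum[OF c(2,1) k k]
    using c k by (simp add: conjugate_complex_def mult.commute)
qed

lemma udiag_trace:
  assumes U: "U \<in> unitary_group n"
  shows "(\<Sum>i<n. udiag U z $$ (i, i)) = (\<Sum>k<n. z k)"
proof -
  have "(\<Sum>i<n. udiag U z $$ (i, i)) = (\<Sum>i<n. \<Sum>k<n. z k * (U $$ (i, k) * cnj (U $$ (i, k))))"
    by (intro sum.cong) (auto simp: udiag_index[OF U] mult_ac)
  also have "\<dots> = (\<Sum>k<n. z k * (\<Sum>i<n. U $$ (i, k) * cnj (U $$ (i, k))))"
    by (subst sum.swap) (simp add: sum_distrib_left)
  also have "\<dots> = (\<Sum>k<n. z k)" using unitary_columns[OF U] by (intro sum.cong) auto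
  finally show ?thesis .
qed

lemma udiag_det:
  assumes U: "U \<in> unitary_group n"
  shows "det (udiag U z) = (\<Prod>k<n. z k)"
proof -
  let ?A = "mat_adjoint U"
  have c: "U \<in> carrier_mat n n" "?A \<in> carrier_mat n n" and AU: "?A * U = 1\<^sub>m n"
    using U mat_adjoint_carrier by (auto simp: unitary_group_def)
  have "det ?A * det U = 1" using det_mult[OF c(2,1)] AU by simp
  moreover have "det (udiag U z) = det U * det (mat_diag n z) * det ?A"
    unfolding udiag_def using c by (simp add: det_mult[of _ n])
  moreover have "det (mat_diag n z) = (\<Prod>k<n. z k)"
  proof -
    have "upper_triangular (mat_diag n z)" by (auto simp: mat_diag_def)
    then have "det (mat_diag n z) = prod_list (diag_mat (mat_diag n z))"
      using det_upper_triangular[of "mat_diag n z" n] by simp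
    also have "diag_mat (mat_diag n z) = map z [0..<n]"
      by (auto simp: diag_mat_def mat_diag_def)
    also have "prod_list (map z [0..<n]) = (\<Prod>k<n. z k)"
      using prod.distinct_set_conv_list[of "[0..<n]" z] by (simp add: lessThan_atLeast0)
    finally show ?thesis .
  qed
  ultimately show ?thesis by (simp add: mult_ac)
qed

lemma frobenius_norm_sq: "A \<in> carrier_mat n m ==> (frobenius_norm A)\<^sup>2 = (\<Sum>i<n. \<Sum>j<m. (norm (A $$ (i, j)))\<^sup>2)"
  by (auto simp: frobenius_norm_def sum_nonneg)

lemma udiag_frobenius:
  assumes U: "U \<in> unitary_group n"
  shows "(frobenius_norm (udiag U z))\<^sup>2 = (\<Sum>k<n. (norm (z k))\<^sup>2)"
proof -
  let ?B = "udiag U z"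
  note c = udiag_carrier[OF U, of z]
  have "(\<Sum>i<n. (?B * mat_adjoint ?B) $$ (i, i)) = (\<Sum>k<n. z k * cnj (z k))"
    by (simp only: udiag_adjoint[OF U] udiag_mult[OF U] udiag_trace[OF U])
  moreover have "(?B * mat_adjoint ?B) $$ (i, i) = of_real (\<Sum>j<n. (norm (?B $$ (i, j)))\<^sup>2)" if "i < n" for i
  proof -
    have "(?B * mat_adjoint ?B) $$ (i, i) = (\<Sum>j<n. ?B $$ (i, j) * cnj (?B $$ (i, j)))"
      unfolding index_mult_sum[OF c mat_adjoint_carrier[OF c] that that]
      using c that by (intro sum.cong) (auto simp: conjugate_complex_def)
    then show ?thesis by (simp only: of_real_sum complex_norm_square)
  qed
  ultimately have "of_real (\<Sum>i<n. \<Sum>j<n. (norm (?B $$ (i, j)))\<^sup>2) = (\<Sum>k<n. z k * cnj (z k))"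
    by (simp only: of_real_sum) simp
  also have "\<dots> = of_real (\<Sum>k<n. (norm (z k))\<^sup>2)"
    by (simp only: of_real_sum complex_norm_square)
  finally show ?thesis unfolding frobenius_norm_sq[OF c] by (simp only: of_real_eq_iff)
qed

lemma udiag_power:
  assumes U: "U \<in> unitary_group n"
  shows "udiag U z ^\<^sub>m k = udiag U (\<lambda>l. z l ^ k)"
proof (induction k)
  case 0
  then show ?case using unitary_dims(1)[OF U] udiag_one[OF U] by simp
next
  case (Suc k)
  then show ?case by (simp add: udiag_mult[OF U] mult.commute)
qed

lemma cmat_power: "X \<in> carrier_mat n n ==> cmat (X ^\<^sub>m k) = cmat X ^\<^sub>m k"
  by (induction k) (auto simp: cmat_mult[of _ n n _ n])

text \<open>Entrywise the spectral form is a finite combination of scalar exponential series. Its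
  partial sums are real, so the limit is real and its real part is the series in
  \<open>exp_mat_def\<close>.\<close>

lemma cmat_exp_mat:
  assumes X: "X \<in> carrier_mat n n" and U: "U \<in> unitary_group n" and w: "cmat X = udiag U w"
  shows "cmat (exp_mat X) = udiag U (\<lambda>k. exp (w k))"
proof (rule eq_squareI[where n = n])
  fix i j :: nat assume ij: "i < n" "j < n"
  let ?f = "\<lambda>k. (X ^\<^sub>m k) $$ (i, j) / fact k"
  let ?s = "udiag U (\<lambda>k. exp (w k)) $$ (i, j)"
  have "(\<lambda>k. \<Sum>l<n. U $$ (i, l) * (w l ^ k /\<^sub>R fact k) * cnj (U $$ (j, l))) sums (\<Sum>l<n. U $$ (i, l) * exp (w l) * cnj (U $$ (j, l)))"
    by (intro sums_sum sums_mult2 sums_mult exp_converges)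
  moreover have "(\<Sum>l<n. U $$ (i, l) * (w l ^ k /\<^sub>R fact k) * cnj (U $$ (j, l))) = complex_of_real (?f k)" for k
  proof -
    have c: "X ^\<^sub>m k \<in> carrier_mat n n" using X by (rule pow_carrier_mat)
    have "complex_of_real ((X ^\<^sub>m k) $$ (i, j)) = cmat (X ^\<^sub>m k) $$ (i, j)" using ij carrier_matD[OF c] by simp
    also have "\<dots> = (\<Sum>l<n. U $$ (i, l) * w l ^ k * cnj (U $$ (j, l)))"
      unfolding cmat_power[OF X] w udiag_power[OF U] by (rule udiag_index[OF U ij])
    finally have "complex_of_real (?f k) = (\<Sum>l<n. U $$ (i, l) * w l ^ k * cnj (U $$ (j, l))) / fact k"
      by simp
    then show ?thesis by (simp add: sum_divide_distrib sum_distrib_left scaleR_conv_of_real divide_inverse mult_ac)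
  qed
  ultimately have s: "(\<lambda>k. complex_of_real (?f k)) sums ?s" using udiag_index[OF U ij] by simp
  have "?f sums Re ?s" using sums_Re[OF s] by (simp only: Re_complex_of_real)
  then have 1: "exp_mat X $$ (i, j) = Re ?s" using ij X by (simp add: exp_mat_def sums_iff)
  have "(\<lambda>k. 0) sums Im ?s" using sums_Im[OF s] by (simp only: Im_complex_of_real)
  then have "Im ?s = 0" by (simp add: sums_iff)
  then show "cmat (exp_mat X) $$ (i, j) = ?s"
    using 1 ij X by (simp add: exp_mat_carrier complex_eq_iff) (simp add: exp_mat_def complex_eq_iff)
qed (use X udiag_carrier[OF U, of "\<lambda>k. exp (w k)"] in \<open>auto simp: exp_mat_def\<close>)

lemma orthogonal_cmat_diag:
  assumes A: "A \<in> O_group n"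
  shows "\<exists>U \<in> unitary_group n. \<exists>z. cmat A = udiag U z \<and> (\<forall>k<n. norm (z k) = 1)"
proof -
  have c: "A \<in> carrier_mat n n" "A * A\<^sup>T = 1\<^sub>m n" "A\<^sup>T * A = 1\<^sub>m n"
    using A by (auto simp: O_group_def)
  then have 1: "cmat A * mat_adjoint (cmat A) = 1\<^sub>m n" "mat_adjoint (cmat A) * cmat A = 1\<^sub>m n"
    using cmat_mult[of A n n "A\<^sup>T" n] cmat_mult[of "A\<^sup>T" n n A n]
    by (simp_all add: cmat_transpose)
  then obtain U z where U: "U \<in> unitary_group n" and z: "cmat A = U * mat_diag n z * mat_adjoint U"
    using normal_mat_unitary_diag[of "cmat A" n] c by auto
  then have z: "cmat A = udiag U z" by (auto simp: udiag_def unitary_group_def)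
  have e: "udiag U (\<lambda>k. z k * cnj (z k)) = udiag U (\<lambda>_. 1)"
    using 1(1) unfolding z by (simp only: udiag_adjoint[OF U] udiag_mult[OF U] udiag_one[OF U])
  have "norm (z k) = 1" if "k < n" for k
  proof -
    have "norm (z k * cnj (z k)) = 1" using udiag_inj[OF U e that] by simp
    then have "norm (z k) * norm (z k) = 1" by (simp add: norm_mult)
    then show ?thesis by (metis abs_norm_cancel real_sqrt_abs2 real_sqrt_one)
  qed
  then show ?thesis using U z by blast
qed

abbreviation idiag :: "complex mat \<Rightarrow> (nat \<Rightarrow> real) \<Rightarrow> complex mat" where
  "idiag U t \<equiv> udiag U (\<lambda>k. \<i> * of_real (t k))"

lemma skew_cmat_diag:
  assumes X: "X \<in> skew_mats n"
  shows "\<exists>U \<in> unitary_group n. \<exists>t. cmat X = idiag U t"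
proof -
  have c: "X \<in> carrier_mat n n" "X\<^sup>T = - X" using X by (auto simp: skew_mats_def)
  have neg: "- M = (-1) \<cdot>\<^sub>m M" for M :: "complex mat" by (rule eq_matI) auto
  have "cmat (- X) = - cmat X" by (rule eq_matI) auto
  then have adj: "mat_adjoint (cmat X) = - cmat X" using cmat_transpose[of X] unfolding c(2) by metis
  have "cmat X * mat_adjoint (cmat X) = mat_adjoint (cmat X) * cmat X" unfolding adj using c(1) by simp
  then obtain U z where U: "U \<in> unitary_group n" and z: "cmat X = U * mat_diag n z * mat_adjoint U"
    using normal_mat_unitary_diag[of "cmat X" n] c(1) by auto
  then have z: "cmat X = udiag U z" by (auto simp: udiag_def unitary_group_def)
  have "udiag U (\<lambda>k. cnj (z k)) = (-1) \<cdot>\<^sub>m udiag U z"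
    using adj unfolding z udiag_adjoint[OF U] neg .
  then have e: "udiag U (\<lambda>k. cnj (z k)) = udiag U (\<lambda>k. - 1 * z k)" by (simp only: udiag_smult[OF U])
  have "cnj (z k) = - z k" if "k < n" for k using udiag_inj[OF U e that] by simp
  then have "z k = \<i> * of_real (Im (z k))" if "k < n" for k using that by (auto simp: complex_eq_iff)
  then have "cmat X = udiag U (\<lambda>k. \<i> * of_real (Im (z k)))" unfolding z by (intro udiag_cong[OF U])
  then show ?thesis by (intro bexI[of _ U] exI[of _ "\<lambda>k. Im (z k)"] U)
qed

lemma det_cmat: "det (cmat A) = of_real (det A)"
  by (rule of_real_hom.hom_det)

lemma exp_mat_SO:
  assumes X: "X \<in> skew_mats n"
  shows "exp_mat X \<in> SO_group n"
proof -
  have c: "X \<in> carrier_mat n n" "X\<^sup>T = - X" using X by (auto simp: skew_mats_def)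
  obtain U t where U: "U \<in> unitary_group n" and t: "cmat X = idiag U t"
    using skew_cmat_diag[OF X] by blast
  have e: "cmat (exp_mat X) = udiag U (\<lambda>k. exp (\<i> * of_real (t k)))" by (rule cmat_exp_mat[OF c(1) U t])
  have ec: "exp_mat X \<in> carrier_mat n n" by (rule exp_mat_carrier[OF c(1)])
  have cn: "exp (\<i> * of_real r) * cnj (exp (\<i> * of_real r)) = 1" "cnj (exp (\<i> * of_real r)) * exp (\<i> * of_real r) = 1" for r :: real
    by (simp_all add: exp_cnj flip: exp_add)
  have "cmat (exp_mat X * (exp_mat X)\<^sup>T) = cmat (1\<^sub>m n)" "cmat ((exp_mat X)\<^sup>T * exp_mat X) = cmat (1\<^sub>m n)"
    using ec by (simp_all add: cmat_mult[of _ n n _ n] cmat_transpose e udiag_adjoint[OF U] udiag_mult[OF U] cn udiag_one[OF U] del: cmat_eq_iff)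
  then have "exp_mat X * (exp_mat X)\<^sup>T = 1\<^sub>m n" "(exp_mat X)\<^sup>T * exp_mat X = 1\<^sub>m n"
    by (simp_all only: cmat_eq_iff)
  then have o: "exp_mat X \<in> O_group n" using ec by (simp add: O_group_def)
  have "X $$ (i, i) = 0" if "i < n" for i
    using arg_cong[OF c(2), of "\<lambda>M. M $$ (i, i)"] that c(1) by simp
  then have "(\<Sum>k<n. \<i> * of_real (t k)) = 0"
    using udiag_trace[OF U, of "\<lambda>k. \<i> * of_real (t k)"] c(1) unfolding t[symmetric] by simp
  then have "of_real (det (exp_mat X)) = (1 :: complex)"
    unfolding det_cmat[symmetric] e udiag_det[OF U] by (simp add: exp_sum[symmetric])
  then show ?thesis using o by (simp add: SO_group_def)
qed

section \<open>Real logarithms of rotations\<close>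

text \<open>\<open>P\<close> is an orthogonal projector, and its column \<open>l\<close> lies in its
  range with squared norm \<open>P l l\<close>. Normalising a column with positive diagonal entry
  gives \<open>v\<close>, and splitting off \<open>v\<close> lowers the trace by 1.\<close>

lemma peel_unit_vector:
  fixes P :: "nat \<Rightarrow> nat \<Rightarrow> real"
  assumes sym: "\<And>i j. i < n ==> j < n ==> P i j = P j i"
    and idem: "\<And>i k. i < n ==> k < n ==> (\<Sum>j<n. P i j * P j k) = P i k"
    and tr: "(\<Sum>i<n. P i i) > 0"
  shows "\<exists>v. (\<Sum>i<n. v i * v i) = 1 \<and> (\<forall>i<n. (\<Sum>j<n. P i j * v j) = v i) \<and>
    (\<forall>i<n. \<forall>k<n. (\<Sum>j<n. (P i j - v i * v j) * (P j k - v j * v k)) = P i k - v i * v k) \<and>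
    (\<forall>i<n. (\<Sum>j<n. (P i j - v i * v j) * v j) = 0)"
proof -
  have "\<exists>k<n. P k k > 0"
  proof (rule ccontr)
    assume "\<not> ?thesis"
    then have "P i i \<le> 0" if "i < n" for i using that by (meson not_less)
    then have "(\<Sum>i<n. P i i) \<le> 0" by (intro sum_nonpos) simp
    then show False using tr by simp
  qed
  then obtain l where l: "l < n" "P l l > 0" by blast
  define v where "v i = P i l / sqrt (P l l)" for i
  have q: "sqrt (P l l) * sqrt (P l l) = P l l" using l by simp
  have "(\<Sum>i<n. v i * v i) = (\<Sum>i<n. P l i * P i l) / P l l"
    unfolding sum_divide_distrib using l sym q by (intro sum.cong) (auto simp: v_def)
  then have 1: "(\<Sum>i<n. v i * v i) = 1" using idem[OF l(1) l(1)] l by simp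
  have 2: "(\<Sum>j<n. P i j * v j) = v i" if "i < n" for i
    using idem[OF that l(1)] by (simp add: v_def sum_divide_distrib[symmetric])
  have two: "(\<Sum>j<n. v j * P j i) = v i" if "i < n" for i
    using 2[OF that] sym that by (simp add: mult.commute)
  have "(\<Sum>j<n. (P i j - v i * v j) * (P j k - v j * v k)) = P i k - v i * v k" if ik: "i < n" "k < n" for i k
  proof -
    have "(\<Sum>j<n. (P i j - v i * v j) * (P j k - v j * v k)) =
        (\<Sum>j<n. P i j * P j k) - v k * (\<Sum>j<n. P i j * v j) - v i * (\<Sum>j<n. v j * P j k) + v i * v k * (\<Sum>j<n. v j * v j)"
      unfolding sum_distrib_left sum.distrib[symmetric] sum_subtractf[symmetric]
      by (intro sum.cong) (auto simp: algebra_simps)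
    then show ?thesis using ik by (simp add: idem 2 two 1)
  qed
  moreover have "(\<Sum>j<n. (P i j - v i * v j) * v j) = 0" if "i < n" for i
  proof -
    have "(\<Sum>j<n. (P i j - v i * v j) * v j) = (\<Sum>j<n. P i j * v j) - v i * (\<Sum>j<n. v j * v j)"
      unfolding sum_distrib_left sum_subtractf[symmetric] by (intro sum.cong) (auto simp: algebra_simps)
    then show ?thesis using that by (simp add: 2 1)
  qed
  ultimately show ?thesis using 1 2 by (intro exI[of _ v]) auto
qed

text \<open>Induction on half the rank of the projector, which is its trace: two orthonormal vectors
  \<open>v\<close>, \<open>w\<close> of the range are split off, and a quarter turn of their plane
  is added to the complex structure on the rest.\<close>

lemma projector_complex_structure:
  fixes P :: "nat \<Rightarrow> nat \<Rightarrow> real"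
  assumes "\<And>i j. i < n ==> j < n ==> P i j = P j i"
    and "\<And>i k. i < n ==> k < n ==> (\<Sum>j<n. P i j * P j k) = P i k"
    and "(\<Sum>i<n. P i i) = 2 * real m"
  shows "\<exists>J. (\<forall>i<n. \<forall>j<n. J i j = - J j i) \<and> (\<forall>i<n. \<forall>k<n. (\<Sum>j<n. J i j * J j k) = - P i k) \<and>
    (\<forall>i<n. \<forall>k<n. (\<Sum>j<n. P i j * J j k) = J i k)"
  using assms
proof (induction m arbitrary: P)
  case 0
  have d: "(\<Sum>j<n. P i j * P i j) = P i i" if "i < n" for i
    using 0(2)[OF that that] 0(1) that by simp
  then have "P i i \<ge> 0" if "i < n" for i using that sum_nonneg[of "{..<n}" "\<lambda>j. P i j * P i j"] by fastforce
  then have "P i i = 0" if "i < n" for i using 0(3) that sum_nonneg_eq_0_iff[of "{..<n}" "\<lambda>i. P i i"] by auto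
  then have "P i j = 0" if "i < n" "j < n" for i j
    using d[OF that(1)] that sum_nonneg_eq_0_iff[of "{..<n}" "\<lambda>j. P i j * P i j"] by auto
  then show ?case by (intro exI[of _ "\<lambda>_ _. 0"]) auto
next
  case (Suc m)
  obtain v where v: "(\<Sum>i<n. v i * v i) = 1" "\<And>i. i < n ==> (\<Sum>j<n. P i j * v j) = v i"
    "\<And>i k. i < n ==> k < n ==> (\<Sum>j<n. (P i j - v i * v j) * (P j k - v j * v k)) = P i k - v i * v k"
    "\<And>i. i < n ==> (\<Sum>j<n. (P i j - v i * v j) * v j) = 0"
    using peel_unit_vector[of n P] Suc.prems by (force simp del: of_nat_Suc)
  define P1 where "P1 i j = P i j - v i * v j" for i j
  have P1: "P1 i j = P1 j i" if "i < n" "j < n" for i j using Suc.prems(1) that by (simp add: P1_def mult.commute)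
  have tr1: "(\<Sum>i<n. P1 i i) = 2 * real m + 1" using v(1) Suc.prems(3) by (simp add: P1_def sum_subtractf)
  obtain w where w: "(\<Sum>i<n. w i * w i) = 1" "\<And>i. i < n ==> (\<Sum>j<n. P1 i j * w j) = w i"
    "\<And>i k. i < n ==> k < n ==> (\<Sum>j<n. (P1 i j - w i * w j) * (P1 j k - w j * w k)) = P1 i k - w i * w k"
    "\<And>i. i < n ==> (\<Sum>j<n. (P1 i j - w i * w j) * w j) = 0"
    using peel_unit_vector[of n P1, OF P1 v(3)[folded P1_def]] tr1 by force
  define P2 where "P2 i j = P1 i j - w i * w j" for i j
  have P2: "P2 i j = P2 j i" if "i < n" "j < n" for i j using P1 that by (simp add: P2_def mult.commute)
  have tr2: "(\<Sum>i<n. P2 i i) = 2 * real m" using w(1) tr1 by (simp add: P2_def sum_subtractf)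
  have "\<exists>J. (\<forall>i<n. \<forall>j<n. J i j = - J j i) \<and> (\<forall>i<n. \<forall>k<n. (\<Sum>j<n. J i j * J j k) = - P2 i k) \<and>
    (\<forall>i<n. \<forall>k<n. (\<Sum>j<n. P2 i j * J j k) = J i k)"
    by (rule Suc.IH) (erule (1) P2, erule (1) w(3)[folded P2_def], rule tr2)
  then obtain J where J': "\<forall>i<n. \<forall>j<n. J i j = - J j i"
    "\<forall>i<n. \<forall>k<n. (\<Sum>j<n. J i j * J j k) = - P2 i k"
    "\<forall>i<n. \<forall>k<n. (\<Sum>j<n. P2 i j * J j k) = J i k"
    by (elim exE conjE)
  note J = J'(1)[rule_format] J'(2)[rule_format] J'(3)[rule_format]
  have P1v: "(\<Sum>j<n. P1 i j * v j) = 0" if "i < n" for i using v(4)[OF that] by (simp add: P1_def)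
  have wv: "(\<Sum>j<n. w j * v j) = 0"
  proof -
    have "(\<Sum>j<n. w j * v j) = (\<Sum>j<n. (\<Sum>k<n. P1 j k * w k) * v j)" using w(2) by (intro sum.cong) auto
    also have "\<dots> = (\<Sum>k<n. w k * (\<Sum>j<n. P1 k j * v j))"
      unfolding sum_distrib_left sum_distrib_right by (subst sum.swap) (auto intro!: sum.cong simp: P1 mult_ac)
    finally show ?thesis using P1v by simp
  qed
  have vw: "(\<Sum>j<n. v j * w j) = 0" using wv by (simp add: mult.commute)
  have P2v: "(\<Sum>j<n. P2 i j * v j) = 0" if "i < n" for i
  proof -
    have "(\<Sum>j<n. P2 i j * v j) = (\<Sum>j<n. P1 i j * v j) - w i * (\<Sum>j<n. w j * v j)"
      unfolding sum_distrib_left sum_subtractf[symmetric] by (intro sum.cong) (auto simp: P2_def algebra_simps)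
    then show ?thesis using P1v[OF that] wv by simp
  qed
  have P2w: "(\<Sum>j<n. P2 i j * w j) = 0" if "i < n" for i using w(4)[OF that] by (simp add: P2_def)
  \<comment> \<open>Vectors annihilated by \<open>P2\<close> are annihilated by \<open>J\<close>
    from both sides, since \<open>J\<close> equals \<open>P2\<close> times \<open>J\<close> and is
    skew.\<close>
  have kill: "(\<Sum>j<n. u j * J j k) = 0 \<and> (\<Sum>j<n. J k j * u j) = 0"
    if u: "\<And>i. i < n ==> (\<Sum>j<n. P2 i j * u j) = 0" and k: "k < n" for u k
  proof -
    have "(\<Sum>j<n. u j * J j k) = (\<Sum>j<n. u j * (\<Sum>l<n. P2 j l * J l k))" using J(3) k by (intro sum.cong) auto
    also have "\<dots> = (\<Sum>l<n. J l k * (\<Sum>j<n. P2 l j * u j))"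
      unfolding sum_distrib_left by (subst sum.swap) (auto intro!: sum.cong simp: P2 mult_ac)
    finally have 1: "(\<Sum>j<n. u j * J j k) = 0" using u by simp
    have "J k j * u j = - (u j * J j k)" if "j < n" for j using J(1)[OF k that] by simp
    then have "(\<Sum>j<n. J k j * u j) = (\<Sum>j<n. - (u j * J j k))" by (intro sum.cong) auto
    then show ?thesis using 1 by (simp add: sum_negf)
  qed
  define J' where "J' i j = v i * w j - w i * v j + J i j" for i j
  have "J' i j = - J' j i" if "i < n" "j < n" for i j using J(1)[OF that] by (simp add: J'_def)
  moreover have "(\<Sum>j<n. J' i j * J' j k) = - P i k" if ik: "i < n" "k < n" for i k
  proof -
    have "(\<Sum>j<n. J' i j * J' j k) = v i * w k * (\<Sum>j<n. w j * v j) - v i * v k * (\<Sum>j<n. w j * w j) + v i * (\<Sum>j<n. w j * J j k)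
       - w i * w k * (\<Sum>j<n. v j * v j) + w i * v k * (\<Sum>j<n. v j * w j) - w i * (\<Sum>j<n. v j * J j k)
       + w k * (\<Sum>j<n. J i j * v j) - v k * (\<Sum>j<n. J i j * w j) + (\<Sum>j<n. J i j * J j k)"
      unfolding sum_distrib_left sum.distrib[symmetric] sum_subtractf[symmetric]
      by (intro sum.cong) (auto simp: J'_def algebra_simps)
    also have "\<dots> = - (v i * v k) - w i * w k - P2 i k"
      using ik kill[OF P2v] kill[OF P2w] by (simp add: wv vw v(1) w(1) J(2))
    finally show ?thesis by (simp add: P2_def P1_def)
  qed
  moreover have "(\<Sum>j<n. P i j * J' j k) = J' i k" if ik: "i < n" "k < n" for i k
  proof -
    have "(\<Sum>j<n. P i j * J' j k) = (\<Sum>j<n. P i j * v j) * w k - v k * (v i * (\<Sum>j<n. v j * w j) + (\<Sum>j<n. P1 i j * w j))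
       + v i * (\<Sum>j<n. v j * J j k) + w i * (\<Sum>j<n. w j * J j k) + (\<Sum>j<n. P2 i j * J j k)"
      unfolding sum_distrib_left sum_distrib_right sum.distrib[symmetric] sum_subtractf[symmetric]
      by (intro sum.cong) (auto simp: J'_def P2_def P1_def algebra_simps)
    also have "\<dots> = J' i k"
      using ik kill[OF P2v] kill[OF P2w] by (simp add: vw v(2) w(2) J(3)) (simp add: J'_def mult.commute)
    finally show ?thesis .
  qed
  ultimately show ?case by blast
qed

lemma map_mat_cnj_mult: "A \<in> carrier_mat n m ==> B \<in> carrier_mat m k ==> map_mat cnj (A * B) = map_mat cnj A * map_mat cnj B"
  by (rule eq_matI) (auto simp: scalar_prod_def)

lemma unitary_cnj:
  assumes U: "U \<in> unitary_group n"
  shows "map_mat cnj U \<in> unitary_group n"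
proof -
  have c: "U \<in> carrier_mat n n" "mat_adjoint U \<in> carrier_mat n n" using U by (auto simp: unitary_group_def)
  have a: "mat_adjoint (map_mat cnj U) = map_mat cnj (mat_adjoint U)"
    by (rule eq_matI) (auto simp: conjugate_complex_def)
  have one: "map_mat cnj (1\<^sub>m n) = 1\<^sub>m n" by (rule eq_matI) auto
  show ?thesis
    using U c by (simp add: unitary_group_def a one flip: map_mat_cnj_mult)
qed

text \<open>A real matrix is also diagonalised by the conjugates of \<open>U\<close> and
  \<open>z\<close>. As \<open>fun_calc\<close> does not depend on the diagonalisation, a function
  that commutes with conjugation yields a matrix equal to its own conjugate.\<close>

lemma real_functional_calculus:
  assumes A: "cmat A = udiag U z" and U: "U \<in> unitary_group n"
    and g: "\<And>k. k < n ==> g (cnj (z k)) = cnj (g (z k))"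
  shows "\<exists>R \<in> carrier_mat n n. cmat R = udiag U (\<lambda>k. g (z k))"
proof -
  let ?V = "map_mat cnj U"
  have V: "?V \<in> unitary_group n" by (rule unitary_cnj[OF U])
  have dU: "dim_row U = n" using U by (auto simp: unitary_group_def)
  have c: "udiag U w \<in> carrier_mat n n" "udiag ?V w \<in> carrier_mat n n" for w by (rule udiag_carrier[OF U], rule udiag_carrier[OF V])
  have cn: "udiag ?V w $$ (i, j) = cnj (udiag U (\<lambda>k. cnj (w k)) $$ (i, j))" if "i < n" "j < n" for w i j
    using that unitary_dims[OF U] by (auto simp: udiag_index[OF U] udiag_index[OF V] intro!: sum.cong)
  have d: "dim_row A = n" "dim_col A = n"
    using arg_cong[OF A, of dim_row] arg_cong[OF A, of dim_col] dU by simp_all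
  have A': "cmat A = udiag ?V (\<lambda>k. cnj (z k))"
  proof (rule eq_squareI[where n = n])
    fix i j :: nat assume ij: "i < n" "j < n"
    have "udiag ?V (\<lambda>k. cnj (z k)) $$ (i, j) = cnj (cmat A $$ (i, j))" using cn[OF ij] A by simp
    then show "cmat A $$ (i, j) = udiag ?V (\<lambda>k. cnj (z k)) $$ (i, j)" using ij d by simp
  qed (use d unitary_dims[OF V] in simp_all)
  have "udiag U (\<lambda>k. g (z k)) = fun_calc g (cmat A)"
    using fun_calc_eq[OF U, of "cmat A" z g] A by (simp add: udiag_def dU)
  also have "\<dots> = udiag ?V (\<lambda>k. g (cnj (z k)))"
    using fun_calc_eq[OF V, of "cmat A" "\<lambda>k. cnj (z k)" g] A' by (simp add: udiag_def dU)
  also have "\<dots> = udiag ?V (\<lambda>k. cnj (g (z k)))" using g by (intro udiag_cong[OF V])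
  finally have e: "udiag U (\<lambda>k. g (z k)) $$ (i, j) = cnj (udiag U (\<lambda>k. g (z k)) $$ (i, j))" if "i < n" "j < n" for i j
    using cn[OF that, of "\<lambda>k. cnj (g (z k))"] by simp
  define R where "R = mat n n (\<lambda>(i, j). Re (udiag U (\<lambda>k. g (z k)) $$ (i, j)))"
  have "cmat R = udiag U (\<lambda>k. g (z k))"
  proof (rule eq_squareI[where n = n])
    fix i j :: nat assume ij: "i < n" "j < n"
    show "cmat R $$ (i, j) = udiag U (\<lambda>k. g (z k)) $$ (i, j)"
      using ij e[OF ij] by (simp add: R_def complex_eq_iff)
  qed (use c(1)[of "\<lambda>k. g (z k)"] in \<open>auto simp: R_def\<close>)
  moreover have "R \<in> carrier_mat n n" by (simp add: R_def)
  ultimately show ?thesis by blast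
qed

lemma exp_mat_add_commute:
  assumes X: "X \<in> carrier_mat n n" and Y: "Y \<in> carrier_mat n n" and XY: "X * Y = Y * X"
  shows "exp_mat (X + Y) = exp_mat X * exp_mat Y"
proof -
  have c: "exp_mat X \<in> carrier_mat n n" "exp_mat Y \<in> carrier_mat n n" "X + Y \<in> carrier_mat n n"
    using X Y by (auto intro: exp_mat_carrier)
  have "emb X * emb Y = emb Y * emb X" using X Y XY emb_mult[OF X Y] emb_mult[OF Y X] by simp
  then have "exp (emb X + emb Y) = exp (emb X) * exp (emb Y)" by (rule exp_add_commuting)
  then have "unital n (exp_mat (X + Y)) = unital n (exp_mat X * exp_mat Y)"
    using X Y c by (simp add: exp_emb[symmetric] emb_add[OF X Y] unital_mult)
  then show ?thesis
    using of_unital_unital[OF exp_mat_carrier[OF c(3)]] of_unital_unital[OF mult_carrier_mat[OF c(1,2)]] by metis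
qed

text \<open>The principal value at -1 is not compatible with complex conjugation and would not yield
  a real matrix. The value 0 is put there instead, and the eigenspace of -1 is treated
  separately.\<close>

definition log_circle :: "complex \<Rightarrow> complex" where
  "log_circle z = (if z = -1 then 0 else Ln z)"

lemma log_circle:
  assumes "norm z = 1"
  shows "exp (log_circle z) = (if z = -1 then 1 else z)" "log_circle (cnj z) = cnj (log_circle z)"
    "cnj (log_circle z) = - log_circle z" "norm (log_circle z) \<le> 2 * pi * norm (z - 1)"
proof -
  have z0: "z \<noteq> 0" using assms by auto
  have n: "z \<notin> \<real>\<^sub>\<le>\<^sub>0" if "z \<noteq> -1"
    using assms that by (auto simp: complex_nonpos_Reals_iff complex_eq_iff cmod_def abs_if power2_eq_1_iff split: if_splits)
  show "exp (log_circle z) = (if z = -1 then 1 else z)" using z0 by (simp add: log_circle_def)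
  show "log_circle (cnj z) = cnj (log_circle z)"
    using cnj_Ln[OF n] by (auto simp: log_circle_def complex_eq_iff)
  have re: "Re (log_circle z) = 0" using z0 assms by (simp add: log_circle_def)
  then show "cnj (log_circle z) = - log_circle z" by (simp add: complex_eq_iff)
  have im: "norm (log_circle z) \<le> pi"
  proof -
    have "norm (log_circle z) = \<bar>Im (log_circle z)\<bar>" using re by (simp add: cmod_def)
    also have "\<dots> \<le> pi" using mpi_less_Im_Ln[OF z0] Im_Ln_le_pi[OF z0] by (auto simp: log_circle_def)
    finally show ?thesis .
  qed
  show "norm (log_circle z) \<le> 2 * pi * norm (z - 1)"
  proof (cases "norm (z - 1) < 1/2")
    case True
    then have "norm (Ln (1 + (z - 1))) \<le> 2 * norm (z - 1)" by (rule norm_Ln_le)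
    also have "\<dots> \<le> 2 * pi * norm (z - 1)" using pi_ge_two by (intro mult_right_mono) auto
    finally show ?thesis by (auto simp: log_circle_def)
  next
    case False
    then have "pi \<le> 2 * pi * norm (z - 1)" by simp
    then show ?thesis using im by linarith
  qed
qed

lemma SO_O: "A \<in> SO_group n ==> A \<in> O_group n" and SO_carrier: "A \<in> SO_group n ==> A \<in> carrier_mat n n"
  by (auto simp: SO_group_def O_group_def)

text \<open>Off the eigenvalue -1 the functional calculus with \<open>log_circle\<close> provides a
  real logarithm \<open>X0\<close>. On the eigenspace of -1, of even dimension because the
  determinant is 1, pi times a complex structure \<open>J\<close> is added. The two parts of the
  constant bound these two summands.\<close>

theorem exp_mat_surj:
  assumes A: "A \<in> SO_group n"
  shows "\<exists>X \<in> skew_mats n. exp_mat X = A \<and>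
    (\<forall>i<n. \<forall>j<n. \<bar>X $$ (i, j)\<bar> \<le> (2 * pi * real n + pi) * frobenius_norm (cmat (A - 1\<^sub>m n)))"
proof -
  have Ac: "A \<in> carrier_mat n n" by (rule SO_carrier[OF A])
  obtain U z where U: "U \<in> unitary_group n" and z: "cmat A = udiag U z" and nz: "\<And>k. k < n ==> norm (z k) = 1"
    using orthogonal_cmat_diag[OF SO_O[OF A]] by blast
  let ?F = "frobenius_norm (cmat (A - 1\<^sub>m n))"
  have "cmat (A - 1\<^sub>m n) = udiag U (\<lambda>k. z k - 1)"
  proof -
    have "cmat (A - 1\<^sub>m n) = cmat A - 1\<^sub>m n" using Ac by (intro eq_matI) auto
    then show ?thesis by (simp add: z udiag_one[OF U, symmetric] udiag_diff[OF U])
  qed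
  then have F: "?F\<^sup>2 = (\<Sum>k<n. (norm (z k - 1))\<^sup>2)" using udiag_frobenius[OF U] by simp
  have F0: "?F \<ge> 0" by (simp add: frobenius_norm_def sum_nonneg)
  have zF: "norm (z k - 1) \<le> ?F" if "k < n" for k
  proof -
    have "(norm (z k - 1))\<^sup>2 \<le> ?F\<^sup>2"
      unfolding F using that by (intro member_le_sum[where f = "\<lambda>k. (norm (z k - 1))\<^sup>2"]) auto
    then show ?thesis using F0 by (simp add: power2_le_iff_abs_le)
  qed
  obtain X0 where X0: "X0 \<in> carrier_mat n n" "cmat X0 = udiag U (\<lambda>k. log_circle (z k))"
    using real_functional_calculus[OF z U, of log_circle] log_circle(2) nz by auto
  define ind where "ind w = (if w = -1 then 1 else 0 :: complex)" for w :: complex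
  have "ind (cnj w) = cnj (ind w)" for w by (auto simp: ind_def complex_eq_iff)
  then obtain P where P: "P \<in> carrier_mat n n" "cmat P = udiag U (\<lambda>k. ind (z k))"
    using real_functional_calculus[OF z U, of ind] by auto
  have skew0: "X0 \<in> skew_mats n"
  proof -
    have "mat_adjoint (cmat X0) = udiag U (\<lambda>k. - 1 * log_circle (z k))"
      unfolding X0(2) udiag_adjoint[OF U] using log_circle(3) nz by (intro udiag_cong[OF U]) auto
    also have "\<dots> = (-1) \<cdot>\<^sub>m cmat X0" by (simp only: X0(2) udiag_smult[OF U])
    also have "\<dots> = cmat (- X0)" by (rule eq_matI) auto
    finally have "X0\<^sup>T = - X0" by (simp flip: cmat_transpose)
    then show ?thesis using X0(1) by (simp add: skew_mats_def)
  qed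
  have eX0: "cmat (exp_mat X0) = udiag U (\<lambda>k. if z k = -1 then 1 else z k)"
    unfolding cmat_exp_mat[OF X0(1) U X0(2)] using log_circle(1) nz by (intro udiag_cong[OF U]) auto
  have Psym: "P $$ (i, j) = P $$ (j, i)" if "i < n" "j < n" for i j
  proof -
    have "mat_adjoint (cmat P) = cmat P"
      unfolding P(2) udiag_adjoint[OF U] by (intro udiag_cong[OF U]) (auto simp: ind_def)
    then have "P\<^sup>T = P" by (simp flip: cmat_transpose)
    then have "P\<^sup>T $$ (j, i) = P $$ (j, i)" by simp
    then show ?thesis using that P(1) by simp
  qed
  have PP: "P * P = P"
  proof -
    have "cmat (P * P) = cmat P"
      unfolding cmat_mult[OF P(1) P(1)] P(2) udiag_mult[OF U] by (intro udiag_cong[OF U]) (auto simp: ind_def)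
    then show ?thesis by simp
  qed
  have XP: "X0 * P = 0\<^sub>m n n" and PX: "P * X0 = 0\<^sub>m n n"
  proof -
    have "log_circle w * ind w = 0 \<and> ind w * log_circle w = 0" for w by (simp add: ind_def log_circle_def)
    moreover have "udiag U (\<lambda>_. 0) = cmat (0\<^sub>m n n)"
      using udiag_carrier[OF U, of "\<lambda>_. 0"] by (intro eq_matI) (auto simp: udiag_index[OF U])
    ultimately have "cmat (X0 * P) = cmat (0\<^sub>m n n)" "cmat (P * X0) = cmat (0\<^sub>m n n)"
      using X0 P by (simp_all only: cmat_mult[of _ n n _ n] udiag_mult[OF U])
    then show "X0 * P = 0\<^sub>m n n" "P * X0 = 0\<^sub>m n n" by simp_all
  qed
  define I where "I = {k. k < n \<and> z k = -1}"
  have fI: "finite I" by (simp add: I_def)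
  have sumI: "(\<Sum>k<n. ind (z k)) = of_nat (card I)"
  proof -
    have "(\<Sum>k<n. ind (z k)) = (\<Sum>k | k \<in> {..<n} \<and> z k = -1. 1)"
      unfolding ind_def by (rule sum.inter_filter[symmetric]) simp
    then show ?thesis by (simp add: I_def)
  qed
  \<comment> \<open>The reflection 1 - 2 P is the quotient of \<open>A\<close> and the exponential
    of \<open>X0\<close>, both of determinant 1; its own determinant is (-1) to the power
    \<open>card I\<close>.\<close>
  have even: "even (card I)"
  proof -
    define R where "R = 1\<^sub>m n - 2 \<cdot>\<^sub>m P"
    have Rc: "R \<in> carrier_mat n n" unfolding R_def by (intro minus_carrier_mat smult_carrier_mat P(1))
    have "cmat R = udiag U (\<lambda>_. 1) - 2 \<cdot>\<^sub>m cmat P"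
      using P(1) unfolding udiag_one[OF U] R_def by (intro eq_matI) auto
    then have R: "cmat R = udiag U (\<lambda>k. 1 - 2 * ind (z k))"
      by (simp only: P(2) udiag_smult[OF U] udiag_diff[OF U])
    have ec: "exp_mat X0 \<in> carrier_mat n n" by (rule exp_mat_carrier[OF X0(1)])
    have "cmat (exp_mat X0 * R) = cmat A"
      unfolding cmat_mult[OF ec Rc] eX0 R udiag_mult[OF U] z by (intro udiag_cong[OF U]) (auto simp: ind_def)
    then have "exp_mat X0 * R = A" by simp
    then have "det (exp_mat X0) * det R = det A" using det_mult[OF ec Rc] by simp
    then have "det R = 1" using A exp_mat_SO[OF skew0] by (simp add: SO_group_def)
    then have "(\<Prod>k<n. 1 - 2 * ind (z k)) = 1" using udiag_det[OF U, of "\<lambda>k. 1 - 2 * ind (z k)"] det_cmat[of R] R by simp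
    moreover have "(\<Prod>k<n. 1 - 2 * ind (z k)) = (\<Prod>k<n. if z k = -1 then -1 else 1)"
      by (intro prod.cong) (auto simp: ind_def)
    moreover have "(\<Prod>k<n. if z k = -1 then -1 else 1 :: complex) = (\<Prod>k | k \<in> {..<n} \<and> z k = -1. -1)"
      by (rule prod.inter_filter[symmetric]) simp
    ultimately have "(-1 :: complex) ^ card I = 1" by (simp add: I_def)
    then show ?thesis by (metis minus_one_power_iff one_neq_neg_one)
  qed
  then obtain m where m: "card I = 2 * m" by blast
  have "complex_of_real (\<Sum>i<n. P $$ (i, i)) = (\<Sum>i<n. cmat P $$ (i, i))" using P(1) by simp
  also have "\<dots> = of_nat (2 * m)" unfolding P(2) udiag_trace[OF U] sumI m ..
  finally have "complex_of_real (\<Sum>i<n. P $$ (i, i)) = complex_of_real (2 * real m)" by simp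
  then have trP: "(\<Sum>i<n. P $$ (i, i)) = 2 * real m" by (simp only: of_real_eq_iff)
  have idem: "(\<Sum>j<n. P $$ (i, j) * P $$ (j, k)) = P $$ (i, k)" if "i < n" "k < n" for i k
    using index_mult_sum[OF P(1) P(1) that] PP by simp
  have "\<exists>j. (\<forall>i<n. \<forall>k<n. j i k = - j k i) \<and> (\<forall>i<n. \<forall>k<n. (\<Sum>l<n. j i l * j l k) = - P $$ (i, k)) \<and>
    (\<forall>i<n. \<forall>k<n. (\<Sum>l<n. P $$ (i, l) * j l k) = j i k)"
    by (rule projector_complex_structure) (erule (1) Psym, erule (1) idem, rule trP)
  then obtain j where j': "\<forall>i<n. \<forall>k<n. j i k = - j k i"
    "\<forall>i<n. \<forall>k<n. (\<Sum>l<n. j i l * j l k) = - P $$ (i, k)"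
    "\<forall>i<n. \<forall>k<n. (\<Sum>l<n. P $$ (i, l) * j l k) = j i k"
    by (elim exE conjE)
  note j = j'(1)[rule_format] j'(2)[rule_format] j'(3)[rule_format]
  define J where "J = mat n n (\<lambda>(i, k). j i k)"
  have Jc: "J \<in> carrier_mat n n" by (simp add: J_def)
  have "J\<^sup>T = - J"
  proof (rule eq_matI)
    fix i k assume "i < dim_row (- J)" "k < dim_col (- J)"
    then have ik: "i < n" "k < n" using Jc by auto
    then show "J\<^sup>T $$ (i, k) = (- J) $$ (i, k)" using j(1)[OF ik(2,1)] by (simp add: J_def)
  qed (use Jc in auto)
  then have Jskew: "J \<in> skew_mats n" using Jc by (simp add: skew_mats_def)
  have JJ: "J * J = - P"
  proof (rule eq_matI)
    fix i k assume "i < dim_row (- P)" "k < dim_col (- P)"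
    then have "i < n" "k < n" using P(1) by auto
    then show "(J * J) $$ (i, k) = (- P) $$ (i, k)"
      using index_mult_sum[OF Jc Jc, of i k] j(2)[of i k] P(1) by (simp add: J_def)
  qed (use P Jc in auto)
  have PJ: "P * J = J"
  proof (rule eq_matI)
    fix i k assume "i < dim_row J" "k < dim_col J"
    then have "i < n" "k < n" using Jc by auto
    then show "(P * J) $$ (i, k) = J $$ (i, k)"
      using index_mult_sum[OF P(1) Jc, of i k] j(3)[of i k] by (simp add: J_def)
  qed (use P Jc in auto)
  note a = assoc_mult_mat[of _ n n _ n _ n]
  have neg_iff: "- M = - N \<longleftrightarrow> M = N" for M N :: "real mat"
    by (auto simp: mat_eq_iff)
  have JP: "J * P = J"
  proof -
    have "J * (J * J) = J * J * J" using Jc by (simp only: a)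
    then have "- (J * P) = - (P * J)" unfolding JJ using Jc P(1) by simp
    then have "J * P = P * J" by (simp only: neg_iff)
    then show ?thesis using PJ by simp
  qed
  have XJ: "X0 * J = 0\<^sub>m n n"
  proof -
    have "X0 * J = (X0 * P) * J" using X0(1) P(1) Jc by (simp add: a PJ)
    then show ?thesis using XP Jc by simp
  qed
  have JX: "J * X0 = 0\<^sub>m n n"
  proof -
    have "J * X0 = J * (P * X0)" using X0(1) P(1) Jc by (simp add: a[symmetric] JP)
    then show ?thesis using PX Jc by simp
  qed
  \<comment> \<open>Since J^3 = -J, the eigenvalues of \<open>J\<close> are 0 and plus or minus i,
    and on them the exponential of pi times w equals 1 + 2 w^2.\<close>
  have eJ: "exp_mat (pi \<cdot>\<^sub>m J) = 1\<^sub>m n - 2 \<cdot>\<^sub>m P"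
  proof -
    obtain V t where V: "V \<in> unitary_group n" and t: "cmat J = udiag V (\<lambda>k. \<i> * of_real (t k))"
      using skew_cmat_diag[OF Jskew] by blast
    have "J * J * J = (-1) \<cdot>\<^sub>m J" using Jc P(1) PJ by (simp add: JJ) (auto simp: mat_eq_iff)
    then have "cmat J * cmat J * cmat J = cmat ((-1) \<cdot>\<^sub>m J)" using Jc by (simp flip: cmat_mult[of _ n n _ n])
    also have "\<dots> = (-1) \<cdot>\<^sub>m cmat J" by (rule eq_matI) auto
    finally have e: "udiag V (\<lambda>k. \<i> * of_real (t k) * (\<i> * of_real (t k)) * (\<i> * of_real (t k))) = udiag V (\<lambda>k. -1 * (\<i> * of_real (t k)))"
      by (simp only: t udiag_mult[OF V] udiag_smult[OF V])
    have "\<i> * of_real (t k) * (\<i> * of_real (t k)) * (\<i> * of_real (t k)) = -1 * (\<i> * of_real (t k))" if "k < n" for k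
      by (rule udiag_inj[OF V e that])
    then have "t k * t k * t k = t k" if "k < n" for k
      using that by (simp add: complex_eq_iff) 
    then have t3: "t k = 0 \<or> t k = 1 \<or> t k = -1" if "k < n" for k
      using that by (metis mult_cancel_right2 square_eq_1_iff)
    have "cmat (pi \<cdot>\<^sub>m J) = of_real pi \<cdot>\<^sub>m cmat J" by (rule eq_matI) auto
    then have pJ: "cmat (pi \<cdot>\<^sub>m J) = udiag V (\<lambda>k. of_real pi * (\<i> * of_real (t k)))" by (simp only: t udiag_smult[OF V])
    have "cmat (exp_mat (pi \<cdot>\<^sub>m J)) = udiag V (\<lambda>k. exp (of_real pi * (\<i> * of_real (t k))))"
      using Jc by (intro cmat_exp_mat[OF _ V pJ]) auto
    also have "\<dots> = udiag V (\<lambda>k. 1 + 2 * (\<i> * of_real (t k) * (\<i> * of_real (t k))))"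
    proof (rule udiag_cong[OF V])
      fix k assume "k < n"
      have "exp (of_real pi * \<i>) = -1" "exp (- (of_real pi * \<i>)) = -1" by (simp_all add: exp_minus mult.commute)
      then show "exp (of_real pi * (\<i> * of_real (t k))) = 1 + 2 * (\<i> * of_real (t k) * (\<i> * of_real (t k)))"
        using t3[OF \<open>k < n\<close>] by auto
    qed
    also have "\<dots> = cmat (1\<^sub>m n) + 2 \<cdot>\<^sub>m (cmat J * cmat J)"
      by (simp only: t udiag_mult[OF V] udiag_smult[OF V] udiag_add[OF V] cmat_one udiag_one[OF V, symmetric])
    also have "\<dots> = cmat (1\<^sub>m n - 2 \<cdot>\<^sub>m P)"
      using Jc P(1) by (simp flip: cmat_mult[of _ n n _ n] add: JJ) (auto simp: mat_eq_iff)
    finally show ?thesis by simp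
  qed
  define X where "X = X0 + pi \<cdot>\<^sub>m J"
  have Xs: "X \<in> skew_mats n"
  proof -
    have "X $$ (k, i) = - X $$ (i, k)" if "i < n" "k < n" for i k
    proof -
      have "X0\<^sup>T $$ (i, k) = (- X0) $$ (i, k)" "J\<^sup>T $$ (i, k) = (- J) $$ (i, k)"
        using skew0 Jskew by (simp_all add: skew_mats_def)
      then show ?thesis using that X0(1) Jc by (simp add: X_def)
    qed
    note sk = this
    have Xc: "X \<in> carrier_mat n n" using X0(1) Jc by (simp add: X_def)
    have "X\<^sup>T = - X"
    proof (rule eq_matI)
      fix i k assume "i < dim_row (- X)" "k < dim_col (- X)"
      then have ik: "i < n" "k < n" using Xc by auto
      then show "X\<^sup>T $$ (i, k) = (- X) $$ (i, k)" using sk[OF ik] Xc by simp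
    qed (use Xc in auto)
    then show ?thesis using Xc by (simp add: skew_mats_def)
  qed
  have "exp_mat X = exp_mat X0 * exp_mat (pi \<cdot>\<^sub>m J)"
    unfolding X_def using X0(1) Jc
    by (intro exp_mat_add_commute[of _ n])
       (simp_all add: mult_smult_distrib[OF X0(1) Jc] mult_smult_assoc_mat[OF Jc X0(1)] XJ JX)
  moreover have "cmat (exp_mat X0 * (1\<^sub>m n - 2 \<cdot>\<^sub>m P)) = cmat A"
  proof -
    have "cmat (1\<^sub>m n - 2 \<cdot>\<^sub>m P) = udiag U (\<lambda>_. 1) - 2 \<cdot>\<^sub>m cmat P"
      using P(1) unfolding udiag_one[OF U] by (intro eq_matI) auto
    then have R: "cmat (1\<^sub>m n - 2 \<cdot>\<^sub>m P) = udiag U (\<lambda>k. 1 - 2 * ind (z k))"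
      by (simp only: P(2) udiag_smult[OF U] udiag_diff[OF U])
    have "cmat (exp_mat X0 * (1\<^sub>m n - 2 \<cdot>\<^sub>m P)) = cmat (exp_mat X0) * cmat (1\<^sub>m n - 2 \<cdot>\<^sub>m P)"
      using P(1) by (intro cmat_mult[of _ n n _ n] exp_mat_carrier[OF X0(1)]) auto
    then show ?thesis
      unfolding eX0 R udiag_mult[OF U] z by (simp only:) (intro udiag_cong[OF U], auto simp: ind_def)
  qed
  ultimately have eX: "exp_mat X = A" using eJ by simp
  have "\<bar>X $$ (i, k)\<bar> \<le> (2 * pi * real n + pi) * ?F" if ik: "i < n" "k < n" for i k
  proof -
    have Ub: "norm (U $$ (i, l)) \<le> 1" if "i < n" "l < n" for i l
    proof -
      have "complex_of_real (\<Sum>i<n. (norm (U $$ (i, l)))\<^sup>2) = 1"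
        using unitary_columns[OF U that(2)] by (simp only: of_real_sum complex_norm_square)
      then have "(\<Sum>i<n. (norm (U $$ (i, l)))\<^sup>2) = 1" by (simp only: of_real_eq_1_iff)
      moreover have "(norm (U $$ (i, l)))\<^sup>2 \<le> (\<Sum>i<n. (norm (U $$ (i, l)))\<^sup>2)"
        using that by (intro member_le_sum[where f = "\<lambda>i. (norm (U $$ (i, l)))\<^sup>2"]) auto
      ultimately show ?thesis by (simp add: power_le_one_iff)
    qed
    have "\<bar>X0 $$ (i, k)\<bar> = norm (cmat X0 $$ (i, k))" using ik X0(1) by simp
    also have "\<dots> \<le> (\<Sum>l<n. norm (U $$ (i, l) * log_circle (z l) * cnj (U $$ (k, l))))"
      unfolding X0(2) udiag_index[OF U ik] by (rule norm_sum)
    also have "\<dots> \<le> (\<Sum>l<n. 2 * pi * ?F)"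
    proof (rule sum_mono)
      fix l assume "l \<in> {..<n}"
      then have l: "l < n" by simp
      have "norm (U $$ (i, l) * log_circle (z l) * cnj (U $$ (k, l))) \<le> 1 * (2 * pi * ?F) * 1"
        unfolding norm_mult
      proof (intro mult_mono)
        have "norm (log_circle (z l)) \<le> 2 * pi * norm (z l - 1)" using nz[OF l] by (rule log_circle(4))
        also have "\<dots> \<le> 2 * pi * ?F" using zF[OF l] by (intro mult_left_mono) auto
        finally show "norm (log_circle (z l)) \<le> 2 * pi * ?F" .
      qed (use Ub ik l F0 in auto)
      then show "norm (U $$ (i, l) * log_circle (z l) * cnj (U $$ (k, l))) \<le> 2 * pi * ?F" by simp
    qed
    finally have 1: "\<bar>X0 $$ (i, k)\<bar> \<le> 2 * pi * real n * ?F" by (simp add: mult_ac)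
    \<comment> \<open>The entries of \<open>J\<close> do not shrink with the distance of
      \<open>A\<close> to the identity. But \<open>J\<close> vanishes unless -1 is an eigenvalue,
      and then the Frobenius distance is at least 2, whereas the entries of \<open>J\<close> are at
      most 1.\<close>
    have 2: "\<bar>J $$ (i, k)\<bar> \<le> ?F"
    proof (cases "I = {}")
      case True
      then have "P = 0\<^sub>m n n"
      proof -
        have "ind (z k) = 0" if "k < n" for k using True that by (auto simp: I_def ind_def)
        then have "udiag U (\<lambda>k. ind (z k)) $$ (i, k) = 0" if "i < n" "k < n" for i k
          unfolding udiag_index[OF U that] by (intro sum.neutral) auto
        then have "cmat P $$ (i, k) = 0" if "i < n" "k < n" for i k using that unfolding P(2) .
        then have "P $$ (i, k) = 0" if "i < n" "k < n" for i k using that P(1) by simp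
        then show ?thesis using P(1) by (intro eq_matI) auto
      qed
      then have "J = 0\<^sub>m n n" using PJ Jc by simp
      then show ?thesis using ik F0 by simp
    next
      case False
      then obtain l where l: "l < n" "z l = -1" by (auto simp: I_def)
      then have "2 \<le> ?F" using zF[OF l(1)] by simp
      moreover have "(J $$ (i, k))\<^sup>2 \<le> 1"
      proof -
        have "(J $$ (i, k))\<^sup>2 \<le> (\<Sum>l<n. (J $$ (i, l))\<^sup>2)"
          using ik by (intro member_le_sum[where f = "\<lambda>l. (J $$ (i, l))\<^sup>2"]) auto
        also have "\<dots> = (\<Sum>l<n. - (j i l * j l i))"
        proof (rule sum.cong)
          fix l assume "l \<in> {..<n}"
          then show "(J $$ (i, l))\<^sup>2 = - (j i l * j l i)"
            using ik j(1)[of l i] by (simp add: J_def power2_eq_square)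
        qed simp
        also have "\<dots> = P $$ (i, i)" unfolding sum_negf j(2)[OF ik(1) ik(1)] by simp
        also have "P $$ (i, i) \<le> 1"
        proof -
          have "(P $$ (i, i))\<^sup>2 \<le> (\<Sum>l<n. (P $$ (i, l))\<^sup>2)"
            using ik by (intro member_le_sum[where f = "\<lambda>l. (P $$ (i, l))\<^sup>2"]) auto
          also have "\<dots> = (\<Sum>l<n. P $$ (i, l) * P $$ (l, i))"
            using ik Psym by (intro sum.cong) (auto simp: power2_eq_square)
          also have "\<dots> = P $$ (i, i)" by (rule idem[OF ik(1) ik(1)])
          finally have le: "P $$ (i, i) * P $$ (i, i) \<le> P $$ (i, i)" by (simp add: power2_eq_square)
          show ?thesis
          proof (rule ccontr)
            assume "\<not> P $$ (i, i) \<le> 1"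
            then have "P $$ (i, i) * 1 < P $$ (i, i) * P $$ (i, i)" by (intro mult_strict_left_mono) auto
            then show False using le by simp
          qed
        qed
        finally show ?thesis .
      qed
      then have "\<bar>J $$ (i, k)\<bar> \<le> 1" by (simp add: abs_square_le_1)
      ultimately show ?thesis by linarith
    qed
    have "\<bar>X $$ (i, k)\<bar> \<le> \<bar>X0 $$ (i, k)\<bar> + pi * \<bar>J $$ (i, k)\<bar>"
      using ik X0(1) Jc abs_triangle_ineq[of "X0 $$ (i, k)" "pi * J $$ (i, k)"] by (simp add: X_def abs_mult)
    also have "\<dots> \<le> 2 * pi * real n * ?F + pi * ?F" using 1 2 by (intro add_mono mult_left_mono) auto
    finally show ?thesis by (simp add: algebra_simps)
  qed
  then show ?thesis using Xs eX by blast
qed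

section \<open>The metric on the orthogonal group\<close>

locale unitary_norm =
  fixes n :: nat and N :: "complex mat \<Rightarrow> real"
  assumes n_pos: "n > 0" and inv_norm: "unitary_invariant_norm n N"
begin

lemma N_nonneg: "X \<in> carrier_mat n n ==> 0 \<le> N X"
  and N_eq_0: "X \<in> carrier_mat n n ==> N X = 0 \<longleftrightarrow> X = 0\<^sub>m n n"
  and N_smult: "X \<in> carrier_mat n n ==> N (c \<cdot>\<^sub>m X) = norm c * N X"
  and N_triangle: "X \<in> carrier_mat n n ==> Y \<in> carrier_mat n n ==> N (X + Y) \<le> N X + N Y"
  and N_unitary: "X \<in> carrier_mat n n ==> U \<in> unitary_group n ==> V \<in> unitary_group n ==> N (U * X * V) = N X"
  using inv_norm by (auto simp: unitary_invariant_norm_def matrix_norm_on_def)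

lemma N_udiag: "U \<in> unitary_group n ==> N (udiag U z) = N (mat_diag n z)"
  unfolding udiag_def using unitary_dims(1)[of U n]
  by (simp add: N_unitary unitary_group_adjoint)

lemma mat_diag_unitary:
  assumes "\<And>k. k < n ==> norm (u k) = 1"
  shows "mat_diag n u \<in> unitary_group n"
proof -
  have a: "mat_adjoint (mat_diag n u) = mat_diag n (\<lambda>k. cnj (u k))"
    by (rule eq_matI) (auto simp: mat_diag_def conjugate_complex_def)
  have "u k * cnj (u k) = 1" "cnj (u k) * u k = 1" if "k < n" for k
    using complex_norm_square[of "u k"] assms[OF that] by (simp_all add: mult.commute)
  then have "mat_diag n (\<lambda>k. u k * cnj (u k)) = 1\<^sub>m n" "mat_diag n (\<lambda>k. cnj (u k) * u k) = 1\<^sub>m n"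
    by (auto simp: mat_diag_def intro!: eq_matI)
  then show ?thesis by (simp add: unitary_group_def a)
qed

lemma N_diag_shrink:
  assumes k: "k < n" and c: "norm c \<le> 1"
  shows "N (mat_diag n (w(k := c * w k))) \<le> N (mat_diag n w)"
proof -
  define r where "r = norm c"
  obtain u where u: "norm u = 1" "c = of_real r * u"
  proof (cases "c = 0")
    case True
    then show ?thesis using that[of 1] by (simp add: r_def)
  next
    case False
    then show ?thesis using that[of "c / of_real (norm c)"] by (simp add: r_def norm_divide)
  qed
  have r: "0 \<le> r" "r \<le> 1" using c by (auto simp: r_def)
  define D where "D v = mat_diag n (\<lambda>i. if i = k then v else 1 :: complex)" for v
  have N1: "N (D v * mat_diag n w) = N (mat_diag n w)" if "norm v = 1" for v
  proof -
    have "D v \<in> unitary_group n" unfolding D_def using that by (intro mat_diag_unitary) auto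
    moreover have "1\<^sub>m n \<in> unitary_group n"
      using mat_diag_unitary[of "\<lambda>_. 1"] by simp
    ultimately have "N (D v * mat_diag n w * 1\<^sub>m n) = N (mat_diag n w)" by (intro N_unitary) auto
    moreover have "D v * mat_diag n w * 1\<^sub>m n = D v * mat_diag n w" by (simp add: D_def right_mult_one_mat[OF mat_diag_dim])
    ultimately show ?thesis by simp
  qed
  have c': "D v * mat_diag n w \<in> carrier_mat n n" for v by (simp add: D_def)
  \<comment> \<open>With c = r u the number c is the average of u and -u with weights (1 + r)/2 and
    (1 - r)/2; the other coordinates are unchanged because the weights add up to 1.\<close>
  have "mat_diag n (w(k := c * w k)) = of_real ((1 + r) / 2) \<cdot>\<^sub>m (D u * mat_diag n w) + of_real ((1 - r) / 2) \<cdot>\<^sub>m (D (- u) * mat_diag n w)"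
  proof -
    have "(w(k := c * w k)) i = of_real ((1 + r) / 2) * ((if i = k then u else 1) * w i) + of_real ((1 - r) / 2) * ((if i = k then - u else 1) * w i)" for i
      by (simp add: u(2) field_simps)
    then show ?thesis
      by (intro eq_matI) (simp_all add: D_def, simp_all add: mat_diag_def)
  qed
  also have "N \<dots> \<le> N (of_real ((1 + r) / 2) \<cdot>\<^sub>m (D u * mat_diag n w)) + N (of_real ((1 - r) / 2) \<cdot>\<^sub>m (D (- u) * mat_diag n w))"
    by (intro N_triangle smult_carrier_mat c')
  also have "\<dots> = (1 + r) / 2 * N (mat_diag n w) + (1 - r) / 2 * N (mat_diag n w)"
    using u r by (simp only: N_smult[OF c'] N1 norm_minus_cancel norm_of_real) simp
  also have "\<dots> = N (mat_diag n w)" by (simp add: field_simps)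
  finally show ?thesis .
qed

lemma mat_diag_cong: "(\<And>k. k < n ==> z k = w k) ==> mat_diag n z = mat_diag n (w :: nat \<Rightarrow> complex)"
  by (auto simp: mat_diag_def intro!: eq_matI)

text \<open>The coordinates are replaced one at a time; a contraction of a single coordinate is a convex
  combination of two diagonal unitary multiplications.\<close>

lemma N_diag_mono:
  assumes "\<And>k. k < n ==> norm (z k) \<le> norm (w k)"
  shows "N (mat_diag n z) \<le> N (mat_diag n w)"
proof -
  have "N (mat_diag n (\<lambda>k. if k < m then z k else w k)) \<le> N (mat_diag n w)" if "m \<le> n" for m
    using that
  proof (induction m)
    case (Suc m)
    define y where "y = (\<lambda>k. if k < m then z k else w k)"
    define c where "c = (if w m = 0 then 0 else z m / w m)"
    have zm: "norm (z m) \<le> norm (w m)" using assms Suc.prems by simp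
    then have "norm c \<le> 1" by (auto simp: c_def norm_divide)
    then have "N (mat_diag n (y(m := c * y m))) \<le> N (mat_diag n y)" using Suc.prems by (intro N_diag_shrink) auto
    moreover have "y(m := c * y m) = (\<lambda>k. if k < Suc m then z k else w k)"
      using zm by (auto simp: y_def c_def fun_eq_iff less_Suc_eq)
    ultimately show ?case using Suc by (simp add: y_def)
  qed simp
  from this[OF order_refl] show ?thesis using mat_diag_cong[of "\<lambda>k. if k < n then z k else w k" z] by simp
qed

lemma N_one_pos: "N (1\<^sub>m n) > 0"
proof -
  have "(1\<^sub>m n :: complex mat) \<noteq> 0\<^sub>m n n"
  proof
    assume "(1\<^sub>m n :: complex mat) = 0\<^sub>m n n"
    then have "(1\<^sub>m n :: complex mat) $$ (0, 0) = 0\<^sub>m n n $$ (0, 0)" by simp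
    then show False using n_pos by simp
  qed
  then show ?thesis using N_eq_0[of "1\<^sub>m n"] N_nonneg[of "1\<^sub>m n"] by auto
qed

lemma N_diag_upper:
  assumes "\<And>k. k < n ==> norm (z k) \<le> M"
  shows "N (mat_diag n z) \<le> M * N (1\<^sub>m n)"
proof -
  have M: "0 \<le> M" by (rule order_trans[OF norm_ge_zero assms[OF n_pos]])
  have "N (mat_diag n z) \<le> N (mat_diag n (\<lambda>_. of_real M))" using assms M by (intro N_diag_mono) auto
  also have "mat_diag n (\<lambda>_. of_real M) = of_real M \<cdot>\<^sub>m 1\<^sub>m n" by (auto simp: mat_diag_def intro!: eq_matI)
  finally show ?thesis using M by (simp add: N_smult)
qed

text \<open>Deleting all diagonal entries but one does not increase the norm; the constant is the
  least norm of a diagonal matrix unit.\<close>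

lemma N_diag_lower: "\<exists>c>0. \<forall>z. \<forall>k<n. c * norm (z k) \<le> N (mat_diag n z)"
proof -
  define e where "e k = N (mat_diag n (\<lambda>i. if i = k then 1 else 0))" for k
  have e: "e k > 0" if "k < n" for k
  proof -
    have "mat_diag n (\<lambda>i. if i = k then 1 else 0 :: complex) \<noteq> 0\<^sub>m n n"
    proof
      assume "mat_diag n (\<lambda>i. if i = k then 1 else 0 :: complex) = 0\<^sub>m n n"
      then have "mat_diag n (\<lambda>i. if i = k then 1 else 0 :: complex) $$ (k, k) = 0\<^sub>m n n $$ (k, k)" by simp
      then show False using that by (simp add: mat_diag_def)
    qed
    then show ?thesis
      unfolding e_def using N_eq_0[OF mat_diag_dim, of "\<lambda>i. if i = k then 1 else 0"] N_nonneg[OF mat_diag_dim, of "\<lambda>i. if i = k then 1 else 0"]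
      by auto
  qed
  define c where "c = Min (e ` {..<n})"
  have "c > 0" unfolding c_def using e n_pos by (subst Min_gr_iff) auto
  moreover have "c * norm (z k) \<le> N (mat_diag n z)" if k: "k < n" for z k
  proof -
    have "c \<le> e k" unfolding c_def using k by (intro Min_le) auto
    then have "c * norm (z k) \<le> e k * norm (z k)" by (intro mult_right_mono) auto
    also have "\<dots> = N (z k \<cdot>\<^sub>m mat_diag n (\<lambda>i. if i = k then 1 else 0))" by (simp add: N_smult e_def)
    also have "z k \<cdot>\<^sub>m mat_diag n (\<lambda>i. if i = k then 1 else 0) = mat_diag n (\<lambda>i. if i = k then z k else 0)"
      by (auto simp: mat_diag_def intro!: eq_matI)
    also have "N \<dots> \<le> N (mat_diag n z)" by (intro N_diag_mono) auto
    finally show ?thesis .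
  qed
  ultimately show ?thesis by blast
qed

end

section \<open>Growth of the function on the circle\<close>

text \<open>The series represents \<open>f\<close> on an arc only, but convergence at one point
  \<open>z0\<close> of the arc other than 1 implies convergence in a disc, where termwise
  differentiation gives the derivative \<open>a 1\<close> at the centre. The distance of
  \<open>z0\<close> to 1 is 2 sin(t/2), at most \<open>t\<close> and so below
  \<open>r\<close>.\<close>

lemma conformal_linear_approx:
  assumes "conformal_at_one f" "f 1 = 0"
  shows "\<exists>a. a \<noteq> 0 \<and> (\<forall>\<epsilon>>0. \<exists>s>0. \<forall>z. norm z = 1 --> norm (z - 1) < s --> norm (f z - a * (z - 1)) \<le> \<epsilon> * norm (z - 1))"
proof -
  obtain a r where r: "0 < r" "a (1 :: nat) \<noteq> 0"
    and s: "\<And>z. norm z = 1 ==> norm (z - 1) < r ==> (\<lambda>k. a k * (z - 1) ^ k) sums f z"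
    using assms(1) unfolding conformal_at_one_def by (auto simp: dist_norm)
  have "(\<lambda>k. a k * (1 - 1) ^ k) sums f 1" using r by (intro s) auto
  then have "(\<lambda>k. a k * 0 ^ k) sums f 1" by simp
  then have a0: "a 0 = 0" using powser_sums_zero[of a] assms(2) sums_unique2 by metis
  define t where "t = min 1 (r / 2)"
  define z0 where "z0 = exp (\<i> * of_real t)"
  have t: "0 < t" "t < r" "t \<le> 1" using r by (auto simp: t_def)
  have d: "norm (z0 - 1) = 2 * \<bar>sin (t / 2)\<bar>" unfolding z0_def by (rule dist_exp_i_1)
  have "sin (t / 2) > 0" using t pi_gt3 by (intro sin_gt_zero) auto
  moreover have "\<bar>sin (t / 2)\<bar> \<le> \<bar>t / 2\<bar>" by (rule abs_sin_x_le_abs_x) 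
  ultimately have z0: "norm (z0 - 1) > 0" "norm (z0 - 1) < r" using d t by auto
  have sm: "summable (\<lambda>k. a k * (z0 - 1) ^ k)"
    using s[of z0] z0 by (auto simp: z0_def sums_iff)
  have "((\<lambda>w. \<Sum>k. a k * w ^ k) has_field_derivative (\<Sum>k. diffs a k * 0 ^ k)) (at 0)"
    using z0 by (intro termdiffs_strong[OF sm]) auto
  moreover have "(\<Sum>k. diffs a k * 0 ^ k) = a 1" using powser_sums_zero[of "diffs a"] by (simp add: sums_iff diffs_def)
  ultimately have D: "((\<lambda>w. \<Sum>k. a k * w ^ k) has_field_derivative a 1) (at 0)" by simp
  have g0: "(\<Sum>k. a k * 0 ^ k) = 0" using powser_sums_zero[of a] a0 by (simp add: sums_iff)
  have "\<exists>s>0. \<forall>z. norm z = 1 --> norm (z - 1) < s --> norm (f z - a 1 * (z - 1)) \<le> \<epsilon> * norm (z - 1)" if \<epsilon>: "\<epsilon> > 0" for \<epsilon>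
  proof -
    have "(\<lambda>w. ((\<Sum>k. a k * w ^ k) - 0) / (w - 0)) \<midarrow>0\<rightarrow> a 1"
      using D unfolding has_field_derivative_iff g0 by simp
    then obtain s where sp: "s > 0" "\<And>w. w \<noteq> 0 ==> norm (w - 0) < s ==> norm (((\<Sum>k. a k * w ^ k) - 0) / (w - 0) - a 1) < \<epsilon>"
      using \<epsilon> unfolding LIM_def dist_norm by blast
    have "norm (f z - a 1 * (z - 1)) \<le> \<epsilon> * norm (z - 1)" if z: "norm z = 1" "norm (z - 1) < min s r" for z
    proof (cases "z = 1")
      case False
      define w where "w = z - 1"
      have w: "w \<noteq> 0" "norm w < s" using False z by (auto simp: w_def)
      have fz: "f z = (\<Sum>k. a k * w ^ k)" using s[OF z(1)] z(2) by (simp add: sums_iff w_def)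
      have "f z - a 1 * w = (f z / w - a 1) * w" using w by (simp add: field_simps)
      then have "norm (f z - a 1 * w) = norm (f z / w - a 1) * norm w" by (simp add: norm_mult)
      also have "\<dots> \<le> \<epsilon> * norm w" using sp(2)[OF w(1)] w(2) by (intro mult_right_mono) (auto simp: fz)
      finally show ?thesis by (simp add: w_def)
    qed (use assms(2) in simp)
    then show ?thesis using sp(1) r(1) by (intro exI[of _ "min s r"]) auto
  qed
  then show ?thesis using r(2) by (intro exI[of _ "a 1"]) auto
qed

locale circle_function =
  fixes f :: "complex \<Rightarrow> complex"
  assumes bdd: "bounded (f ` sphere 0 1)"
    and zero: "\<And>z. z \<in> sphere 0 1 ==> f z = 0 \<longleftrightarrow> z = 1"
    and conf: "conformal_at_one f"
    and cont: "continuous_on (sphere 0 1 - {-1}) f"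
    and left_lim: "((\<lambda>t. f (exp (\<i> * complex_of_real t))) \<longlongrightarrow> f (-1)) (at_left pi)"
    and right_lim: "\<exists>l. l \<noteq> 0 \<and> ((\<lambda>t. f (exp (\<i> * complex_of_real t))) \<longlongrightarrow> l) (at_right (- pi))"
begin

text \<open>Near -1, where \<open>f\<close> may jump, the nonzero one-sided limits keep the modulus
  away from 0; the left limit is nonzero because it equals \<open>f (-1)\<close>. The rest of the
  circle outside the ball around 1 is a compact set on which \<open>f\<close> is continuous without
  zeros.\<close>

lemma f_away_from_one:
  assumes "s > 0"
  shows "\<exists>\<mu>>0. \<forall>z. norm z = 1 --> s \<le> norm (z - 1) --> \<mu> \<le> norm (f z)"
proof -
  define g where "g t = f (exp (\<i> * complex_of_real t))" for t :: real
  have fm1: "f (-1) \<noteq> 0" using zero[of "-1"] by simp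
  have "\<forall>\<^sub>F t in at_left pi. dist (g t) (f (-1)) < norm (f (-1)) / 2"
    using left_lim fm1 unfolding g_def by (intro tendstoD) auto
  then obtain t1 where t1: "t1 < pi" "\<And>t. t1 < t ==> t < pi ==> dist (g t) (f (-1)) < norm (f (-1)) / 2"
    unfolding eventually_at_left_field by blast
  obtain l where l: "l \<noteq> 0" "(g \<longlongrightarrow> l) (at_right (- pi))" using right_lim unfolding g_def by blast
  have "\<forall>\<^sub>F t in at_right (- pi). dist (g t) l < norm l / 2" using l by (intro tendstoD) auto
  then obtain t2 where t2: "- pi < t2" "\<And>t. - pi < t ==> t < t2 ==> dist (g t) l < norm l / 2"
    unfolding eventually_at_right_field by blast
  define a b where "a = min t2 0" and "b = max t1 0"
  have ab: "- pi < a" "b < pi" "a \<le> b" using t1(1) t2(1) by (auto simp: a_def b_def)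
  define S where "S = (\<lambda>t. exp (\<i> * complex_of_real t)) ` {a..b} - ball 1 s"
  have "compact ((\<lambda>t. exp (\<i> * complex_of_real t)) ` {a..b})"
    by (intro compact_continuous_image continuous_intros) auto
  then have S: "compact S" unfolding S_def by (intro compact_diff) auto
  have S': "S \<subseteq> sphere 0 1 - {-1} - {1}"
  proof
    fix z assume "z \<in> S"
    then obtain t where t: "z = exp (\<i> * complex_of_real t)" "a \<le> t" "t \<le> b" "z \<notin> ball 1 s" by (auto simp: S_def)
    have "z \<noteq> -1"
    proof
      assume "z = -1"
      then have "Ln z = \<i> * pi" by simp
      moreover have "Ln z = \<i> * t" unfolding t(1) using t ab by (intro Ln_exp) auto
      ultimately show False using t ab by simp
    qed
    then show "z \<in> sphere 0 1 - {-1} - {1}" using t assms by auto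
  qed
  have "\<exists>\<mu>>0. \<forall>z\<in>S. \<mu> \<le> norm (f z)"
  proof (cases "S = {}")
    case False
    have "continuous_on S (\<lambda>z. norm (f z))"
      using continuous_on_subset[OF cont] S' by (intro continuous_on_norm) auto
    then obtain x where x: "x \<in> S" "\<And>y. y \<in> S ==> norm (f x) \<le> norm (f y)"
      using continuous_attains_inf[OF S False] by blast
    moreover have "f x \<noteq> 0" using zero[of x] x(1) S' by auto
    ultimately show ?thesis by (intro exI[of _ "norm (f x)"]) auto
  qed (auto intro: exI[of _ 1])
  then obtain \<mu> where \<mu>: "\<mu> > 0" "\<And>z. z \<in> S ==> \<mu> \<le> norm (f z)" by blast
  define \<nu> where "\<nu> = min \<mu> (min (norm (f (-1)) / 2) (norm l / 2))"
  have "\<nu> \<le> norm (f z)" if z: "norm z = 1" "s \<le> norm (z - 1)" for z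
  proof -
    define t where "t = Im (Ln z)"
    have z0: "z \<noteq> 0" using z(1) by auto
    have t: "- pi < t" "t \<le> pi" using mpi_less_Im_Ln[OF z0] Im_Ln_le_pi[OF z0] by (auto simp: t_def)
    have "Ln z = \<i> * t" using z z0 by (simp add: t_def complex_eq_iff)
    then have zt: "z = exp (\<i> * complex_of_real t)" using exp_Ln[OF z0] by simp
    have fz: "f z = g t" by (simp add: g_def zt)
    have half: "norm v / 2 \<le> norm u" if "dist u v < norm v / 2" for u v :: complex
      using that norm_triangle_ineq2[of v u] by (simp add: dist_norm norm_minus_commute)
    consider "t = pi" | "t1 < t" "t < pi" | "t < t2" | "t2 \<le> t" "t \<le> t1" using t by linarith
    then show ?thesis
    proof cases
      case 1
      then have "z = -1" using zt by simp
      then show ?thesis by (simp add: \<nu>_def min_le_iff_disj)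
    next
      case 2
      then have "norm (f (-1)) / 2 \<le> norm (f z)" unfolding fz by (intro half t1)
      then show ?thesis by (simp add: \<nu>_def min_le_iff_disj)
    next
      case 3
      then have "norm l / 2 \<le> norm (f z)" unfolding fz using t by (intro half t2)
      then show ?thesis by (simp add: \<nu>_def min_le_iff_disj)
    next
      case 4
      then have "t \<in> {a..b}" by (auto simp: a_def b_def)
      then have "z \<in> (\<lambda>t. exp (\<i> * complex_of_real t)) ` {a..b}" unfolding zt by (rule imageI)
      then have "z \<in> S" using z(2) by (simp add: S_def dist_norm norm_minus_commute)
      then show ?thesis using \<mu>(2) by (simp add: \<nu>_def min_le_iff_disj)
    qed
  qed
  moreover have "\<nu> > 0" using \<mu>(1) fm1 l(1) by (simp add: \<nu>_def)
  ultimately show ?thesis by blast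
qed

lemma f_one: "f 1 = 0" using zero[of 1] by simp

lemma f_linear_bounds:
  "\<exists>\<alpha>>0. \<exists>\<beta>>0. \<forall>z. norm z = 1 --> \<alpha> * norm (z - 1) \<le> norm (f z) \<and> norm (f z) \<le> \<beta> * norm (z - 1)"
proof -
  obtain a where a: "a \<noteq> 0" and ap: "\<And>\<epsilon>. \<epsilon> > 0 ==> \<exists>s>0. \<forall>z. norm z = 1 --> norm (z - 1) < s --> norm (f z - a * (z - 1)) \<le> \<epsilon> * norm (z - 1)"
    using conformal_linear_approx[OF conf f_one] by blast
  obtain s where s: "s > 0" "\<And>z. norm z = 1 ==> norm (z - 1) < s ==> norm (f z - a * (z - 1)) \<le> norm a / 2 * norm (z - 1)"
    using ap[of "norm a / 2"] a by auto
  obtain \<mu> where \<mu>: "\<mu> > 0" "\<And>z. norm z = 1 ==> s \<le> norm (z - 1) ==> \<mu> \<le> norm (f z)"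
    using f_away_from_one[OF s(1)] by blast
  obtain B where "\<forall>x\<in>f ` sphere 0 1. norm x \<le> B" using bdd unfolding bounded_iff by blast
  then have B: "norm (f z) \<le> B" if "norm z = 1" for z using that by auto
  have B0: "B \<ge> 0" using order_trans[OF norm_ge_zero B[of 1]] by simp
  \<comment> \<open>Near 1 the linear approximation with relative error 1/2 gives the terms with
    \<open>a\<close>. Elsewhere the lower bound \<open>\<mu>\<close> is halved because chords have
    length at most 2, and the upper bound \<open>B\<close> is divided by the least chord length
    \<open>s\<close>.\<close>
  define \<alpha> \<beta> where "\<alpha> = min (norm a / 2) (\<mu> / 2)" and "\<beta> = max (2 * norm a) (B / s)"
  have \<alpha>: "\<alpha> > 0" using a \<mu> by (simp add: \<alpha>_def)
  have \<beta>: "\<beta> > 0" using a by (simp add: \<beta>_def less_max_iff_disj)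
  have "\<alpha> * norm (z - 1) \<le> norm (f z) \<and> norm (f z) \<le> \<beta> * norm (z - 1)" if z: "norm z = 1" for z
  proof (cases "norm (z - 1) < s")
    case True
    have e: "norm (f z - a * (z - 1)) \<le> norm a / 2 * norm (z - 1)" by (rule s(2)[OF z True])
    have m: "norm (a * (z - 1)) = norm a * norm (z - 1)" by (rule norm_mult)
    have "norm (a * (z - 1)) - norm (f z) \<le> norm (f z - a * (z - 1))" "norm (f z) - norm (a * (z - 1)) \<le> norm (f z - a * (z - 1))"
      using norm_triangle_ineq2[of "a * (z - 1)" "f z"] norm_triangle_ineq2[of "f z" "a * (z - 1)"] by (auto simp: norm_minus_commute)
    then have 1: "norm a / 2 * norm (z - 1) \<le> norm (f z)" "norm (f z) \<le> 2 * norm a * norm (z - 1)"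
      using e m mult_nonneg_nonneg[of "norm a" "norm (z - 1)"] by auto
    have "\<alpha> * norm (z - 1) \<le> norm a / 2 * norm (z - 1)"
      by (rule mult_right_mono) (simp_all add: \<alpha>_def)
    moreover have "2 * norm a * norm (z - 1) \<le> \<beta> * norm (z - 1)"
      by (rule mult_right_mono) (simp_all add: \<beta>_def)
    ultimately show ?thesis using 1 by linarith
  next
    case False
    have "norm (z - 1) \<le> 2" using norm_triangle_ineq4[of z 1] z by simp
    then have "\<alpha> * norm (z - 1) \<le> \<mu> / 2 * 2" using \<alpha> by (intro mult_mono) (auto simp: \<alpha>_def)
    moreover have "B / s * s \<le> \<beta> * norm (z - 1)" using False s \<beta> B0 by (intro mult_mono) (auto simp: \<beta>_def)
    ultimately show ?thesis using \<mu>(2)[OF z] B[OF z] False s(1) by auto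
  qed
  then show ?thesis using \<alpha> \<beta> by blast
qed

text \<open>Squaring doubles z - 1 in the limit, since z^2 - 1 is (z - 1)(z + 1). With relative
  errors of 1/20 and |z + 1| at least 19/10 the factor is still at least 0.95 times 1.9 divided by
  1.05, which exceeds 3/2.\<close>

lemma f_double:
  "\<exists>r>0. \<forall>z. norm z = 1 --> norm (z - 1) < r --> 3 / 2 * norm (f z) \<le> norm (f (z * z))"
proof -
  obtain a where a: "a \<noteq> 0" and ap: "\<And>\<epsilon>. \<epsilon> > 0 ==> \<exists>s>0. \<forall>z. norm z = 1 --> norm (z - 1) < s --> norm (f z - a * (z - 1)) \<le> \<epsilon> * norm (z - 1)"
    using conformal_linear_approx[OF conf f_one] by blast
  obtain s where s: "s > 0" "\<And>z. norm z = 1 ==> norm (z - 1) < s ==> norm (f z - a * (z - 1)) \<le> norm a / 20 * norm (z - 1)"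
    using ap[of "norm a / 20"] a by auto
  have "3 / 2 * norm (f z) \<le> norm (f (z * z))" if z: "norm z = 1" "norm (z - 1) < min (s / 2) (1 / 10)" for z
  proof -
    define d where "d = norm a * norm (z - 1)"
    define d' where "d' = norm a * norm (z * z - 1)"
    have zz: "z * z - 1 = (z - 1) * (z + 1)" by (simp add: algebra_simps)
    have p2: "norm (z + 1) \<le> 2" using norm_triangle_ineq[of z 1] z by simp
    have p1: "19 / 10 \<le> norm (z + 1)" using norm_triangle_ineq4[of "z + 1" "z - 1"] z by simp
    have "norm (z * z - 1) \<le> norm (z - 1) * 2" unfolding zz norm_mult using p2 by (intro mult_left_mono) auto
    then have sm: "norm (z * z - 1) < s" using z(2) by simp
    have "norm (z - 1) * (19 / 10) \<le> norm (z * z - 1)" unfolding zz norm_mult using p1 by (intro mult_left_mono) auto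
    then have dd: "19 / 10 * d \<le> d'" unfolding d_def d'_def using mult_left_mono[of "norm (z - 1) * (19 / 10)" "norm (z * z - 1)" "norm a"] by (simp add: mult_ac)
    have d0: "d \<ge> 0" by (simp add: d_def)
    have e1: "norm (f z - a * (z - 1)) \<le> d / 20" using s(2)[OF z(1)] z(2) s(1) by (simp add: d_def)
    have e2: "norm (f (z * z) - a * (z * z - 1)) \<le> d' / 20" using s(2)[OF _ sm] z(1) by (simp add: d'_def norm_mult)
    have "norm (f z) \<le> d + d / 20"
      using norm_triangle_ineq2[of "f z" "a * (z - 1)"] e1 by (simp add: d_def norm_mult)
    moreover have "d' - d' / 20 \<le> norm (f (z * z))"
      using norm_triangle_ineq2[of "a * (z * z - 1)" "f (z * z)"] e2 by (simp add: d'_def norm_mult norm_minus_commute)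
    ultimately show ?thesis using dd d0 by linarith
  qed
  then show ?thesis using s(1) by (intro exI[of _ "min (s / 2) (1 / 10)"]) auto
qed

end

section \<open>Orthogonal matrices and the functional calculus\<close>

lemma inv_mat_unique:
  fixes A B :: "'a :: field mat"
  assumes A: "A \<in> carrier_mat n n" and B: "B \<in> carrier_mat n n" and AB: "A * B = 1\<^sub>m n" and BA: "B * A = 1\<^sub>m n"
  shows "inv_mat A = B"
proof (cases "mat_inverse A")
  case None
  have "A \<in> Units (ring_mat TYPE('a) n ())"
    using A B AB BA by (auto simp: Units_def ring_mat_def intro!: bexI[of _ B])
  then show ?thesis using mat_inverse(1)[OF A None, of "()"] by blast
next
  case (Some C)
  then have C: "A * C = 1\<^sub>m n" "C * A = 1\<^sub>m n" "C \<in> carrier_mat n n" using mat_inverse(2)[OF A Some] by auto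
  have "C = C * (A * B)" using AB C(3) by simp
  also have "\<dots> = C * A * B" using A B C(3) by (simp only: assoc_mult_mat[of _ n n _ n _ n])
  also have "\<dots> = B" using C(2) B by simp
  finally show ?thesis using Some by (simp add: inv_mat_def)
qed

lemma O_groupD:
  assumes "A \<in> O_group n"
  shows "A \<in> carrier_mat n n" "A\<^sup>T \<in> carrier_mat n n"
    "A * A\<^sup>T = 1\<^sub>m n" "A\<^sup>T * A = 1\<^sub>m n"
  using assms by (auto simp: O_group_def)

lemma inv_mat_O: "A \<in> O_group n ==> inv_mat A = A\<^sup>T"
  by (rule inv_mat_unique[OF O_groupD])

lemma O_group_one: "1\<^sub>m n \<in> O_group n"
  by (simp add: O_group_def)

lemma O_group_transpose: "A \<in> O_group n ==> A\<^sup>T \<in> O_group n"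
  by (auto simp: O_group_def)

lemma O_group_mult:
  assumes A: "A \<in> O_group n" and B: "B \<in> O_group n"
  shows "A * B \<in> O_group n"
proof -
  note a = assoc_mult_mat[of _ n n _ n _ n] and AD = O_groupD[OF A] and BD = O_groupD[OF B]
  have mc: "X * Y \<in> carrier_mat n n" if "X \<in> carrier_mat n n" "Y \<in> carrier_mat n n" for X Y :: "real mat"
    using that by simp
  have t: "(A * B)\<^sup>T = B\<^sup>T * A\<^sup>T" using AD(1) BD(1) by (rule transpose_mult)
  have "A * B * (B\<^sup>T * A\<^sup>T) = A * (B * B\<^sup>T) * A\<^sup>T"
    using AD(1,2) BD(1,2) by (simp only: a mc)
  also have "\<dots> = 1\<^sub>m n" using AD BD by simp
  finally have 1: "A * B * (A * B)\<^sup>T = 1\<^sub>m n" unfolding t .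
  have "B\<^sup>T * A\<^sup>T * (A * B) = B\<^sup>T * (A\<^sup>T * A) * B"
    using AD(1,2) BD(1,2) by (simp only: a mc)
  also have "\<dots> = 1\<^sub>m n" using AD BD by simp
  finally have 2: "(A * B)\<^sup>T * (A * B) = 1\<^sub>m n" unfolding t .
  show ?thesis using 1 2 mc[OF AD(1) BD(1)] by (simp add: O_group_def)
qed

lemma SO_group_one: "1\<^sub>m n \<in> SO_group n"
  by (simp add: SO_group_def O_group_one)

lemma SO_group_mult: "A \<in> SO_group n ==> B \<in> SO_group n ==> A * B \<in> SO_group n"
  using det_mult[OF O_groupD(1)[of A n] O_groupD(1)[of B n]] by (simp add: SO_group_def O_group_mult)

lemma SO_group_transpose: "A \<in> SO_group n ==> A\<^sup>T \<in> SO_group n"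
  using det_transpose[OF O_groupD(1)[of A n]] by (simp add: SO_group_def O_group_transpose)

lemma O_group_entry_le:
  assumes "A \<in> O_group n" "i < n" "j < n"
  shows "\<bar>A $$ (i, j)\<bar> \<le> 1"
proof -
  note AD = O_groupD[OF assms(1)]
  have "(\<Sum>l<n. A $$ (i, l) * A\<^sup>T $$ (l, i)) = 1"
    using index_mult_sum[OF AD(1,2) assms(2) assms(2)] AD(3) assms(2) by simp
  then have "(\<Sum>l<n. (A $$ (i, l))\<^sup>2) = 1" using AD(1) assms(2) by (simp add: power2_eq_square)
  moreover have "(A $$ (i, j))\<^sup>2 \<le> (\<Sum>l<n. (A $$ (i, l))\<^sup>2)"
    using assms by (intro member_le_sum[where f = "\<lambda>l. (A $$ (i, l))\<^sup>2"]) auto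
  ultimately show ?thesis by (simp add: abs_square_le_1)
qed

lemma cmat_O_unitary:
  assumes "A \<in> O_group n"
  shows "cmat A \<in> unitary_group n"
proof -
  note AD = O_groupD[OF assms]
  have "cmat A * mat_adjoint (cmat A) = cmat (1\<^sub>m n)" "mat_adjoint (cmat A) * cmat A = cmat (1\<^sub>m n)"
    unfolding AD(3)[symmetric] cmat_transpose[symmetric] by (rule cmat_mult[OF AD(1,2), symmetric])
      (unfold AD(3), fold AD(4), rule cmat_mult[OF AD(2,1), symmetric])
  then show ?thesis using AD(1) by (simp add: unitary_group_def)
qed

lemma real_udiag_cnj:
  assumes A: "cmat A = udiag U z" and U: "U \<in> unitary_group n"
  shows "cmat A = udiag (map_mat cnj U) (\<lambda>k. cnj (z k))"
proof (rule eq_matI)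
  have d: "dim_row A = n" "dim_col A = n"
    using arg_cong[OF A, of dim_row] arg_cong[OF A, of dim_col] unitary_dims[OF U] by simp_all
  note V = unitary_cnj[OF U]
  fix i j assume "i < dim_row (udiag (map_mat cnj U) (\<lambda>k. cnj (z k)))" "j < dim_col (udiag (map_mat cnj U) (\<lambda>k. cnj (z k)))"
  then have ij: "i < n" "j < n" using unitary_dims[OF V] by auto
  have "udiag (map_mat cnj U) (\<lambda>k. cnj (z k)) $$ (i, j) = cnj (udiag U z $$ (i, j))"
    using ij unitary_dims[OF U] by (auto simp: udiag_index[OF U] udiag_index[OF V] intro!: sum.cong)
  also have "\<dots> = cmat A $$ (i, j)" using ij d by (simp flip: A)
  finally show "cmat A $$ (i, j) = udiag (map_mat cnj U) (\<lambda>k. cnj (z k)) $$ (i, j)" ..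
next
  show "dim_row (cmat A) = dim_row (udiag (map_mat cnj U) (\<lambda>k. cnj (z k)))"
    using arg_cong[OF A, of dim_row] by simp
  show "dim_col (cmat A) = dim_col (udiag (map_mat cnj U) (\<lambda>k. cnj (z k)))"
    using arg_cong[OF A, of dim_col] by simp
qed

lemma fun_calc_udiag:
  assumes U: "U \<in> unitary_group n"
  shows "fun_calc f (udiag U z) = udiag U (\<lambda>k. f (z k))"
  using fun_calc_eq[OF U, of "udiag U z" z f] unitary_dims(1)[OF U] by (simp add: udiag_def)

lemma udiag_conj:
  assumes U: "U \<in> unitary_group n" and V: "V \<in> unitary_group n"
  shows "V * udiag U z * mat_adjoint V = udiag (V * U) z"
proof -
  have c: "U \<in> carrier_mat n n" "mat_adjoint U \<in> carrier_mat n n" "V \<in> carrier_mat n n" "mat_adjoint V \<in> carrier_mat n n"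
    using U V by (auto simp: unitary_group_def)
  have mc: "X * Y \<in> carrier_mat n n" if "X \<in> carrier_mat n n" "Y \<in> carrier_mat n n" for X Y :: "complex mat"
    using that by simp
  have d: "dim_row U = n" "dim_row V = n" using c by auto
  show ?thesis unfolding udiag_def index_mult_mat d mat_adjoint_mult[OF c(3,1)]
    using c by (simp only: assoc_mult_mat[of _ n n _ n _ n] mc mat_diag_dim)
qed

section \<open>The gauge of the distance and its comparison with the Frobenius norm\<close>

locale circle_metric = unitary_norm n N + circle_function f for n N f
begin

definition \<delta> :: "real mat \<Rightarrow> real" where "\<delta> C = N (fun_calc f (cmat C))"

lemma d_Nf_\<delta>: "A \<in> O_group n ==> d_Nf N f A B = \<delta> (A\<^sup>T * B)"
  by (simp add: d_Nf_def \<delta>_def inv_mat_O)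

lemma \<delta>_udiag: "cmat C = udiag U z ==> U \<in> unitary_group n ==> \<delta> C = N (mat_diag n (\<lambda>k. f (z k)))"
  by (simp add: \<delta>_def fun_calc_udiag N_udiag)

text \<open>The function \<open>f\<close> has no symmetry under conjugation. Instead,
  \<open>C\<close> and its transpose are both unitarily similar to the diagonal matrix of the
  conjugate eigenvalues, the transpose through \<open>U\<close> and the real matrix \<open>C\<close>
  through the conjugate of \<open>U\<close>.\<close>

lemma \<delta>_transpose:
  assumes C: "C \<in> O_group n"
  shows "\<delta> (C\<^sup>T) = \<delta> C"
proof -
  obtain U z where U: "U \<in> unitary_group n" and z: "cmat C = udiag U z"
    using orthogonal_cmat_diag[OF C] by blast
  have "cmat (C\<^sup>T) = udiag U (\<lambda>k. cnj (z k))"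
    unfolding cmat_transpose z by (rule udiag_adjoint[OF U])
  then show ?thesis
    using \<delta>_udiag[OF _ U] \<delta>_udiag[OF real_udiag_cnj[OF z U] unitary_cnj[OF U]] by simp
qed

lemma \<delta>_conj:
  assumes C: "C \<in> O_group n" and Q: "Q \<in> O_group n"
  shows "\<delta> (Q * C * Q\<^sup>T) = \<delta> C"
proof -
  obtain U z where U: "U \<in> unitary_group n" and z: "cmat C = udiag U z"
    using orthogonal_cmat_diag[OF C] by blast
  note CD = O_groupD[OF C] and QD = O_groupD[OF Q]
  have "cmat (Q * C * Q\<^sup>T) = cmat Q * cmat C * mat_adjoint (cmat Q)"
    using CD QD by (simp only: cmat_mult[of _ n n _ n] mult_carrier_mat[of _ n n _ n] cmat_transpose)
  also have "\<dots> = udiag (cmat Q * U) z" unfolding z by (rule udiag_conj[OF U cmat_O_unitary[OF Q]])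
  finally show ?thesis
    using \<delta>_udiag[OF _ unitary_group_mult[OF cmat_O_unitary[OF Q] U]] \<delta>_udiag[OF z U] by simp
qed

abbreviation frob :: "real mat \<Rightarrow> real" where "frob C \<equiv> frobenius_norm (cmat (C - 1\<^sub>m n))"

lemma frob_udiag:
  assumes U: "U \<in> unitary_group n" and z: "cmat C = udiag U z"
  shows "(frob C)\<^sup>2 = (\<Sum>k<n. (norm (z k - 1))\<^sup>2)"
proof -
  have Cc: "C \<in> carrier_mat n n"
    using arg_cong[OF z, of dim_row] arg_cong[OF z, of dim_col] unitary_dims[OF U] by auto
  have "cmat (C - 1\<^sub>m n) = cmat C - 1\<^sub>m n" using Cc by (intro eq_matI) auto
  also have "\<dots> = udiag U (\<lambda>k. z k - 1)"
    by (simp add: z udiag_one[OF U, symmetric] udiag_diff[OF U])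
  finally show ?thesis using udiag_frobenius[OF U] by simp
qed

lemma frob_nonneg: "0 \<le> frob C"
  by (simp add: frobenius_norm_def sum_nonneg)

lemma eigenvalue_le_frob:
  assumes U: "U \<in> unitary_group n" and z: "cmat C = udiag U z" and k: "k < n"
  shows "norm (z k - 1) \<le> frob C"
proof -
  have "(norm (z k - 1))\<^sup>2 \<le> (frob C)\<^sup>2"
    unfolding frob_udiag[OF U z] using k by (intro member_le_sum[where f = "\<lambda>k. (norm (z k - 1))\<^sup>2"]) auto
  then show ?thesis using frob_nonneg[of C] by (simp add: power2_le_iff_abs_le)
qed

lemma norm_cmat_diff_one_entry:
  assumes "i < n" "j < n"
  shows "norm (cmat (C - 1\<^sub>m n) $$ (i, j)) = \<bar>(C - 1\<^sub>m n) $$ (i, j)\<bar>"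
  using assms by (subst index_map_mat(1)) (auto simp only: norm_of_real index_minus_mat index_one_mat)

lemma frob_le:
  assumes C: "C \<in> carrier_mat n n" and m: "\<And>i j. i < n ==> j < n ==> \<bar>(C - 1\<^sub>m n) $$ (i, j)\<bar> \<le> m"
  shows "frob C \<le> real n * m"
proof -
  have m0: "0 \<le> m" using m[OF n_pos n_pos] by (meson abs_ge_zero order_trans)
  have c: "cmat (C - 1\<^sub>m n) \<in> carrier_mat n n" using minus_carrier_mat[OF one_carrier_mat[of n], of C] by simp
  have "(frob C)\<^sup>2 = (\<Sum>i<n. \<Sum>j<n. ((C - 1\<^sub>m n) $$ (i, j))\<^sup>2)"
    unfolding frobenius_norm_sq[OF c] by (intro sum.cong refl) (simp only: norm_cmat_diff_one_entry lessThan_iff power2_abs)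
  also have "\<dots> \<le> (\<Sum>i<n. \<Sum>j<n. m\<^sup>2)"
  proof (intro sum_mono)
    fix i j assume "i \<in> {..<n}" "j \<in> {..<n}"
    then have "\<bar>(C - 1\<^sub>m n) $$ (i, j)\<bar> \<le> \<bar>m\<bar>" using m[of i j] m0 by simp
    then show "((C - 1\<^sub>m n) $$ (i, j))\<^sup>2 \<le> m\<^sup>2" by (simp only: abs_le_square_iff)
  qed
  also have "\<dots> = (real n * m)\<^sup>2" by (simp add: power2_eq_square)
  finally show ?thesis using m0 by (simp add: power2_le_iff_abs_le)
qed

lemma entry_le_frob:
  assumes C: "C \<in> carrier_mat n n" and ij: "i < n" "j < n"
  shows "\<bar>(C - 1\<^sub>m n) $$ (i, j)\<bar> \<le> frob C"
proof -
  have c: "cmat (C - 1\<^sub>m n) \<in> carrier_mat n n" using minus_carrier_mat[OF one_carrier_mat[of n], of C] by simp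
  have "((C - 1\<^sub>m n) $$ (i, j))\<^sup>2 = (norm (cmat (C - 1\<^sub>m n) $$ (i, j)))\<^sup>2"
    by (simp only: norm_cmat_diff_one_entry[OF ij] power2_abs)
  also have "\<dots> \<le> (\<Sum>j<n. (norm (cmat (C - 1\<^sub>m n) $$ (i, j)))\<^sup>2)"
    using ij by (intro member_le_sum[where f = "\<lambda>j. (norm (cmat (C - 1\<^sub>m n) $$ (i, j)))\<^sup>2"]) auto
  also have "\<dots> \<le> (\<Sum>i<n. \<Sum>j<n. (norm (cmat (C - 1\<^sub>m n) $$ (i, j)))\<^sup>2)"
    using ij by (intro member_le_sum[where f = "\<lambda>i. \<Sum>j<n. (norm (cmat (C - 1\<^sub>m n) $$ (i, j)))\<^sup>2"]) (auto intro: sum_nonneg)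
  also have "\<dots> = (frob C)\<^sup>2" by (rule frobenius_norm_sq[OF c, symmetric])
  finally show ?thesis using frob_nonneg[of C] by (simp add: power2_le_iff_abs_le)
qed

lemma frob_le_\<delta>: "\<exists>c>0. \<forall>C\<in>O_group n. c * frob C \<le> \<delta> C"
proof -
  obtain \<alpha> \<beta> where \<alpha>: "\<alpha> > 0" "\<And>z. norm z = 1 ==> \<alpha> * norm (z - 1) \<le> norm (f z)"
    using f_linear_bounds by blast
  obtain c where c: "c > 0" "\<And>z k. k < n ==> c * norm (z k) \<le> N (mat_diag n z)"
    using N_diag_lower by blast
  have "c * \<alpha> / real n * frob C \<le> \<delta> C" if C: "C \<in> O_group n" for C
  proof -
    obtain U z where U: "U \<in> unitary_group n" and z: "cmat C = udiag U z" and nz: "\<And>k. k < n ==> norm (z k) = 1"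
      using orthogonal_cmat_diag[OF C] by blast
    have \<delta>: "\<delta> C = N (mat_diag n (\<lambda>k. f (z k)))" by (rule \<delta>_udiag[OF z U])
    have "c * (\<alpha> * norm (z k - 1)) \<le> \<delta> C" if "k < n" for k
    proof -
      have "c * (\<alpha> * norm (z k - 1)) \<le> c * norm (f (z k))" using \<alpha>(2)[OF nz[OF that]] c(1) by (intro mult_left_mono) auto
      also have "\<dots> \<le> \<delta> C" unfolding \<delta> using c(2)[OF that, of "\<lambda>k. f (z k)"] .
      finally show ?thesis .
    qed
    then have zk: "norm (z k - 1) \<le> \<delta> C / (c * \<alpha>)" if "k < n" for k
      using that c(1) \<alpha>(1) by (simp add: pos_le_divide_eq mult_ac)
    have d0: "0 \<le> \<delta> C / (c * \<alpha>)" by (rule order_trans[OF norm_ge_zero zk[OF n_pos]])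
    have "(frob C)\<^sup>2 \<le> (\<Sum>k<n. (\<delta> C / (c * \<alpha>))\<^sup>2)"
      unfolding frob_udiag[OF U z] using zk by (intro sum_mono power_mono) auto
    also have "\<dots> = real n * (\<delta> C / (c * \<alpha>))\<^sup>2" by simp
    \<comment> \<open>One factor \<open>n\<close> is replaced by its square so that the bound
      becomes a perfect square.\<close>
    also have "\<dots> \<le> (real n * real n) * (\<delta> C / (c * \<alpha>))\<^sup>2"
      using n_pos by (intro mult_right_mono) (auto simp: Suc_le_eq)
    also have "\<dots> = (real n * (\<delta> C / (c * \<alpha>)))\<^sup>2" by (simp add: power2_eq_square)
    finally have "frob C \<le> real n * (\<delta> C / (c * \<alpha>))"
      by (rule power2_le_imp_le) (rule mult_nonneg_nonneg[OF of_nat_0_le_iff d0])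
    then have "c * \<alpha> / real n * frob C \<le> c * \<alpha> / real n * (real n * (\<delta> C / (c * \<alpha>)))"
      using c(1) \<alpha>(1) by (intro mult_left_mono) auto
    also have "\<dots> = \<delta> C" using c(1) \<alpha>(1) n_pos by simp
    finally show ?thesis .
  qed
  moreover have "c * \<alpha> / real n > 0" using c(1) \<alpha>(1) n_pos by simp
  ultimately show ?thesis by blast
qed

lemma \<delta>_le_frob: "\<exists>c>0. \<forall>C\<in>O_group n. \<delta> C \<le> c * frob C"
proof -
  obtain \<beta> where \<beta>: "\<beta> > 0" "\<And>z. norm z = 1 ==> norm (f z) \<le> \<beta> * norm (z - 1)"
    using f_linear_bounds by blast
  have "\<delta> C \<le> \<beta> * N (1\<^sub>m n) * frob C" if C: "C \<in> O_group n" for C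
  proof -
    obtain U z where U: "U \<in> unitary_group n" and z: "cmat C = udiag U z" and nz: "\<And>k. k < n ==> norm (z k) = 1"
      using orthogonal_cmat_diag[OF C] by blast
    have "norm (f (z k)) \<le> \<beta> * frob C" if "k < n" for k
    proof -
      have "norm (f (z k)) \<le> \<beta> * norm (z k - 1)" by (rule \<beta>(2)[OF nz[OF that]])
      also have "\<dots> \<le> \<beta> * frob C" using eigenvalue_le_frob[OF U z that] \<beta>(1) by (intro mult_left_mono) auto
      finally show ?thesis .
    qed
    then have "\<delta> C \<le> \<beta> * frob C * N (1\<^sub>m n)" unfolding \<delta>_udiag[OF z U] by (intro N_diag_upper)
    then show ?thesis by (simp add: mult_ac)
  qed
  moreover have "\<beta> * N (1\<^sub>m n) > 0" using \<beta>(1) N_one_pos by simp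
  ultimately show ?thesis by blast
qed

text \<open>All eigenvalues lie within \<open>frob C\<close> of 1, so \<open>f_double\<close>
  applies to each of them; monotonicity of the norm in the moduli of diagonal entries does the
  rest.\<close>

lemma \<delta>_double: "\<exists>r>0. \<forall>C\<in>O_group n. frob C < r --> 3 / 2 * \<delta> C \<le> \<delta> (C * C)"
proof -
  obtain r where r: "r > 0" "\<And>z. norm z = 1 ==> norm (z - 1) < r ==> 3 / 2 * norm (f z) \<le> norm (f (z * z))"
    using f_double by blast
  have "3 / 2 * \<delta> C \<le> \<delta> (C * C)" if C: "C \<in> O_group n" and Cr: "frob C < r" for C
  proof -
    obtain U z where U: "U \<in> unitary_group n" and z: "cmat C = udiag U z" and nz: "\<And>k. k < n ==> norm (z k) = 1"
      using orthogonal_cmat_diag[OF C] by blast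
    note Cc = O_groupD(1)[OF C]
    have zz: "cmat (C * C) = udiag U (\<lambda>k. z k * z k)" by (simp only: cmat_mult[OF Cc Cc] z udiag_mult[OF U])
    have "3 / 2 * \<delta> C = N ((3 / 2) \<cdot>\<^sub>m mat_diag n (\<lambda>k. f (z k)))"
      by (simp add: N_smult \<delta>_udiag[OF z U])
    also have "(3 / 2) \<cdot>\<^sub>m mat_diag n (\<lambda>k. f (z k)) = mat_diag n (\<lambda>k. 3 / 2 * f (z k))"
      by (auto simp: mat_diag_def intro!: eq_matI)
    also have "N \<dots> \<le> N (mat_diag n (\<lambda>k. f (z k * z k)))"
    proof (rule N_diag_mono)
      fix k assume k: "k < n"
      have "norm (z k - 1) < r" using eigenvalue_le_frob[OF U z k] Cr by linarith
      then show "norm (3 / 2 * f (z k)) \<le> norm (f (z k * z k))" using r(2)[OF nz[OF k]] by (simp add: norm_mult)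
    qed
    also have "\<dots> = \<delta> (C * C)" by (rule \<delta>_udiag[OF zz U, symmetric])
    finally show ?thesis .
  qed
  then show ?thesis using r(1) by blast
qed

end

section \<open>The rotation group as an exponential group\<close>

lemma bounded_family_convergent_subseq:
  fixes s :: "nat \<Rightarrow> 'i \<Rightarrow> real"
  assumes "finite I" "\<And>k i. i \<in> I ==> \<bar>s k i\<bar> \<le> B"
  shows "\<exists>\<sigma> l. strict_mono \<sigma> \<and> (\<forall>i\<in>I. (\<lambda>k. s (\<sigma> k) i) \<longlonglongrightarrow> l i)"
  using assms
proof (induction I)
  case empty
  then show ?case by (intro exI[of _ id]) (auto simp: strict_mono_def)
next
  case (insert i I)
  then obtain \<sigma> l where \<sigma>: "strict_mono \<sigma>" "\<And>j. j \<in> I ==> (\<lambda>k. s (\<sigma> k) j) \<longlonglongrightarrow> l j" by blast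
  have "seq_compact {- B..B}" by (simp flip: compact_eq_seq_compact_metric)
  moreover have "s (\<sigma> k) i \<in> {- B..B}" for k using insert.prems[of i "\<sigma> k"] by (simp add: abs_le_iff)
  ultimately obtain a \<tau> where \<tau>: "strict_mono \<tau>" "((\<lambda>k. s (\<sigma> k) i) \<circ> \<tau>) \<longlonglongrightarrow> a"
    unfolding seq_compact_def by meson
  have "(\<lambda>k. s ((\<sigma> \<circ> \<tau>) k) j) \<longlonglongrightarrow> (l(i := a)) j" if "j \<in> insert i I" for j
  proof (cases "j = i")
    case True
    then show ?thesis using \<tau>(2) by (simp add: comp_def)
  next
    case False
    then show ?thesis using LIMSEQ_subseq_LIMSEQ[OF \<sigma>(2) \<tau>(1), of j] that by (simp add: comp_def)
  qed
  then show ?case using strict_mono_o[OF \<sigma>(1) \<tau>(1)] by blast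
qed

lemma SO_group_limit:
  assumes A: "\<And>k. A k \<in> SO_group n" and L: "L \<in> carrier_mat n n"
    and lim: "\<And>i j. i < n ==> j < n ==> (\<lambda>k. A k $$ (i, j)) \<longlonglongrightarrow> L $$ (i, j)"
  shows "L \<in> SO_group n"
proof -
  have O: "A k \<in> O_group n" and d1: "det (A k) = 1" for k using A by (auto simp: SO_group_def)
  note AD = O_groupD[OF O]
  have 1: "L * L\<^sup>T = 1\<^sub>m n"
  proof (rule eq_squareI[where n = n])
    fix i j :: nat assume ij: "i < n" "j < n"
    have "(\<lambda>k. \<Sum>l<n. A k $$ (i, l) * A k $$ (j, l)) \<longlonglongrightarrow> (\<Sum>l<n. L $$ (i, l) * L $$ (j, l))"
      using ij by (intro tendsto_sum tendsto_mult lim) auto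
    moreover have c: "(\<Sum>l<n. A k $$ (i, l) * A k $$ (j, l)) = 1\<^sub>m n $$ (i, j)" for k
      using index_mult_sum[OF AD(1,2) ij, of k k] AD(3)[of k] AD(1)[of k] ij by simp
    ultimately have "(\<Sum>l<n. L $$ (i, l) * L $$ (j, l)) = 1\<^sub>m n $$ (i, j)"
      unfolding c by (simp only: LIMSEQ_const_iff)
    then show "(L * L\<^sup>T) $$ (i, j) = 1\<^sub>m n $$ (i, j)"
      using index_mult_sum[of L n n "L\<^sup>T" n i j] L ij by simp
  qed (use L in auto)
  have 2: "L\<^sup>T * L = 1\<^sub>m n"
  proof (rule eq_squareI[where n = n])
    fix i j :: nat assume ij: "i < n" "j < n"
    have "(\<lambda>k. \<Sum>l<n. A k $$ (l, i) * A k $$ (l, j)) \<longlonglongrightarrow> (\<Sum>l<n. L $$ (l, i) * L $$ (l, j))"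
      using ij by (intro tendsto_sum tendsto_mult lim) auto
    moreover have c: "(\<Sum>l<n. A k $$ (l, i) * A k $$ (l, j)) = 1\<^sub>m n $$ (i, j)" for k
      using index_mult_sum[OF AD(2,1) ij, of k k] AD(4)[of k] AD(1)[of k] ij by simp
    ultimately have "(\<Sum>l<n. L $$ (l, i) * L $$ (l, j)) = 1\<^sub>m n $$ (i, j)"
      unfolding c by (simp only: LIMSEQ_const_iff)
    then show "(L\<^sup>T * L) $$ (i, j) = 1\<^sub>m n $$ (i, j)"
      using index_mult_sum[of "L\<^sup>T" n n L n i j] L ij by simp
  qed (use L in auto)
  have "(\<lambda>k. \<Sum>p\<in>{p. p permutes {0..<n}}. signof p * (\<Prod>i = 0..<n. A k $$ (i, p i)))
     \<longlonglongrightarrow> (\<Sum>p\<in>{p. p permutes {0..<n}}. signof p * (\<Prod>i = 0..<n. L $$ (i, p i)))"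
    by (intro tendsto_sum tendsto_mult tendsto_prod lim tendsto_const) (auto dest: permutes_in_image)
  then have "(\<lambda>k. det (A k)) \<longlonglongrightarrow> det L" by (simp add: det_def'[OF AD(1)] det_def'[OF L])
  then have "det L = 1" unfolding d1 by (simp add: LIMSEQ_const_iff)
  then show ?thesis using 1 2 L by (simp add: SO_group_def O_group_def)
qed

lemma mat_abs_sum_le:
  assumes "A \<in> carrier_mat n n" "\<And>i j. i < n ==> j < n ==> \<bar>A $$ (i, j)\<bar> \<le> m"
  shows "mat_abs_sum A \<le> real n * real n * m"
proof -
  have "mat_abs_sum A \<le> (\<Sum>i<n. \<Sum>j<n. m)"
    unfolding mat_abs_sum_def carrier_matD[OF assms(1)] using assms(2) by (intro sum_mono) auto
  then show ?thesis by simp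
qed

lemma emb_diff: "A \<in> carrier_mat n m ==> B \<in> carrier_mat n m ==> emb (A - B) = emb A - emb B"
  by (rule endo_eqI)
     (simp add: op_of_emb mat_op_def minus_endo.rep_eq minus_blinfun.rep_eq left_diff_distrib sum_subtractf scaleR_left_diff_distrib)

lemma unital_diff: "A \<in> carrier_mat n n ==> B \<in> carrier_mat n n ==> unital n A - unital n B = emb (A - B)"
  by (simp add: unital_def emb_diff)

text \<open>Entries of rotations are bounded by 1, so a subsequence converges entrywise, to a
  rotation by \<open>SO_group_limit\<close>. Since the operator norm is at most the sum of the
  moduli of the entries, the convergence also holds in norm.\<close>

lemma compact_unital_SO: "compact (unital n ` SO_group n)"
  unfolding compact_def
proof (intro allI impI)
  fix g :: "nat \<Rightarrow> endo" assume g: "\<forall>k. g k \<in> unital n ` SO_group n"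
  then have "\<forall>k. \<exists>A. A \<in> SO_group n \<and> g k = unital n A" by blast
  from choice[OF this] obtain A where A: "\<And>k. A k \<in> SO_group n" "\<And>k. g k = unital n (A k)" by blast
  have Ac: "A k \<in> carrier_mat n n" for k by (rule SO_carrier[OF A(1)])
  have "\<exists>\<sigma> l. strict_mono \<sigma> \<and> (\<forall>ij\<in>{..<n} \<times> {..<n}. (\<lambda>k. A (\<sigma> k) $$ ij) \<longlonglongrightarrow> l ij)"
    using O_group_entry_le[OF SO_O[OF A(1)]] by (intro bounded_family_convergent_subseq[where B = 1]) auto
  then obtain \<sigma> l where \<sigma>: "strict_mono \<sigma>" "\<forall>ij\<in>{..<n} \<times> {..<n}. (\<lambda>k. A (\<sigma> k) $$ ij) \<longlonglongrightarrow> l ij"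
    by (elim exE conjE)
  define X where "X = mat n n l"
  have Xc: "X \<in> carrier_mat n n" by (simp add: X_def)
  have lim: "(\<lambda>k. A (\<sigma> k) $$ (i, j)) \<longlonglongrightarrow> X $$ (i, j)" if "i < n" "j < n" for i j
    using bspec[OF \<sigma>(2), of "(i, j)"] that by (simp add: X_def)
  have X: "X \<in> SO_group n" by (rule SO_group_limit[OF A(1) Xc lim])
  have "(\<lambda>k. \<Sum>i<n. \<Sum>j<n. \<bar>A (\<sigma> k) $$ (i, j) - X $$ (i, j)\<bar>) \<longlonglongrightarrow> (\<Sum>i<n. \<Sum>j<n. \<bar>X $$ (i, j) - X $$ (i, j)\<bar>)"
    by (intro tendsto_sum tendsto_rabs tendsto_diff lim tendsto_const) auto
  then have "(\<lambda>k. \<Sum>i<n. \<Sum>j<n. \<bar>A (\<sigma> k) $$ (i, j) - X $$ (i, j)\<bar>) \<longlonglongrightarrow> 0" by simp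
  moreover have "norm (unital n (A (\<sigma> k)) - unital n X) \<le> (\<Sum>i<n. \<Sum>j<n. \<bar>A (\<sigma> k) $$ (i, j) - X $$ (i, j)\<bar>)" for k
    using norm_emb_le[of "A (\<sigma> k) - X"] Ac[of "\<sigma> k"] Xc by (simp add: unital_diff mat_abs_sum_def)
  ultimately have "(\<lambda>k. unital n (A (\<sigma> k)) - unital n X) \<longlonglongrightarrow> 0"
    by (rule Lim_null_comparison[OF always_eventually[OF allI], rotated])
  then have "(g \<circ> \<sigma>) \<longlonglongrightarrow> unital n X" by (simp add: LIM_zero_iff A(2) comp_def)
  then show "\<exists>l\<in>unital n ` SO_group n. \<exists>r. strict_mono r \<and> (g \<circ> r) \<longlonglongrightarrow> l"
    using X \<sigma>(1) by blast
qed

lemma skew_carrier: "X \<in> skew_mats n ==> X \<in> carrier_mat n n"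
  by (simp add: skew_mats_def)

lemma skew_entry:
  assumes X: "X \<in> skew_mats n" and ij: "i < n" "j < n"
  shows "X $$ (j, i) = - X $$ (i, j)"
proof -
  have "X\<^sup>T $$ (i, j) = (- X) $$ (i, j)" using X by (simp add: skew_mats_def)
  then show ?thesis using ij skew_carrier[OF X] by simp
qed

lemma skewI:
  assumes "X \<in> carrier_mat n n" "\<And>i j. i < n ==> j < n ==> X $$ (j, i) = - X $$ (i, j)"
  shows "X \<in> skew_mats n"
proof -
  have "X\<^sup>T = - X"
  proof (rule eq_squareI[where n = n])
    fix i j :: nat assume ij: "i < n" "j < n"
    then show "X\<^sup>T $$ (i, j) = (- X) $$ (i, j)" using assms(2)[OF ij] assms(1) by simp
  qed (use assms(1) in auto)
  then show ?thesis using assms(1) by (simp add: skew_mats_def)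
qed

lemma skew_add:
  assumes X: "X \<in> skew_mats n" and Y: "Y \<in> skew_mats n"
  shows "X + Y \<in> skew_mats n"
proof (rule skewI)
  show "X + Y \<in> carrier_mat n n" using skew_carrier[OF X] skew_carrier[OF Y] by simp
  show "(X + Y) $$ (j, i) = - (X + Y) $$ (i, j)" if "i < n" "j < n" for i j
    using skew_entry[OF X that] skew_entry[OF Y that] skew_carrier[OF X] skew_carrier[OF Y] that by simp
qed

lemma skew_smult:
  assumes X: "X \<in> skew_mats n"
  shows "c \<cdot>\<^sub>m X \<in> skew_mats n"
proof (rule skewI)
  show "c \<cdot>\<^sub>m X \<in> carrier_mat n n" using skew_carrier[OF X] by simp
  show "(c \<cdot>\<^sub>m X) $$ (j, i) = - (c \<cdot>\<^sub>m X) $$ (i, j)" if "i < n" "j < n" for i j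
    using skew_entry[OF X that] skew_carrier[OF X] that by simp
qed

lemma skew_zero: "0\<^sub>m n n \<in> skew_mats n"
  by (rule skewI) auto

definition bracket :: "real mat \<Rightarrow> real mat \<Rightarrow> real mat" where
  "bracket X Y = X * Y - Y * X"

lemma bracket_carrier: "X \<in> carrier_mat n n ==> Y \<in> carrier_mat n n ==> bracket X Y \<in> carrier_mat n n"
  by (simp add: bracket_def minus_carrier_mat)

lemma bracket_skew:
  assumes X: "X \<in> skew_mats n" and Y: "Y \<in> skew_mats n"
  shows "bracket X Y \<in> skew_mats n"
proof (rule skewI)
  note c = skew_carrier[OF X] skew_carrier[OF Y]
  show "bracket X Y \<in> carrier_mat n n" by (rule bracket_carrier[OF c])
  fix i j assume ij: "i < n" "j < n"
  have 1: "(X * Y) $$ (j, i) = (Y * X) $$ (i, j)" if "i < n" "j < n" for i j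
    unfolding index_mult_sum[OF c that(2,1)] index_mult_sum[OF c(2,1) that]
  proof (rule sum.cong)
    fix l assume "l \<in> {..<n}"
    then show "X $$ (j, l) * Y $$ (l, i) = Y $$ (i, l) * X $$ (l, j)"
      using skew_entry[OF X, of l j] skew_entry[OF Y, of i l] that by simp
  qed simp
  show "bracket X Y $$ (j, i) = - bracket X Y $$ (i, j)"
    using 1[OF ij] 1[OF ij(2,1)] ij c by (simp add: bracket_def del: index_mult_mat(1))
qed

lemma emb_bracket:
  assumes "X \<in> carrier_mat n n" "Y \<in> carrier_mat n n"
  shows "emb (bracket X Y) = emb X * emb Y - emb Y * emb X"
  unfolding bracket_def using assms
  by (simp add: emb_diff[of _ n n] emb_mult[of _ n n _ n])

lemma of_unital_emb: "X \<in> carrier_mat n n ==> of_unital n (emb X) = X"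
  by (rule eq_matI) (auto simp: of_unital_def entry_emb)

context circle_metric
begin

lemma exponential_metric_group_SO:
  "\<exists>M B c C r. exponential_metric_group (unital n ` SO_group n) (emb ` skew_mats n)
     (\<lambda>g. unital n ((of_unital n g)\<^sup>T)) (\<lambda>g. \<delta> (of_unital n g)) M B c C r (3 / 2)"
proof -
  obtain c where c: "c > 0" "\<And>C. C \<in> O_group n ==> c * frob C \<le> \<delta> C" using frob_le_\<delta> by blast
  obtain C where C: "C > 0" "\<And>A. A \<in> O_group n ==> \<delta> A \<le> C * frob A" using \<delta>_le_frob by blast
  obtain r where r: "r > 0" "\<And>C. C \<in> O_group n ==> frob C < r ==> 3 / 2 * \<delta> C \<le> \<delta> (C * C)" using \<delta>_double by blast
  have nr: "real n > 0" using n_pos by simp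
  \<comment> \<open>\<open>a\<close> is the constant of \<open>exp_mat_surj\<close>. Passing from
    entries to the operator norm costs n^2, and the Frobenius norm costs \<open>n\<close> against
    the operator norm. \<open>B\<close> adds the bounds for \<open>emb A\<close> and for the
    complementary projection.\<close>
  define a where "a = 2 * pi * real n + pi"
  have a: "a > 0" using pi_gt_zero n_pos by (simp add: a_def add_pos_pos)
  define M where "M = real n * real n * (a * real n)"
  define B where "B = real n * real n * 1 + (1 + real n * real n * 1)"
  have M0: "M > 0" using a nr by (simp add: M_def)
  note SOc = SO_carrier
  have ou: "of_unital n (unital n A) = A" if "A \<in> SO_group n" for A using that by (intro of_unital_unital SOc)
  have diff: "unital n A - 1 = emb (A - 1\<^sub>m n)" if "A \<in> SO_group n" for A
    using unital_diff[OF SOc[OF that] one_carrier_mat] by (simp add: unital_one)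
  have frob_norm: "frob A \<le> real n * norm (unital n A - 1)" if A: "A \<in> SO_group n" for A
  proof (rule frob_le[OF SOc[OF A]])
    fix i j assume ij: "i < n" "j < n"
    have "(A - 1\<^sub>m n) $$ (i, j) = entry_op i j (emb (A - 1\<^sub>m n))"
      using ij SOc[OF A] by (intro entry_emb[symmetric]) auto
    then show "\<bar>(A - 1\<^sub>m n) $$ (i, j)\<bar> \<le> norm (unital n A - 1)"
      unfolding diff[OF A] by (simp only: abs_entry_op_le)
  qed
  have norm_frob: "norm (unital n A - 1) \<le> real n * real n * frob A" if A: "A \<in> SO_group n" for A
    unfolding diff[OF A]
    by (rule order_trans[OF norm_emb_le mat_abs_sum_le])
       (auto intro: entry_le_frob[OF SOc[OF A]] minus_carrier_mat simp del: index_minus_mat)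
  have "exponential_metric_group (unital n ` SO_group n) (emb ` skew_mats n)
     (\<lambda>g. unital n ((of_unital n g)\<^sup>T)) (\<lambda>g. \<delta> (of_unital n g)) M B (c / (real n * real n)) (C * real n) (r / real n) (3 / 2)"
  proof (unfold_locales)
    show "real_vector.subspace (emb ` skew_mats n)"
    proof (rule real_vector.subspaceI)
      have "emb (0\<^sub>m n n) = 0 *\<^sub>R emb (0\<^sub>m n n)" by (subst emb_smult[symmetric]) (rule arg_cong[of _ _ emb], auto)
      then show "0 \<in> emb ` skew_mats n" using skew_zero[of n] by (metis imageI scaleR_zero_left)
    next
      fix x y assume "x \<in> emb ` skew_mats n" "y \<in> emb ` skew_mats n"
      then obtain X Y where X: "x = emb X" "X \<in> skew_mats n" and Y: "y = emb Y" "Y \<in> skew_mats n" by blast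
      have "x + y = emb (X + Y)" unfolding X Y by (rule emb_add[OF skew_carrier[OF X(2)] skew_carrier[OF Y(2)], symmetric])
      then show "x + y \<in> emb ` skew_mats n" using skew_add[OF X(2) Y(2)] by blast
    next
      fix s :: real and x assume "x \<in> emb ` skew_mats n"
      then obtain X where X: "x = emb X" "X \<in> skew_mats n" by blast
      have "s *\<^sub>R x = emb (s \<cdot>\<^sub>m X)" unfolding X by (rule emb_smult[symmetric])
      then show "s *\<^sub>R x \<in> emb ` skew_mats n" using skew_smult[OF X(2)] by blast
    qed
    show "x * y - y * x \<in> emb ` skew_mats n" if xy: "x \<in> emb ` skew_mats n" "y \<in> emb ` skew_mats n" for x y
    proof -
      obtain X Y where X: "x = emb X" "X \<in> skew_mats n" and Y: "y = emb Y" "Y \<in> skew_mats n" using xy by blast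
      show ?thesis unfolding X Y emb_bracket[OF skew_carrier[OF X(2)] skew_carrier[OF Y(2)], symmetric]
        by (rule imageI[OF bracket_skew[OF X(2) Y(2)]])
    qed
    show "exp x \<in> unital n ` SO_group n" if "x \<in> emb ` skew_mats n" for x
      using that by (auto simp: exp_emb[OF skew_carrier] intro!: imageI exp_mat_SO)
    show "\<exists>x\<in>emb ` skew_mats n. exp x = g \<and> norm x \<le> M * norm (g - 1)" if gG: "g \<in> unital n ` SO_group n" for g
    proof -
      obtain A where A: "g = unital n A" "A \<in> SO_group n" using gG by blast
      obtain X where X: "X \<in> skew_mats n" "exp_mat X = A"
        and Xb: "\<And>i j. i < n ==> j < n ==> \<bar>X $$ (i, j)\<bar> \<le> a * frob A"
        using exp_mat_surj[OF A(2)] unfolding a_def by blast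
      have "norm (emb X) \<le> real n * real n * (a * frob A)"
        using order_trans[OF norm_emb_le mat_abs_sum_le[OF skew_carrier[OF X(1)] Xb]] .
      also have "\<dots> \<le> real n * real n * (a * (real n * norm (g - 1)))"
        using frob_norm[OF A(2)] a unfolding A by (intro mult_left_mono) auto
      also have "\<dots> = M * norm (g - 1)" by (simp add: M_def)
      finally have nX: "norm (emb X) \<le> M * norm (g - 1)" .
      have "exp (emb X) = g" unfolding exp_emb[OF skew_carrier[OF X(1)]] X(2) A(1) ..
      then show ?thesis using nX by (intro bexI[OF _ imageI[OF X(1)]] conjI)
    qed
    show "g * h \<in> unital n ` SO_group n" if "g \<in> unital n ` SO_group n" "h \<in> unital n ` SO_group n" for g h
      using that by (auto simp: unital_mult[OF SOc SOc, symmetric] intro!: imageI SO_group_mult)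
    show "unital n ((of_unital n g)\<^sup>T) \<in> unital n ` SO_group n" if "g \<in> unital n ` SO_group n" for g
      using that by (auto simp: ou intro!: imageI SO_group_transpose)
    show "unital n ((of_unital n g)\<^sup>T) * g = 1" if gG: "g \<in> unital n ` SO_group n" for g
    proof -
      obtain A where A: "g = unital n A" "A \<in> SO_group n" using gG by blast
      note AD = O_groupD[OF SO_O[OF A(2)]]
      show ?thesis unfolding A(1) ou[OF A(2)] unital_mult[OF AD(2,1), symmetric] AD(4) by (rule unital_one)
    qed
    show "compact (unital n ` SO_group n)" by (rule compact_unital_SO)
    show "norm g \<le> B" if gG: "g \<in> unital n ` SO_group n" for g
    proof -
      obtain A where A: "g = unital n A" "A \<in> SO_group n" using gG by blast
      have "norm (emb X) \<le> real n * real n * 1" if "X \<in> O_group n" for X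
        using order_trans[OF norm_emb_le mat_abs_sum_le[OF O_groupD(1)[OF that] O_group_entry_le[OF that]]] .
      note 1 = this[OF SO_O[OF A(2)]] this[OF O_group_one]
      have "norm g \<le> norm (emb A) + norm (1 - emb (1\<^sub>m n))" unfolding A(1) unital_def by (rule norm_triangle_ineq)
      moreover have "norm (1 - emb (1\<^sub>m n)) \<le> norm (1 :: endo) + norm (emb (1\<^sub>m n))" by (rule norm_triangle_ineq4)
      ultimately show ?thesis using 1 unfolding B_def norm_one by linarith
    qed
    show "\<delta> (of_unital n (unital n ((of_unital n g)\<^sup>T))) = \<delta> (of_unital n g)" if gG: "g \<in> unital n ` SO_group n" for g
      using that by (auto simp: ou SO_group_transpose \<delta>_transpose[OF SO_O])
    show "\<delta> (of_unital n (h * g * unital n ((of_unital n h)\<^sup>T))) = \<delta> (of_unital n g)"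
      if gh: "g \<in> unital n ` SO_group n" "h \<in> unital n ` SO_group n" for g h
    proof -
      obtain A where A: "g = unital n A" "A \<in> SO_group n" using gh by blast
      obtain H where H: "h = unital n H" "H \<in> SO_group n" using gh by blast
      have "h * g * unital n ((of_unital n h)\<^sup>T) = unital n (H * A * H\<^sup>T)"
        unfolding A H(1) ou[OF H(2)]
        using A(2) H(2) by (simp only: unital_mult[OF SOc SOc] SO_group_mult SO_group_transpose)
      then show ?thesis using A H by (simp add: ou SO_group_mult SO_group_transpose \<delta>_conj[OF SO_O SO_O])
    qed
    show "c / (real n * real n) * norm (g - 1) \<le> \<delta> (of_unital n g)" if gG: "g \<in> unital n ` SO_group n" for g
    proof -
      obtain A where A: "g = unital n A" "A \<in> SO_group n" using gG by blast
      have "c / (real n * real n) * norm (g - 1) \<le> c / (real n * real n) * (real n * real n * frob A)"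
        using norm_frob[OF A(2)] c(1) unfolding A by (intro mult_left_mono) auto
      also have "\<dots> = c * frob A" using nr by simp
      also have "\<dots> \<le> \<delta> A" by (rule c(2)[OF SO_O[OF A(2)]])
      finally show ?thesis unfolding A ou[OF A(2)] .
    qed
    show "\<delta> (of_unital n g) \<le> C * real n * norm (g - 1)" if gG: "g \<in> unital n ` SO_group n" for g
    proof -
      obtain A where A: "g = unital n A" "A \<in> SO_group n" using gG by blast
      have "\<delta> A \<le> C * frob A" by (rule C(2)[OF SO_O[OF A(2)]])
      also have "\<dots> \<le> C * (real n * norm (g - 1))"
        using frob_norm[OF A(2)] C(1) unfolding A by (intro mult_left_mono) auto
      finally show ?thesis unfolding A ou[OF A(2)] by (simp add: mult.assoc)
    qed
    show "3 / 2 * \<delta> (of_unital n g) \<le> \<delta> (of_unital n (g * g))" if gG: "g \<in> unital n ` SO_group n" "norm (g - 1) < r / real n" for g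
    proof -
      obtain A where A: "g = unital n A" "A \<in> SO_group n" using gG by blast
      have "real n * norm (g - 1) < r" using gG(2) nr by (simp add: pos_less_divide_eq mult.commute)
      then have "frob A < r" using frob_norm[OF A(2)] unfolding A by linarith
      then have "3 / 2 * \<delta> A \<le> \<delta> (A * A)" by (rule r(2)[OF SO_O[OF A(2)]])
      then show ?thesis unfolding A ou[OF A(2)] unital_mult[OF SOc[OF A(2)] SOc[OF A(2)], symmetric] ou[OF SO_group_mult[OF A(2) A(2)]] .
    qed
  qed (use c C r a nr M0 in \<open>auto simp: B_def\<close>)
  then show ?thesis by blast
qed

theorem isometry_linear_part:
  assumes \<psi>: "\<psi> \<in> SO_group n \<rightarrow> SO_group n"
    and iso: "\<And>A B. A \<in> SO_group n ==> B \<in> SO_group n ==> d_Nf N f (\<psi> A) (\<psi> B) = d_Nf N f A B"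
    and one: "\<psi> (1\<^sub>m n) = 1\<^sub>m n"
  shows "\<exists>L. (\<forall>X\<in>skew_mats n. L X \<in> skew_mats n \<and> \<psi> (exp_mat X) = exp_mat (L X)) \<and>
    (\<forall>X\<in>skew_mats n. \<forall>Y\<in>skew_mats n. L (X + Y) = L X + L Y) \<and>
    (\<forall>X\<in>skew_mats n. \<forall>s. L (s \<cdot>\<^sub>m X) = s \<cdot>\<^sub>m L X) \<and>
    (\<forall>X\<in>skew_mats n. L X = 0\<^sub>m n n --> X = 0\<^sub>m n n) \<and>
    (\<forall>Y\<in>skew_mats n. \<exists>X\<in>skew_mats n. L X = Y) \<and>
    (\<forall>X\<in>skew_mats n. \<forall>Y\<in>skew_mats n. L (bracket X (bracket X Y)) = bracket (L X) (bracket (L X) (L Y)))"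
proof -
  let ?G = "unital n ` SO_group n" and ?K = "emb ` skew_mats n"
  let ?inv = "\<lambda>g. unital n ((of_unital n g)\<^sup>T)" and ?\<delta> = "\<lambda>g. \<delta> (of_unital n g)"
  obtain M B c C r where E: "exponential_metric_group ?G ?K ?inv ?\<delta> M B c C r (3 / 2)"
    using exponential_metric_group_SO by blast
  interpret E: exponential_metric_group ?G ?K ?inv ?\<delta> M B c C r "3 / 2" by (rule E)
  have ou: "of_unital n (unital n A) = A" if "A \<in> SO_group n" for A using that by (intro of_unital_unital SO_carrier)
  have \<psi>G: "\<psi> A \<in> SO_group n" if "A \<in> SO_group n" for A using \<psi> that by blast
  define \<psi>' where "\<psi>' g = unital n (\<psi> (of_unital n g))" for g
  have d: "E.d (unital n A) (unital n B) = d_Nf N f A B" if AB: "A \<in> SO_group n" "B \<in> SO_group n" for A B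
    unfolding E.d_def d_Nf_\<delta>[OF SO_O[OF AB(1)]] ou[OF AB(1)]
    by (simp only: unital_mult[OF SO_carrier[OF SO_group_transpose[OF AB(1)]] SO_carrier[OF AB(2)], symmetric]
        ou[OF SO_group_mult[OF SO_group_transpose[OF AB(1)] AB(2)]])
  have "E.isometry \<psi>'"
    unfolding E.isometry_def
  proof (intro conjI ballI)
    show "\<psi>' \<in> ?G \<rightarrow> ?G" using \<psi>G by (auto simp: \<psi>'_def ou)
    fix g h assume "g \<in> ?G" "h \<in> ?G"
    then obtain A B where A: "g = unital n A" "A \<in> SO_group n" and B: "h = unital n B" "B \<in> SO_group n" by blast
    then show "E.d (\<psi>' g) (\<psi>' h) = E.d g h" by (simp add: \<psi>'_def ou d \<psi>G iso)
  qed
  moreover have "\<psi>' 1 = 1" using ou[OF SO_group_one] by (simp add: \<psi>'_def unital_one one)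
  ultimately interpret I: based_isometry ?G ?K ?inv ?\<delta> M B c C r "3 / 2" \<psi>' by unfold_locales
  obtain L' where L0: "(\<forall>x\<in>?K. L' x \<in> ?K \<and> \<psi>' (exp x) = exp (L' x)) \<and>
    (\<forall>x\<in>?K. \<forall>y\<in>?K. L' (x + y) = L' x + L' y) \<and> (\<forall>x\<in>?K. \<forall>s. L' (s *\<^sub>R x) = s *\<^sub>R L' x) \<and>
    (\<forall>x\<in>?K. L' x = 0 --> x = 0) \<and> (\<forall>y\<in>?K. \<exists>x\<in>?K. L' x = y) \<and>
    (\<forall>x\<in>?K. \<forall>y\<in>?K. L' (x * (x * y - y * x) - (x * y - y * x) * x) =
       L' x * (L' x * L' y - L' y * L' x) - (L' x * L' y - L' y * L' x) * L' x)"
    using I.isometry_exp_linear by (rule exE)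
  note L1 = L0[THEN conjunct1] and L2 = L0[THEN conjunct2, THEN conjunct1]
    and L3 = L0[THEN conjunct2, THEN conjunct2, THEN conjunct1]
    and L4 = L0[THEN conjunct2, THEN conjunct2, THEN conjunct2, THEN conjunct1]
    and L5 = L0[THEN conjunct2, THEN conjunct2, THEN conjunct2, THEN conjunct2, THEN conjunct1]
    and L6 = L0[THEN conjunct2, THEN conjunct2, THEN conjunct2, THEN conjunct2, THEN conjunct2]
  note L' = L1[rule_format, THEN conjunct1] L1[rule_format, THEN conjunct2]
    L2[rule_format] L3[rule_format] L4[rule_format] L5[rule_format] L6[rule_format]
  define L where "L X = of_unital n (L' (emb X))" for X
  have inj: "X = Y" if "emb X = emb Y" "X \<in> skew_mats n" "Y \<in> skew_mats n" for X Y
    using arg_cong[OF that(1), of "of_unital n"]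
    unfolding of_unital_emb[OF skew_carrier[OF that(2)]] of_unital_emb[OF skew_carrier[OF that(3)]] .
  have eL: "L X \<in> skew_mats n \<and> emb (L X) = L' (emb X)" if X: "X \<in> skew_mats n" for X
  proof -
    obtain Y where "L' (emb X) = emb Y" "Y \<in> skew_mats n" using L'(1)[OF imageI[OF X]] by blast
    then show ?thesis by (simp add: L_def of_unital_emb[OF skew_carrier])
  qed
  note LK = eL[THEN conjunct1] and emL = eL[THEN conjunct2]
  have e0: "emb (0\<^sub>m n n) = 0"
  proof -
    have "emb (0\<^sub>m n n) = 0 *\<^sub>R emb (0\<^sub>m n n)" by (subst emb_smult[symmetric]) (rule arg_cong[of _ _ emb], auto)
    then show ?thesis by simp
  qed
  show ?thesis
  proof (intro exI[of _ L] conjI ballI allI impI)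
    fix X assume X: "X \<in> skew_mats n"
    note Xc = skew_carrier[OF X]
    show "L X \<in> skew_mats n" by (rule LK[OF X])
    have e: "unital n (\<psi> (exp_mat X)) = unital n (exp_mat (L X))"
      using L'(2)[OF imageI[OF X]]
      by (simp add: exp_emb[OF Xc] \<psi>'_def ou[OF exp_mat_SO[OF X]] exp_emb[OF skew_carrier[OF LK[OF X]]] flip: emL[OF X])
    show "\<psi> (exp_mat X) = exp_mat (L X)"
      using arg_cong[OF e, of "of_unital n"]
      unfolding ou[OF \<psi>G[OF exp_mat_SO[OF X]]] ou[OF exp_mat_SO[OF LK[OF X]]] .
    show "L (s \<cdot>\<^sub>m X) = s \<cdot>\<^sub>m L X" for s
      using L'(4)[OF imageI[OF X], of s]
      by (intro inj LK skew_smult X) (simp add: emL[OF skew_smult[OF X]] emL[OF X] emb_smult)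
    show "X = 0\<^sub>m n n" if "L X = 0\<^sub>m n n"
      using L'(5)[OF imageI[OF X]] that emL[OF X] e0 by (intro inj[OF _ X skew_zero]) simp
    show "\<exists>Y\<in>skew_mats n. L Y = X"
    proof -
      obtain Y where Y: "Y \<in> skew_mats n" "L' (emb Y) = emb X" using L'(6)[OF imageI[OF X]] by blast
      have "L Y = X" using Y(2) emL[OF Y(1)] by (intro inj LK Y(1) X) simp
      then show ?thesis using Y(1) by blast
    qed
    fix Y assume Y: "Y \<in> skew_mats n"
    note Yc = skew_carrier[OF Y]
    show "L (X + Y) = L X + L Y"
    proof (rule inj)
      have "emb (L (X + Y)) = L' (emb X + emb Y)" by (simp add: emL[OF skew_add[OF X Y]] emb_add[OF Xc Yc])
      also have "\<dots> = emb (L X) + emb (L Y)" by (simp add: L'(3)[OF imageI[OF X] imageI[OF Y]] emL X Y)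
      also have "\<dots> = emb (L X + L Y)" by (rule emb_add[OF skew_carrier[OF LK[OF X]] skew_carrier[OF LK[OF Y]], symmetric])
      finally show "emb (L (X + Y)) = emb (L X + L Y)" .
    qed (simp_all add: LK skew_add X Y)
    show "L (bracket X (bracket X Y)) = bracket (L X) (bracket (L X) (L Y))"
    proof (rule inj)
      note bc = bracket_carrier[OF Xc Yc]
      have "emb (L (bracket X (bracket X Y))) = L' (emb X * (emb X * emb Y - emb Y * emb X) - (emb X * emb Y - emb Y * emb X) * emb X)"
        by (simp add: emL bracket_skew X Y emb_bracket[OF Xc bc] emb_bracket[OF Xc Yc])
      also have "\<dots> = emb (bracket (L X) (bracket (L X) (L Y)))"
        unfolding L'(7)[OF imageI[OF X] imageI[OF Y]]
        using emb_bracket[OF skew_carrier[OF LK[OF X]] bracket_carrier[OF skew_carrier[OF LK[OF X]] skew_carrier[OF LK[OF Y]]]]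
          emb_bracket[OF skew_carrier[OF LK[OF X]] skew_carrier[OF LK[OF Y]]]
        by (simp add: emL X Y)
      finally show "emb (L (bracket X (bracket X Y))) = emb (bracket (L X) (bracket (L X) (L Y)))" .
    qed (simp_all add: LK bracket_skew X Y)
  qed
qed

end

section \<open>Unit bivectors\<close>

text \<open>Vectors are functions on the natural numbers of which only the first \<open>n\<close>
  values count; equalities between vectors are therefore passed on through \<open>dot_cong\<close>,
  \<open>mvec_cong\<close> and \<open>wedge_cong\<close>.\<close>

definition dot :: "nat \<Rightarrow> (nat \<Rightarrow> real) \<Rightarrow> (nat \<Rightarrow> real) \<Rightarrow> real" where
  "dot n a b = (\<Sum>i<n. a i * b i)"

definition mvec :: "nat \<Rightarrow> real mat \<Rightarrow> (nat \<Rightarrow> real) \<Rightarrow> nat \<Rightarrow> real" where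
  "mvec n X a i = (\<Sum>j<n. X $$ (i, j) * a j)"

definition wedge :: "nat \<Rightarrow> (nat \<Rightarrow> real) \<Rightarrow> (nat \<Rightarrow> real) \<Rightarrow> real mat" where
  "wedge n a b = mat n n (\<lambda>(i, j). a i * b j - a j * b i)"

definition unit_bivectors :: "nat \<Rightarrow> real mat set" where
  "unit_bivectors n = {wedge n a b | a b. dot n a a = 1 \<and> dot n b b = 1 \<and> dot n a b = 0}"

lemma dot_commute: "dot n a b = dot n b a"
  by (simp add: dot_def mult.commute)

lemma dot_add_left: "dot n (\<lambda>i. a i + b i) c = dot n a c + dot n b c"
  and dot_add_right: "dot n c (\<lambda>i. a i + b i) = dot n c a + dot n c b"
  and dot_diff_left: "dot n (\<lambda>i. a i - b i) c = dot n a c - dot n b c"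
  and dot_diff_right: "dot n c (\<lambda>i. a i - b i) = dot n c a - dot n c b"
  and dot_scale_left: "dot n (\<lambda>i. r * a i) c = r * dot n a c"
  and dot_scale_right: "dot n c (\<lambda>i. r * a i) = r * dot n c a"
  and dot_scale_left': "dot n (\<lambda>i. a i * r) c = r * dot n a c"
  and dot_scale_right': "dot n c (\<lambda>i. a i * r) = r * dot n c a"
  and dot_minus_left: "dot n (\<lambda>i. - a i) c = - dot n a c"
  and dot_minus_right: "dot n c (\<lambda>i. - a i) = - dot n c a"
  by (simp_all add: dot_def algebra_simps sum.distrib sum_subtractf sum_distrib_left sum_negf)

lemmas dot_simps = dot_add_left dot_add_right dot_diff_left dot_diff_right dot_scale_left dot_scale_right
  dot_scale_left' dot_scale_right' dot_minus_left dot_minus_right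

lemma dot_self_eq_0: "dot n a a = 0 ==> i < n ==> a i = 0"
  unfolding dot_def by (subst (asm) sum_nonneg_eq_0_iff) auto

lemma dot_self_nonneg: "0 \<le> dot n a a"
  by (simp add: dot_def sum_nonneg)

lemma dot_cong: "(\<And>i. i < n ==> a i = a' i) ==> (\<And>i. i < n ==> b i = b' i) ==> dot n a b = dot n a' b'"
  by (simp add: dot_def)

lemma wedge_carrier [simp]: "wedge n a b \<in> carrier_mat n n"
  and wedge_dim [simp]: "dim_row (wedge n a b) = n" "dim_col (wedge n a b) = n"
  and wedge_index [simp]: "i < n ==> j < n ==> wedge n a b $$ (i, j) = a i * b j - a j * b i"
  by (simp_all add: wedge_def)

lemma wedge_skew: "wedge n a b \<in> skew_mats n"
  by (rule skewI) auto

lemma unit_bivectors_skew: "X \<in> unit_bivectors n ==> X \<in> skew_mats n"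
  by (auto simp: unit_bivectors_def wedge_skew)

lemma dot_mvec_skew:
  assumes X: "X \<in> skew_mats n"
  shows "dot n a (mvec n X b) = - dot n (mvec n X a) b"
proof -
  have "dot n a (mvec n X b) = (\<Sum>i<n. \<Sum>j<n. a i * X $$ (i, j) * b j)"
    by (simp add: dot_def mvec_def sum_distrib_left mult.assoc)
  also have "\<dots> = (\<Sum>j<n. \<Sum>i<n. a i * X $$ (i, j) * b j)" by (rule sum.swap)
  also have "\<dots> = (\<Sum>j<n. \<Sum>i<n. - (X $$ (j, i) * a i * b j))"
  proof (intro sum.cong refl)
    fix j i assume "j \<in> {..<n}" "i \<in> {..<n}"
    then show "a i * X $$ (i, j) * b j = - (X $$ (j, i) * a i * b j)" using skew_entry[OF X, of j i] by simp
  qed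
  also have "\<dots> = - dot n (mvec n X a) b"
    by (simp add: dot_def mvec_def sum_negf sum_distrib_right)
  finally show ?thesis .
qed

lemma dot_mvec_self: "X \<in> skew_mats n ==> dot n a (mvec n X a) = 0"
  using dot_mvec_skew[of X n a a] dot_commute[of n a "mvec n X a"] by simp

lemma left_mvec_skew:
  assumes X: "X \<in> skew_mats n" and j: "j < n"
  shows "(\<Sum>k<n. a k * X $$ (k, j)) = - mvec n X a j"
  unfolding mvec_def sum_negf[symmetric]
proof (rule sum.cong)
  fix k assume "k \<in> {..<n}"
  then show "a k * X $$ (k, j) = - (X $$ (j, k) * a k)" using skew_entry[OF X j, of k] by simp
qed simp

lemma wedge_mult_skew:
  assumes Z: "Z \<in> skew_mats n" and ij: "i < n" "j < n"
  shows "(wedge n a b * Z) $$ (i, j) = b i * mvec n Z a j - a i * mvec n Z b j"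
proof -
  have "(wedge n a b * Z) $$ (i, j) = (\<Sum>k<n. a i * (b k * Z $$ (k, j)) - b i * (a k * Z $$ (k, j)))"
    unfolding index_mult_sum[OF wedge_carrier skew_carrier[OF Z] ij] using ij
    by (intro sum.cong) (auto simp: algebra_simps)
  also have "\<dots> = a i * (\<Sum>k<n. b k * Z $$ (k, j)) - b i * (\<Sum>k<n. a k * Z $$ (k, j))"
    by (simp add: sum_subtractf sum_distrib_left)
  finally show ?thesis by (simp add: left_mvec_skew[OF Z ij(2)])
qed

lemma mult_wedge:
  assumes Z: "Z \<in> carrier_mat n n" and ij: "i < n" "j < n"
  shows "(Z * wedge n a b) $$ (i, j) = mvec n Z a i * b j - mvec n Z b i * a j"
proof -
  have "(Z * wedge n a b) $$ (i, j) = (\<Sum>k<n. Z $$ (i, k) * a k * b j - Z $$ (i, k) * b k * a j)"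
    unfolding index_mult_sum[OF Z wedge_carrier ij] using ij
    by (intro sum.cong) (auto simp: algebra_simps)
  then show ?thesis by (simp add: mvec_def sum_subtractf sum_distrib_right)
qed

lemma mvec_wedge: "i < n ==> mvec n (wedge n a b) c i = a i * dot n b c - b i * dot n a c"
  by (simp add: mvec_def dot_def sum_distrib_left flip: sum_subtractf) (intro sum.cong, auto simp: algebra_simps)

text \<open>Only the compression of \<open>Z\<close> to the plane of \<open>a\<close> and
  \<open>b\<close> matters, and the skew maps of a plane form a line.\<close>

lemma wedge_sandwich:
  assumes Z: "Z \<in> skew_mats n"
  shows "wedge n a b * Z * wedge n a b = dot n b (mvec n Z a) \<cdot>\<^sub>m wedge n a b"
proof (rule eq_squareI[where n = n])
  fix i j :: nat assume ij: "i < n" "j < n"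
  have c: "wedge n a b * Z \<in> carrier_mat n n" using skew_carrier[OF Z] by (rule mult_carrier_mat[OF wedge_carrier])
  have m: "mvec n (wedge n a b * Z) x i = b i * dot n (mvec n Z a) x - a i * dot n (mvec n Z b) x" for x
  proof -
    have "mvec n (wedge n a b * Z) x i = (\<Sum>j<n. (b i * mvec n Z a j - a i * mvec n Z b j) * x j)"
      unfolding mvec_def[of n "wedge n a b * Z"] using wedge_mult_skew[OF Z ij(1)] by (intro sum.cong) auto
    then show ?thesis by (simp add: dot_def algebra_simps sum_subtractf sum_distrib_left)
  qed
  have 1: "dot n (mvec n Z a) a = 0" "dot n (mvec n Z b) b = 0" "dot n (mvec n Z b) a = - dot n b (mvec n Z a)"
    using dot_mvec_self[OF Z] dot_mvec_skew[OF Z, of b a] by (simp_all add: dot_commute[of n _ a] dot_commute[of n _ b])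
  show "(wedge n a b * Z * wedge n a b) $$ (i, j) = (dot n b (mvec n Z a) \<cdot>\<^sub>m wedge n a b) $$ (i, j)"
    unfolding mult_wedge[OF c ij] m using ij 1 dot_commute[of n b "mvec n Z a"] by (simp add: algebra_simps)
qed (use skew_carrier[OF Z] in auto)

lemma mvec_cong: "(\<And>j. j < n ==> a j = b j) ==> mvec n X a i = mvec n X b i"
  by (simp add: mvec_def)

lemma wedge_square_index:
  assumes on: "dot n a a = 1" "dot n b b = 1" "dot n a b = 0" and ij: "i < n" "j < n"
  shows "(wedge n a b * wedge n a b) $$ (i, j) = - (a i * a j + b i * b j)"
  unfolding mult_wedge[OF wedge_carrier ij] mvec_wedge[OF ij(1)]
  using on dot_commute[of n b a] by (simp add: algebra_simps)

lemma unit_bivector_cube: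
  assumes "X \<in> unit_bivectors n"
  shows "X * X * X = - X"
proof -
  obtain a b where X: "X = wedge n a b" and on: "dot n a a = 1" "dot n b b = 1" "dot n a b = 0"
    using assms by (auto simp: unit_bivectors_def)
  have "dot n b (mvec n X a) = dot n b (\<lambda>i. - b i)"
    unfolding X by (rule dot_cong) (auto simp: mvec_wedge on dot_commute[of n b a])
  then have "dot n b (mvec n X a) = -1" by (simp add: dot_simps on)
  moreover have "X * X * X = dot n b (mvec n X a) \<cdot>\<^sub>m X" unfolding X by (rule wedge_sandwich[OF wedge_skew])
  ultimately show ?thesis by (auto simp: X intro!: eq_matI)
qed

definition sqnorm :: "nat \<Rightarrow> real mat \<Rightarrow> real" where
  "sqnorm n X = (\<Sum>i<n. \<Sum>j<n. (X $$ (i, j))\<^sup>2)"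

lemma sum_wedge:
  assumes "Y \<in> skew_mats n"
  shows "(\<Sum>i<n. \<Sum>j<n. Y $$ (i, j) * wedge n a b $$ (i, j)) = 2 * dot n a (mvec n Y b)"
proof -
  have "(\<Sum>i<n. \<Sum>j<n. Y $$ (i, j) * wedge n a b $$ (i, j)) =
      (\<Sum>i<n. a i * (\<Sum>j<n. Y $$ (i, j) * b j) - b i * (\<Sum>j<n. Y $$ (i, j) * a j))"
    unfolding sum_distrib_left sum_subtractf[symmetric] by (intro sum.cong) (auto simp: algebra_simps)
  also have "\<dots> = dot n a (mvec n Y b) - dot n b (mvec n Y a)"
    by (simp add: sum_subtractf dot_def mvec_def)
  finally show ?thesis using dot_mvec_skew[OF assms, of b a] dot_commute[of n a "mvec n Y b"] by simp
qed

lemma unit_bivector_sqnorm: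
  assumes "X \<in> unit_bivectors n"
  shows "sqnorm n X = 2"
proof -
  obtain a b where X: "X = wedge n a b" and on: "dot n a a = 1" "dot n b b = 1" "dot n a b = 0"
    using assms by (auto simp: unit_bivectors_def)
  have "sqnorm n X = (\<Sum>i<n. \<Sum>j<n. X $$ (i, j) * wedge n a b $$ (i, j))"
    by (simp add: X sqnorm_def power2_eq_square)
  also have "\<dots> = 2 * dot n a (mvec n X b)" by (rule sum_wedge[OF unit_bivectors_skew[OF assms]])
  also have "dot n a (mvec n X b) = dot n a a"
    unfolding X by (rule dot_cong) (auto simp: mvec_wedge on)
  finally show ?thesis using on by simp
qed

lemma mvec_mult:
  assumes "X \<in> carrier_mat n n" "Y \<in> carrier_mat n n" "i < n"
  shows "mvec n (X * Y) v i = mvec n X (mvec n Y v) i"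
proof -
  have "mvec n (X * Y) v i = (\<Sum>j<n. \<Sum>k<n. X $$ (i, k) * Y $$ (k, j) * v j)"
    unfolding mvec_def using index_mult_sum[OF assms] by (simp add: sum_distrib_right)
  also have "\<dots> = mvec n X (mvec n Y v) i"
    unfolding mvec_def sum_distrib_left by (subst sum.swap) (simp add: mult.assoc)
  finally show ?thesis .
qed

text \<open>The cube equation makes -X^2 an orthogonal projector, of trace 2 by the norm condition.
  A unit vector \<open>v\<close> in its range and \<open>b = - X v\<close> span a plane whose
  bivector has the same norm as \<open>X\<close>; their inner product is also 2, so the difference
  has norm 0.\<close>

lemma unit_bivectorI:
  assumes X: "X \<in> skew_mats n" and cube: "X * X * X = - X" and norm: "sqnorm n X = 2"
  shows "X \<in> unit_bivectors n"
proof -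
  note Xc = skew_carrier[OF X]
  have XXc: "X * X \<in> carrier_mat n n" using Xc by simp
  define P where "P i j = - (X * X) $$ (i, j)" for i j
  have P': "P i j = (\<Sum>k<n. X $$ (i, k) * X $$ (j, k))" if "i < n" "j < n" for i j
  proof -
    have "(X * X) $$ (i, j) = (\<Sum>k<n. - (X $$ (i, k) * X $$ (j, k)))"
      unfolding index_mult_sum[OF Xc Xc that]
    proof (rule sum.cong)
      fix k assume "k \<in> {..<n}"
      then show "X $$ (i, k) * X $$ (k, j) = - (X $$ (i, k) * X $$ (j, k))" using skew_entry[OF X that(2), of k] by simp
    qed simp
    then show ?thesis by (simp add: P_def sum_negf)
  qed
  have sym: "P i j = P j i" if "i < n" "j < n" for i j
    using P'[OF that] P'[OF that(2,1)] by (simp add: mult.commute)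
  have "X * X * (X * X) = (X * X * X) * X" using Xc by (simp add: assoc_mult_mat[of _ n n _ n _ n])
  also have "\<dots> = - (X * X)" unfolding cube using Xc by simp
  finally have X4: "X * X * (X * X) = - (X * X)" .
  have idem: "(\<Sum>j<n. P i j * P j k) = P i k" if "i < n" "k < n" for i k
    using arg_cong[OF X4, of "\<lambda>M. M $$ (i, k)"] index_mult_sum[OF XXc XXc that] that Xc by (simp add: P_def)
  have "(\<Sum>i<n. P i i) = sqnorm n X" unfolding sqnorm_def using P' by (intro sum.cong) (auto simp: power2_eq_square)
  then have tr: "(\<Sum>i<n. P i i) > 0" using norm by simp
  obtain v where v: "(\<Sum>i<n. v i * v i) = 1" "\<And>i. i < n ==> (\<Sum>j<n. P i j * v j) = v i"
    using peel_unit_vector[of n P] sym idem tr by blast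
  define b where "b i = - mvec n X v i" for i
  have Pv: "mvec n X (mvec n X v) i = - v i" if i: "i < n" for i
  proof -
    have "mvec n X (mvec n X v) i = mvec n (X * X) v i" using mvec_mult[OF Xc Xc i] by simp
    also have "\<dots> = (\<Sum>j<n. - (P i j * v j))" by (simp add: mvec_def P_def)
    finally show ?thesis using v(2)[OF i] by (simp add: sum_negf)
  qed
  have Xb: "mvec n X b i = v i" if "i < n" for i
    using Pv[OF that] by (simp add: b_def mvec_def sum_negf)
  have vv: "dot n v v = 1" using v(1) by (simp add: dot_def)
  have vb: "dot n v b = 0" using dot_mvec_self[OF X, of v] by (simp add: b_def[abs_def] dot_simps)
  have vXb: "dot n v (mvec n X b) = 1"
    using dot_cong[of n v v "mvec n X b" v] Xb vv by simp
  have bb: "dot n b b = 1"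
    using vXb dot_mvec_skew[OF X, of v b] by (simp add: b_def[abs_def] dot_simps)
  let ?W = "wedge n v b"
  have W: "?W \<in> unit_bivectors n" using vv bb vb unfolding unit_bivectors_def by blast
  have "(\<Sum>i<n. \<Sum>j<n. (X $$ (i, j) - ?W $$ (i, j))\<^sup>2) =
      sqnorm n X + sqnorm n ?W - 2 * (\<Sum>i<n. \<Sum>j<n. X $$ (i, j) * ?W $$ (i, j))"
    unfolding sqnorm_def sum_distrib_left sum.distrib[symmetric] sum_subtractf[symmetric]
    by (intro sum.cong) (auto simp: power2_eq_square algebra_simps)
  also have "\<dots> = 0" unfolding norm unit_bivector_sqnorm[OF W] sum_wedge[OF X] vXb by simp
  finally have z: "(\<Sum>i<n. \<Sum>j<n. (X $$ (i, j) - ?W $$ (i, j))\<^sup>2) = 0" .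
  have "X $$ (i, j) = ?W $$ (i, j)" if ij: "i < n" "j < n" for i j
  proof -
    have "(\<Sum>j<n. (X $$ (i, j) - ?W $$ (i, j))\<^sup>2) = 0"
      using z ij by (subst (asm) sum_nonneg_eq_0_iff) (auto intro: sum_nonneg)
    then have "(X $$ (i, j) - ?W $$ (i, j))\<^sup>2 = 0"
      using ij by (subst (asm) sum_nonneg_eq_0_iff) auto
    then show ?thesis by simp
  qed
  then have "X = ?W" using Xc by (intro eq_matI) auto
  then show ?thesis using W by simp
qed

section \<open>Adjacency of unit bivectors\<close>

text \<open>Formulated through the linear structure and \<open>unit_bivectors\<close> alone, so that
  a linear map preserving unit bivectors transports it.\<close>

definition adjacent :: "nat \<Rightarrow> real mat \<Rightarrow> real mat \<Rightarrow> bool" where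
  "adjacent n X Y \<longleftrightarrow> (\<forall>c s. c\<^sup>2 + s\<^sup>2 = 1 --> c \<cdot>\<^sub>m X + s \<cdot>\<^sub>m Y \<in> unit_bivectors n)"

lemma one_smult_mat: "(1 :: real) \<cdot>\<^sub>m X = X" by (rule eq_matI) auto
lemma zero_smult_add: "X \<in> carrier_mat n n ==> Y \<in> carrier_mat n n ==> Y + (0 :: real) \<cdot>\<^sub>m X = Y" "X \<in> carrier_mat n n ==> Y \<in> carrier_mat n n ==> (0 :: real) \<cdot>\<^sub>m X + Y = Y"
  by (auto intro!: eq_matI)

lemma adjacent_unit:
  assumes "adjacent n X Y" "X \<in> carrier_mat n n" "Y \<in> carrier_mat n n"
  shows "X \<in> unit_bivectors n" "Y \<in> unit_bivectors n"
  using assms(1)[unfolded adjacent_def, rule_format, of 1 0] assms(1)[unfolded adjacent_def, rule_format, of 0 1]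
    zero_smult_add[OF assms(2,3)] zero_smult_add[OF assms(3,2)] by (simp_all add: one_smult_mat)

text \<open>Polarisation of the cube equation at (x + y)/sqrt 2 and (x - y)/sqrt 2. Multiplied by
  sqrt 2 these points satisfy w^3 = -2 w, and the difference of the two equations keeps the terms of
  odd degree in \<open>y\<close>.\<close>

lemma double_cube_identity:
  fixes x y :: "'a::real_algebra_1"
  assumes "(x + y) * (x + y) * (x + y) = - (2 *\<^sub>R (x + y))" "(x - y) * (x - y) * (x - y) = - (2 *\<^sub>R (x - y))"
    and "y * y * y = - y" "x * y * x = 0"
  shows "x * x * y + y * (x * x) = - y"
proof -
  have "(x + y) * (x + y) * (x + y) - (x - y) * (x - y) * (x - y) =
      2 *\<^sub>R (x * x * y + y * (x * x)) + 2 *\<^sub>R (x * y * x) + 2 *\<^sub>R (y * y * y)"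
    by (simp add: algebra_simps scaleR_2)
  then have "2 *\<^sub>R (x * x * y + y * (x * x)) = 2 *\<^sub>R (- y)"
    unfolding assms by (simp add: algebra_simps scaleR_2) (metis add.right_inverse)
  moreover have "2 *\<^sub>R u = 2 *\<^sub>R v ==> u = v" for u v :: 'a by simp
  ultimately show ?thesis by blast
qed

lemma emb_inj: "X \<in> carrier_mat n n ==> Y \<in> carrier_mat n n ==> emb X = emb Y ==> X = Y"
  using of_unital_emb[of X n] of_unital_emb[of Y n] by metis

lemma emb_zero: "emb (0\<^sub>m n n) = 0"
proof -
  have "emb (0\<^sub>m n n) = 0 *\<^sub>R emb (0\<^sub>m n n)" by (subst emb_smult[symmetric]) (rule arg_cong[of _ _ emb], auto)
  then show ?thesis by simp
qed

lemma emb_uminus: "emb (- X) = - emb X"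
proof -
  have "- X = (-1) \<cdot>\<^sub>m X" by (rule eq_matI) auto
  then show ?thesis by (simp add: emb_smult)
qed

text \<open>The norm at the point halfway along the circle gives orthogonality, hence X Y X = 0 by
  \<open>wedge_sandwich\<close>. With the projector p = -X^2 onto the plane of \<open>a\<close> and
  \<open>b\<close>, the polarised cube equation then reads Y = p Y + Y p, which is the expansion of
  \<open>Y\<close> in terms of its values on \<open>a\<close> and \<open>b\<close>.\<close>

lemma adjacent_orthogonal:
  assumes adj: "adjacent n (wedge n a b) Y" and Y: "Y \<in> skew_mats n" and on: "dot n a a = 1" "dot n b b = 1" "dot n a b = 0"
  shows "dot n a (mvec n Y b) = 0"
    and "\<And>i j. i < n ==> j < n ==> Y $$ (i, j) = mvec n Y a i * a j - a i * mvec n Y a j + mvec n Y b i * b j - b i * mvec n Y b j"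
proof -
  let ?X = "wedge n a b"
  note Yc = skew_carrier[OF Y]
  have X1: "?X \<in> unit_bivectors n" using on unfolding unit_bivectors_def by blast
  have Y1: "Y \<in> unit_bivectors n" using adjacent_unit[OF adj wedge_carrier Yc] by blast
  define q :: real where "q = 1 / sqrt 2"
  have q: "q * q = 1 / 2" "q\<^sup>2 = 1 / 2" "q \<noteq> 0" by (simp_all add: q_def power_divide)
  have Zp: "q \<cdot>\<^sub>m ?X + q \<cdot>\<^sub>m Y \<in> unit_bivectors n" and Zm: "q \<cdot>\<^sub>m ?X + (- q) \<cdot>\<^sub>m Y \<in> unit_bivectors n"
    using adj unfolding adjacent_def by (auto simp: q)
  have "sqnorm n (q \<cdot>\<^sub>m ?X + q \<cdot>\<^sub>m Y) = q\<^sup>2 * sqnorm n ?X + q\<^sup>2 * sqnorm n Y + 2 * q\<^sup>2 * (\<Sum>i<n. \<Sum>j<n. Y $$ (i, j) * ?X $$ (i, j))"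
    unfolding sqnorm_def sum_distrib_left sum.distrib[symmetric] using Yc
    by (intro sum.cong) (auto simp: power2_eq_square algebra_simps)
  then show 0: "dot n a (mvec n Y b) = 0"
    unfolding unit_bivector_sqnorm[OF Zp] unit_bivector_sqnorm[OF X1] unit_bivector_sqnorm[OF Y1] sum_wedge[OF Y] q(2) by simp
  have bYa: "dot n b (mvec n Y a) = 0" using 0 dot_mvec_skew[OF Y, of b a] dot_commute[of n a "mvec n Y b"] by simp
  have cz: "Z * Z * Z = - Z ==> Z \<in> carrier_mat n n ==> emb Z * emb Z * emb Z = - emb Z" for Z
    by (simp add: emb_mult[of _ n n _ n, symmetric] emb_uminus)
  let ?x = "emb ?X" and ?y = "emb Y"
  have Zpc: "q \<cdot>\<^sub>m ?X + q \<cdot>\<^sub>m Y \<in> carrier_mat n n" "q \<cdot>\<^sub>m ?X + (- q) \<cdot>\<^sub>m Y \<in> carrier_mat n n" using Yc by auto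
  have ep: "emb (q \<cdot>\<^sub>m ?X + r \<cdot>\<^sub>m Y) = q *\<^sub>R ?x + r *\<^sub>R ?y" for r
    by (subst emb_add[of _ n n]) (use Yc in \<open>auto simp: emb_smult\<close>)
  have sc: "u * u * u = - (2 *\<^sub>R u)" if "q *\<^sub>R u * (q *\<^sub>R u) * (q *\<^sub>R u) = - (q *\<^sub>R u)" for u :: endo
  proof -
    have "q *\<^sub>R ((q * q) *\<^sub>R (u * u * u)) = q *\<^sub>R (- u)" using that by simp
    then have "(q * q) *\<^sub>R (u * u * u) = - u" using q(3) by (simp only: scaleR_cancel_left simp_thms)
    then have "2 *\<^sub>R ((q * q) *\<^sub>R (u * u * u)) = 2 *\<^sub>R (- u)" by simp
    then show ?thesis by (simp add: q(1))
  qed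
  have "?x * ?x * ?y + ?y * (?x * ?x) = - ?y"
  proof (rule double_cube_identity)
    show "(?x + ?y) * (?x + ?y) * (?x + ?y) = - (2 *\<^sub>R (?x + ?y))"
      using cz[OF unit_bivector_cube[OF Zp] Zpc(1)] unfolding ep by (intro sc) (simp only: scaleR_add_right)
    show "(?x - ?y) * (?x - ?y) * (?x - ?y) = - (2 *\<^sub>R (?x - ?y))"
      using cz[OF unit_bivector_cube[OF Zm] Zpc(2)] unfolding ep by (intro sc) (simp add: scaleR_diff_right)
    show "?y * ?y * ?y = - ?y" by (rule cz[OF unit_bivector_cube[OF Y1] Yc])
    have "?X * Y * ?X = 0\<^sub>m n n" unfolding wedge_sandwich[OF Y] bYa by (auto intro!: eq_matI)
    then have "emb (?X * Y * ?X) = 0" by (simp add: emb_zero)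
    then show "?x * ?y * ?x = 0"
      by (simp add: emb_mult[OF mult_carrier_mat[OF wedge_carrier Yc] wedge_carrier] emb_mult[OF wedge_carrier Yc])
  qed
  then have "emb (?X * ?X * Y + Y * (?X * ?X)) = emb (- Y)"
    by (simp add: emb_uminus emb_add[OF mult_carrier_mat[OF mult_carrier_mat[OF wedge_carrier wedge_carrier] Yc]
      mult_carrier_mat[OF Yc mult_carrier_mat[OF wedge_carrier wedge_carrier]]]
      emb_mult[OF mult_carrier_mat[OF wedge_carrier wedge_carrier] Yc]
      emb_mult[OF Yc mult_carrier_mat[OF wedge_carrier wedge_carrier]] emb_mult[OF wedge_carrier wedge_carrier])
  then have e: "?X * ?X * Y + Y * (?X * ?X) = - Y"
    using Yc by (intro emb_inj[of _ n]) auto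
  fix i j assume ij: "i < n" "j < n"
  have XXc: "?X * ?X \<in> carrier_mat n n" by (rule mult_carrier_mat[OF wedge_carrier wedge_carrier])
  have "(?X * ?X * Y) $$ (i, j) = (\<Sum>k<n. - (a i * (a k * Y $$ (k, j))) - b i * (b k * Y $$ (k, j)))"
    unfolding index_mult_sum[OF XXc Yc ij]
  proof (intro sum.cong refl)
    fix k assume "k \<in> {..<n}"
    then have k: "k < n" by simp
    show "(?X * ?X) $$ (i, k) * Y $$ (k, j) = - (a i * (a k * Y $$ (k, j))) - b i * (b k * Y $$ (k, j))"
      unfolding wedge_square_index[OF on ij(1) k] by (simp add: algebra_simps)
  qed
  also have "\<dots> = - (a i * (\<Sum>k<n. a k * Y $$ (k, j))) - b i * (\<Sum>k<n. b k * Y $$ (k, j))"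
    by (simp add: sum_subtractf sum_negf sum_distrib_left)
  finally have 1: "(?X * ?X * Y) $$ (i, j) = a i * mvec n Y a j + b i * mvec n Y b j"
    by (simp add: left_mvec_skew[OF Y ij(2)])
  have "(Y * (?X * ?X)) $$ (i, j) = (\<Sum>k<n. - (Y $$ (i, k) * a k * a j) - Y $$ (i, k) * b k * b j)"
    unfolding index_mult_sum[OF Yc XXc ij]
  proof (intro sum.cong refl)
    fix k assume "k \<in> {..<n}"
    then have k: "k < n" by simp
    show "Y $$ (i, k) * (?X * ?X) $$ (k, j) = - (Y $$ (i, k) * a k * a j) - Y $$ (i, k) * b k * b j"
      unfolding wedge_square_index[OF on k ij(2)] by (simp add: algebra_simps)
  qed
  then have 2: "(Y * (?X * ?X)) $$ (i, j) = - (mvec n Y a i * a j) - mvec n Y b i * b j"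
    by (simp add: sum_subtractf sum_negf mvec_def sum_distrib_right)
  have "(?X * ?X * Y + Y * (?X * ?X)) $$ (i, j) = (- Y) $$ (i, j)" unfolding e ..
  then have "(?X * ?X * Y) $$ (i, j) + (Y * (?X * ?X)) $$ (i, j) = - Y $$ (i, j)"
    using ij Yc by (simp del: index_mult_mat(1))
  then show "Y $$ (i, j) = mvec n Y a i * a j - a i * mvec n Y a j + mvec n Y b i * b j - b i * mvec n Y b j"
    unfolding 1 2 by simp
qed

text \<open>By \<open>adjacent_orthogonal\<close>, \<open>Y\<close> is the sum of the wedges of
  \<open>a\<close> with \<open>c\<close> and of \<open>b\<close> with \<open>d\<close>, where
  \<open>c\<close> and \<open>d\<close> are orthogonal to the plane. The cube equation makes
  \<open>c\<close> and \<open>d\<close> parallel, so one vector \<open>u\<close> can be factored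
  out.\<close>

lemma adjacent_common_vector:
  assumes adj: "adjacent n (wedge n a b) Y" and Y: "Y \<in> skew_mats n" and on: "dot n a a = 1" "dot n b b = 1" "dot n a b = 0"
  shows "\<exists>l m u. l\<^sup>2 + m\<^sup>2 = 1 \<and> dot n u u = 1 \<and> dot n a u = 0 \<and> dot n b u = 0 \<and> Y = wedge n (\<lambda>i. l * a i + m * b i) u"
proof -
  note Yc = skew_carrier[OF Y]
  have Y1: "Y \<in> unit_bivectors n" using adjacent_unit[OF adj wedge_carrier Yc] by blast
  define c d where "c i = - mvec n Y a i" and "d i = - mvec n Y b i" for i
  have Ye: "Y $$ (i, j) = a i * c j - c i * a j + b i * d j - d i * b j" if "i < n" "j < n" for i j
    using adjacent_orthogonal(2)[OF adj Y on that] by (simp add: c_def d_def)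
  have ad: "dot n a d = 0" using adjacent_orthogonal(1)[OF adj Y on] by (simp add: d_def[abs_def] dot_simps)
  have bc: "dot n b c = 0"
    using adjacent_orthogonal(1)[OF adj Y on] dot_mvec_skew[OF Y, of b a] dot_commute[of n a "mvec n Y b"] by (simp add: c_def[abs_def] dot_simps)
  have ac: "dot n a c = 0" and bd: "dot n b d = 0"
    using dot_mvec_self[OF Y] by (simp_all add: c_def[abs_def] d_def[abs_def] dot_simps)
  have ba: "dot n b a = 0" using on dot_commute[of n a b] by simp
  have mv: "mvec n Y x i = a i * dot n c x - c i * dot n a x + b i * dot n d x - d i * dot n b x" if "i < n" for x i
  proof -
    have "mvec n Y x i = (\<Sum>j<n. a i * (c j * x j) - c i * (a j * x j) + b i * (d j * x j) - d i * (b j * x j))"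
      unfolding mvec_def
    proof (rule sum.cong)
      fix j assume "j \<in> {..<n}"
      then have j: "j < n" by simp
      show "Y $$ (i, j) * x j = a i * (c j * x j) - c i * (a j * x j) + b i * (d j * x j) - d i * (b j * x j)"
        unfolding Ye[OF that j] by (simp add: algebra_simps)
    qed simp
    then show ?thesis by (simp add: dot_def sum.distrib sum_subtractf sum_distrib_left)
  qed
  have "sqnorm n Y = (\<Sum>i<n. \<Sum>j<n. Y $$ (i, j) * wedge n a c $$ (i, j)) + (\<Sum>i<n. \<Sum>j<n. Y $$ (i, j) * wedge n b d $$ (i, j))"
    unfolding sqnorm_def sum.distrib[symmetric]
  proof (intro sum.cong refl)
    fix i j assume "i \<in> {..<n}" "j \<in> {..<n}"
    then have ij: "i < n" "j < n" by auto
    have "Y $$ (i, j) = wedge n a c $$ (i, j) + wedge n b d $$ (i, j)" using Ye[OF ij] ij by simp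
    then show "(Y $$ (i, j))\<^sup>2 = Y $$ (i, j) * wedge n a c $$ (i, j) + Y $$ (i, j) * wedge n b d $$ (i, j)"
      by (simp only: power2_eq_square distrib_left[symmetric])
  qed
  also have "\<dots> = 2 * dot n a (mvec n Y c) + 2 * dot n b (mvec n Y d)" unfolding sum_wedge[OF Y] ..
  also have "dot n a (mvec n Y c) = - dot n (mvec n Y a) c" by (rule dot_mvec_skew[OF Y])
  also have "\<dots> = dot n c c" by (simp add: c_def[abs_def] dot_simps)
  also have "dot n b (mvec n Y d) = - dot n (mvec n Y b) d" by (rule dot_mvec_skew[OF Y])
  also have "\<dots> = dot n d d" by (simp add: d_def[abs_def] dot_simps)
  finally have ccdd: "dot n c c + dot n d d = 1" unfolding unit_bivector_sqnorm[OF Y1] by simp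
  \<comment> \<open>The cube equation of \<open>Y\<close> applied to \<open>a\<close>. Together with
    \<open>ccdd\<close> it says that (d.d) c = (c.d) d.\<close>
  have cc: "c i = c i * dot n c c + d i * dot n c d" if i: "i < n" for i
  proof -
    have Ya: "mvec n Y a j = - c j" for j by (simp add: c_def)
    have Yc': "mvec n Y c j = a j * dot n c c + b j * dot n c d" if "j < n" for j
      using mv[OF that, of c] ac bc dot_commute[of n d c] by simp
    have Yab: "mvec n Y (\<lambda>j. a j * dot n c c + b j * dot n c d) i = - (c i * dot n c c) - d i * dot n c d"
      using mv[OF i] by (simp add: dot_simps on ba dot_commute[of n c a] dot_commute[of n c b] dot_commute[of n d a] dot_commute[of n d b] ac bc ad bd)
    have YYc: "Y * Y \<in> carrier_mat n n" using Yc by simp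
    have "mvec n (Y * Y * Y) a i = mvec n (Y * Y) (mvec n Y a) i" by (rule mvec_mult[OF YYc Yc i])
    also have "\<dots> = mvec n Y (mvec n Y (mvec n Y a)) i" by (rule mvec_mult[OF Yc Yc i])
    also have "\<dots> = mvec n Y (\<lambda>j. - mvec n Y c j) i"
      by (rule mvec_cong) (simp add: mvec_def[of n Y "mvec n Y a"] mvec_def[of n Y c] Ya sum_negf)
    also have "\<dots> = - mvec n Y (\<lambda>j. a j * dot n c c + b j * dot n c d) i"
      unfolding mvec_def[of n Y "\<lambda>j. - mvec n Y c j"] mvec_def[of n Y "\<lambda>j. a j * dot n c c + b j * dot n c d"] sum_negf[symmetric]
    proof (intro sum.cong refl)
      fix j assume "j \<in> {..<n}"
      then show "Y $$ (i, j) * - mvec n Y c j = - (Y $$ (i, j) * (a j * dot n c c + b j * dot n c d))"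
        using Yc'[of j] by (simp only: lessThan_iff mult_minus_right)
    qed
    finally have "mvec n (- Y) a i = c i * dot n c c + d i * dot n c d"
      unfolding unit_bivector_cube[OF Y1] Yab by simp
    moreover have "mvec n (- Y) a i = - mvec n Y a i" using Yc i by (simp add: mvec_def sum_negf)
    ultimately have "- mvec n Y a i = c i * dot n c c + d i * dot n c d" by linarith
    then show ?thesis unfolding c_def[of i, symmetric] .
  qed
  show ?thesis
  proof (cases "dot n d d = 0")
    case True
    then have d0: "d i = 0" if "i < n" for i using dot_self_eq_0 that by blast
    have "Y = wedge n (\<lambda>i. 1 * a i + 0 * b i) c"
      using Yc Ye d0 by (intro eq_matI) (auto simp: algebra_simps)
    then show ?thesis using ccdd True ac bc by (intro exI[of _ 1] exI[of _ 0] exI[of _ c]) auto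
  next
    case False
    define m where "m = sqrt (dot n d d)"
    define l where "l = dot n c d / m"
    define u where "u i = d i / m" for i
    have dd: "dot n d d > 0" using False dot_self_nonneg[of n d] by simp
    have m: "m > 0" "m * m = dot n d d" using dd by (simp_all add: m_def)
    have du: "d i = m * u i" for i using m by (simp add: u_def)
    have cu: "c i = l * u i" if "i < n" for i
    proof -
      have "c i * dot n d d = d i * dot n c d"
      proof -
        have "dot n d d = 1 - dot n c c" using ccdd by simp
        then have "c i * dot n d d = c i - c i * dot n c c" by (simp add: right_diff_distrib)
        then show ?thesis using cc[OF that] by linarith
      qed
      then show ?thesis using m dd by (simp add: l_def u_def field_simps)
    qed
    have u: "u = (\<lambda>i. (1 / m) * d i)" by (simp add: u_def fun_eq_iff)
    have uu: "dot n u u = 1" unfolding u dot_simps using m dd by (simp add: field_simps)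
    have "dot n c c = l * l"
      using dot_cong[of n c "\<lambda>i. l * u i" c "\<lambda>i. l * u i"] cu by (simp add: dot_simps uu)
    then have "l\<^sup>2 + m\<^sup>2 = 1" using ccdd m(2) by (simp add: power2_eq_square)
    moreover have "Y = wedge n (\<lambda>i. l * a i + m * b i) u"
      using Yc Ye cu du by (intro eq_matI) (auto simp: algebra_simps)
    moreover have "dot n a u = 0" "dot n b u = 0" unfolding u dot_simps using ad bd by auto
    ultimately show ?thesis using uu by blast
  qed
qed

section \<open>Unit bivectors recognised by their spectrum\<close>

lemma bracket_wedge:
  assumes Y: "Y \<in> skew_mats n"
  shows "bracket Y (wedge n a b) = wedge n (mvec n Y a) b + wedge n a (mvec n Y b)"
proof (rule eq_squareI[where n = n])
  fix i j :: nat assume ij: "i < n" "j < n"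
  have c: "wedge n a b * Y \<in> carrier_mat n n" using skew_carrier[OF Y] by (rule mult_carrier_mat[OF wedge_carrier])
  have "bracket Y (wedge n a b) $$ (i, j) = (Y * wedge n a b) $$ (i, j) - (wedge n a b * Y) $$ (i, j)"
    unfolding bracket_def by (rule index_minus_mat(1)) (use c ij in auto)
  then show "bracket Y (wedge n a b) $$ (i, j) = (wedge n (mvec n Y a) b + wedge n a (mvec n Y b)) $$ (i, j)"
    unfolding mult_wedge[OF skew_carrier[OF Y] ij] wedge_mult_skew[OF Y ij] using ij by simp
qed (use bracket_carrier[OF skew_carrier[OF Y] wedge_carrier, of a b] in auto)

lemma wedge_cong: "(\<And>i. i < n ==> a i = a' i) ==> (\<And>i. i < n ==> b i = b' i) ==> wedge n a b = wedge n a' b'"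
  by (rule eq_matI) auto

lemma bracket_add_right:
  assumes "Y \<in> carrier_mat n n" "A \<in> carrier_mat n n" "B \<in> carrier_mat n n"
  shows "bracket Y (A + B) = bracket Y A + bracket Y B"
proof (rule emb_inj[of _ n])
  show "emb (bracket Y (A + B)) = emb (bracket Y A + bracket Y B)"
    using assms by (simp add: emb_add[OF bracket_carrier bracket_carrier] emb_bracket[of _ n] emb_add[of _ n n] algebra_simps)
qed (use assms bracket_carrier in auto)

lemma bracket_smult_right:
  assumes "Y \<in> carrier_mat n n" "A \<in> carrier_mat n n"
  shows "bracket Y (c \<cdot>\<^sub>m A) = c \<cdot>\<^sub>m bracket Y A"
proof (rule emb_inj[of _ n])
  show "emb (bracket Y (c \<cdot>\<^sub>m A)) = emb (c \<cdot>\<^sub>m bracket Y A)"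
    using assms by (simp add: emb_bracket[of _ n] emb_smult algebra_simps)
qed (use assms bracket_carrier in auto)

text \<open>Real form of the eigenvector equation \<open>ad Y (u \<and> v) = \<i> (s + t) (u \<and> v)\<close> for
  \<open>Y u = \<i> s u\<close>, \<open>Y v = \<i> t v\<close>, where \<open>u = a + \<i> b\<close> and \<open>v = c + \<i> d\<close>.\<close>

lemma bracket_eigenpair:
  assumes Y: "Y \<in> skew_mats n"
    and a: "\<And>i. i < n ==> mvec n Y a i = - s * b i" and b: "\<And>i. i < n ==> mvec n Y b i = s * a i"
    and c: "\<And>i. i < n ==> mvec n Y c i = - t * d i" and d: "\<And>i. i < n ==> mvec n Y d i = t * c i"
  defines "R \<equiv> wedge n a c + (-1) \<cdot>\<^sub>m wedge n b d" and "J \<equiv> wedge n a d + wedge n b c"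
  shows "bracket Y R = - (s + t) \<cdot>\<^sub>m J" "bracket Y J = (s + t) \<cdot>\<^sub>m R"
proof -
  note Yc = skew_carrier[OF Y]
  have w: "bracket Y (wedge n x y) = wedge n x' y + wedge n x y'"
    if "\<And>i. i < n ==> mvec n Y x i = x' i" "\<And>i. i < n ==> mvec n Y y i = y' i" for x y x' y'
    unfolding bracket_wedge[OF Y] by (intro arg_cong2[of _ _ _ _ "(+)"] wedge_cong refl that)
  have "bracket Y R = bracket Y (wedge n a c) + (-1) \<cdot>\<^sub>m bracket Y (wedge n b d)"
    unfolding R_def using Yc by (simp add: bracket_add_right[of _ n] bracket_smult_right[of _ n])
  also have "\<dots> = (wedge n (\<lambda>i. - s * b i) c + wedge n a (\<lambda>i. - t * d i)) + (-1) \<cdot>\<^sub>m (wedge n (\<lambda>i. s * a i) d + wedge n b (\<lambda>i. t * c i))"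
    by (simp only: w[OF a c] w[OF b d])
  also have "\<dots> = - (s + t) \<cdot>\<^sub>m J"
    unfolding J_def by (rule eq_matI) (auto simp: algebra_simps)
  finally show "bracket Y R = - (s + t) \<cdot>\<^sub>m J" .
  have "bracket Y J = bracket Y (wedge n a d) + bracket Y (wedge n b c)"
    unfolding J_def using Yc by (simp add: bracket_add_right[of _ n])
  also have "\<dots> = (wedge n (\<lambda>i. - s * b i) d + wedge n a (\<lambda>i. t * c i)) + (wedge n (\<lambda>i. s * a i) c + wedge n b (\<lambda>i. - t * d i))"
    by (simp only: w[OF a d] w[OF b c])
  also have "\<dots> = (s + t) \<cdot>\<^sub>m R"
    unfolding R_def by (rule eq_matI) (auto simp: algebra_simps)
  finally show "bracket Y J = (s + t) \<cdot>\<^sub>m R" .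
qed

text \<open>The eigenvalues of \<open>X\<close> are i and -i, once each, and 0, so
  \<open>ad X\<close> has only the eigenvalues 0, i, -i on skew matrices. The proof is algebraic:
  after expansion all words reduce by X X X = -X and X Z X = \<mu> X.\<close>

lemma unit_bivector_bracket_power:
  assumes X: "X \<in> unit_bivectors n" and Z: "Z \<in> skew_mats n"
  shows "bracket X (bracket X (bracket X (bracket X Z))) = (-1) \<cdot>\<^sub>m bracket X (bracket X Z)"
proof (rule emb_inj[of _ n])
  note Xc = skew_carrier[OF unit_bivectors_skew[OF X]] and Zc = skew_carrier[OF Z]
  obtain \<mu> where \<mu>: "X * Z * X = \<mu> \<cdot>\<^sub>m X"
    using X wedge_sandwich[OF Z] by (auto simp: unit_bivectors_def)
  let ?x = "emb X" and ?z = "emb Z"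
  have "emb (X * Z * X) = ?x * ?z * ?x" "emb (X * X * X) = ?x * ?x * ?x"
    using emb_mult[OF Xc Zc] emb_mult[OF mult_carrier_mat[OF Xc Zc] Xc] emb_mult[OF Xc Xc] emb_mult[OF mult_carrier_mat[OF Xc Xc] Xc] by simp_all
  then have xzx: "?x * (?z * ?x) = \<mu> *\<^sub>R ?x" and xxx: "?x * (?x * ?x) = - ?x"
    using unit_bivector_cube[OF X] by (simp_all add: \<mu> emb_smult emb_uminus mult.assoc)
  have xxx': "?x * (?x * (?x * w)) = - (?x * w)" and xzx': "?x * (?z * (?x * w)) = \<mu> *\<^sub>R (?x * w)" for w
    using arg_cong[OF xxx, of "\<lambda>v. v * w"] arg_cong[OF xzx, of "\<lambda>v. v * w"] by (simp_all add: mult.assoc)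
  have b: "bracket X Z \<in> carrier_mat n n" "bracket X (bracket X Z) \<in> carrier_mat n n" "bracket X (bracket X (bracket X Z)) \<in> carrier_mat n n"
    using bracket_carrier[OF Xc] Zc by auto
  show "emb (bracket X (bracket X (bracket X (bracket X Z)))) = emb ((-1) \<cdot>\<^sub>m bracket X (bracket X Z))"
    unfolding emb_smult emb_bracket[OF Xc b(3)] emb_bracket[OF Xc b(2)] emb_bracket[OF Xc b(1)] emb_bracket[OF Xc Zc]
    by (simp add: algebra_simps xxx xxx' xzx xzx')
qed (use skew_carrier[OF unit_bivectors_skew[OF X]] skew_carrier[OF Z] in \<open>auto intro!: bracket_carrier smult_carrier_mat\<close>)

lemma skew_eigenpairs:
  assumes Y: "Y \<in> skew_mats n" and U: "U \<in> unitary_group n" and t: "cmat Y = idiag U t" and k: "k < n" and i: "i < n"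
  shows "mvec n Y (\<lambda>j. Re (U $$ (j, k))) i = - t k * Im (U $$ (i, k))"
    and "mvec n Y (\<lambda>j. Im (U $$ (j, k))) i = t k * Re (U $$ (i, k))"
proof -
  have Uc: "U \<in> carrier_mat n n" "mat_adjoint U \<in> carrier_mat n n" and UU: "mat_adjoint U * U = 1\<^sub>m n"
    using U mat_adjoint_carrier by (auto simp: unitary_group_def)
  note Yc = skew_carrier[OF Y]
  let ?D = "mat_diag n (\<lambda>k. \<i> * of_real (t k))"
  have D: "?D \<in> carrier_mat n n" by (simp add: mat_diag_def)
  have UD: "U * ?D \<in> carrier_mat n n" using Uc D by simp
  have "cmat Y * U = U * ?D * mat_adjoint U * U" unfolding t udiag_def unitary_dims[OF U] ..
  also have "\<dots> = U * ?D * (mat_adjoint U * U)" by (rule assoc_mult_mat[OF UD Uc(2,1)])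
  finally have e: "cmat Y * U = U * ?D" unfolding UU right_mult_one_mat[OF UD] .
  have "(cmat Y * U) $$ (i, k) = (\<Sum>j<n. complex_of_real (Y $$ (i, j)) * U $$ (j, k))"
    using Yc Uc i k by (subst index_mult_sum[of _ n n _ n]) auto
  moreover have "(U * ?D) $$ (i, k) = U $$ (i, k) * (\<i> * of_real (t k))"
    using i k by (simp add: mat_diag_mult_right[OF Uc(1)])
  ultimately have s: "(\<Sum>j<n. complex_of_real (Y $$ (i, j)) * U $$ (j, k)) = U $$ (i, k) * (\<i> * of_real (t k))" using e by simp
  show "mvec n Y (\<lambda>j. Re (U $$ (j, k))) i = - t k * Im (U $$ (i, k))"
    using arg_cong[OF s, of Re] by (simp add: mvec_def)
  show "mvec n Y (\<lambda>j. Im (U $$ (j, k))) i = t k * Re (U $$ (i, k))"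
    using arg_cong[OF s, of Im] by (simp add: mvec_def)
qed

lemma smult_mat_right_cancel:
  assumes X: "X \<in> carrier_mat n n" "X \<noteq> 0\<^sub>m n n" and e: "(r::real) \<cdot>\<^sub>m X = s \<cdot>\<^sub>m X"
  shows "r = s"
proof -
  obtain i j where ij: "i < n" "j < n" "X $$ (i, j) \<noteq> 0"
    using X by (auto simp: mat_eq_iff)
  have "(r \<cdot>\<^sub>m X) $$ (i, j) = (s \<cdot>\<^sub>m X) $$ (i, j)" using e by simp
  then show ?thesis using ij X(1) by simp
qed

lemma unitary_columns_orthogonal:
  assumes U: "U \<in> unitary_group n" and "k < n" "l < n"
  shows "(\<Sum>i<n. cnj (U $$ (i, k)) * U $$ (i, l)) = (if k = l then 1 else 0)"
proof -
  have Uc: "U \<in> carrier_mat n n" "mat_adjoint U \<in> carrier_mat n n" and UU: "mat_adjoint U * U = 1\<^sub>m n"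
    using U mat_adjoint_carrier by (auto simp: unitary_group_def)
  have "(mat_adjoint U * U) $$ (k, l) = (\<Sum>i<n. mat_adjoint U $$ (k, i) * U $$ (i, l))"
    by (rule index_mult_sum[OF Uc(2,1) assms(2,3)])
  then show ?thesis unfolding UU using assms Uc by (simp add: conjugate_complex_def)
qed

text \<open>\<open>R\<close> and \<open>J\<close> are the real and imaginary parts of the wedge of
  the eigenvectors in columns \<open>p\<close> and \<open>q\<close>. On their span
  \<open>ad Y\<close> acts as a quarter turn times \<open>h\<close>, so the relation on
  \<open>ad Y\<close> becomes one on \<open>h\<close> as soon as \<open>R\<close> or
  \<open>J\<close> is nonzero.\<close>

lemma eigenvalue_sum_fourth:
  assumes Y: "Y \<in> skew_mats n" and U: "U \<in> unitary_group n" and t: "cmat Y = idiag U t"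
    and ad: "\<And>Z. Z \<in> skew_mats n ==> bracket Y (bracket Y (bracket Y (bracket Y Z))) = (-1) \<cdot>\<^sub>m bracket Y (bracket Y Z)"
    and pq: "p < n" "q < n" "p \<noteq> q"
  shows "(t p + t q) ^ 4 = (t p + t q)\<^sup>2"
proof -
  note Yc = skew_carrier[OF Y]
  define a b c d where "a j = Re (U $$ (j, p))" and "b j = Im (U $$ (j, p))" and "c j = Re (U $$ (j, q))" and "d j = Im (U $$ (j, q))" for j
  define R J where "R = wedge n a c + (-1) \<cdot>\<^sub>m wedge n b d" and "J = wedge n a d + wedge n b c"
  define h where "h = t p + t q"
  have sk: "R \<in> skew_mats n" "J \<in> skew_mats n" unfolding R_def J_def by (intro skew_add skew_smult wedge_skew)+
  note C = skew_carrier[OF sk(1)] skew_carrier[OF sk(2)]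
  have ev: "mvec n Y a i = - t p * b i" "mvec n Y b i = t p * a i" "mvec n Y c i = - t q * d i" "mvec n Y d i = t q * c i" if "i < n" for i
    unfolding a_def b_def c_def d_def using skew_eigenpairs[OF Y U t pq(1) that] skew_eigenpairs[OF Y U t pq(2) that] by auto
  have br: "bracket Y R = (- h) \<cdot>\<^sub>m J" "bracket Y J = h \<cdot>\<^sub>m R"
    unfolding R_def J_def h_def using bracket_eigenpair[OF Y ev] by (simp_all only:) 
  have s: "bracket Y (x \<cdot>\<^sub>m R) = (- (x * h)) \<cdot>\<^sub>m J" "bracket Y (x \<cdot>\<^sub>m J) = (x * h) \<cdot>\<^sub>m R" for x
    unfolding bracket_smult_right[OF Yc C(1)] bracket_smult_right[OF Yc C(2)] br by (auto intro!: eq_matI)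
  have 2: "h ^ 4 \<cdot>\<^sub>m Z = h\<^sup>2 \<cdot>\<^sub>m Z" if "Z = R \<or> Z = J" for Z
  proof -
    have "bracket Y (bracket Y (bracket Y (bracket Y Z))) = h ^ 4 \<cdot>\<^sub>m Z \<and> (-1) \<cdot>\<^sub>m bracket Y (bracket Y Z) = h\<^sup>2 \<cdot>\<^sub>m Z"
      using that by (elim disjE) (auto simp: br s power2_eq_square power4_eq_xxxx mult.assoc intro!: eq_matI)
    note c = this
    have Z: "Z \<in> skew_mats n" using that sk by auto
    show ?thesis by (rule trans[OF conjunct1[OF c, symmetric] trans[OF ad[OF Z] conjunct2[OF c]]])
  qed
  \<comment> \<open>Otherwise the two columns would be proportional, against their
    orthonormality.\<close>
  have "R \<noteq> 0\<^sub>m n n \<or> J \<noteq> 0\<^sub>m n n"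
  proof (rule ccontr)
    assume "\<not> ?thesis"
    then have z: "R = 0\<^sub>m n n" "J = 0\<^sub>m n n" by auto
    have e: "U $$ (i, p) * U $$ (j, q) = U $$ (j, p) * U $$ (i, q)" if "i < n" "j < n" for i j
    proof -
      have "R $$ (i, j) = 0" "J $$ (i, j) = 0" using z that by auto
      then show ?thesis
        using that by (simp add: R_def J_def complex_eq_iff a_def b_def c_def d_def algebra_simps)
    qed
    have "U $$ (j, q) = 0" if j: "j < n" for j
    proof -
      have "U $$ (j, q) = (\<Sum>i<n. cnj (U $$ (i, p)) * U $$ (i, p)) * U $$ (j, q)"
        using unitary_columns_orthogonal[OF U pq(1,1)] by simp
      also have "\<dots> = (\<Sum>i<n. cnj (U $$ (i, p)) * (U $$ (j, p) * U $$ (i, q)))"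
        unfolding sum_distrib_right
      proof (intro sum.cong refl)
        fix i assume "i \<in> {..<n}"
        then show "cnj (U $$ (i, p)) * U $$ (i, p) * U $$ (j, q) = cnj (U $$ (i, p)) * (U $$ (j, p) * U $$ (i, q))"
          using e[of i j] j by (simp only: mult.assoc lessThan_iff)
      qed
      also have "\<dots> = U $$ (j, p) * (\<Sum>i<n. cnj (U $$ (i, p)) * U $$ (i, q))"
        unfolding sum_distrib_left by (intro sum.cong) (auto simp: mult_ac)
      also have "\<dots> = 0" unfolding unitary_columns_orthogonal[OF U pq(1,2)] using pq(3) by simp
      finally show ?thesis .
    qed
    then show False using unitary_columns_orthogonal[OF U pq(2,2)] by simp
  qed
  then show ?thesis using smult_mat_right_cancel[OF C(1)] smult_mat_right_cancel[OF C(2)] 2 unfolding h_def by blast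
qed

text \<open>If \<open>t p\<close> were at least 2, two further values would both be at most -1 and
  their sum at most -2; this needs a third index, and for two indices the values k and -k are a
  counterexample. As the sum is 0, both 1 and -1 occur, and any further value is squeezed to 0 by
  pairing it with each of them.\<close>

lemma integer_spectrum_pm_one:
  fixes t :: "nat \<Rightarrow> int"
  assumes n: "n \<ge> 3" and pair: "\<And>p q. p < n ==> q < n ==> p \<noteq> q ==> t p + t q \<in> {-1, 0, 1}"
    and sum: "(\<Sum>k<n. t k) = 0" and nz: "k < n" "t k \<noteq> 0"
  shows "(\<forall>k<n. t k \<in> {-1, 0, 1}) \<and> (\<Sum>k<n. (t k)\<^sup>2) = 2"
proof -
  have b: "\<bar>t p\<bar> \<le> 1" if p: "p < n" for p
  proof -
    have "\<exists>q r. q < n \<and> r < n \<and> q \<noteq> p \<and> r \<noteq> p \<and> q \<noteq> r"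
    proof -
      have "card ({..<n} - {p}) \<ge> 2" using n p by simp
      then obtain q r where "q \<in> {..<n} - {p}" "r \<in> {..<n} - {p}" "q \<noteq> r"
        using card_le_Suc0_iff_eq[of "{..<n} - {p}"] by (auto simp: numeral_2_eq_2)
      then show ?thesis by auto
    qed
    then obtain q r where qr: "q < n" "r < n" "q \<noteq> p" "r \<noteq> p" "q \<noteq> r" by blast
    show ?thesis using pair[OF p qr(1)] pair[OF p qr(2)] pair[OF qr(1,2)] qr by auto
  qed
  have "\<exists>p<n. t p = 1"
  proof (rule ccontr)
    assume "\<not> ?thesis"
    then have np: "t p \<le> 0" if "p < n" for p using b[OF that] that by (force simp: abs_le_iff)
    have "(\<Sum>k<n. - t k) = 0" using sum by (simp add: sum_negf)
    then have "- t k = 0" using np nz(1) by (subst (asm) sum_nonneg_eq_0_iff) auto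
    then show False using nz by simp
  qed
  then obtain p where p: "p < n" "t p = 1" by blast
  have "\<exists>q<n. t q = -1"
  proof (rule ccontr)
    assume "\<not> ?thesis"
    then have np: "t q \<ge> 0" if "q < n" for q using b[OF that] that by (force simp: abs_le_iff)
    then have "t p = 0" using sum p(1) by (subst (asm) sum_nonneg_eq_0_iff) auto
    then show False using p by simp
  qed
  then obtain q where q: "q < n" "t q = -1" by blast
  have "t r = 0" if "r < n" "r \<noteq> p" "r \<noteq> q" for r
    using pair[OF that(1) p(1) that(2)] pair[OF that(1) q(1) that(3)] p q by auto
  moreover have pq: "p \<noteq> q" using p q by auto
  ultimately have "(\<Sum>k<n. (t k)\<^sup>2) = (\<Sum>k\<in>{p, q}. (t k)\<^sup>2)"
    using p q by (intro sum.mono_neutral_right) auto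
  then have "(\<Sum>k<n. (t k)\<^sup>2) = 2" using pq p q by simp
  moreover have "t r \<in> {-1, 0, 1}" if "r < n" for r using b[OF that] by auto
  ultimately show ?thesis by blast
qed

lemma udiag_eq_iff:
  assumes U: "U \<in> unitary_group n"
  shows "udiag U z = udiag U w \<longleftrightarrow> (\<forall>k<n. z k = w k)"
proof
  assume e: "udiag U z = udiag U w"
  show "\<forall>k<n. z k = w k" by (intro allI impI) (rule udiag_inj[OF U e])
next
  assume "\<forall>k<n. z k = w k"
  then show "udiag U z = udiag U w" by (intro udiag_cong[OF U]) simp
qed

lemma skew_diag_cube:
  assumes Y: "Y \<in> skew_mats n" and U: "U \<in> unitary_group n" and t: "cmat Y = idiag U t"
  shows "Y * Y * Y = - Y \<longleftrightarrow> (\<forall>k<n. t k ^ 3 = t k)"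
proof -
  note Yc = skew_carrier[OF Y]
  have 1: "cmat (Y * Y * Y) = udiag U (\<lambda>k. - (\<i> * of_real (t k ^ 3)))"
  proof -
    have "cmat (Y * Y * Y) = cmat Y * cmat Y * cmat Y" using Yc by (simp add: cmat_mult[of _ n n _ n])
    also have "\<dots> = udiag U (\<lambda>k. - (\<i> * of_real (t k ^ 3)))"
      unfolding t udiag_mult[OF U] by (rule udiag_cong[OF U]) (simp add: power3_eq_cube algebra_simps)
    finally show ?thesis .
  qed
  have 2: "cmat (- Y) = udiag U (\<lambda>k. - (\<i> * of_real (t k)))"
  proof -
    have "cmat (- Y) = (-1) \<cdot>\<^sub>m cmat Y" by (rule eq_matI) auto
    then show ?thesis unfolding t udiag_smult[OF U] by simp
  qed
  have "Y * Y * Y = - Y \<longleftrightarrow> udiag U (\<lambda>k. - (\<i> * of_real (t k ^ 3))) = udiag U (\<lambda>k. - (\<i> * of_real (t k)))"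
    unfolding 1[symmetric] 2[symmetric] by simp
  also have "\<dots> \<longleftrightarrow> (\<forall>k<n. - (\<i> * complex_of_real (t k ^ 3)) = - (\<i> * of_real (t k)))"
    by (rule udiag_eq_iff[OF U])
  also have "\<dots> \<longleftrightarrow> (\<forall>k<n. t k ^ 3 = t k)"
    by (simp only: neg_equal_iff_equal mult_cancel_left of_real_eq_iff complex_i_not_zero simp_thms)
  finally show ?thesis .
qed

lemma skew_diag_sqnorm:
  assumes Y: "Y \<in> skew_mats n" and U: "U \<in> unitary_group n" and t: "cmat Y = idiag U t"
  shows "sqnorm n Y = (\<Sum>k<n. (t k)\<^sup>2)"
proof -
  have c: "cmat Y \<in> carrier_mat n n" using skew_carrier[OF Y] by simp
  have "sqnorm n Y = (frobenius_norm (cmat Y))\<^sup>2"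
    unfolding frobenius_norm_sq[OF c] sqnorm_def using skew_carrier[OF Y] by simp
  also have "\<dots> = (\<Sum>k<n. (t k)\<^sup>2)" unfolding t udiag_frobenius[OF U] by (simp add: norm_mult)
  finally show ?thesis .
qed

lemma exp_mat_smult_eq_one_iff:
  assumes Y: "Y \<in> skew_mats n" and U: "U \<in> unitary_group n" and t: "cmat Y = idiag U t"
  shows "exp_mat (r \<cdot>\<^sub>m Y) = 1\<^sub>m n \<longleftrightarrow> (\<forall>k<n. \<exists>m::int. r * t k = 2 * pi * m)"
proof -
  have "cmat (r \<cdot>\<^sub>m Y) = of_real r \<cdot>\<^sub>m cmat Y" by (rule eq_matI) auto
  then have c: "cmat (r \<cdot>\<^sub>m Y) = udiag U (\<lambda>k. \<i> * of_real (r * t k))"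
    unfolding t udiag_smult[OF U] by (simp add: mult_ac)
  have "exp_mat (r \<cdot>\<^sub>m Y) = 1\<^sub>m n \<longleftrightarrow> cmat (exp_mat (r \<cdot>\<^sub>m Y)) = cmat (1\<^sub>m n)" by (simp only: cmat_eq_iff)
  also have "\<dots> \<longleftrightarrow> udiag U (\<lambda>k. exp (\<i> * of_real (r * t k))) = udiag U (\<lambda>_. 1)"
    unfolding cmat_exp_mat[OF skew_carrier[OF skew_smult[OF Y]] U c] udiag_one[OF U] cmat_one ..
  also have "\<dots> \<longleftrightarrow> (\<forall>k<n. exp (\<i> * of_real (r * t k)) = (1 :: complex))"
    by (rule udiag_eq_iff[OF U])
  also have "\<dots> \<longleftrightarrow> (\<forall>k<n. \<exists>m::int. r * t k = 2 * pi * m)"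
    by (auto simp: exp_eq_1 mult_ac)
  finally show ?thesis .
qed

lemma unit_bivector_diag:
  assumes X: "X \<in> unit_bivectors n" and U: "U \<in> unitary_group n" and t: "cmat X = idiag U t"
  shows "\<forall>k<n. t k \<in> {-1, 0, 1}" "\<exists>k<n. t k \<noteq> 0"
proof -
  note Xs = unit_bivectors_skew[OF X]
  have "t k = -1 \<or> t k = 0 \<or> t k = 1" if "k < n" for k
  proof -
    have "t k ^ 3 = t k" using skew_diag_cube[OF Xs U t] unit_bivector_cube[OF X] that by blast
    then have "t k * (t k - 1) * (t k + 1) = 0" by (simp add: algebra_simps power3_eq_cube)
    then show ?thesis by auto
  qed
  then show "\<forall>k<n. t k \<in> {-1, 0, 1}" by blast
  have "(\<Sum>k<n. (t k)\<^sup>2) = 2" using skew_diag_sqnorm[OF Xs U t] unit_bivector_sqnorm[OF X] by simp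
  then show "\<exists>k<n. t k \<noteq> 0" by (metis (no_types, lifting) lessThan_iff power_zero_numeral sum.neutral zero_neq_numeral)
qed

lemma unit_bivector_exp_eq_one_iff:
  assumes X: "X \<in> unit_bivectors n"
  shows "exp_mat (r \<cdot>\<^sub>m X) = 1\<^sub>m n \<longleftrightarrow> (\<exists>m::int. r = 2 * pi * m)"
proof -
  note Xs = unit_bivectors_skew[OF X]
  obtain U t where U: "U \<in> unitary_group n" and t: "cmat X = idiag U t"
    using skew_cmat_diag[OF Xs] by blast
  note d = unit_bivector_diag[OF X U t]
  show ?thesis unfolding exp_mat_smult_eq_one_iff[OF Xs U t]
  proof
    assume a: "\<forall>k<n. \<exists>m::int. r * t k = 2 * pi * m"
    obtain k where k: "k < n" "t k \<noteq> 0" using d(2) by blast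
    then have tk: "t k = 1 \<or> t k = -1" using d(1) by auto
    obtain m :: int where m: "r * t k = 2 * pi * m" using a k by blast
    show "\<exists>m::int. r = 2 * pi * m"
      using tk m by (elim disjE) (auto intro: exI[of _ m] exI[of _ "- m"])
  next
    assume "\<exists>m::int. r = 2 * pi * m"
    then obtain m :: int where m: "r = 2 * pi * m" by blast
    show "\<forall>k<n. \<exists>m::int. r * t k = 2 * pi * m"
    proof (intro allI impI)
      fix k assume "k < n"
      then consider "t k = -1" | "t k = 0" | "t k = 1" using d(1) by auto
      then show "\<exists>m::int. r * t k = 2 * pi * m"
        by cases (auto simp: m intro: exI[of _ m] exI[of _ "- m"] exI[of _ 0])
    qed
  qed
qed

text \<open>The exponential condition makes the eigenvalues integer multiples of i. It excludes
  spectra such as i/2, i/2, -i/2, -i/2 in dimension four, all of whose pair sums obey the relation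
  on \<open>ad Y\<close>.\<close>

lemma unit_bivector_criterion:
  assumes n: "n \<ge> 3" and Y: "Y \<in> skew_mats n" "Y \<noteq> 0\<^sub>m n n" and e: "exp_mat ((2 * pi) \<cdot>\<^sub>m Y) = 1\<^sub>m n"
    and ad: "\<And>Z. Z \<in> skew_mats n ==> bracket Y (bracket Y (bracket Y (bracket Y Z))) = (-1) \<cdot>\<^sub>m bracket Y (bracket Y Z)"
  shows "Y \<in> unit_bivectors n"
proof -
  obtain U t where U: "U \<in> unitary_group n" and t: "cmat Y = idiag U t"
    using skew_cmat_diag[OF Y(1)] by blast
  have "\<forall>k. \<exists>m::int. k < n --> t k = m"
    using e unfolding exp_mat_smult_eq_one_iff[OF Y(1) U t] by auto
  then have "\<exists>m::nat \<Rightarrow> int. \<forall>k. k < n --> t k = m k" by (rule choice)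
  then obtain m :: "nat \<Rightarrow> int" where m: "\<And>k. k < n ==> t k = m k" by blast
  have "(\<Sum>i<n. idiag U t $$ (i, i)) = 0"
  proof (rule sum.neutral, rule ballI)
    fix i assume "i \<in> {..<n}"
    then show "idiag U t $$ (i, i) = 0"
      unfolding t[symmetric] using skew_entry[OF Y(1), of i i] skew_carrier[OF Y(1)] by simp
  qed
  then have "(\<Sum>k<n. \<i> * complex_of_real (t k)) = 0" unfolding udiag_trace[OF U] .
  then have "\<i> * complex_of_real (\<Sum>k<n. t k) = 0" by (simp only: of_real_sum sum_distrib_left)
  then have "(\<Sum>k<n. t k) = 0" by (simp only: mult_eq_0_iff complex_i_not_zero of_real_eq_0_iff simp_thms)
  then have "real_of_int (\<Sum>k<n. m k) = 0" using m by simp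
  then have sm: "(\<Sum>k<n. m k) = 0" by linarith
  have "\<exists>k<n. m k \<noteq> 0"
  proof (rule ccontr)
    assume "\<not> ?thesis"
    then have z: "t k = 0" if "k < n" for k using m[OF that] that by simp
    have e0: "cmat Y = udiag U (\<lambda>_. 0)" unfolding t by (rule udiag_cong[OF U]) (simp add: z)
    then have "complex_of_real (Y $$ (i, j)) = 0" if "i < n" "j < n" for i j
    proof -
      have "complex_of_real (Y $$ (i, j)) = cmat Y $$ (i, j)" using that skew_carrier[OF Y(1)] by simp
      also have "\<dots> = 0" unfolding e0 udiag_index[OF U that] by simp
      finally show ?thesis .
    qed
    then have "Y = 0\<^sub>m n n" using skew_carrier[OF Y(1)] by (intro eq_matI) auto
    then show False using Y(2) by simp
  qed
  then obtain k where k: "k < n" "m k \<noteq> 0" by blast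
  have pm: "m p + m q \<in> {-1, 0, 1}" if pq: "p < n" "q < n" "p \<noteq> q" for p q
  proof -
    have "(t p + t q) ^ 4 = (t p + t q)\<^sup>2" by (rule eigenvalue_sum_fourth[OF Y(1) U t ad pq])
    then have "real_of_int ((m p + m q) ^ 4) = real_of_int ((m p + m q)\<^sup>2)" using m pq by simp
    then have "(m p + m q) ^ 4 = (m p + m q)\<^sup>2" by (simp only: of_int_eq_iff)
    then have "(m p + m q)\<^sup>2 * ((m p + m q) - 1) * ((m p + m q) + 1) = 0"
      by (simp add: algebra_simps power2_eq_square power4_eq_xxxx)
    then show ?thesis by auto
  qed
  note i = integer_spectrum_pm_one[OF n pm sm k]
  show ?thesis
  proof (rule unit_bivectorI[OF Y(1)])
    show "Y * Y * Y = - Y" unfolding skew_diag_cube[OF Y(1) U t]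
    proof (intro allI impI)
      fix k assume "k < n"
      then have "t k = -1 \<or> t k = 0 \<or> t k = 1" using conjunct1[OF i] m by auto
      then show "t k ^ 3 = t k" by auto
    qed
    have "real_of_int (\<Sum>k<n. (m k)\<^sup>2) = 2" using conjunct2[OF i] by simp
    then show "sqnorm n Y = 2" unfolding skew_diag_sqnorm[OF Y(1) U t] using m by simp
  qed
qed

section \<open>Linear maps preserving unit bivectors\<close>

definition coord :: "nat \<Rightarrow> nat \<Rightarrow> real" where "coord i k = (if k = i then 1 else 0)"

abbreviation cwedge :: "nat \<Rightarrow> nat \<Rightarrow> nat \<Rightarrow> real mat" where
  "cwedge n i j \<equiv> wedge n (coord i) (coord j)"

lemma dot_coord_left: "i < n ==> dot n (coord i) a = a i"
  and dot_coord_right: "i < n ==> dot n a (coord i) = a i"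
proof -
  assume i: "i < n"
  have "(\<Sum>k<n. coord i k * a k) = (\<Sum>k<n. if k = i then a k else 0)"
    by (intro sum.cong) (auto simp: coord_def)
  then show "dot n (coord i) a = a i" using i by (simp add: dot_def)
  then show "dot n a (coord i) = a i" by (simp add: dot_commute)
qed

locale skew_linear =
  fixes n :: nat and L :: "real mat \<Rightarrow> real mat"
  assumes skew: "X \<in> skew_mats n ==> L X \<in> skew_mats n"
    and add: "X \<in> skew_mats n ==> Y \<in> skew_mats n ==> L (X + Y) = L X + L Y"
    and smult: "X \<in> skew_mats n ==> L (s \<cdot>\<^sub>m X) = s \<cdot>\<^sub>m L X"

lemma skew_linear_id: "skew_linear n (\<lambda>X. X)"
  by unfold_locales auto

lemma skew_linear_uminus:
  assumes "skew_linear n L"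
  shows "skew_linear n (\<lambda>X. - L X)"
proof -
  interpret skew_linear n L by (rule assms)
  have u: "- L X = (-1) \<cdot>\<^sub>m L X" for X by (rule eq_matI) auto
  have d: "dim_row (L X) = n" "dim_col (L X) = n" if "X \<in> skew_mats n" for X
    using skew_carrier[OF skew[OF that]] by auto
  show ?thesis
  proof
    fix X assume X: "X \<in> skew_mats n"
    show "- L X \<in> skew_mats n" unfolding u by (rule skew_smult[OF skew[OF X]])
    show "- L (X + Y) = - L X + - L Y" if "Y \<in> skew_mats n" for Y
      unfolding add[OF X that] by (rule eq_matI) (auto simp: d X that)
    show "- L (s \<cdot>\<^sub>m X) = s \<cdot>\<^sub>m - L X" for s
      unfolding smult[OF X] by (rule eq_matI) (auto simp: d X)
  qed
qed

lemma conj_skew: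
  assumes X: "X \<in> skew_mats n" and T: "T \<in> carrier_mat n n"
  shows "T * X * T\<^sup>T \<in> skew_mats n"
proof -
  have c: "X \<in> carrier_mat n n" "X\<^sup>T = - X" using X by (auto simp: skew_mats_def)
  have TX: "T * X \<in> carrier_mat n n" and Tt: "T\<^sup>T \<in> carrier_mat n n" using T c by auto
  have "(T * X * T\<^sup>T)\<^sup>T = T * (T * X)\<^sup>T"
    using transpose_mult[OF TX Tt] T by simp
  also have "\<dots> = T * (X\<^sup>T * T\<^sup>T)"
    using transpose_mult[OF T c(1)] by simp
  also have "\<dots> = T * ((- X) * T\<^sup>T)" unfolding c(2) ..
  also have "\<dots> = - (T * X * T\<^sup>T)"
    using T c(1) Tt by (simp add: assoc_mult_mat[of _ n n _ n _ n])
  finally show ?thesis using TX Tt by (simp add: skew_mats_def)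
qed

lemma skew_linear_conj:
  assumes "skew_linear n L" and T: "T \<in> carrier_mat n n"
  shows "skew_linear n (\<lambda>X. T * L X * T\<^sup>T)"
proof -
  interpret skew_linear n L by (rule assms)
  have Tt: "T\<^sup>T \<in> carrier_mat n n" using T by simp
  show ?thesis
  proof
    fix X assume X: "X \<in> skew_mats n"
    note c = skew_carrier[OF skew[OF X]]
    have TX: "T * L X \<in> carrier_mat n n" using T c by simp
    show "T * L X * T\<^sup>T \<in> skew_mats n" by (rule conj_skew[OF skew[OF X] T])
    show "T * L (X + Y) * T\<^sup>T = T * L X * T\<^sup>T + T * L Y * T\<^sup>T" if Y: "Y \<in> skew_mats n" for Y
    proof -
      have cY: "L Y \<in> carrier_mat n n" by (rule skew_carrier[OF skew[OF Y]])
      then have TY: "T * L Y \<in> carrier_mat n n" using T by simp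
      show ?thesis unfolding add[OF X Y] mult_add_distrib_mat[OF T c cY] by (rule add_mult_distrib_mat[OF TX TY Tt])
    qed
    show "T * L (s \<cdot>\<^sub>m X) * T\<^sup>T = s \<cdot>\<^sub>m (T * L X * T\<^sup>T)" for s
      unfolding smult[OF X] mult_smult_distrib[OF T c] by (rule mult_smult_assoc_mat[OF TX Tt])
  qed
qed

text \<open>Linear extension from the coordinate bivectors, asking for agreement only on those that
  occur in \<open>X\<close>; the restriction to the support is what allows statements about a single
  pencil. Linearity is available on skew matrices only, hence the induction over partial
  sums.\<close>

lemma skew_linear_agree:
  assumes "skew_linear n L" "skew_linear n M" and X: "X \<in> skew_mats n"
    and agree: "\<And>i j. i < n ==> j < n ==> X $$ (i, j) \<noteq> 0 ==> L (cwedge n i j) = M (cwedge n i j)"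
  shows "L X = M X"
proof -
  interpret L: skew_linear n L by (rule assms)
  interpret M: skew_linear n M by (rule assms)
  define G where "G S = mat n n (\<lambda>q. \<Sum>p\<in>S. X $$ p * cwedge n (fst p) (snd p) $$ q)" for S
  have Z: "0 \<cdot>\<^sub>m A = 0 \<cdot>\<^sub>m B" if "A \<in> carrier_mat n n" "B \<in> carrier_mat n n" for A B :: "real mat"
    using that by (intro eq_matI) auto
  have main: "G S \<in> skew_mats n \<and> L (G S) = M (G S)" if "S \<subseteq> {..<n} \<times> {..<n}" for S
  proof -
    have "finite S" using that by (rule finite_subset) simp
    then show ?thesis using that
    proof (induction S rule: finite_induct)
      case empty
      have 1: "G {} = 0 \<cdot>\<^sub>m 0\<^sub>m n n" by (rule eq_matI) (auto simp: G_def)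
      show ?case unfolding 1 L.smult[OF skew_zero] M.smult[OF skew_zero]
        using Z skew_carrier[OF L.skew[OF skew_zero]] skew_carrier[OF M.skew[OF skew_zero]] skew_smult[OF skew_zero] by blast
    next
      case (insert p S)
      obtain i j where p: "p = (i, j)" by (rule prod.exhaust)
      have ij: "i < n" "j < n" using insert.prems p by auto
      have IH: "G S \<in> skew_mats n" "L (G S) = M (G S)" using insert.IH insert.prems by auto
      have 1: "G (insert p S) = X $$ (i, j) \<cdot>\<^sub>m cwedge n i j + G S"
        using insert.hyps by (intro eq_matI) (auto simp: G_def p)
      note ws = skew_smult[OF wedge_skew]
      have "L (X $$ (i, j) \<cdot>\<^sub>m cwedge n i j) = M (X $$ (i, j) \<cdot>\<^sub>m cwedge n i j)"
        unfolding L.smult[OF wedge_skew] M.smult[OF wedge_skew]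
        using agree[OF ij] Z[OF skew_carrier[OF L.skew[OF wedge_skew]] skew_carrier[OF M.skew[OF wedge_skew]]]
        by (cases "X $$ (i, j) = 0") auto
      then show ?case unfolding 1 L.add[OF ws IH(1)] M.add[OF ws IH(1)] using IH skew_add[OF ws IH(1)] by simp
    qed
  qed
  \<comment> \<open>The sum runs over ordered pairs, so each coordinate plane is counted
    twice.\<close>
  have 2: "X = (1/2) \<cdot>\<^sub>m G ({..<n} \<times> {..<n})"
  proof (rule eq_matI)
    fix a b assume "a < dim_row ((1/2) \<cdot>\<^sub>m G ({..<n} \<times> {..<n}))" "b < dim_col ((1/2) \<cdot>\<^sub>m G ({..<n} \<times> {..<n}))"
    then have ab: "a < n" "b < n" by (auto simp: G_def)
    have "(\<Sum>p\<in>{..<n} \<times> {..<n}. X $$ p * cwedge n (fst p) (snd p) $$ (a, b)) =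
        (\<Sum>i<n. \<Sum>j<n. X $$ (i, j) * cwedge n i j $$ (a, b))"
      by (simp add: sum.cartesian_product case_prod_beta)
    also have "\<dots> = 2 * dot n (coord a) (mvec n X (coord b))"
    proof -
      have "X $$ (i, j) * cwedge n i j $$ (a, b) = X $$ (i, j) * cwedge n a b $$ (i, j)" if "i < n" "j < n" for i j
        using that ab by (auto simp: coord_def)
      then have "(\<Sum>i<n. \<Sum>j<n. X $$ (i, j) * cwedge n i j $$ (a, b)) = (\<Sum>i<n. \<Sum>j<n. X $$ (i, j) * cwedge n a b $$ (i, j))"
        by (intro sum.cong refl) (simp only: lessThan_iff)
      then show ?thesis unfolding sum_wedge[OF X] .
    qed
    also have "\<dots> = 2 * X $$ (a, b)"
    proof -
      have "mvec n X (coord b) a = dot n (\<lambda>j. X $$ (a, j)) (coord b)" by (simp add: mvec_def dot_def)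
      then show ?thesis using ab by (simp add: dot_coord_left dot_coord_right)
    qed
    finally show "X $$ (a, b) = ((1/2) \<cdot>\<^sub>m G ({..<n} \<times> {..<n})) $$ (a, b)" using ab by (simp add: G_def)
  qed (use skew_carrier[OF X] in \<open>auto simp: G_def\<close>)
  have G: "G ({..<n} \<times> {..<n}) \<in> skew_mats n" "L (G ({..<n} \<times> {..<n})) = M (G ({..<n} \<times> {..<n}))" using main by auto
  show ?thesis by (subst (1 2) 2) (simp only: L.smult[OF G(1)] M.smult[OF G(1)] G(2))
qed

section \<open>Pencils and triangles\<close>

lemma adjacent_wedge:
  assumes "dot n v v = 1" "dot n w w = 1" "dot n u u = 1" "dot n v w = 0" "dot n v u = 0" "dot n w u = 0"
  shows "adjacent n (wedge n v w) (wedge n v u)"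
  unfolding adjacent_def
proof (intro allI impI)
  fix c s :: real assume cs: "c\<^sup>2 + s\<^sup>2 = 1"
  have 1: "c \<cdot>\<^sub>m wedge n v w + s \<cdot>\<^sub>m wedge n v u = wedge n v (\<lambda>i. c * w i + s * u i)"
    by (rule eq_matI) (auto simp: algebra_simps)
  have uw: "dot n u w = 0" using assms dot_commute[of n u w] by simp
  have "dot n (\<lambda>i. c * w i + s * u i) (\<lambda>i. c * w i + s * u i) = 1" "dot n v (\<lambda>i. c * w i + s * u i) = 0"
    using cs by (simp_all add: dot_simps assms uw power2_eq_square)
  then show "c \<cdot>\<^sub>m wedge n v w + s \<cdot>\<^sub>m wedge n v u \<in> unit_bivectors n"
    unfolding 1 unit_bivectors_def using assms(1) by blast
qed

lemma wedge_swap: "wedge n v w = wedge n w (\<lambda>i. - v i)"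
  by (rule eq_matI) auto

lemma adjacent_coord:
  assumes "i < n" "j < n" "k < n" "i \<noteq> j" "i \<noteq> k" "j \<noteq> k"
  shows "adjacent n (cwedge n i j) (cwedge n i k)"
    and "adjacent n (cwedge n i j) (cwedge n j k)"
    and "adjacent n (cwedge n i k) (cwedge n j k)"
proof -
  have d: "dot n (coord a) (coord b) = (if a = b then 1 else 0)" if "a < n" for a b
    using that by (simp add: dot_coord_left coord_def)
  show "adjacent n (cwedge n i j) (cwedge n i k)"
    by (rule adjacent_wedge) (use assms d in auto)
  show "adjacent n (cwedge n i j) (cwedge n j k)"
    unfolding wedge_swap[of n "coord i" "coord j"] by (rule adjacent_wedge) (use assms d in \<open>auto simp: dot_simps\<close>)
  show "adjacent n (cwedge n i k) (cwedge n j k)"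
    unfolding wedge_swap[of n "coord i" "coord k"] wedge_swap[of n "coord j" "coord k"]
    by (rule adjacent_wedge) (use assms d in \<open>auto simp: dot_simps\<close>)
qed

text \<open>A rotation of the orthonormal basis of the plane of \<open>X\<close> does not change its
  wedge, so the common vector found by \<open>adjacent_common_vector\<close> can be made the first
  basis vector.\<close>

lemma adjacent_normal_form:
  assumes X: "X \<in> skew_mats n" and Y: "Y \<in> skew_mats n" and adj: "adjacent n X Y"
  shows "\<exists>v w u. dot n v v = 1 \<and> dot n w w = 1 \<and> dot n u u = 1 \<and> dot n v w = 0 \<and> dot n v u = 0 \<and> dot n w u = 0 \<and>
    X = wedge n v w \<and> Y = wedge n v u"
proof -
  have "X \<in> unit_bivectors n" by (rule adjacent_unit(1)[OF adj skew_carrier[OF X] skew_carrier[OF Y]])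
  then obtain a b where Xe: "X = wedge n a b" and on: "dot n a a = 1" "dot n b b = 1" "dot n a b = 0"
    by (auto simp: unit_bivectors_def)
  obtain l m u where u: "l\<^sup>2 + m\<^sup>2 = 1" "dot n u u = 1" "dot n a u = 0" "dot n b u = 0" "Y = wedge n (\<lambda>i. l * a i + m * b i) u"
    using adjacent_common_vector[OF adj[unfolded Xe] Y on] by (elim exE conjE)
  have ba: "dot n b a = 0" using on dot_commute[of n a b] by simp
  have "X = (l\<^sup>2 + m\<^sup>2) \<cdot>\<^sub>m wedge n a b" unfolding u(1) Xe one_smult_mat ..
  also have "\<dots> = wedge n (\<lambda>i. l * a i + m * b i) (\<lambda>i. l * b i - m * a i)"
    by (rule eq_matI) (auto simp: algebra_simps power2_eq_square)
  finally have X2: "X = wedge n (\<lambda>i. l * a i + m * b i) (\<lambda>i. l * b i - m * a i)" .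
  show ?thesis
    using u(1) by (intro exI[of _ "\<lambda>i. l * a i + m * b i"] exI[of _ "\<lambda>i. l * b i - m * a i"] exI[of _ u] conjI X2 u(5))
      (simp_all add: dot_simps on ba u power2_eq_square algebra_simps)
qed

text \<open>A plane that meets the planes of \<open>v\<close>, \<open>w\<close> and of
  \<open>v\<close>, \<open>z\<close> in this way either contains \<open>v\<close>, or it is the
  third side of the triangle, spanned by \<open>w\<close> and \<open>z\<close>.\<close>

lemma adjacent_pencil:
  assumes on: "dot n v v = 1" "dot n w w = 1" "dot n z z = 1" "dot n v w = 0" "dot n v z = 0" "dot n w z = 0"
    and Y: "Y \<in> skew_mats n" and adj: "adjacent n (wedge n v w) Y" "adjacent n (wedge n v z) Y"
  shows "(\<exists>u. dot n u u = 1 \<and> dot n v u = 0 \<and> dot n w u = 0 \<and> dot n z u = 0 \<and> Y = wedge n v u) \<or>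
    Y = wedge n w z \<or> Y = wedge n z w"
proof -
  obtain l m u where u: "l\<^sup>2 + m\<^sup>2 = 1" "dot n u u = 1" "dot n v u = 0" "dot n w u = 0" and e: "Y = wedge n (\<lambda>i. l * v i + m * w i) u"
    using adjacent_common_vector[OF adj(1) Y on(1,2,4)] by (elim exE conjE)
  obtain l' m' u' where u': "l'\<^sup>2 + m'\<^sup>2 = 1" "dot n u' u' = 1" "dot n v u' = 0" "dot n z u' = 0" and e': "Y = wedge n (\<lambda>i. l' * v i + m' * z i) u'"
    using adjacent_common_vector[OF adj(2) Y on(1,3,5)] by (elim exE conjE)
  have c: "dot n u v = 0" "dot n u w = 0" "dot n u' v = 0" "dot n u' z = 0" "dot n w v = 0" "dot n z v = 0" "dot n z w = 0"
    using u u' on dot_commute by metis+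
  have y: "mvec n Y x i = (l * v i + m * w i) * dot n u x - u i * (l * dot n v x + m * dot n w x)"
    and y': "mvec n Y x i = (l' * v i + m' * z i) * dot n u' x - u' i * (l' * dot n v x + m' * dot n z x)" if "i < n" for x i
  proof -
    show "mvec n Y x i = (l * v i + m * w i) * dot n u x - u i * (l * dot n v x + m * dot n w x)"
      unfolding e mvec_wedge[OF that] by (simp add: dot_simps)
    show "mvec n Y x i = (l' * v i + m' * z i) * dot n u' x - u' i * (l' * dot n v x + m' * dot n z x)"
      unfolding e' mvec_wedge[OF that] by (simp add: dot_simps)
  qed
  have A: "l * u i = l' * u' i" if "i < n" for i
    using y[OF that, of v] y'[OF that, of v] by (simp add: on c mult.commute)
  have B: "(l * v i + m * w i) * dot n u z = - m' * u' i" if "i < n" for i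
    using y[OF that, of z] y'[OF that, of z] by (simp add: on c mult.commute)
  \<comment> \<open>Applying \<open>Y\<close> to \<open>v\<close> yields \<open>A\<close>, so the
    coefficients \<open>l\<close> and \<open>l'\<close> of \<open>v\<close> in the two common
    vectors vanish together; the case distinction on \<open>l\<close> separates pencil from
    triangle.\<close>
  have ll: "l * l = l' * l'"
    using dot_cong[of n "\<lambda>i. l * u i" "\<lambda>i. l' * u' i" "\<lambda>i. l * u i" "\<lambda>i. l' * u' i"] A by (simp add: dot_simps u u')
  show ?thesis
  proof (cases "l = 0")
    case False
    have "l * dot n u z = 0"
      using dot_cong[of n "\<lambda>i. l * u i" "\<lambda>i. l' * u' i" z z] A by (simp add: dot_simps c)
    then have uz: "dot n u z = 0" using False by simp
    have "dot n (\<lambda>i. m' * u' i) (\<lambda>i. m' * u' i) = dot n (\<lambda>i. 0 * u i) (\<lambda>i. 0 * u i)"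
      using B uz by (intro dot_cong) auto
    then have "m' = 0" by (simp add: dot_simps u' dot_def[of n "\<lambda>i. 0"])
    then have l1: "l * l = 1" using u'(1) ll by (simp add: power2_eq_square)
    then have m0: "m = 0" using u(1) by (simp add: power2_eq_square)
    have "Y = wedge n v (\<lambda>i. l * u i)" unfolding e m0 by (rule eq_matI) (auto simp: algebra_simps)
    moreover have "dot n z u = 0" using uz by (simp add: dot_commute)
    ultimately show ?thesis
      using l1 u by (intro disjI1 exI[of _ "\<lambda>i. l * u i"]) (simp add: dot_simps)
  next
    case True
    then have m1: "m * m = 1" using u(1) by (simp add: power2_eq_square)
    have "m' * m' = 1" using True ll u'(1) by (simp add: power2_eq_square)
    moreover have "dot n (\<lambda>i. (m * dot n u z) * w i) (\<lambda>i. (m * dot n u z) * w i) = dot n (\<lambda>i. (- m') * u' i) (\<lambda>i. (- m') * u' i)"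
    proof (rule dot_cong)
      fix i assume i: "i < n"
      show "(m * dot n u z) * w i = (- m') * u' i" using B[OF i] True by (simp add: mult_ac)
      then show "(m * dot n u z) * w i = (- m') * u' i" .
    qed
    ultimately have "(m * dot n u z) * (m * dot n u z) = 1" by (simp only: dot_simps on u' mult_1_right minus_mult_minus)
    then have q: "m * dot n u z = 1 \<or> m * dot n u z = -1"
      using square_eq_1_iff by blast
    have "(m * m) * (dot n u z * dot n u z) = 1" using \<open>(m * dot n u z) * (m * dot n u z) = 1\<close> by (simp add: mult_ac)
    then have uz: "dot n u z * dot n u z = 1" unfolding m1 by simp
    have "dot n (\<lambda>i. u i - dot n u z * z i) (\<lambda>i. u i - dot n u z * z i) = 0"
      using uz dot_commute[of n z u] by (simp add: dot_simps u on)
    then have ue: "u i = dot n u z * z i" if "i < n" for i using dot_self_eq_0[of n _ i] that by fastforce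
    have "Y = (m * dot n u z) \<cdot>\<^sub>m wedge n w z"
    proof (rule eq_squareI[where n = n])
      fix i j :: nat assume ij: "i < n" "j < n"
      have "Y $$ (i, j) = m * w i * u j - m * w j * u i" unfolding e True using ij by simp
      also have "\<dots> = m * w i * (dot n u z * z j) - m * w j * (dot n u z * z i)" using ue[OF ij(1)] ue[OF ij(2)] by (simp only:)
      finally show "Y $$ (i, j) = ((m * dot n u z) \<cdot>\<^sub>m wedge n w z) $$ (i, j)" using ij by (simp add: algebra_simps)
    qed (simp_all add: e)
    moreover have "(-1) \<cdot>\<^sub>m wedge n w z = wedge n z w" by (rule eq_matI) auto
    ultimately show ?thesis using q by (auto simp: one_smult_mat)
  qed
qed

lemma mvec_adjoint:
  assumes "C \<in> carrier_mat n n"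
  shows "dot n (mvec n C a) b = dot n a (mvec n (C\<^sup>T) b)"
proof -
  have "dot n (mvec n C a) b = (\<Sum>i<n. \<Sum>j<n. C $$ (i, j) * a j * b i)"
    by (simp add: dot_def mvec_def sum_distrib_right)
  also have "\<dots> = (\<Sum>j<n. \<Sum>i<n. C $$ (i, j) * a j * b i)" by (rule sum.swap)
  also have "\<dots> = dot n a (mvec n (C\<^sup>T) b)"
    using assms by (simp add: dot_def mvec_def sum_distrib_left mult_ac)
  finally show ?thesis .
qed

lemma mvec_one: "i < n ==> mvec n (1\<^sub>m n) a i = a i"
proof -
  assume i: "i < n"
  have "mvec n (1\<^sub>m n) a i = dot n (coord i) a" unfolding mvec_def dot_def using i by (intro sum.cong) (auto simp: coord_def)
  then show ?thesis using i by (simp add: dot_coord_left)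
qed

lemma dot_mvec_O:
  assumes C: "C \<in> O_group n"
  shows "dot n (mvec n C a) (mvec n C b) = dot n a b"
proof -
  have c: "C \<in> carrier_mat n n" "C\<^sup>T \<in> carrier_mat n n" "C\<^sup>T * C = 1\<^sub>m n" using C by (auto simp: O_group_def)
  have "dot n (mvec n C a) (mvec n C b) = dot n a (mvec n (C\<^sup>T) (mvec n C b))" by (rule mvec_adjoint[OF c(1)])
  also have "\<dots> = dot n a b"
    using mvec_mult[OF c(2,1)] c(3) by (intro dot_cong) (auto simp: mvec_one)
  finally show ?thesis .
qed

lemma conj_wedge:
  assumes C: "C \<in> carrier_mat n n"
  shows "C * wedge n a b * C\<^sup>T = wedge n (mvec n C a) (mvec n C b)"
proof (rule eq_matI)
  have CW: "C * wedge n a b \<in> carrier_mat n n" using C by (rule mult_carrier_mat) simp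
  have Ct: "C\<^sup>T \<in> carrier_mat n n" using C by simp
  fix i j assume "i < dim_row (wedge n (mvec n C a) (mvec n C b))" "j < dim_col (wedge n (mvec n C a) (mvec n C b))"
  then have ij: "i < n" "j < n" by auto
  have "(C * wedge n a b * C\<^sup>T) $$ (i, j) = (\<Sum>k<n. mvec n C a i * (C $$ (j, k) * b k) - mvec n C b i * (C $$ (j, k) * a k))"
    unfolding index_mult_sum[OF CW Ct ij]
  proof (intro sum.cong refl)
    fix k assume "k \<in> {..<n}"
    then have k: "k < n" by simp
    have t: "C\<^sup>T $$ (k, j) = C $$ (j, k)" using C ij k by simp
    show "(C * wedge n a b) $$ (i, k) * C\<^sup>T $$ (k, j) = mvec n C a i * (C $$ (j, k) * b k) - mvec n C b i * (C $$ (j, k) * a k)"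
      unfolding mult_wedge[OF C ij(1) k] t by (simp add: algebra_simps)
  qed
  also have "\<dots> = mvec n C a i * mvec n C b j - mvec n C b i * mvec n C a j"
    by (simp add: sum_subtractf sum_distrib_left mvec_def[of n C _ j])
  finally show "(C * wedge n a b * C\<^sup>T) $$ (i, j) = wedge n (mvec n C a) (mvec n C b) $$ (i, j)"
    using ij by (simp add: mult.commute)
qed (use C in auto)

lemma conj_unit_bivector:
  assumes C: "C \<in> O_group n" and X: "X \<in> unit_bivectors n"
  shows "C * X * C\<^sup>T \<in> unit_bivectors n"
proof -
  obtain a b where Xe: "X = wedge n a b" and on: "dot n a a = 1" "dot n b b = 1" "dot n a b = 0"
    using X by (auto simp: unit_bivectors_def)
  have c: "C \<in> carrier_mat n n" using C by (simp add: O_group_def)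
  show ?thesis unfolding Xe conj_wedge[OF c] unit_bivectors_def mem_Collect_eq
    by (intro exI[of _ "mvec n C a"] exI[of _ "mvec n C b"]) (simp add: dot_mvec_O[OF C] on)
qed

lemma pluecker:
  assumes X: "X \<in> unit_bivectors n" and "i < n" "j < n" "k < n" "l < n"
  shows "X $$ (i, j) * X $$ (k, l) - X $$ (i, k) * X $$ (j, l) + X $$ (i, l) * X $$ (j, k) = 0"
proof -
  obtain a b where "X = wedge n a b" using X by (auto simp: unit_bivectors_def)
  then show ?thesis using assms(2-) by (simp add: algebra_simps)
qed

locale bivector_preserver = skew_linear +
  assumes kernel: "X \<in> skew_mats n ==> L X = 0\<^sub>m n n ==> X = 0\<^sub>m n n"
    and unit: "X \<in> unit_bivectors n ==> L X \<in> unit_bivectors n"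
begin

lemma inj:
  assumes X: "X \<in> skew_mats n" and Y: "Y \<in> skew_mats n" and e: "L X = L Y"
  shows "X = Y"
proof -
  have c: "X \<in> carrier_mat n n" "Y \<in> carrier_mat n n" "L Y \<in> carrier_mat n n" using X Y skew by (auto intro: skew_carrier)
  have "L (X + (-1) \<cdot>\<^sub>m Y) = L Y + (-1) \<cdot>\<^sub>m L Y" unfolding add[OF X skew_smult[OF Y]] smult[OF Y] e ..
  also have "\<dots> = 0\<^sub>m n n" using c by (intro eq_matI) auto
  finally have "X + (-1) \<cdot>\<^sub>m Y = 0\<^sub>m n n" by (rule kernel[OF skew_add[OF X skew_smult[OF Y]]])
  then have "(X + (-1) \<cdot>\<^sub>m Y) $$ (i, j) = 0" if "i < n" "j < n" for i j using that by simp
  then show ?thesis using c by (intro eq_matI) auto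
qed

lemma adjacent:
  assumes X: "X \<in> skew_mats n" and Y: "Y \<in> skew_mats n" and adj: "adjacent n X Y"
  shows "adjacent n (L X) (L Y)"
  unfolding adjacent_def
proof (intro allI impI)
  fix c s :: real assume "c\<^sup>2 + s\<^sup>2 = 1"
  then have "c \<cdot>\<^sub>m X + s \<cdot>\<^sub>m Y \<in> unit_bivectors n" using adj unfolding adjacent_def by blast
  then have "L (c \<cdot>\<^sub>m X + s \<cdot>\<^sub>m Y) \<in> unit_bivectors n" by (rule unit)
  then show "c \<cdot>\<^sub>m L X + s \<cdot>\<^sub>m L Y \<in> unit_bivectors n"
    unfolding add[OF skew_smult[OF X] skew_smult[OF Y]] smult[OF X] smult[OF Y] .
qed

end

lemma conj_conj:
  assumes "A \<in> carrier_mat n n" "B \<in> carrier_mat n n" "(X :: real mat) \<in> carrier_mat n n"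
  shows "A * (B * X * B\<^sup>T) * A\<^sup>T = (A * B) * X * (A * B)\<^sup>T"
proof -
  have mc: "M * N \<in> carrier_mat n n" if "M \<in> carrier_mat n n" "N \<in> carrier_mat n n" for M N :: "real mat"
    using that by simp
  have t: "A\<^sup>T \<in> carrier_mat n n" "B\<^sup>T \<in> carrier_mat n n" using assms by auto
  show ?thesis
    unfolding transpose_mult[OF assms(1,2)] using assms t
    by (simp add: mc assoc_mult_mat[of _ n n _ n _ n])
qed

lemma conj_uminus:
  assumes "A \<in> carrier_mat n n" "(M :: real mat) \<in> carrier_mat n n"
  shows "A * (- M) * A\<^sup>T = - (A * M * A\<^sup>T)"
proof -
  have t: "A\<^sup>T \<in> carrier_mat n n" using assms by simp
  show ?thesis using assms t by (simp add: assoc_mult_mat[of _ n n _ n _ n])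
qed

lemma conj_cancel:
  assumes T: "T \<in> O_group n" and X: "X \<in> carrier_mat n n"
  shows "T\<^sup>T * (T * X * T\<^sup>T) * T = X"
proof -
  have c: "T \<in> carrier_mat n n" "T\<^sup>T \<in> carrier_mat n n" "T\<^sup>T * T = 1\<^sub>m n" using T by (auto simp: O_group_def)
  show ?thesis using conj_conj[OF c(2,1) X] X by (simp add: c(3))
qed

lemma bivector_preserver_conj:
  assumes "bivector_preserver n L" and T: "T \<in> O_group n"
  shows "bivector_preserver n (\<lambda>X. T * L X * T\<^sup>T)"
proof -
  interpret bivector_preserver n L by (rule assms)
  have c: "T \<in> carrier_mat n n" "T\<^sup>T \<in> carrier_mat n n" using T by (auto simp: O_group_def)
  interpret M: skew_linear n "\<lambda>X. T * L X * T\<^sup>T"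
    by (rule skew_linear_conj[OF skew_linear_axioms c(1)])
  show ?thesis
  proof
    fix X assume X: "X \<in> skew_mats n" and z: "T * L X * T\<^sup>T = 0\<^sub>m n n"
    have "L X = T\<^sup>T * 0\<^sub>m n n * T"
      using conj_cancel[OF T skew_carrier[OF skew[OF X]]] unfolding z by simp
    also have "\<dots> = 0\<^sub>m n n" using c by simp
    finally show "X = 0\<^sub>m n n" by (rule kernel[OF X])
  next
    fix X assume "X \<in> unit_bivectors n"
    then show "T * L X * T\<^sup>T \<in> unit_bivectors n" by (intro conj_unit_bivector[OF T] unit)
  qed
qed

section \<open>Reconstruction of the linear map from the image of a pencil\<close>

text \<open>Minus conjugation by this reflection fixes every \<open>cwedge n 0 j\<close> with j > 0
  and negates every other coordinate bivector: it is the only freedom left once the pencil at e_0 is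
  fixed.\<close>

definition flip_first :: "nat \<Rightarrow> real mat" where
  "flip_first n = mat n n (\<lambda>(i, j). (if i = 0 then -1 else 1) * coord i j)"

lemma flip_first_carrier: "flip_first n \<in> carrier_mat n n"
  by (simp add: flip_first_def)

lemma flip_first_O: "flip_first n \<in> O_group n"
proof -
  have t: "(flip_first n)\<^sup>T = flip_first n"
    by (rule eq_matI) (auto simp: flip_first_def coord_def)
  have "flip_first n * flip_first n = 1\<^sub>m n"
  proof (rule eq_squareI[where n = n])
    fix i j :: nat assume ij: "i < n" "j < n"
    have "(flip_first n * flip_first n) $$ (i, j) =
        (\<Sum>k<n. ((if i = 0 then -1 else 1) * (if j = 0 then -1 else 1)) * (coord i k * coord j k))"
      unfolding index_mult_sum[OF flip_first_carrier flip_first_carrier ij]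
      using ij by (intro sum.cong) (auto simp: flip_first_def coord_def)
    also have "\<dots> = ((if i = 0 then -1 else 1) * (if j = 0 then -1 else 1)) * dot n (coord i) (coord j)"
      by (simp add: dot_def sum_distrib_left)
    also have "\<dots> = (1\<^sub>m n) $$ (i, j)" unfolding dot_coord_left[OF ij(1)] using ij by (auto simp: coord_def)
    finally show "(flip_first n * flip_first n) $$ (i, j) = (1\<^sub>m n) $$ (i, j)" .
  qed (auto simp: flip_first_def)
  then show ?thesis using flip_first_carrier by (simp add: O_group_def t)
qed

lemma mvec_flip_first:
  assumes "i < n" "k < n"
  shows "mvec n (flip_first n) (coord k) i = (if k = 0 then -1 else 1) * coord k i"
proof -
  have "mvec n (flip_first n) (coord k) i = dot n (\<lambda>j. flip_first n $$ (i, j)) (coord k)" by (simp add: mvec_def dot_def)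
  then show ?thesis unfolding dot_coord_right[OF assms(2)] using assms by (auto simp: flip_first_def coord_def)
qed

lemma cwedge_swap: "cwedge n k j = (-1) \<cdot>\<^sub>m cwedge n j k"
  by (rule eq_matI) auto

lemma flip_first_conj_coord:
  assumes "j < n" "k < n"
  shows "- (flip_first n * cwedge n j k * (flip_first n)\<^sup>T) =
    (- (if j = 0 then -1 else 1) * (if k = 0 then -1 else 1)) \<cdot>\<^sub>m cwedge n j k"
  unfolding conj_wedge[OF flip_first_carrier]
  by (rule eq_matI) (auto simp: mvec_flip_first assms)

text \<open>The image of \<open>cwedge n j k\<close> is adjacent to the two fixed bivectors
  \<open>cwedge n 0 j\<close> and \<open>cwedge n 0 k\<close>, so by \<open>adjacent_pencil\<close>
  and injectivity it is the same bivector up to a sign. The Pluecker relation then forces all these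
  signs to be equal.\<close>

lemma bivector_preserver_normalised:
  assumes "bivector_preserver n L"
    and fix0: "\<And>j. 0 < j ==> j < n ==> L (cwedge n 0 j) = cwedge n 0 j"
  shows "(\<forall>X\<in>skew_mats n. L X = X) \<or>
    (\<forall>X\<in>skew_mats n. L X = - (flip_first n * X * (flip_first n)\<^sup>T))"
proof -
  interpret bivector_preserver n L by (rule assms)
  have fix0': "L (cwedge n j 0) = cwedge n j 0" if "0 < j" "j < n" for j
    unfolding cwedge_swap[of n j 0] smult[OF wedge_skew] fix0[OF that] ..
  \<comment> \<open>All wedges with e_0 are fixed, so injectivity excludes the pencil case for the
    images below.\<close>
  have w0: "L (wedge n (coord 0) u) = wedge n (coord 0) u" for u
  proof (rule skew_linear_agree[OF skew_linear_axioms skew_linear_id wedge_skew])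
    fix i j assume ij: "i < n" "j < n" and nz: "wedge n (coord 0) u $$ (i, j) \<noteq> 0"
    then have "(i = 0 \<and> 0 < j) \<or> (j = 0 \<and> 0 < i)" by (auto simp: coord_def split: if_splits)
    then show "L (cwedge n i j) = cwedge n i j"
      by (elim disjE conjE) (use fix0[of j] fix0'[of i] ij in simp_all)
  qed
  define s where "s j k = L (cwedge n j k) $$ (j, k)" for j k
  have dots: "dot n (coord a) (coord b) = (if a = b then 1 else 0)" if "a < n" for a b
    using that by (simp add: dot_coord_left coord_def)
  have sm: "L (cwedge n j k) = s j k \<cdot>\<^sub>m cwedge n j k \<and> (s j k = 1 \<or> s j k = -1)"
    if jk: "0 < j" "j < n" "0 < k" "k < n" "j \<noteq> k" for j k
  proof -
    have n0: "0 < n" using jk by simp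
    note dist = n0 jk(2,4) jk(1)[THEN less_imp_neq] jk(3)[THEN less_imp_neq] jk(5)
    have adj: "adjacent n (cwedge n 0 j) (L (cwedge n j k))" "adjacent n (cwedge n 0 k) (L (cwedge n j k))"
      using adjacent[OF wedge_skew wedge_skew adjacent_coord(2)[OF dist]] adjacent[OF wedge_skew wedge_skew adjacent_coord(3)[OF dist]]
      unfolding fix0[OF jk(1,2)] fix0[OF jk(3,4)] .
    have "(\<exists>u. dot n u u = 1 \<and> dot n (coord 0) u = 0 \<and> dot n (coord j) u = 0 \<and> dot n (coord k) u = 0 \<and> L (cwedge n j k) = wedge n (coord 0) u) \<or>
      L (cwedge n j k) = cwedge n j k \<or> L (cwedge n j k) = cwedge n k j"
      by (rule adjacent_pencil[OF _ _ _ _ _ _ skew[OF wedge_skew] adj]) (use dist in \<open>auto simp: dots\<close>)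
    moreover have "L (cwedge n j k) \<noteq> wedge n (coord 0) u" for u
    proof
      assume "L (cwedge n j k) = wedge n (coord 0) u"
      then have "cwedge n j k = wedge n (coord 0) u" using inj[OF wedge_skew wedge_skew] w0 by simp
      then have "cwedge n j k $$ (j, k) = wedge n (coord 0) u $$ (j, k)" by simp
      then show False using dist by (simp add: coord_def)
    qed
    ultimately have c: "L (cwedge n j k) = cwedge n j k \<or> L (cwedge n j k) = cwedge n k j"
    proof (elim disjE exE conjE)
      fix u assume ne: "\<And>u. L (cwedge n j k) \<noteq> wedge n (coord 0) u" and e: "L (cwedge n j k) = wedge n (coord 0) u"
      show ?thesis by (rule notE[OF ne e])
    qed (erule disjI1, erule disjI2)
    then show ?thesis
    proof
      assume e: "L (cwedge n j k) = cwedge n j k"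
      have "s j k = 1" unfolding s_def e using dist by (simp add: coord_def)
      then show ?thesis unfolding e by (simp add: one_smult_mat)
    next
      assume e: "L (cwedge n j k) = cwedge n k j"
      have "s j k = -1" unfolding s_def e using dist by (simp add: coord_def)
      then show ?thesis unfolding e using cwedge_swap[of n k j] by simp
    qed
  qed
  have s_sym: "s k j = s j k" if jk: "0 < j" "j < n" "0 < k" "k < n" "j \<noteq> k" for j k
  proof -
    have "s k j = ((-1) \<cdot>\<^sub>m L (cwedge n j k)) $$ (k, j)"
      unfolding s_def cwedge_swap[of n k j] smult[OF wedge_skew] ..
    also have "\<dots> = s j k" unfolding conjunct1[OF sm[OF jk]] using jk by (simp add: coord_def)
    finally show ?thesis .
  qed
  have s3: "s j k = s j l" if jkl: "0 < j" "j < n" "0 < k" "k < n" "0 < l" "l < n" "j \<noteq> k" "j \<noteq> l" "k \<noteq> l" for j k l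
  proof -
    define q :: real where "q = 1 / sqrt 2"
    have q: "q * q = 1 / 2" by (simp add: q_def)
    have n0: "0 < n" using jkl by simp
    \<comment> \<open>The decomposable bivector (e_0 + e_j) with (e_k + e_l), normalised. Its image
      has the entry 0 at (0, j), and the Pluecker relation reduces to equality of the signs
      \<open>s j k\<close> and \<open>s j l\<close>.\<close>
    let ?X = "wedge n (\<lambda>i. q * (coord 0 i + coord j i)) (\<lambda>i. q * (coord k i + coord l i))"
    have "?X \<in> unit_bivectors n"
      unfolding unit_bivectors_def mem_Collect_eq
      by (intro exI conjI refl) (use jkl n0 q in \<open>auto simp: dot_simps dots\<close>)
    then have LX: "L ?X \<in> unit_bivectors n" by (rule unit)
    have X: "?X = (1/2) \<cdot>\<^sub>m ((cwedge n 0 k + cwedge n 0 l) + (cwedge n j k + cwedge n j l))"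
    proof (rule eq_matI)
      fix a b assume "a < dim_row ((1/2) \<cdot>\<^sub>m ((cwedge n 0 k + cwedge n 0 l) + (cwedge n j k + cwedge n j l)))"
        "b < dim_col ((1/2) \<cdot>\<^sub>m ((cwedge n 0 k + cwedge n 0 l) + (cwedge n j k + cwedge n j l)))"
      then have ab: "a < n" "b < n" by auto
      have "?X $$ (a, b) = (q * q) * ((coord 0 a + coord j a) * (coord k b + coord l b) - (coord 0 b + coord j b) * (coord k a + coord l a))"
        using ab by (simp add: algebra_simps)
      then show "?X $$ (a, b) = ((1/2) \<cdot>\<^sub>m ((cwedge n 0 k + cwedge n 0 l) + (cwedge n j k + cwedge n j l))) $$ (a, b)"
        unfolding q using ab by (simp add: algebra_simps)
    qed auto
    have e: "L ?X = (1/2) \<cdot>\<^sub>m ((cwedge n 0 k + cwedge n 0 l) + (s j k \<cdot>\<^sub>m cwedge n j k + s j l \<cdot>\<^sub>m cwedge n j l))"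
      unfolding X smult[OF skew_add[OF skew_add[OF wedge_skew wedge_skew] skew_add[OF wedge_skew wedge_skew]]]
        add[OF skew_add[OF wedge_skew wedge_skew] skew_add[OF wedge_skew wedge_skew]] add[OF wedge_skew wedge_skew]
        fix0[OF jkl(3,4)] fix0[OF jkl(5,6)] conjunct1[OF sm[OF jkl(1-4,7)]] conjunct1[OF sm[OF jkl(1,2,5,6,8)]] ..
    have E: "L ?X $$ (0, j) = 0" "L ?X $$ (0, k) = 1/2" "L ?X $$ (j, l) = 1/2 * s j l" "L ?X $$ (0, l) = 1/2" "L ?X $$ (j, k) = 1/2 * s j k"
      unfolding e using n0 jkl jkl(7-9)[symmetric] by (simp_all add: coord_def)
    show ?thesis using pluecker[OF LX n0 jkl(2,4,6)] unfolding E by simp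
  qed
  have "\<exists>r. (r = 1 \<or> r = -1) \<and> (\<forall>j k. 0 < j \<and> j < n \<and> 0 < k \<and> k < n \<and> j \<noteq> k --> s j k = r)"
  proof (cases "n \<ge> 3")
    case True
    have one: "s 1 k = s 1 2" if "0 < k" "k < n" "k \<noteq> 1" for k
      using s3[of 1 k 2] that True by (cases "k = 2") auto
    have c1: "s j k = s 1 2" if jk: "0 < j" "j < n" "0 < k" "k < n" "j \<noteq> k" for j k
    proof -
      consider "j = 1" | "k = 1" | "j \<noteq> 1" "k \<noteq> 1" by blast
      then show ?thesis
      proof cases
        case 1 then show ?thesis using one[of k] jk by simp
      next
        case 2 then show ?thesis using one[of j] s_sym[of j 1] jk by simp
      next
        case 3
        have "s j k = s j 1" using s3[of j k 1] jk 3 by simp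
        also have "\<dots> = s 1 j" using s_sym[of 1 j] jk 3 by simp
        finally show ?thesis using one[of j] jk 3 by simp
      qed
    qed
    have c2: "s 1 2 = 1 \<or> s 1 2 = -1" using sm[of 1 2] True by simp
    show ?thesis by (intro exI[of _ "s 1 2"] conjI c2 allI impI) (elim conjE, rule c1)
  next
    case False
    then show ?thesis by (intro exI[of _ 1]) auto
  qed
  then obtain r where r: "r = 1 \<or> r = -1" and sr0: "\<forall>j k. 0 < j \<and> j < n \<and> 0 < k \<and> k < n \<and> j \<noteq> k --> s j k = r" by (elim exE conjE)
  have sr: "s j k = r" if "0 < j" "j < n" "0 < k" "k < n" "j \<noteq> k" for j k using sr0 that by simp
  have Le: "L (cwedge n i j) = (if i = 0 \<or> j = 0 then 1 else r) \<cdot>\<^sub>m cwedge n i j" if ij: "i < n" "j < n" "i \<noteq> j" for i j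
  proof -
    consider "i = 0" "0 < j" | "j = 0" "0 < i" | "0 < i" "0 < j" using ij by force
    then show ?thesis
    proof cases
      case 1 then show ?thesis using fix0[of j] ij by (simp add: one_smult_mat)
    next
      case 2 then show ?thesis using fix0'[of i] ij by (simp add: one_smult_mat)
    next
      case 3 then show ?thesis using conjunct1[OF sm[OF 3(1) ij(1) 3(2) ij(2,3)]] sr[OF 3(1) ij(1) 3(2) ij(2,3)] by simp
    qed
  qed
  have ne: "i \<noteq> j" if "X \<in> skew_mats n" "i < n" "j < n" "X $$ (i, j) \<noteq> 0" for X i j
    using skew_entry[OF that(1) that(2) that(2)] that by auto
  from r show ?thesis
  proof
    assume r1: "r = 1"
    have "L X = X" if X: "X \<in> skew_mats n" for X
      by (rule skew_linear_agree[OF skew_linear_axioms skew_linear_id X]) (simp add: Le ne[OF X] r1 one_smult_mat)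
    then show ?thesis by blast
  next
    assume r1: "r = -1"
    have "L X = - (flip_first n * X * (flip_first n)\<^sup>T)" if X: "X \<in> skew_mats n" for X
    proof (rule skew_linear_agree[OF skew_linear_axioms skew_linear_uminus[OF skew_linear_conj[OF skew_linear_id flip_first_carrier]] X])
      fix i j assume ij: "i < n" "j < n" "X $$ (i, j) \<noteq> 0"
      have "i \<noteq> j" by (rule ne[OF X ij])
      then show "L (cwedge n i j) = - (flip_first n * cwedge n i j * (flip_first n)\<^sup>T)"
        unfolding flip_first_conj_coord[OF ij(1,2)] Le[OF ij(1,2) \<open>i \<noteq> j\<close>] r1 by auto
    qed
    then show ?thesis by blast
  qed
qed

text \<open>Adjacency makes the vectors \<open>W j\<close> pairwise orthogonal, so together with
  \<open>v\<close> they are the columns of an orthogonal matrix; conjugating back by it leads to the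
  normalised situation.\<close>

lemma bivector_preserver_pencil:
  assumes "bivector_preserver n L" and n: "0 < n" and v: "dot n v v = 1"
    and W: "\<And>j. 0 < j ==> j < n ==> dot n (W j) (W j) = 1 \<and> dot n v (W j) = 0 \<and> L (cwedge n 0 j) = wedge n v (W j)"
  shows "\<exists>Q\<in>O_group n. (\<forall>X\<in>skew_mats n. L X = Q * X * Q\<^sup>T) \<or> (\<forall>X\<in>skew_mats n. L X = - (Q * X * Q\<^sup>T))"
proof -
  interpret bivector_preserver n L by (rule assms)
  define q where "q k = (if k = 0 then v else W k)" for k
  have WW: "dot n (W j) (W k) = 0" if jk: "0 < j" "j < n" "0 < k" "k < n" "j \<noteq> k" for j k
  proof -
    have "adjacent n (wedge n v (W k)) (wedge n v (W j))"
      using adjacent[OF wedge_skew wedge_skew adjacent_coord(1)[OF n jk(4,2)]] W[of j] W[of k] jk by simp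
    then have "dot n v (mvec n (wedge n v (W j)) (W k)) = 0"
      using adjacent_orthogonal(1)[OF _ wedge_skew v] W[OF jk(3,4)] by blast
    moreover have "dot n v (mvec n (wedge n v (W j)) (W k)) = dot n v (\<lambda>i. dot n (W j) (W k) * v i)"
      using W[OF jk(3,4)] by (intro dot_cong) (auto simp: mvec_wedge)
    ultimately show ?thesis by (simp add: dot_simps v)
  qed
  have qq: "dot n (q k) (q l) = (if k = l then 1 else 0)" if "k < n" "l < n" for k l
    using that WW[of k l] W[of k] W[of l] v dot_commute[of n "W k" v] by (auto simp: q_def)
  define Q where "Q = mat n n (\<lambda>(i, k). q k i)"
  define T where "T = Q\<^sup>T"
  have c: "Q \<in> carrier_mat n n" "T \<in> carrier_mat n n" and Tt: "T\<^sup>T = Q" by (auto simp: Q_def T_def)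
  have TQ: "T * Q = 1\<^sub>m n"
  proof (rule eq_squareI[where n = n])
    fix i j :: nat assume ij: "i < n" "j < n"
    have "(T * Q) $$ (i, j) = dot n (q i) (q j)"
      unfolding index_mult_sum[OF c(2,1) ij] dot_def using ij by (intro sum.cong) (auto simp: Q_def T_def)
    then show "(T * Q) $$ (i, j) = (1\<^sub>m n) $$ (i, j)" using qq[OF ij] ij by simp
  qed (use c in auto)
  have QT: "Q * T = 1\<^sub>m n" by (rule mat_mult_left_right_inverse[OF c(2,1) TQ])
  have QO: "Q \<in> O_group n" using c QT TQ by (simp add: O_group_def T_def)
  have TO: "T \<in> O_group n" using c QT TQ by (simp add: O_group_def Tt)
  have Tq: "mvec n T (q k) i = coord k i" if "k < n" "i < n" for k i
  proof -
    have "mvec n T (q k) i = dot n (q i) (q k)" unfolding mvec_def dot_def using that by (intro sum.cong) (auto simp: T_def Q_def)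
    then show ?thesis using qq[OF that(2,1)] by (auto simp: coord_def)
  qed
  have "T * L (cwedge n 0 j) * T\<^sup>T = cwedge n 0 j" if j: "0 < j" "j < n" for j
  proof -
    have "L (cwedge n 0 j) = wedge n (q 0) (q j)" using W[OF j] j by (simp add: q_def)
    then have "T * L (cwedge n 0 j) * T\<^sup>T = wedge n (mvec n T (q 0)) (mvec n T (q j))"
      using conj_wedge[OF c(2)] by simp
    also have "\<dots> = cwedge n 0 j" by (rule wedge_cong) (use Tq n j in auto)
    finally show ?thesis .
  qed
  note norm = bivector_preserver_normalised[OF bivector_preserver_conj[OF assms(1) TO] this]
  have recover: "L X = Q * (T * L X * T\<^sup>T) * Q\<^sup>T" if "X \<in> skew_mats n" for X
    using conj_cancel[OF TO skew_carrier[OF skew[OF that]]] unfolding Tt by (simp add: T_def)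
  from norm show ?thesis
  proof
    assume a: "\<forall>X\<in>skew_mats n. T * L X * T\<^sup>T = X"
    have "L X = Q * X * Q\<^sup>T" if "X \<in> skew_mats n" for X
      using recover[OF that] bspec[OF a that] by simp
    then show ?thesis using QO by blast
  next
    assume a: "\<forall>X\<in>skew_mats n. T * L X * T\<^sup>T = - (flip_first n * X * (flip_first n)\<^sup>T)"
    let ?D = "flip_first n"
    have "L X = - ((Q * ?D) * X * (Q * ?D)\<^sup>T)" if X: "X \<in> skew_mats n" for X
    proof -
      have DX: "?D * X * ?D\<^sup>T \<in> carrier_mat n n" by (rule skew_carrier[OF conj_skew[OF X flip_first_carrier]])
      have "L X = Q * (- (?D * X * ?D\<^sup>T)) * Q\<^sup>T"
        by (rule trans[OF recover[OF X]]) (simp only: bspec[OF a X])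
      also have "\<dots> = - (Q * (?D * X * ?D\<^sup>T) * Q\<^sup>T)"
        by (rule conj_uminus[OF c(1) DX])
      finally show ?thesis unfolding conj_conj[OF c(1) flip_first_carrier skew_carrier[OF X]] .
    qed
    then show ?thesis using O_group_mult[OF QO flip_first_O] by blast
  qed
qed

text \<open>The pairwise adjacent images of \<open>e\<^sub>0 \<and> e\<^sub>j\<close> either share a vector (a pencil) or,
  in dimension 4 only, form the three sides of a triangle; \<^const>\<open>tilde_mat\<close> exchanges the two.\<close>

lemma bivector_preserver_base:
  assumes "bivector_preserver n L" and n: "3 \<le> n"
  shows "\<exists>v w z. dot n v v = 1 \<and> dot n w w = 1 \<and> dot n z z = 1 \<and> dot n v w = 0 \<and> dot n v z = 0 \<and> dot n w z = 0 \<and>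
    L (cwedge n 0 1) = wedge n v w \<and> L (cwedge n 0 2) = wedge n v z \<and>
    (\<forall>X\<in>skew_mats n. adjacent n (cwedge n 0 1) X --> adjacent n (cwedge n 0 2) X -->
      (\<exists>u. dot n u u = 1 \<and> dot n v u = 0 \<and> dot n w u = 0 \<and> dot n z u = 0 \<and> L X = wedge n v u) \<or>
      L X = wedge n w z \<or> L X = wedge n z w)"
proof -
  interpret bivector_preserver n L by (rule assms)
  have "adjacent n (L (cwedge n 0 1)) (L (cwedge n 0 2))"
    by (rule adjacent[OF wedge_skew wedge_skew adjacent_coord(1)]) (use n in auto)
  from adjacent_normal_form[OF skew[OF wedge_skew] skew[OF wedge_skew] this]
  obtain v w z where on: "dot n v v = 1" "dot n w w = 1" "dot n z z = 1" "dot n v w = 0" "dot n v z = 0" "dot n w z = 0"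
    and e: "L (cwedge n 0 1) = wedge n v w" "L (cwedge n 0 2) = wedge n v z"
    by (elim exE conjE)
  have "(\<exists>u. dot n u u = 1 \<and> dot n v u = 0 \<and> dot n w u = 0 \<and> dot n z u = 0 \<and> L X = wedge n v u) \<or>
      L X = wedge n w z \<or> L X = wedge n z w"
    if X: "X \<in> skew_mats n" and adj: "adjacent n (cwedge n 0 1) X" "adjacent n (cwedge n 0 2) X" for X
    using adjacent[OF wedge_skew X adj(1)] adjacent[OF wedge_skew X adj(2)] unfolding e
    by (rule adjacent_pencil[OF on skew[OF X]])
  then show ?thesis using on e by (intro exI[of _ v] exI[of _ w] exI[of _ z]) simp
qed

text \<open>At most one coordinate plane is mapped to the third side of the triangle, because two of
  them would have images equal up to sign, against injectivity.\<close>

lemma cwedge_independent: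
  assumes "bivector_preserver n L" and ij: "i < n" "j < n" "i \<noteq> j" and kl: "(i \<noteq> k \<or> j \<noteq> l)" "(i \<noteq> l \<or> j \<noteq> k)"
    and "L (cwedge n i j) = wedge n w z \<or> L (cwedge n i j) = wedge n z w"
    and "L (cwedge n k l) = wedge n w z \<or> L (cwedge n k l) = wedge n z w"
  shows False
proof -
  interpret bivector_preserver n L by (rule assms)
  have sw: "wedge n z w = (-1) \<cdot>\<^sub>m wedge n w z" "wedge n w z = (-1) \<cdot>\<^sub>m wedge n z w" by (auto intro!: eq_matI)
  have "L (cwedge n i j) = L (cwedge n k l) \<or> L (cwedge n i j) = (-1) \<cdot>\<^sub>m L (cwedge n k l)"
    using assms(7,8) by (elim disjE) (simp_all only: sw(1)[symmetric] sw(2)[symmetric] simp_thms)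
  then have "L (cwedge n i j) = L (cwedge n k l) \<or> L (cwedge n i j) = L ((-1) \<cdot>\<^sub>m cwedge n k l)"
    unfolding smult[OF wedge_skew] .
  then have "cwedge n i j = cwedge n k l \<or> cwedge n i j = (-1) \<cdot>\<^sub>m cwedge n k l"
    using inj[OF wedge_skew wedge_skew] inj[OF wedge_skew skew_smult[OF wedge_skew]] by blast
  then have "cwedge n i j $$ (i, j) = cwedge n k l $$ (i, j) \<or> cwedge n i j $$ (i, j) = ((-1) \<cdot>\<^sub>m cwedge n k l) $$ (i, j)"
    by auto
  then show False using ij kl by (auto simp: coord_def split: if_splits)
qed

text \<open>If some \<open>cwedge n 0 j\<close> went to the third side of the triangle, another
  index \<open>k\<close> would give a plane whose image contains \<open>v\<close> and is orthogonal
  to \<open>w\<close> and \<open>z\<close>. Such a plane is not adjacent to that of \<open>w\<close>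
  and \<open>z\<close>, although the two preimages are adjacent.\<close>

theorem bivector_preserver_not_four:
  assumes "bivector_preserver n L" and n: "3 \<le> n" "n \<noteq> 4"
  shows "\<exists>Q\<in>O_group n. (\<forall>X\<in>skew_mats n. L X = Q * X * Q\<^sup>T) \<or> (\<forall>X\<in>skew_mats n. L X = - (Q * X * Q\<^sup>T))"
proof -
  interpret bivector_preserver n L by (rule assms)
  obtain v w z where on: "dot n v v = 1" "dot n w w = 1" "dot n z z = 1" "dot n v w = 0" "dot n v z = 0" "dot n w z = 0"
    and e: "L (cwedge n 0 1) = wedge n v w" "L (cwedge n 0 2) = wedge n v z"
    and cases: "\<forall>X\<in>skew_mats n. adjacent n (cwedge n 0 1) X --> adjacent n (cwedge n 0 2) X -->
      (\<exists>u. dot n u u = 1 \<and> dot n v u = 0 \<and> dot n w u = 0 \<and> dot n z u = 0 \<and> L X = wedge n v u) \<or>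
      L X = wedge n w z \<or> L X = wedge n z w"
    using bivector_preserver_base[OF assms(1) n(1)] by (elim exE conjE)
  have cs: "(\<exists>u. dot n u u = 1 \<and> dot n v u = 0 \<and> dot n w u = 0 \<and> dot n z u = 0 \<and> L (cwedge n 0 j) = wedge n v u) \<or>
      L (cwedge n 0 j) = wedge n w z \<or> L (cwedge n 0 j) = wedge n z w" if "3 \<le> j" "j < n" for j
    by (rule cases[rule_format, OF wedge_skew adjacent_coord(1) adjacent_coord(1)]) (use that in auto)
  have no: "\<not> (L (cwedge n 0 j) = wedge n w z \<or> L (cwedge n 0 j) = wedge n z w)" if j: "3 \<le> j" "j < n" for j
  proof
    assume t: "L (cwedge n 0 j) = wedge n w z \<or> L (cwedge n 0 j) = wedge n z w"
    \<comment> \<open>A second index from 3 on exists because \<open>j\<close> forces n > 3 and the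
      value 4 is excluded.\<close>
    define k where "k = (if j = 3 then 4 else 3 :: nat)"
    have k: "3 \<le> k" "k < n" "k \<noteq> j" using j n by (auto simp: k_def)
    from cs[OF k(1,2)] show False
    proof
      assume "L (cwedge n 0 k) = wedge n w z \<or> L (cwedge n 0 k) = wedge n z w"
      then show False by (intro cwedge_independent[OF assms(1) _ _ _ _ _ t, where k = 0 and l = k]) (use j k in auto)
    next
      assume "\<exists>u. dot n u u = 1 \<and> dot n v u = 0 \<and> dot n w u = 0 \<and> dot n z u = 0 \<and> L (cwedge n 0 k) = wedge n v u"
      then obtain u where u: "dot n u u = 1" "dot n v u = 0" "dot n w u = 0" "dot n z u = 0" "L (cwedge n 0 k) = wedge n v u"
        by (elim exE conjE)
      have adj: "adjacent n (L (cwedge n 0 j)) (wedge n v u)"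
        unfolding u(5)[symmetric] by (rule adjacent[OF wedge_skew wedge_skew adjacent_coord(1)]) (use j k in auto)
      have zw: "dot n z w = 0" using on dot_commute[of n z w] by simp
      have uz: "dot n u z = 0" "dot n u w = 0" using u dot_commute[of n u z] dot_commute[of n u w] by auto
      have m: "mvec n (wedge n v u) w i = 0" "mvec n (wedge n v u) z i = 0" if "i < n" for i
        unfolding mvec_wedge[OF that] by (simp_all add: on uz)
      have "wedge n v u $$ (a, b) = 0" if ab: "a < n" "b < n" for a b
        using t
      proof
        assume t': "L (cwedge n 0 j) = wedge n w z"
        show ?thesis using adjacent_orthogonal(2)[OF adj[unfolded t'] wedge_skew on(2,3,6) ab] by (simp only: m ab)
      next
        assume t': "L (cwedge n 0 j) = wedge n z w"
        show ?thesis using adjacent_orthogonal(2)[OF adj[unfolded t'] wedge_skew on(3,2) zw ab] by (simp only: m ab)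
      qed
      then have "sqnorm n (wedge n v u) = 0" by (simp add: sqnorm_def del: wedge_index)
      moreover have "wedge n v u \<in> unit_bivectors n" unfolding unit_bivectors_def using on(1) u by blast
      ultimately show False using unit_bivector_sqnorm by fastforce
    qed
  qed
  have "\<forall>j. \<exists>u. 0 < j \<and> j < n --> dot n u u = 1 \<and> dot n v u = 0 \<and> L (cwedge n 0 j) = wedge n v u"
  proof
    fix j :: nat
    consider "j = 0" | "j = 1" | "j = 2" | "3 \<le> j" by linarith
    then show "\<exists>u. 0 < j \<and> j < n --> dot n u u = 1 \<and> dot n v u = 0 \<and> L (cwedge n 0 j) = wedge n v u"
    proof cases
      case 2 then show ?thesis using on e by (intro exI[of _ w]) simp
    next
      case 3 then show ?thesis using on e by (intro exI[of _ z]) simp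
    next
      case 4 then show ?thesis using cs[of j] no[of j] by (cases "j < n") auto
    qed auto
  qed
  then have "\<exists>W. \<forall>j. 0 < j \<and> j < n --> dot n (W j) (W j) = 1 \<and> dot n v (W j) = 0 \<and> L (cwedge n 0 j) = wedge n v (W j)"
    by (rule choice)
  then obtain W where "\<forall>j. 0 < j \<and> j < n --> dot n (W j) (W j) = 1 \<and> dot n v (W j) = 0 \<and> L (cwedge n 0 j) = wedge n v (W j)" ..
  then show ?thesis using n by (intro bivector_preserver_pencil[OF assms(1) _ on(1), of W]) auto
qed

section \<open>Dimension four and the exchange of pencils with triangles\<close>

lemma sum4: "(\<Sum>i<(4::nat). g i) = g 0 + g 1 + g 2 + g 3"
  by (simp add: eval_nat_numeral)

lemma less4: "(i::nat) < 4 \<longleftrightarrow> i = 0 \<or> i = 1 \<or> i = 2 \<or> i = 3"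
  by auto

lemma tilde_carrier [simp]: "tilde_mat X \<in> carrier_mat 4 4"
  by (simp add: tilde_mat_def)

text \<open>An involution of the index pairs that commutes with exchanging the two indices; this is
  why \<open>tilde_mat\<close> is an involution that keeps skewness.\<close>

definition tilde_perm :: "nat \<times> nat \<Rightarrow> nat \<times> nat" where
  "tilde_perm p = (if p = (0, 3) then (1, 2) else if p = (1, 2) then (0, 3)
     else if p = (3, 0) then (2, 1) else if p = (2, 1) then (3, 0) else p)"

lemma tilde_mat_perm: "tilde_mat X = mat 4 4 (\<lambda>p. X $$ tilde_perm p)"
  unfolding tilde_mat_def tilde_perm_def by (rule arg_cong[of _ _ "mat 4 4"]) (rule ext, simp)

lemma tilde_perm_range: "i < 4 ==> j < 4 ==> tilde_perm (i, j) \<in> {..<4} \<times> {..<4}"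
  by (simp add: tilde_perm_def)

lemma tilde_perm_tilde_perm: "tilde_perm (tilde_perm p) = p"
  by (simp add: tilde_perm_def)

lemma tilde_perm_swap: "tilde_perm (j, i) = prod.swap (tilde_perm (i, j))"
  by (simp add: tilde_perm_def)

lemma tilde_index: "i < 4 ==> j < 4 ==> tilde_mat X $$ (i, j) = X $$ tilde_perm (i, j)"
  by (simp add: tilde_mat_perm)

lemma tilde_obtain:
  assumes "i < 4" "j < 4"
  obtains a b where "tilde_perm (i, j) = (a, b)" "a < 4" "b < 4"
proof -
  obtain a b where ab: "tilde_perm (i, j) = (a, b)" by (rule prod.exhaust)
  show ?thesis by (rule that[OF ab]) (use tilde_perm_range[OF assms] ab in auto)
qed

lemma tilde_skew:
  assumes X: "X \<in> skew_mats 4"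
  shows "tilde_mat X \<in> skew_mats 4"
proof (rule skewI)
  fix i j :: nat assume ij: "i < 4" "j < 4"
  obtain a b where ab: "tilde_perm (i, j) = (a, b)" "a < 4" "b < 4" by (rule tilde_obtain[OF ij])
  show "tilde_mat X $$ (j, i) = - tilde_mat X $$ (i, j)"
    unfolding tilde_index[OF ij] tilde_index[OF ij(2,1)] tilde_perm_swap[of j i] ab(1) prod.swap_def fst_conv snd_conv
    by (rule skew_entry[OF X ab(2,3)])
qed simp

lemma tilde_add:
  assumes X: "X \<in> carrier_mat 4 4" and Y: "Y \<in> carrier_mat 4 4"
  shows "tilde_mat (X + Y) = tilde_mat X + tilde_mat Y"
proof (rule eq_squareI[where n = 4])
  fix i j :: nat assume ij: "i < 4" "j < 4"
  obtain a b where ab: "tilde_perm (i, j) = (a, b)" "a < 4" "b < 4" by (rule tilde_obtain[OF ij])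
  show "tilde_mat (X + Y) $$ (i, j) = (tilde_mat X + tilde_mat Y) $$ (i, j)"
    using ij ab X Y by (simp add: tilde_mat_perm)
qed (auto simp: tilde_mat_perm)

lemma tilde_smult:
  assumes X: "X \<in> carrier_mat 4 4"
  shows "tilde_mat (c \<cdot>\<^sub>m X) = c \<cdot>\<^sub>m tilde_mat X"
proof (rule eq_squareI[where n = 4])
  fix i j :: nat assume ij: "i < 4" "j < 4"
  obtain a b where ab: "tilde_perm (i, j) = (a, b)" "a < 4" "b < 4" by (rule tilde_obtain[OF ij])
  show "tilde_mat (c \<cdot>\<^sub>m X) $$ (i, j) = (c \<cdot>\<^sub>m tilde_mat X) $$ (i, j)"
    using ij ab X by (simp add: tilde_mat_perm)
qed (auto simp: tilde_mat_perm)

lemma tilde_tilde: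
  assumes X: "X \<in> carrier_mat 4 4"
  shows "tilde_mat (tilde_mat X) = X"
proof (rule eq_squareI[where n = 4])
  fix i j :: nat assume ij: "i < 4" "j < 4"
  obtain a b where ab: "tilde_perm (i, j) = (a, b)" "a < 4" "b < 4" by (rule tilde_obtain[OF ij])
  have "tilde_mat (tilde_mat X) $$ (i, j) = tilde_mat X $$ (a, b)" unfolding tilde_index[OF ij] ab(1) ..
  also have "\<dots> = X $$ tilde_perm (a, b)" by (rule tilde_index[OF ab(2,3)])
  also have "\<dots> = X $$ (i, j)" unfolding ab(1)[symmetric] tilde_perm_tilde_perm ..
  finally show "tilde_mat (tilde_mat X) $$ (i, j) = X $$ (i, j)" .
qed (use X in \<open>auto simp: tilde_mat_perm\<close>)

lemma skew4_entries:
  assumes X: "X \<in> skew_mats 4"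
  shows "X $$ (0, 0) = 0" "X $$ (1, 1) = 0" "X $$ (2, 2) = 0" "X $$ (3, 3) = 0"
    "X $$ (1, 0) = - X $$ (0, 1)" "X $$ (2, 0) = - X $$ (0, 2)" "X $$ (3, 0) = - X $$ (0, 3)"
    "X $$ (2, 1) = - X $$ (1, 2)" "X $$ (3, 1) = - X $$ (1, 3)" "X $$ (3, 2) = - X $$ (2, 3)"
  using skew_entry[OF X, of 0 0] skew_entry[OF X, of 1 1] skew_entry[OF X, of 2 2] skew_entry[OF X, of 3 3]
    skew_entry[OF X, of 0 1] skew_entry[OF X, of 0 2] skew_entry[OF X, of 0 3] skew_entry[OF X, of 1 2]
    skew_entry[OF X, of 1 3] skew_entry[OF X, of 2 3] by simp_all

text \<open>In dimension four decomposability is the vanishing of the Pfaffian, which is the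
  condition \<open>p\<close>.\<close>

lemma unit_bivector4I:
  assumes X: "X \<in> skew_mats 4"
    and s: "(X $$ (0, 1))\<^sup>2 + (X $$ (0, 2))\<^sup>2 + (X $$ (0, 3))\<^sup>2 + (X $$ (1, 2))\<^sup>2 + (X $$ (1, 3))\<^sup>2 + (X $$ (2, 3))\<^sup>2 = 1"
    and p: "X $$ (0, 1) * X $$ (2, 3) - X $$ (0, 2) * X $$ (1, 3) + X $$ (0, 3) * X $$ (1, 2) = 0"
  shows "X \<in> unit_bivectors 4"
proof (rule unit_bivectorI[OF X])
  note Xc = skew_carrier[OF X]
  note ent = skew4_entries[OF X]
  show "sqnorm 4 X = 2" unfolding sqnorm_def sum4 ent using s by (simp add: power2_eq_square)
  have XXc: "X * X \<in> carrier_mat 4 4" using Xc by simp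
  show "X * X * X = - X"
  proof (rule eq_squareI[where n = 4])
    fix i j :: nat assume ij: "i < 4" "j < 4"
    have neg: "(- X) $$ (i, j) = - X $$ (i, j)" using ij Xc by simp
    define a b c d e f where ab: "a = X $$ (0, 1)" "b = X $$ (0, 2)" "c = X $$ (0, 3)" "d = X $$ (1, 2)" "e = X $$ (1, 3)" "f = X $$ (2, 3)"
    have s': "a\<^sup>2 + b\<^sup>2 + c\<^sup>2 + d\<^sup>2 + e\<^sup>2 + f\<^sup>2 = 1" and p': "a * f - b * e + c * d = 0" using s p unfolding ab .
    \<comment> \<open>The entries \<open>h i j - h j i\<close> form the Hodge dual of
      \<open>X\<close>. Every skew matrix of size four satisfies X^3 = -q X + Pf(X) times this dual,
      where q is the sum of squares above the diagonal.\<close>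
    define h where "h i j = (if i = (0::nat) \<and> j = (1::nat) then f else if i = 0 \<and> j = 2 then - e else if i = 0 \<and> j = 3 then d
      else if i = 1 \<and> j = 2 then c else if i = 1 \<and> j = 3 then - b else if i = 2 \<and> j = 3 then a else 0)" for i j
    have "(\<Sum>l<4. (\<Sum>k<4. X $$ (i, k) * X $$ (k, l)) * X $$ (l, j)) =
      - (a\<^sup>2 + b\<^sup>2 + c\<^sup>2 + d\<^sup>2 + e\<^sup>2 + f\<^sup>2) * X $$ (i, j) + (a * f - b * e + c * d) * (h i j - h j i)"
      using ij unfolding less4 sum4
      by (elim disjE; simp only: ent ab[symmetric]; simp add: h_def algebra_simps power2_eq_square)
    then have "(\<Sum>l<4. (\<Sum>k<4. X $$ (i, k) * X $$ (k, l)) * X $$ (l, j)) = - X $$ (i, j)"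
      unfolding s' p' by simp
    then show "(X * X * X) $$ (i, j) = (- X) $$ (i, j)"
      unfolding neg index_mult_sum[OF XXc Xc ij] using index_mult_sum[OF Xc Xc ij(1)] by simp
  qed (use Xc in auto)
qed

text \<open>The entries (0, 3) and (1, 2) that are exchanged enter the Pfaffian as a product and the
  norm as a sum of squares, so both are unchanged.\<close>

lemma tilde_unit_bivector:
  assumes X: "X \<in> unit_bivectors 4"
  shows "tilde_mat X \<in> unit_bivectors 4"
proof (rule unit_bivector4I[OF tilde_skew])
  show Xs: "X \<in> skew_mats 4" by (rule unit_bivectors_skew[OF X])
  have "sqnorm 4 X = 2" by (rule unit_bivector_sqnorm[OF X])
  then have "(X $$ (0, 1))\<^sup>2 + (X $$ (0, 2))\<^sup>2 + (X $$ (0, 3))\<^sup>2 + (X $$ (1, 2))\<^sup>2 + (X $$ (1, 3))\<^sup>2 + (X $$ (2, 3))\<^sup>2 = 1"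
    unfolding sqnorm_def sum4 skew4_entries[OF Xs] by (simp add: power2_eq_square)
  then show "(tilde_mat X $$ (0, 1))\<^sup>2 + (tilde_mat X $$ (0, 2))\<^sup>2 + (tilde_mat X $$ (0, 3))\<^sup>2 + (tilde_mat X $$ (1, 2))\<^sup>2 + (tilde_mat X $$ (1, 3))\<^sup>2 + (tilde_mat X $$ (2, 3))\<^sup>2 = 1"
    by (simp add: tilde_mat_def)
  show "tilde_mat X $$ (0, 1) * tilde_mat X $$ (2, 3) - tilde_mat X $$ (0, 2) * tilde_mat X $$ (1, 3) + tilde_mat X $$ (0, 3) * tilde_mat X $$ (1, 2) = 0"
    using pluecker[OF X, of 0 1 2 3] by (simp add: tilde_mat_def mult.commute)
qed

lemma bivector_preserver_tilde:
  assumes "bivector_preserver 4 L"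
  shows "bivector_preserver 4 (\<lambda>X. L (tilde_mat X))"
proof -
  interpret bivector_preserver 4 L by (rule assms)
  show ?thesis
  proof
    fix X assume X: "X \<in> skew_mats 4"
    note Xc = skew_carrier[OF X]
    show "L (tilde_mat X) \<in> skew_mats 4" by (rule skew[OF tilde_skew[OF X]])
    show "L (tilde_mat (X + Y)) = L (tilde_mat X) + L (tilde_mat Y)" if Y: "Y \<in> skew_mats 4" for Y
      unfolding tilde_add[OF Xc skew_carrier[OF Y]] by (rule add[OF tilde_skew[OF X] tilde_skew[OF Y]])
    show "L (tilde_mat (s \<cdot>\<^sub>m X)) = s \<cdot>\<^sub>m L (tilde_mat X)" for s
      unfolding tilde_smult[OF Xc] by (rule smult[OF tilde_skew[OF X]])
    assume "L (tilde_mat X) = 0\<^sub>m 4 4"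
    then have "tilde_mat X = 0\<^sub>m 4 4" by (rule kernel[OF tilde_skew[OF X]])
    then have "X = tilde_mat (0\<^sub>m 4 4)" using tilde_tilde[OF Xc] by simp
    also have "\<dots> = 0\<^sub>m 4 4" by (rule eq_matI) (auto simp: tilde_mat_def)
    finally show "X = 0\<^sub>m 4 4" .
  next
    fix X assume "X \<in> unit_bivectors 4"
    then show "L (tilde_mat X) \<in> unit_bivectors 4" by (intro unit tilde_unit_bivector)
  qed
qed

text \<open>If \<open>cwedge 4 0 3\<close> goes to the third side of the triangle, then
  \<open>cwedge 4 1 2\<close>, the third side of the triangle with \<open>cwedge 4 0 1\<close> and
  \<open>cwedge 4 0 2\<close>, must be sent into the pencil at \<open>v\<close>. Precomposing with
  \<open>tilde_mat\<close>, which exchanges the two, restores the pencil case.\<close>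

theorem bivector_preserver_four:
  assumes "bivector_preserver 4 L"
  shows "\<exists>Q\<in>O_group 4. (\<forall>X\<in>skew_mats 4. L X = Q * X * Q\<^sup>T) \<or> (\<forall>X\<in>skew_mats 4. L X = - (Q * X * Q\<^sup>T)) \<or>
    (\<forall>X\<in>skew_mats 4. L (tilde_mat X) = Q * X * Q\<^sup>T) \<or> (\<forall>X\<in>skew_mats 4. L (tilde_mat X) = - (Q * X * Q\<^sup>T))"
proof -
  interpret bivector_preserver 4 L by (rule assms)
  have n34: "3 \<le> (4::nat)" by simp
  obtain v w z where on: "dot 4 v v = 1" "dot 4 w w = 1" "dot 4 z z = 1" "dot 4 v w = 0" "dot 4 v z = 0" "dot 4 w z = 0"
    and e: "L (cwedge 4 0 1) = wedge 4 v w" "L (cwedge 4 0 2) = wedge 4 v z"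
    and cases: "\<forall>X\<in>skew_mats 4. adjacent 4 (cwedge 4 0 1) X --> adjacent 4 (cwedge 4 0 2) X -->
      (\<exists>u. dot 4 u u = 1 \<and> dot 4 v u = 0 \<and> dot 4 w u = 0 \<and> dot 4 z u = 0 \<and> L X = wedge 4 v u) \<or>
      L X = wedge 4 w z \<or> L X = wedge 4 z w"
    using bivector_preserver_base[OF assms n34] by (elim exE conjE)
  have c03: "(\<exists>u. dot 4 u u = 1 \<and> dot 4 v u = 0 \<and> dot 4 w u = 0 \<and> dot 4 z u = 0 \<and> L (cwedge 4 0 3) = wedge 4 v u) \<or>
      L (cwedge 4 0 3) = wedge 4 w z \<or> L (cwedge 4 0 3) = wedge 4 z w"
    by (rule cases[rule_format, OF wedge_skew adjacent_coord(1) adjacent_coord(1)]) auto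
  have c12: "(\<exists>u. dot 4 u u = 1 \<and> dot 4 v u = 0 \<and> dot 4 w u = 0 \<and> dot 4 z u = 0 \<and> L (cwedge 4 1 2) = wedge 4 v u) \<or>
      L (cwedge 4 1 2) = wedge 4 w z \<or> L (cwedge 4 1 2) = wedge 4 z w"
    by (rule cases[rule_format, OF wedge_skew adjacent_coord(2) adjacent_coord(3)]) auto
  have j: "j = 1 \<or> j = 2 \<or> j = 3" if "0 < j" "j < 4" for j :: nat using that by auto
  from c03 show ?thesis
  proof
    assume "\<exists>u. dot 4 u u = 1 \<and> dot 4 v u = 0 \<and> dot 4 w u = 0 \<and> dot 4 z u = 0 \<and> L (cwedge 4 0 3) = wedge 4 v u"
    then obtain u where u: "dot 4 u u = 1" "dot 4 v u = 0" "L (cwedge 4 0 3) = wedge 4 v u" by (elim exE conjE)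
    have "\<exists>Q\<in>O_group 4. (\<forall>X\<in>skew_mats 4. L X = Q * X * Q\<^sup>T) \<or> (\<forall>X\<in>skew_mats 4. L X = - (Q * X * Q\<^sup>T))"
      by (rule bivector_preserver_pencil[OF assms _ on(1), of "\<lambda>j. if j = 1 then w else if j = 2 then z else u"])
        (simp, drule (1) j, elim disjE, simp_all add: on e[simplified] u)
    then show ?thesis by blast
  next
    assume t: "L (cwedge 4 0 3) = wedge 4 w z \<or> L (cwedge 4 0 3) = wedge 4 z w"
    have "\<not> (L (cwedge 4 1 2) = wedge 4 w z \<or> L (cwedge 4 1 2) = wedge 4 z w)"
      by (rule notI, rule cwedge_independent[OF assms _ _ _ _ _ t]) auto
    then obtain u where u: "dot 4 u u = 1" "dot 4 v u = 0" "L (cwedge 4 1 2) = wedge 4 v u" using c12 by blast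
    have te: "tilde_mat (cwedge 4 0 1) = cwedge 4 0 1" "tilde_mat (cwedge 4 0 2) = cwedge 4 0 2" "tilde_mat (cwedge 4 0 3) = cwedge 4 1 2"
      by (rule eq_matI; auto simp: tilde_mat_def coord_def less4)+
    have "\<exists>Q\<in>O_group 4. (\<forall>X\<in>skew_mats 4. L (tilde_mat X) = Q * X * Q\<^sup>T) \<or> (\<forall>X\<in>skew_mats 4. L (tilde_mat X) = - (Q * X * Q\<^sup>T))"
      by (rule bivector_preserver_pencil[OF bivector_preserver_tilde[OF assms] _ on(1), of "\<lambda>j. if j = 1 then w else if j = 2 then z else u"])
        (simp, drule (1) j, elim disjE, simp_all add: on te[simplified] e[simplified] u[simplified])
    then show ?thesis by blast
  qed
qed

section \<open>The linear part of an isometry\<close>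

lemma skew_one_zero:
  assumes "X \<in> skew_mats 1"
  shows "X = 0\<^sub>m 1 1"
  using skew_carrier[OF assms] skew_entry[OF assms, of 0 0] by (intro eq_matI) auto

lemma skew_two_span:
  assumes X: "X \<in> skew_mats 2"
  shows "X = X $$ (0, 1) \<cdot>\<^sub>m cwedge 2 0 1"
proof (rule eq_matI)
  fix i j assume "i < dim_row (X $$ (0, 1) \<cdot>\<^sub>m cwedge 2 0 1)" "j < dim_col (X $$ (0, 1) \<cdot>\<^sub>m cwedge 2 0 1)"
  then have ij: "i < 2" "j < 2" by auto
  have e: "X $$ (0, 0) = 0" "X $$ (1, 1) = 0" "X $$ (1, 0) = - X $$ (0, 1)"
    using skew_entry[OF X, of 0 0] skew_entry[OF X, of 1 1] skew_entry[OF X, of 0 1] by simp_all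
  have "(i = 0 \<or> i = 1) \<and> (j = 0 \<or> j = 1)" using ij by auto
  then show "X $$ (i, j) = (X $$ (0, 1) \<cdot>\<^sub>m cwedge 2 0 1) $$ (i, j)"
    using e by (elim conjE disjE) (simp_all add: coord_def)
qed (use skew_carrier[OF X] in auto)

lemma cwedge_unit:
  assumes "i < n" "j < n" "i \<noteq> j"
  shows "cwedge n i j \<in> unit_bivectors n"
proof -
  have "dot n (coord i) (coord i) = 1" "dot n (coord j) (coord j) = 1" "dot n (coord i) (coord j) = 0"
    unfolding dot_coord_left[OF assms(1)] dot_coord_left[OF assms(2)] using assms by (auto simp: coord_def)
  then show ?thesis unfolding unit_bivectors_def by blast
qed

lemma int_unit_of_inverse:
  fixes c :: real
  assumes "c * of_int k = 1" "c = of_int m"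
  shows "c = 1 \<or> c = -1"
proof -
  have "of_int (m * k) = (1 :: real)" using assms by simp
  then have "m * k = 1" by (simp only: of_int_eq_1_iff)
  then have "m = 1 \<or> m = -1" by (metis abs_zmult_eq_1 abs_eq_iff' abs_1)
  then show ?thesis using assms by auto
qed

context circle_metric
begin

lemma \<delta>_le_one_imp_one:
  assumes A: "A \<in> O_group n" and le: "\<delta> A \<le> \<delta> (1\<^sub>m n)"
  shows "A = 1\<^sub>m n"
proof -
  note Ac = O_groupD(1)[OF A]
  obtain c where c: "c > 0" "\<forall>C\<in>O_group n. c * frob C \<le> \<delta> C" using frob_le_\<delta> by blast
  obtain c' where c': "c' > 0" "\<forall>C\<in>O_group n. \<delta> C \<le> c' * frob C" using \<delta>_le_frob by blast
  have "frob (1\<^sub>m n) = 0" by (simp add: frobenius_norm_def)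
  then have "\<delta> (1\<^sub>m n) \<le> 0" using bspec[OF c'(2) O_group_one] by simp
  then have "c * frob A \<le> 0" using bspec[OF c(2) A] le by linarith
  then have f: "frob A \<le> 0" using c(1) by (simp add: mult_le_0_iff)
  show ?thesis
  proof (rule eq_squareI[where n = n])
    fix i j :: nat assume ij: "i < n" "j < n"
    have "\<bar>(A - 1\<^sub>m n) $$ (i, j)\<bar> \<le> 0" using entry_le_frob[OF Ac ij] f by linarith
    then have "(A - 1\<^sub>m n) $$ (i, j) = 0" by simp
    then show "A $$ (i, j) = 1\<^sub>m n $$ (i, j)" using ij Ac by simp
  qed (use Ac in auto)
qed

theorem isometry_conj_part:
  assumes \<psi>: "\<psi> \<in> SO_group n \<rightarrow> SO_group n"
    and iso: "\<And>A B. A \<in> SO_group n ==> B \<in> SO_group n ==> d_Nf N f (\<psi> A) (\<psi> B) = d_Nf N f A B"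
    and one: "\<psi> (1\<^sub>m n) = 1\<^sub>m n"
  shows "\<exists>Q\<in>O_group n.
    (\<forall>X\<in>skew_mats n. \<psi> (exp_mat X) = exp_mat (Q * X * Q\<^sup>T)) \<or>
    (\<forall>X\<in>skew_mats n. \<psi> (exp_mat X) = exp_mat (Q * (- X) * Q\<^sup>T)) \<or>
    (n = 4 \<and> (\<forall>X\<in>skew_mats n. \<psi> (exp_mat X) = exp_mat (Q * tilde_mat X * Q\<^sup>T))) \<or>
    (n = 4 \<and> (\<forall>X\<in>skew_mats n. \<psi> (exp_mat X) = exp_mat (Q * (- tilde_mat X) * Q\<^sup>T)))"
proof -
  have "\<exists>L. (\<forall>X\<in>skew_mats n. L X \<in> skew_mats n \<and> \<psi> (exp_mat X) = exp_mat (L X)) \<and>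
    (\<forall>X\<in>skew_mats n. \<forall>Y\<in>skew_mats n. L (X + Y) = L X + L Y) \<and>
    (\<forall>X\<in>skew_mats n. \<forall>s. L (s \<cdot>\<^sub>m X) = s \<cdot>\<^sub>m L X) \<and>
    (\<forall>X\<in>skew_mats n. L X = 0\<^sub>m n n --> X = 0\<^sub>m n n) \<and>
    (\<forall>Y\<in>skew_mats n. \<exists>X\<in>skew_mats n. L X = Y) \<and>
    (\<forall>X\<in>skew_mats n. \<forall>Y\<in>skew_mats n. L (bracket X (bracket X Y)) = bracket (L X) (bracket (L X) (L Y)))"
    by (rule isometry_linear_part[OF \<psi> iso one]) assumption+
  then obtain L where h1: "\<forall>X\<in>skew_mats n. L X \<in> skew_mats n \<and> \<psi> (exp_mat X) = exp_mat (L X)"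
    and h2: "\<forall>X\<in>skew_mats n. \<forall>Y\<in>skew_mats n. L (X + Y) = L X + L Y"
    and h3: "\<forall>X\<in>skew_mats n. \<forall>s. L (s \<cdot>\<^sub>m X) = s \<cdot>\<^sub>m L X"
    and h4: "\<forall>X\<in>skew_mats n. L X = 0\<^sub>m n n --> X = 0\<^sub>m n n"
    and h5: "\<forall>Y\<in>skew_mats n. \<exists>X\<in>skew_mats n. L X = Y"
    and h6: "\<forall>X\<in>skew_mats n. \<forall>Y\<in>skew_mats n. L (bracket X (bracket X Y)) = bracket (L X) (bracket (L X) (L Y))"
    by (elim exE conjE)
  interpret L: skew_linear n L
    by unfold_locales (use h1 h2 h3 in simp_all)
  have \<psi>L: "\<psi> (exp_mat X) = exp_mat (L X)" if "X \<in> skew_mats n" for X using h1 that by simp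
  \<comment> \<open>For the converse direction the distance to the identity is compared: the gauge
    detects the identity matrix.\<close>
  have exp_one: "exp_mat (L X) = 1\<^sub>m n \<longleftrightarrow> exp_mat X = 1\<^sub>m n" if X: "X \<in> skew_mats n" for X
  proof
    assume "exp_mat X = 1\<^sub>m n"
    then show "exp_mat (L X) = 1\<^sub>m n" using \<psi>L[OF X] one by simp
  next
    assume e: "exp_mat (L X) = 1\<^sub>m n"
    note A = exp_mat_SO[OF X]
    have "d_Nf N f (1\<^sub>m n) (exp_mat X) = d_Nf N f (1\<^sub>m n) (1\<^sub>m n)"
      using iso[OF SO_group_one A] unfolding one \<psi>L[OF X] e by simp
    then have "\<delta> (exp_mat X) = \<delta> (1\<^sub>m n)"
      unfolding d_Nf_\<delta>[OF O_group_one] transpose_one left_mult_one_mat[OF SO_carrier[OF A]] by simp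
    then show "exp_mat X = 1\<^sub>m n" by (intro \<delta>_le_one_imp_one[OF SO_O[OF A]]) simp
  qed
  have "\<exists>Q\<in>O_group n. (\<forall>X\<in>skew_mats n. L X = Q * X * Q\<^sup>T) \<or>
    (\<forall>X\<in>skew_mats n. L X = - (Q * X * Q\<^sup>T)) \<or>
    (n = 4 \<and> (\<forall>X\<in>skew_mats n. L (tilde_mat X) = Q * X * Q\<^sup>T)) \<or>
    (n = 4 \<and> (\<forall>X\<in>skew_mats n. L (tilde_mat X) = - (Q * X * Q\<^sup>T)))" (is "\<exists>Q\<in>_. ?c Q")
  proof -
    consider "n = 1" | "n = 2" | "3 \<le> n" using n_pos by linarith
    then show ?thesis
    proof cases
      case 1
      have "L X = 1\<^sub>m n * X * (1\<^sub>m n)\<^sup>T" if X: "X \<in> skew_mats n" for X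
        using skew_one_zero[OF X[unfolded 1]] skew_one_zero[OF L.skew[OF X, unfolded 1]] by (simp add: 1)
      then have "\<forall>X\<in>skew_mats n. L X = 1\<^sub>m n * X * (1\<^sub>m n)\<^sup>T" by (rule ballI)
      then show ?thesis by (rule bexI[OF disjI1 O_group_one])
    next
      case 2
      let ?J = "cwedge n 0 1"
      have J: "?J \<in> unit_bivectors n" by (rule cwedge_unit) (simp_all add: 2)
      note Js = unit_bivectors_skew[OF J]
      \<comment> \<open>Skew matrices of size two form a line, so \<open>L\<close> is multiplication
        by some \<open>c\<close>. The times r with exponential 1 must correspond under r to r c: r =
        2 pi makes \<open>c\<close> an integer, r = 2 pi / c makes its inverse an integer.\<close>
      define c where "c = L ?J $$ (0, 1)"
      have LJ: "L ?J = c \<cdot>\<^sub>m ?J" unfolding c_def using skew_two_span[of "L ?J"] L.skew[OF Js] 2 by simp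
      have iff: "(\<exists>m::int. r * c = 2 * pi * m) \<longleftrightarrow> (\<exists>m::int. r = 2 * pi * m)" for r
      proof -
        have "L (r \<cdot>\<^sub>m ?J) = (r * c) \<cdot>\<^sub>m ?J" unfolding L.smult[OF Js] LJ by (rule eq_matI) auto
        then show ?thesis
          using exp_one[OF skew_smult[OF Js], of r] unfolding unit_bivector_exp_eq_one_iff[OF J, symmetric] by simp
      qed
      have c0: "c \<noteq> 0"
      proof
        assume "c = 0"
        then have "L ?J = 0\<^sub>m n n" unfolding LJ by (intro eq_matI) auto
        then have "?J = 0\<^sub>m n n" by (rule h4[rule_format, OF Js])
        then have "?J $$ (0, 1) = 0\<^sub>m n n $$ (0, 1)" by simp
        then show False by (simp add: 2 coord_def)
      qed
      have "\<exists>m::int. 2 * pi = 2 * pi * m" by (rule exI[of _ 1]) simp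
      from iffD2[OF iff this] obtain m :: int where "2 * pi * c = 2 * pi * m" by (rule exE)
      then have m: "c = m" by simp
      have "\<exists>m::int. 2 * pi / c * c = 2 * pi * m" using c0 by (intro exI[of _ 1]) simp
      from iffD1[OF iff this] obtain k :: int where "2 * pi / c = 2 * pi * k" by (rule exE)
      then have "c * k = 1" using c0 by (simp add: field_simps)
      then have cc: "c = 1 \<or> c = -1" using m by (rule int_unit_of_inverse)
      have LX: "L X = c \<cdot>\<^sub>m X" if X: "X \<in> skew_mats n" for X
      proof -
        have e: "X = X $$ (0, 1) \<cdot>\<^sub>m ?J" using skew_two_span[of X] X 2 by simp
        have "L X = X $$ (0, 1) \<cdot>\<^sub>m (c \<cdot>\<^sub>m ?J)" using arg_cong[OF e, of L] unfolding L.smult[OF Js] LJ .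
        also have "\<dots> = c \<cdot>\<^sub>m (X $$ (0, 1) \<cdot>\<^sub>m ?J)" by (rule eq_matI) auto
        finally show ?thesis unfolding e[symmetric] .
      qed
      have o: "1\<^sub>m n * X * (1\<^sub>m n)\<^sup>T = X" if "X \<in> skew_mats n" for X
        using skew_carrier[OF that] by (simp add: transpose_one)
      from cc show ?thesis
      proof
        assume "c = 1"
        then have "\<forall>X\<in>skew_mats n. L X = 1\<^sub>m n * X * (1\<^sub>m n)\<^sup>T" using LX o by (simp add: one_smult_mat)
        then show ?thesis by (rule bexI[OF disjI1 O_group_one])
      next
        assume c: "c = -1"
        have "(-1) \<cdot>\<^sub>m X = - X" for X :: "real mat" by (rule eq_matI) auto
        then have "\<forall>X\<in>skew_mats n. L X = - (1\<^sub>m n * X * (1\<^sub>m n)\<^sup>T)" using LX o c by simp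
        then show ?thesis by (rule bexI[OF disjI2[OF disjI1] O_group_one])
      qed
    next
      case 3
      interpret bivector_preserver n L
      proof
        show "X = 0\<^sub>m n n" if "X \<in> skew_mats n" "L X = 0\<^sub>m n n" for X by (rule h4[rule_format, OF that])
        fix X assume X: "X \<in> unit_bivectors n"
        note Xs = unit_bivectors_skew[OF X]
        show "L X \<in> unit_bivectors n"
        proof (rule unit_bivector_criterion[OF 3 L.skew[OF Xs]])
          show "L X \<noteq> 0\<^sub>m n n"
          proof
            assume "L X = 0\<^sub>m n n"
            then have "X = 0\<^sub>m n n" by (rule h4[rule_format, OF Xs])
            then have "sqnorm n X = 0" by (simp add: sqnorm_def)
            then show False using unit_bivector_sqnorm[OF X] by simp
          qed
          have "\<exists>m::int. 2 * pi = 2 * pi * m" by (rule exI[of _ 1]) simp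
          then have "exp_mat ((2 * pi) \<cdot>\<^sub>m X) = 1\<^sub>m n" unfolding unit_bivector_exp_eq_one_iff[OF X] .
          then show "exp_mat ((2 * pi) \<cdot>\<^sub>m L X) = 1\<^sub>m n"
            using exp_one[OF skew_smult[OF Xs], of "2 * pi"] unfolding L.smult[OF Xs] by simp
          fix Z assume "Z \<in> skew_mats n"
          then obtain W where W: "W \<in> skew_mats n" and Z: "L W = Z" by (rule bexE[OF bspec[OF h5]])
          note XW = bracket_skew[OF Xs bracket_skew[OF Xs W]]
          have b: "bracket (L X) (bracket (L X) (L V)) = L (bracket X (bracket X V))" if "V \<in> skew_mats n" for V
            using h6 Xs that by simp
          have "bracket (L X) (bracket (L X) (bracket (L X) (bracket (L X) Z))) = L (bracket X (bracket X (bracket X (bracket X W))))"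
            unfolding Z[symmetric] b[OF W] b[OF XW] ..
          also have "\<dots> = (-1) \<cdot>\<^sub>m L (bracket X (bracket X W))"
            unfolding unit_bivector_bracket_power[OF X W] L.smult[OF XW] ..
          finally show "bracket (L X) (bracket (L X) (bracket (L X) (bracket (L X) Z))) = (-1) \<cdot>\<^sub>m bracket (L X) (bracket (L X) Z)"
            unfolding Z[symmetric] b[OF W] .
        qed
      qed
      show ?thesis
      proof (cases "n = 4")
        case True
        then show ?thesis using bivector_preserver_four[OF bivector_preserver_axioms[unfolded True]] by simp
      next
        case False
        obtain Q where Q: "Q \<in> O_group n"
          and c: "(\<forall>X\<in>skew_mats n. L X = Q * X * Q\<^sup>T) \<or> (\<forall>X\<in>skew_mats n. L X = - (Q * X * Q\<^sup>T))"
          by (rule bexE[OF bivector_preserver_not_four[OF bivector_preserver_axioms 3 False]])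
        from c show ?thesis
          by (rule disjE) (erule bexI[OF disjI1 Q], erule bexI[OF disjI2[OF disjI1] Q])
      qed
    qed
  qed
  then obtain Q where Q: "Q \<in> O_group n" and cs: "?c Q" by (rule bexE)
  note Qc = O_groupD(1)[OF Q]
  have neg: "- (Q * X * Q\<^sup>T) = Q * (- X) * Q\<^sup>T" if "X \<in> carrier_mat n n" for X
    by (rule conj_uminus[OF Qc that, symmetric])
  have t: "L X = L (tilde_mat (tilde_mat X))" "tilde_mat X \<in> skew_mats n" if "X \<in> skew_mats n" "n = 4" for X
    using that tilde_tilde[OF skew_carrier[of X 4]] tilde_skew[of X] by simp_all
  from cs show ?thesis
  proof (elim disjE conjE)
    assume a: "\<forall>X\<in>skew_mats n. L X = Q * X * Q\<^sup>T"
    have "\<forall>X\<in>skew_mats n. \<psi> (exp_mat X) = exp_mat (Q * X * Q\<^sup>T)"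
      using \<psi>L a by simp
    then show ?thesis by (rule bexI[OF disjI1 Q])
  next
    assume a: "\<forall>X\<in>skew_mats n. L X = - (Q * X * Q\<^sup>T)"
    have "\<forall>X\<in>skew_mats n. \<psi> (exp_mat X) = exp_mat (Q * (- X) * Q\<^sup>T)"
      using \<psi>L a by (simp add: neg skew_carrier)
    then show ?thesis by (rule bexI[OF disjI2[OF disjI1] Q])
  next
    assume n4: "n = 4" and a: "\<forall>X\<in>skew_mats n. L (tilde_mat X) = Q * X * Q\<^sup>T"
    have "\<psi> (exp_mat X) = exp_mat (Q * tilde_mat X * Q\<^sup>T)" if X: "X \<in> skew_mats n" for X
      unfolding \<psi>L[OF X] t(1)[OF X n4] bspec[OF a t(2)[OF X n4]] ..
    then have "\<forall>X\<in>skew_mats n. \<psi> (exp_mat X) = exp_mat (Q * tilde_mat X * Q\<^sup>T)" by (rule ballI)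
    then show ?thesis by (intro bexI[OF disjI2[OF disjI2[OF disjI1[OF conjI[OF n4]]]] Q])
  next
    assume n4: "n = 4" and a: "\<forall>X\<in>skew_mats n. L (tilde_mat X) = - (Q * X * Q\<^sup>T)"
    have "\<psi> (exp_mat X) = exp_mat (Q * (- tilde_mat X) * Q\<^sup>T)" if X: "X \<in> skew_mats n" for X
      unfolding \<psi>L[OF X] t(1)[OF X n4] bspec[OF a t(2)[OF X n4]] neg[OF skew_carrier[OF t(2)[OF X n4]]] ..
    then have "\<forall>X\<in>skew_mats n. \<psi> (exp_mat X) = exp_mat (Q * (- tilde_mat X) * Q\<^sup>T)" by (rule ballI)
    then show ?thesis by (intro bexI[OF disjI2[OF disjI2[OF disjI2[OF conjI[OF n4]]]] Q])
  qed
qed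

end

section \<open>The exceptional isometry in dimension four\<close>

lemma exp_conj:
  fixes g h x :: "'a::{real_normed_algebra_1, banach}"
  assumes hg: "h * g = 1"
  shows "g * h = 1 ==> exp (g * x * h) = g * exp x * h"
proof -
  assume gh: "g * h = 1"
  have pw: "(g * x * h) ^ k = g * x ^ k * h" for k
  proof (induction k)
    case 0
    then show ?case by (simp add: gh)
  next
    case (Suc k)
    have "h * (g * w) = w" for w by (simp add: mult.assoc[symmetric] hg)
    then show ?case unfolding power_Suc Suc by (simp add: mult.assoc)
  qed
  have "(\<lambda>k. g * (x ^ k /\<^sub>R fact k) * h) sums (g * exp x * h)"
    by (intro sums_mult sums_mult2 exp_converges)
  then have "(\<lambda>k. (g * x * h) ^ k /\<^sub>R fact k) sums (g * exp x * h)"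
    unfolding pw by simp
  then show ?thesis using exp_converges sums_unique2 by blast
qed

lemma exp_mat_conj:
  assumes C: "C \<in> O_group n" and X: "X \<in> carrier_mat n n"
  shows "exp_mat (C * X * C\<^sup>T) = C * exp_mat X * C\<^sup>T"
proof -
  note c = O_groupD[OF C]
  note E = exp_mat_carrier[OF X]
  have CX: "C * X \<in> carrier_mat n n" "C * X * C\<^sup>T \<in> carrier_mat n n" "C * exp_mat X \<in> carrier_mat n n" "C * exp_mat X * C\<^sup>T \<in> carrier_mat n n"
    using c X E by auto
  let ?g = "unital n C" and ?h = "unital n (C\<^sup>T)"
  have hg: "?h * ?g = 1" "?g * ?h = 1"
    unfolding unital_mult[OF c(2,1), symmetric] unital_mult[OF c(1,2), symmetric] c(3,4) unital_one by auto
  have "?g * emb X * ?h = emb (C * X * C\<^sup>T)"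
  proof -
    have "?g * emb X = emb (C * X)"
      unfolding unital_def by (simp add: algebra_simps emb_one_mult[OF X] emb_mult[OF c(1) X])
    moreover have "emb (C * X) * ?h = emb (C * X * C\<^sup>T)"
      unfolding unital_def by (simp add: algebra_simps emb_mult_one[OF CX(1)] emb_mult[OF CX(1) c(2)])
    ultimately show ?thesis by simp
  qed
  then have "unital n (exp_mat (C * X * C\<^sup>T)) = ?g * exp (emb X) * ?h"
    unfolding exp_emb[OF CX(2), symmetric] using exp_conj[OF hg] by metis
  also have "\<dots> = unital n (C * exp_mat X * C\<^sup>T)"
    unfolding exp_emb[OF X] unital_mult[OF CX(3) c(2)] unital_mult[OF c(1) E] ..
  finally have "of_unital n (unital n (exp_mat (C * X * C\<^sup>T))) = of_unital n (unital n (C * exp_mat X * C\<^sup>T))"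
    by (rule arg_cong)
  then show ?thesis unfolding of_unital_unital[OF exp_mat_carrier[OF CX(2)]] of_unital_unital[OF CX(4)] .
qed

lemma exp_mat_zero: "exp_mat (0\<^sub>m n n) = 1\<^sub>m n"
proof -
  have "unital n (exp_mat (0\<^sub>m n n)) = unital n (1\<^sub>m n)"
    unfolding exp_emb[OF zero_carrier_mat, symmetric] emb_zero unital_one by simp
  then have "of_unital n (unital n (exp_mat (0\<^sub>m n n))) = of_unital n (unital n (1\<^sub>m n))" by (rule arg_cong)
  then show ?thesis
    unfolding of_unital_unital[OF exp_mat_carrier[OF zero_carrier_mat]] of_unital_unital[OF one_carrier_mat] .
qed

lemma exp_mat_uminus:
  assumes X: "X \<in> skew_mats n"
  shows "exp_mat (- X) = (exp_mat X)\<^sup>T"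
proof -
  note Xc = skew_carrier[OF X] and E = SO_O[OF exp_mat_SO[OF X]]
  note c = O_groupD[OF E]
  have m: "- X \<in> carrier_mat n n" using Xc by simp
  note Em = exp_mat_carrier[OF m]
  have "exp_mat (X + - X) = exp_mat X * exp_mat (- X)"
    by (rule exp_mat_add_commute[OF Xc m]) (use Xc in simp)
  moreover have "X + - X = 0\<^sub>m n n" using Xc by (intro eq_matI) auto
  ultimately have e: "exp_mat X * exp_mat (- X) = 1\<^sub>m n" by (simp add: exp_mat_zero)
  have "exp_mat (- X) = (exp_mat X)\<^sup>T * exp_mat X * exp_mat (- X)" unfolding c(4) using Em by simp
  also have "\<dots> = (exp_mat X)\<^sup>T * (exp_mat X * exp_mat (- X))" by (rule assoc_mult_mat[OF c(2,1) Em])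
  also have "\<dots> = (exp_mat X)\<^sup>T" unfolding e using c by simp
  finally show ?thesis .
qed

text \<open>Left (\<open>s = 1\<close>) and right (\<open>s = -1\<close>) multiplication by quaternions on \<open>\<real>\<^sup>4\<close>; the skew ones are the
  self-dual and anti-self-dual matrices.\<close>

definition quat :: "real \<Rightarrow> real \<Rightarrow> real \<Rightarrow> real \<Rightarrow> real \<Rightarrow> real mat" where
  "quat s t x y z = mat 4 4 (\<lambda>(i, j). [[t, x, y, z], [- x, t, s * z, - s * y], [- y, - s * z, t, s * x], [- z, s * y, - s * x, t]] ! i ! j)"

lemma quat_carrier [simp]: "quat s t x y z \<in> carrier_mat 4 4"
  and quat_dims [simp]: "dim_row (quat s t x y z) = 4" "dim_col (quat s t x y z) = 4"
  by (simp_all add: quat_def)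

lemma quat_entries:
  "quat s t x y z $$ (0, 0) = t" "quat s t x y z $$ (0, 1) = x" "quat s t x y z $$ (0, 2) = y" "quat s t x y z $$ (0, 3) = z"
  "quat s t x y z $$ (1, 0) = - x" "quat s t x y z $$ (1, 1) = t" "quat s t x y z $$ (1, 2) = s * z" "quat s t x y z $$ (1, 3) = - s * y"
  "quat s t x y z $$ (2, 0) = - y" "quat s t x y z $$ (2, 1) = - s * z" "quat s t x y z $$ (2, 2) = t" "quat s t x y z $$ (2, 3) = s * x"
  "quat s t x y z $$ (3, 0) = - z" "quat s t x y z $$ (3, 1) = s * y" "quat s t x y z $$ (3, 2) = - s * x" "quat s t x y z $$ (3, 3) = t"
  by (simp_all add: quat_def numeral_3_eq_3 numeral_2_eq_2)

lemma mat4_eqI: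
  assumes "A \<in> carrier_mat 4 4" "B \<in> carrier_mat 4 4"
    and "\<And>i j. (i = 0 \<or> i = 1 \<or> i = 2 \<or> i = 3) ==> (j = 0 \<or> j = 1 \<or> j = 2 \<or> j = 3) ==> A $$ (i, j) = B $$ (i, j)"
  shows "A = B"
  using assms(1,2) by (intro eq_matI) (auto intro!: assms(3) simp: less4)

lemma mult4_index:
  assumes "A \<in> carrier_mat 4 4" "B \<in> carrier_mat 4 4" "(i = 0 \<or> i = 1 \<or> i = 2 \<or> i = 3)" "(j = 0 \<or> j = 1 \<or> j = 2 \<or> j = 3)"
  shows "(A * B) $$ (i, j) = A $$ (i, 0) * B $$ (0, j) + A $$ (i, 1) * B $$ (1, j) + A $$ (i, 2) * B $$ (2, j) + A $$ (i, 3) * B $$ (3, j)"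
  using index_mult_sum[OF assms(1,2), of i j] assms(3,4) unfolding sum4 less4[symmetric] by blast

lemma quat_transpose: "(quat s t x y z)\<^sup>T = quat s t (- x) (- y) (- z)"
proof (rule mat4_eqI)
  fix i j :: nat assume ij: "i = 0 \<or> i = 1 \<or> i = 2 \<or> i = 3" "j = 0 \<or> j = 1 \<or> j = 2 \<or> j = 3"
  then have "(quat s t x y z)\<^sup>T $$ (i, j) = quat s t x y z $$ (j, i)" by auto
  then show "(quat s t x y z)\<^sup>T $$ (i, j) = quat s t (- x) (- y) (- z) $$ (i, j)"
    using ij by (elim disjE; simp only: quat_entries; simp)
qed auto

lemma quat_commute: "quat 1 t x y z * quat (-1) t' x' y' z' = quat (-1) t' x' y' z' * quat 1 t x y z"
proof (rule mat4_eqI)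
  fix i j :: nat assume ij: "i = 0 \<or> i = 1 \<or> i = 2 \<or> i = 3" "j = 0 \<or> j = 1 \<or> j = 2 \<or> j = 3"
  show "(quat 1 t x y z * quat (-1) t' x' y' z') $$ (i, j) = (quat (-1) t' x' y' z' * quat 1 t x y z) $$ (i, j)"
    unfolding mult4_index[OF quat_carrier quat_carrier ij] using ij
    by (elim disjE; simp only: quat_entries; simp add: algebra_simps)
qed (auto intro: mult_carrier_mat)

lemma quat_unit_O:
  assumes "t * t + x * x + y * y + z * z = 1" "s = 1 \<or> s = -1"
  shows "quat s t x y z \<in> O_group 4"
proof -
  have "quat s t x y z * (quat s t x y z)\<^sup>T = 1\<^sub>m 4" if 1: "t * t + x * x + y * y + z * z = 1" for x y z
  proof (rule mat4_eqI)
    have ss: "s * s = 1" "s * (s * w) = w" for w using assms(2) by auto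
    fix i j :: nat assume ij: "i = 0 \<or> i = 1 \<or> i = 2 \<or> i = 3" "j = 0 \<or> j = 1 \<or> j = 2 \<or> j = 3"
    have d: "1\<^sub>m 4 $$ (i, j) = (if i = j then 1 else 0 :: real)" using ij by auto
    show "(quat s t x y z * (quat s t x y z)\<^sup>T) $$ (i, j) = 1\<^sub>m 4 $$ (i, j)"
      unfolding quat_transpose mult4_index[OF quat_carrier quat_carrier ij] d using ij
      by (elim disjE; simp only: quat_entries; use 1 in \<open>simp add: algebra_simps ss\<close>)
  qed (auto intro: mult_carrier_mat)
  from this[of x y z] this[of "- x" "- y" "- z"] assms(1) show ?thesis
    unfolding O_group_def by (simp add: quat_transpose)
qed

text \<open>A purely imaginary quaternion anticommutes with the imaginary quaternions orthogonal to
  it; moving it past another quaternion therefore conjugates the latter.\<close>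

lemma quat_anticommute:
  assumes 0: "x * x' + y * y' + z * z' = 0"
  shows "quat (-1) 0 x y z * quat (-1) t' x' y' z' = quat (-1) t' (- x') (- y') (- z') * quat (-1) 0 x y z"
proof (rule mat4_eqI)
  fix i j :: nat assume ij: "i = 0 \<or> i = 1 \<or> i = 2 \<or> i = 3" "j = 0 \<or> j = 1 \<or> j = 2 \<or> j = 3"
  have 0: "x * x' + y * y' + z * z' = 0" "x' * x + y' * y + z' * z = 0" using 0 by (simp_all add: mult.commute)
  show "(quat (-1) 0 x y z * quat (-1) t' x' y' z') $$ (i, j) = (quat (-1) t' (- x') (- y') (- z') * quat (-1) 0 x y z) $$ (i, j)"
    unfolding mult4_index[OF quat_carrier quat_carrier ij] using ij
    by (elim disjE; simp only: quat_entries; use 0 in \<open>simp add: mult_ac\<close>)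
qed (auto intro: mult_carrier_mat)

text \<open>The left multiplications by i and j generate all left multiplications, whose commutant
  consists of the right multiplications. Comparing the entries of the two commutation relations
  expresses every entry of \<open>W\<close> through its first row.\<close>

lemma quat_commutant:
  assumes W: "W \<in> carrier_mat 4 4" and "W * quat 1 0 1 0 0 = quat 1 0 1 0 0 * W" "W * quat 1 0 0 1 0 = quat 1 0 0 1 0 * W"
  shows "W = quat (-1) (W $$ (0, 0)) (W $$ (0, 1)) (W $$ (0, 2)) (W $$ (0, 3))"
proof -
  have e1: "(W * quat 1 0 1 0 0) $$ (i, j) = (quat 1 0 1 0 0 * W) $$ (i, j)" and e2: "(W * quat 1 0 0 1 0) $$ (i, j) = (quat 1 0 0 1 0 * W) $$ (i, j)" for i j
    using assms by simp_all
  have m: "(W * quat 1 a b c d) $$ (i, j) = W $$ (i, 0) * quat 1 a b c d $$ (0, j) + W $$ (i, 1) * quat 1 a b c d $$ (1, j) + W $$ (i, 2) * quat 1 a b c d $$ (2, j) + W $$ (i, 3) * quat 1 a b c d $$ (3, j)"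
    "(quat 1 a b c d * W) $$ (i, j) = quat 1 a b c d $$ (i, 0) * W $$ (0, j) + quat 1 a b c d $$ (i, 1) * W $$ (1, j) + quat 1 a b c d $$ (i, 2) * W $$ (2, j) + quat 1 a b c d $$ (i, 3) * W $$ (3, j)"
    if "i = 0 \<or> i = 1 \<or> i = 2 \<or> i = 3" "j = 0 \<or> j = 1 \<or> j = 2 \<or> j = 3" for i j a b c d
    by (rule mult4_index[OF W quat_carrier that], rule mult4_index[OF quat_carrier W that])
  have r1: "- W $$ (0, 1) = W $$ (1, 0)" "W $$ (0, 0) = W $$ (1, 1)" "- W $$ (0, 3) = W $$ (1, 2)" "W $$ (0, 2) = W $$ (1, 3)"
    "- W $$ (2, 1) = W $$ (3, 0)" "W $$ (2, 0) = W $$ (3, 1)" "- W $$ (2, 3) = W $$ (3, 2)" "W $$ (2, 2) = W $$ (3, 3)"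
    using e1[of 0 0] e1[of 0 1] e1[of 0 2] e1[of 0 3] e1[of 2 0] e1[of 2 1] e1[of 2 2] e1[of 2 3]
    by (simp_all only: m simp_thms quat_entries, simp_all?)
  have r2: "- W $$ (0, 2) = W $$ (2, 0)" "W $$ (0, 3) = W $$ (2, 1)" "W $$ (0, 0) = W $$ (2, 2)" "- W $$ (0, 1) = W $$ (2, 3)"
    using e2[of 0 0] e2[of 0 1] e2[of 0 2] e2[of 0 3]
    by (simp_all only: m simp_thms quat_entries, simp_all?)
  show ?thesis
  proof (rule mat4_eqI[OF W quat_carrier])
    fix i j :: nat assume ij: "i = 0 \<or> i = 1 \<or> i = 2 \<or> i = 3" "j = 0 \<or> j = 1 \<or> j = 2 \<or> j = 3"
    show "W $$ (i, j) = quat (-1) (W $$ (0, 0)) (W $$ (0, 1)) (W $$ (0, 2)) (W $$ (0, 3)) $$ (i, j)"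
      using ij by (elim disjE; simp only: quat_entries; use r1 r2 in linarith)
  qed
qed

lemma conj_fixed_iff_commute:
  assumes C: "C \<in> O_group n" and A: "A \<in> carrier_mat n n" and B: "B \<in> carrier_mat n n"
  shows "C * A * C\<^sup>T = B \<longleftrightarrow> C * A = B * C"
proof -
  note c = O_groupD[OF C]
  have CA: "C * A \<in> carrier_mat n n" "B * C \<in> carrier_mat n n" using c A B by auto
  show ?thesis
  proof
    assume "C * A * C\<^sup>T = B"
    then have "B * C = C * A * C\<^sup>T * C" by simp
    also have "\<dots> = C * A * (C\<^sup>T * C)" by (rule assoc_mult_mat[OF CA(1) c(2,1)])
    finally show "C * A = B * C" unfolding c(4) right_mult_one_mat[OF CA(1)] by simp
  next
    assume "C * A = B * C"
    then have "C * A * C\<^sup>T = B * C * C\<^sup>T" by simp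
    also have "\<dots> = B * (C * C\<^sup>T)" by (rule assoc_mult_mat[OF B c(1,2)])
    finally show "C * A * C\<^sup>T = B" unfolding c(3) using B by simp
  qed
qed

lemma exp_mat_commute_O:
  assumes C: "C \<in> O_group n" and X: "X \<in> carrier_mat n n" and cm: "C * X = X * C"
  shows "C * exp_mat X = exp_mat X * C"
proof -
  have "C * X * C\<^sup>T = X" using conj_fixed_iff_commute[OF C X X] cm by simp
  then have "C * exp_mat X * C\<^sup>T = exp_mat X" using exp_mat_conj[OF C X] by simp
  then show ?thesis using conj_fixed_iff_commute[OF C exp_mat_carrier[OF X] exp_mat_carrier[OF X]] by simp
qed

lemma quat_skew: "quat s 0 x y z \<in> skew_mats 4"
proof -
  have "quat s 0 (- x) (- y) (- z) = - quat s 0 x y z"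
  proof (rule mat4_eqI)
    fix i j :: nat assume ij: "i = 0 \<or> i = 1 \<or> i = 2 \<or> i = 3" "j = 0 \<or> j = 1 \<or> j = 2 \<or> j = 3"
    then have "(- quat s 0 x y z) $$ (i, j) = - quat s 0 x y z $$ (i, j)" by auto
    then show "quat s 0 (- x) (- y) (- z) $$ (i, j) = (- quat s 0 x y z) $$ (i, j)"
      using ij by (elim disjE; simp only: quat_entries; simp)
  qed auto
  then show ?thesis by (simp add: skew_mats_def quat_transpose)
qed

lemma orthogonal_unit_vector3: "\<exists>u v w. u * u + v * v + w * w = (1::real) \<and> u * x + v * y + w * z = 0"
proof (cases "x = 0 \<and> y = 0")
  case True
  then show ?thesis by (intro exI[of _ 1] exI[of _ 0]) simp
next
  case False
  then have p: "x * x + y * y > 0" by (metis sum_squares_gt_zero_iff)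
  define r where "r = sqrt (x * x + y * y)"
  have r: "r > 0" "r * r = x * x + y * y" using p by (simp_all add: r_def)
  have "y / r * (y / r) + - x / r * (- x / r) + 0 * 0 = (x * x + y * y) / (r * r)" by (simp add: add_divide_distrib)
  also have "\<dots> = 1" unfolding r(2) by (rule divide_self) (rule less_imp_neq[OF p, THEN not_sym])
  finally have "y / r * (y / r) + - x / r * (- x / r) + 0 * 0 = 1" .
  moreover have "y / r * x + - x / r * y + 0 * z = 0" by simp
  ultimately show ?thesis by blast
qed

text \<open>Splitting into self-dual and anti-self-dual parts, \<open>tilde_mat\<close> keeps the
  former and changes the sign of \<open>z\<close> only in the latter. Conjugation by right
  multiplication with k negates \<open>x\<close> and \<open>y\<close> and keeps \<open>z\<close>.
  Hence \<open>tilde_mat\<close> is this conjugation after the sign change of the whole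
  anti-self-dual part.\<close>

lemma skew_mats_quat_decomp:
  assumes X: "X \<in> skew_mats 4"
  shows "\<exists>a b c x y z. X = quat 1 0 a b c + quat (-1) 0 x y z \<and>
    tilde_mat X = quat (-1) 0 0 0 1 * (quat 1 0 a b c + quat (-1) 0 (- x) (- y) (- z)) * (quat (-1) 0 0 0 1)\<^sup>T"
proof -
  note ent = skew4_entries[OF X] and Xc = skew_carrier[OF X]
  define a b c x y z where d: "a = (X $$ (0, 1) + X $$ (2, 3)) / 2" "b = (X $$ (0, 2) - X $$ (1, 3)) / 2" "c = (X $$ (0, 3) + X $$ (1, 2)) / 2"
    "x = (X $$ (0, 1) - X $$ (2, 3)) / 2" "y = (X $$ (0, 2) + X $$ (1, 3)) / 2" "z = (X $$ (0, 3) - X $$ (1, 2)) / 2"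
  have add: "(quat 1 0 a b c + quat (-1) 0 x y z) $$ (i, j) = quat 1 0 a b c $$ (i, j) + quat (-1) 0 x y z $$ (i, j)"
    if "i = 0 \<or> i = 1 \<or> i = 2 \<or> i = 3" "j = 0 \<or> j = 1 \<or> j = 2 \<or> j = 3" for i j x y z
    using that by auto
  have 1: "X = quat 1 0 a b c + quat (-1) 0 x y z"
  proof (rule mat4_eqI[OF Xc])
    fix i j :: nat assume ij: "i = 0 \<or> i = 1 \<or> i = 2 \<or> i = 3" "j = 0 \<or> j = 1 \<or> j = 2 \<or> j = 3"
    show "X $$ (i, j) = (quat 1 0 a b c + quat (-1) 0 x y z) $$ (i, j)"
      unfolding add[OF ij] using ij by (elim disjE; simp only: quat_entries ent d; simp add: field_simps)
  qed auto
  let ?K = "quat (-1) 0 0 0 1" and ?D = "quat 1 0 a b c + quat (-1) 0 (- x) (- y) (- z)"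
  have K: "?K \<in> O_group 4" by (rule quat_unit_O) auto
  have Dc: "?D \<in> carrier_mat 4 4" by simp
  have "?K * ?D = tilde_mat X * ?K"
  proof (rule mat4_eqI)
    have tt: "tilde_mat X $$ (0, 0) = 0" "tilde_mat X $$ (0, 1) = X $$ (0, 1)" "tilde_mat X $$ (0, 2) = X $$ (0, 2)" "tilde_mat X $$ (0, 3) = X $$ (1, 2)"
      "tilde_mat X $$ (1, 0) = - X $$ (0, 1)" "tilde_mat X $$ (1, 1) = 0" "tilde_mat X $$ (1, 2) = X $$ (0, 3)" "tilde_mat X $$ (1, 3) = X $$ (1, 3)"
      "tilde_mat X $$ (2, 0) = - X $$ (0, 2)" "tilde_mat X $$ (2, 1) = - X $$ (0, 3)" "tilde_mat X $$ (2, 2) = 0" "tilde_mat X $$ (2, 3) = X $$ (2, 3)"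
      "tilde_mat X $$ (3, 0) = - X $$ (1, 2)" "tilde_mat X $$ (3, 1) = - X $$ (1, 3)" "tilde_mat X $$ (3, 2) = - X $$ (2, 3)" "tilde_mat X $$ (3, 3) = 0"
      using ent by (simp_all add: tilde_mat_def)
    fix i j :: nat assume ij: "i = 0 \<or> i = 1 \<or> i = 2 \<or> i = 3" "j = 0 \<or> j = 1 \<or> j = 2 \<or> j = 3"
    have k: "(0 = 0 \<or> 0 = 1 \<or> 0 = 2 \<or> 0 = (3::nat))" "(1 = 0 \<or> 1 = 1 \<or> 1 = 2 \<or> 1 = (3::nat))" "(2 = 0 \<or> 2 = 1 \<or> 2 = 2 \<or> 2 = (3::nat))" "(3 = 0 \<or> 3 = 1 \<or> 3 = 2 \<or> 3 = (3::nat))" by auto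
    show "(?K * ?D) $$ (i, j) = (tilde_mat X * ?K) $$ (i, j)"
      unfolding mult4_index[OF quat_carrier Dc ij] mult4_index[OF tilde_carrier quat_carrier ij]
        add[OF k(1) ij(2)] add[OF k(2) ij(2)] add[OF k(3) ij(2)] add[OF k(4) ij(2)]
      using ij by (elim disjE; simp only: quat_entries tt d; simp add: field_simps)
  qed (rule mult_carrier_mat[OF quat_carrier Dc], rule mult_carrier_mat[OF tilde_carrier quat_carrier])
  then have "?K * ?D * ?K\<^sup>T = tilde_mat X"
    using conj_fixed_iff_commute[OF K Dc tilde_carrier] by simp
  then show ?thesis using 1 by (intro exI[of _ a] exI[of _ b] exI[of _ c] exI[of _ x] exI[of _ y] exI[of _ z]) simp
qed

text \<open>Conjugation by \<open>u\<close> passes through \<open>a' * b\<close> and turns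
  \<open>q' * r\<close> into \<open>r' * q\<close>, whose last factor is then cancelled by
  \<open>q'\<close>. Working in a monoid keeps the reassociation free of dimension
  conditions.\<close>

lemma monoid_twist:
  fixes a' b q q' r r' k k' u u' :: "'a::monoid_mult"
  assumes "u * (a' * b) = (a' * b) * u" "u * (q' * r) = (r' * q) * u" "u * u' = 1" "q * q' = 1" "q * (a' * b) = (a' * b) * q"
  shows "k * (q * a') * (b * r') * k' = k * q * u * (a' * b * (q' * r)) * u' * q' * k'"
proof -
  have "u * (a' * b * (q' * r)) * u' = (a' * b) * (u * (q' * r)) * u'" by (metis assms(1) mult.assoc)
  also have "\<dots> = (a' * b) * (r' * q)" unfolding assms(2) by (simp only: mult.assoc assms(3) mult_1_right)
  finally have "u * (a' * b * (q' * r)) * u' * q' = (a' * b) * r' * (q * q')" by (simp only: mult.assoc)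
  then have "k * q * (u * (a' * b * (q' * r)) * u' * q') * k' = k * q * ((a' * b) * r') * k'" unfolding assms(4) by simp
  then show ?thesis by (simp only: mult.assoc)
qed

text \<open>On unit quaternions the twist sends the right factor \<open>q\<inverse> r\<close> to \<open>q r\<inverse>\<close>, which is conjugate to \<open>r\<inverse> q\<close> and
  hence to \<open>q\<inverse> r\<close>; the conjugating elements are themselves right multiplications and leave the left factor alone.\<close>

lemma exp_tilde_similar:
  assumes X: "X \<in> skew_mats 4" and Y: "Y \<in> skew_mats 4"
  shows "\<exists>C\<in>O_group 4. (exp_mat (tilde_mat X))\<^sup>T * exp_mat (tilde_mat Y) =
    C * ((exp_mat X)\<^sup>T * exp_mat Y) * C\<^sup>T"
proof -
  let ?K = "quat (-1) 0 0 0 1"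
  have K: "?K \<in> O_group 4" by (rule quat_unit_O) auto
  obtain a b c x y z where Xe: "X = quat 1 0 a b c + quat (-1) 0 x y z"
    and Xt: "tilde_mat X = ?K * (quat 1 0 a b c + quat (-1) 0 (- x) (- y) (- z)) * ?K\<^sup>T"
    using skew_mats_quat_decomp[OF X] by (elim exE conjE)
  obtain a2 b2 c2 x2 y2 z2 where Ye: "Y = quat 1 0 a2 b2 c2 + quat (-1) 0 x2 y2 z2"
    and Yt: "tilde_mat Y = ?K * (quat 1 0 a2 b2 c2 + quat (-1) 0 (- x2) (- y2) (- z2)) * ?K\<^sup>T"
    using skew_mats_quat_decomp[OF Y] by (elim exE conjE)
  define P M P2 M2 where PM: "P = exp_mat (quat 1 0 a b c)" "M = exp_mat (quat (-1) 0 x y z)"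
    "P2 = exp_mat (quat 1 0 a2 b2 c2)" "M2 = exp_mat (quat (-1) 0 x2 y2 z2)"
  have O: "P \<in> O_group 4" "M \<in> O_group 4" "P2 \<in> O_group 4" "M2 \<in> O_group 4"
    unfolding PM by (auto intro!: SO_O exp_mat_SO quat_skew)
  note Pc = O_groupD[OF O(1)] and Mc = O_groupD[OF O(2)] and P2c = O_groupD[OF O(3)] and M2c = O_groupD[OF O(4)] and Kc = O_groupD[OF K]
  have mc: "A * B \<in> carrier_mat 4 4" if "A \<in> carrier_mat 4 4" "B \<in> carrier_mat 4 4" for A B :: "real mat" using that by simp
  have neg: "exp_mat (quat (-1) 0 (- x) (- y) (- z)) = (exp_mat (quat (-1) 0 x y z))\<^sup>T" for x y z
    using exp_mat_uminus[OF quat_skew[of "-1" x y z]] quat_skew[of "-1" x y z] by (simp add: skew_mats_def quat_transpose)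
  have split: "exp_mat (quat 1 0 a b c + quat (-1) 0 x y z) = exp_mat (quat 1 0 a b c) * exp_mat (quat (-1) 0 x y z)" for a b c x y z
    by (rule exp_mat_add_commute[OF quat_carrier quat_carrier quat_commute])
  have comm: "exp_mat (quat 1 0 a b c) * exp_mat (quat (-1) 0 x y z) = exp_mat (quat (-1) 0 x y z) * exp_mat (quat 1 0 a b c)" for a b c x y z
  proof -
    have "quat 1 0 a b c + quat (-1) 0 x y z = quat (-1) 0 x y z + quat 1 0 a b c" by (rule comm_add_mat) auto
    then show ?thesis unfolding split[symmetric] exp_mat_add_commute[OF quat_carrier quat_carrier quat_commute[symmetric], symmetric] by simp
  qed
  have eX: "exp_mat X = P * M" "exp_mat Y = P2 * M2" unfolding Xe Ye split PM by auto
  have tX: "exp_mat (tilde_mat X) = ?K * (P * M\<^sup>T) * ?K\<^sup>T"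
    and tY: "exp_mat (tilde_mat Y) = ?K * (P2 * M2\<^sup>T) * ?K\<^sup>T"
    unfolding Xt Yt by (subst exp_mat_conj[OF K]; simp add: split neg PM)+
  \<comment> \<open>The right factor q^-1 r. That this product of exponentials is again a right
    multiplication is recovered from its commuting with left multiplications.\<close>
  define W where "W = M\<^sup>T * M2"
  have Wc: "W \<in> carrier_mat 4 4" unfolding W_def using Mc M2c by simp
  have IM: "quat 1 0 d e g * exp_mat (quat (-1) 0 x y z) = exp_mat (quat (-1) 0 x y z) * quat 1 0 d e g" if "d * d + e * e + g * g = 1" for d e g x y z
    by (rule exp_mat_commute_O[OF quat_unit_O quat_carrier quat_commute]) (use that in auto)
  have Wcomm: "W * quat 1 0 d e g = quat 1 0 d e g * W" if "d * d + e * e + g * g = 1" for d e g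
  proof -
    let ?I = "quat 1 0 d e g"
    have 1: "?I * M\<^sup>T = M\<^sup>T * ?I" unfolding PM neg[symmetric] by (rule IM[OF that])
    have 2: "?I * M2 = M2 * ?I" unfolding PM by (rule IM[OF that])
    have "W * ?I = M\<^sup>T * (M2 * ?I)" unfolding W_def by (rule assoc_mult_mat[OF Mc(2) M2c(1) quat_carrier])
    also have "\<dots> = M\<^sup>T * ?I * M2" unfolding 2[symmetric] by (rule assoc_mult_mat[OF Mc(2) quat_carrier M2c(1), symmetric])
    also have "\<dots> = ?I * W" unfolding 1[symmetric] W_def by (rule assoc_mult_mat[OF quat_carrier Mc(2) M2c(1)])
    finally show ?thesis .
  qed
  define w0 w1 w2 w3 where w: "w0 = W $$ (0, 0)" "w1 = W $$ (0, 1)" "w2 = W $$ (0, 2)" "w3 = W $$ (0, 3)"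
  have We: "W = quat (-1) w0 w1 w2 w3" unfolding w by (rule quat_commutant[OF Wc]) (auto intro: Wcomm)
  \<comment> \<open>A unit imaginary quaternion orthogonal to the imaginary part of
    \<open>W\<close>; conjugation by it sends \<open>W\<close> to its transpose.\<close>
  obtain u1 u2 u3 where u: "u1 * u1 + u2 * u2 + u3 * u3 = 1" "u1 * w1 + u2 * w2 + u3 * w3 = 0"
    using orthogonal_unit_vector3 by blast
  let ?U = "quat (-1) 0 u1 u2 u3"
  have U: "?U \<in> O_group 4" by (rule quat_unit_O) (use u in auto)
  note Uc = O_groupD[OF U]
  have UW: "?U * W = W\<^sup>T * ?U" unfolding We quat_transpose by (rule quat_anticommute[OF u(2)])
  have Wt: "W\<^sup>T = M2\<^sup>T * M" unfolding W_def using transpose_mult[OF Mc(2) M2c(1)] by simp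
  have UP: "?U * exp_mat (quat 1 0 a b c) = exp_mat (quat 1 0 a b c) * ?U" for a b c
    by (rule exp_mat_commute_O[OF U quat_carrier quat_commute[symmetric]])
  have Pt: "P\<^sup>T = exp_mat (quat 1 0 (- a) (- b) (- c))"
    using exp_mat_uminus[OF quat_skew[of 1 a b c]] quat_skew[of 1 a b c] by (simp add: skew_mats_def quat_transpose PM)
  have pc: "Z * (P\<^sup>T * P2) = (P\<^sup>T * P2) * Z"
    if Z: "Z \<in> carrier_mat 4 4" and cm: "\<And>a b c. Z * exp_mat (quat 1 0 a b c) = exp_mat (quat 1 0 a b c) * Z" for Z
  proof -
    have "Z * (P\<^sup>T * P2) = Z * P\<^sup>T * P2" by (rule assoc_mult_mat[OF Z Pc(2) P2c(1), symmetric])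
    also have "\<dots> = P\<^sup>T * (Z * P2)" unfolding Pt cm unfolding Pt[symmetric] by (rule assoc_mult_mat[OF Pc(2) Z P2c(1)])
    also have "\<dots> = (P\<^sup>T * P2) * Z" unfolding PM(3) cm unfolding PM(3)[symmetric] by (rule assoc_mult_mat[OF Pc(2) P2c(1) Z, symmetric])
    finally show ?thesis .
  qed
  define h where "h = unital 4"
  have hm: "h (A * B) = h A * h B" if "A \<in> carrier_mat 4 4" "B \<in> carrier_mat 4 4" for A B
    unfolding h_def by (rule unital_mult[OF that])
  let ?C = "?K * M * ?U"
  have C: "?C \<in> O_group 4" by (intro O_group_mult K O U)
  note Ct = O_groupD[OF C]
  have tXt: "(exp_mat (tilde_mat X))\<^sup>T = ?K * (M * P\<^sup>T) * ?K\<^sup>T"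
  proof -
    have 1: "P * M\<^sup>T \<in> carrier_mat 4 4" "?K * (P * M\<^sup>T) \<in> carrier_mat 4 4" using mc Pc Mc Kc by auto
    have "(exp_mat (tilde_mat X))\<^sup>T = ?K * (?K * (P * M\<^sup>T))\<^sup>T"
      unfolding tX transpose_mult[OF 1(2) Kc(2)] by simp
    also have "(?K * (P * M\<^sup>T))\<^sup>T = (P * M\<^sup>T)\<^sup>T * ?K\<^sup>T" by (rule transpose_mult[OF Kc(1) 1(1)])
    also have "(P * M\<^sup>T)\<^sup>T = M * P\<^sup>T" using transpose_mult[OF Pc(1) Mc(2)] by simp
    finally show ?thesis using mc Pc Mc Kc by (simp add: assoc_mult_mat[of _ 4 4 _ 4 _ 4])
  qed
  have CT: "?C\<^sup>T = ?U\<^sup>T * (M\<^sup>T * ?K\<^sup>T)"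
    using transpose_mult[OF mc[OF Kc(1) Mc(1)] Uc(1)] transpose_mult[OF Kc(1) Mc(1)] by simp
  have eXt: "(exp_mat X)\<^sup>T * exp_mat Y = P\<^sup>T * P2 * (M\<^sup>T * M2)"
  proof -
    have 1: "(P * M)\<^sup>T = P\<^sup>T * M\<^sup>T"
      unfolding PM comm using transpose_mult[OF exp_mat_carrier[OF quat_carrier] exp_mat_carrier[OF quat_carrier]] by simp
    have 2: "M\<^sup>T * P2 = P2 * M\<^sup>T" unfolding PM neg[symmetric] comm ..
    have "P\<^sup>T * M\<^sup>T * (P2 * M2) = P\<^sup>T * (M\<^sup>T * P2) * M2"
      using mc Pc Mc P2c M2c by (simp add: assoc_mult_mat[of _ 4 4 _ 4 _ 4])
    then show ?thesis unfolding eX 1 2 using mc Pc Mc P2c M2c by (simp add: assoc_mult_mat[of _ 4 4 _ 4 _ 4])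
  qed
  let ?L = "(exp_mat (tilde_mat X))\<^sup>T * exp_mat (tilde_mat Y)"
    and ?R = "?C * (P\<^sup>T * P2 * (M\<^sup>T * M2)) * ?C\<^sup>T"
  have hK: "h (?K\<^sup>T) * h ?K = 1"
    unfolding hm[OF Kc(2,1), symmetric] Kc(4) unfolding h_def by (rule unital_one)
  have "h ?L = h ?K * (h M * h (P\<^sup>T)) * (h P2 * h (M2\<^sup>T)) * h (?K\<^sup>T)"
  proof -
    have "h ?L = h ?K * (h M * h (P\<^sup>T)) * (h (?K\<^sup>T) * h ?K) * (h P2 * h (M2\<^sup>T)) * h (?K\<^sup>T)"
      unfolding tXt tY using Pc Mc P2c M2c Kc by (simp add: hm mc mult.assoc)
    then show ?thesis unfolding hK by simp
  qed
  also have "\<dots> = h ?K * h M * h ?U * (h (P\<^sup>T) * h P2 * (h (M\<^sup>T) * h M2)) * h (?U\<^sup>T) * h (M\<^sup>T) * h (?K\<^sup>T)"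
  proof (rule monoid_twist)
    have m1: "M * exp_mat (quat 1 0 a b c) = exp_mat (quat 1 0 a b c) * M" for a b c unfolding PM comm ..
    show "h ?U * (h (P\<^sup>T) * h P2) = h (P\<^sup>T) * h P2 * h ?U"
      using arg_cong[OF pc[OF Uc(1) UP], of h] Pc P2c Uc by (simp add: hm mc mult.assoc)
    show "h M * (h (P\<^sup>T) * h P2) = h (P\<^sup>T) * h P2 * h M"
      using arg_cong[OF pc[OF Mc(1) m1], of h] Pc P2c Mc by (simp add: hm mc mult.assoc)
    show "h ?U * (h (M\<^sup>T) * h M2) = h (M2\<^sup>T) * h M * h ?U"
      using arg_cong[OF UW, of h] unfolding Wt unfolding W_def using Mc M2c Uc by (simp add: hm mc mult.assoc)
    show "h ?U * h (?U\<^sup>T) = 1" unfolding hm[OF Uc(1,2), symmetric] Uc(3) unfolding h_def by (rule unital_one)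
    show "h M * h (M\<^sup>T) = 1" unfolding hm[OF Mc(1,2), symmetric] Mc(3) unfolding h_def by (rule unital_one)
  qed
  also have "\<dots> = h ?R" unfolding CT using Pc Mc P2c M2c Kc Uc by (simp add: hm mc mult.assoc)
  finally have hh: "h ?L = h ?R" .
  have cR: "?R \<in> carrier_mat 4 4" using Pc P2c Mc M2c Ct(2) by (intro mc quat_carrier)
  have cL: "?L \<in> carrier_mat 4 4"
    by (rule mc[OF _ exp_mat_carrier[OF tilde_carrier]]) (simp add: exp_mat_carrier[OF tilde_carrier])
  have "of_unital 4 (h ?L) = of_unital 4 (h ?R)" unfolding hh ..
  then have "?L = ?R" unfolding h_def of_unital_unital[OF cL] of_unital_unital[OF cR] .
  then show ?thesis unfolding eXt using C by (intro bexI[of _ ?C])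
qed

section \<open>Classification of the isometries\<close>

lemma transpose_left_cancel:
  assumes S: "S \<in> O_group n" and A: "A \<in> carrier_mat n n" and B: "B \<in> carrier_mat n n"
  shows "(S * A)\<^sup>T * (S * B) = A\<^sup>T * B"
proof -
  note s = O_groupD[OF S]
  have At: "A\<^sup>T \<in> carrier_mat n n" and SB: "S * B \<in> carrier_mat n n" using A B s by auto
  have "(S * A)\<^sup>T * (S * B) = A\<^sup>T * (S\<^sup>T * (S * B))"
    unfolding transpose_mult[OF s(1) A] by (rule assoc_mult_mat[OF At s(2) SB])
  also have "S\<^sup>T * (S * B) = S\<^sup>T * S * B" by (rule assoc_mult_mat[OF s(2,1) B, symmetric])
  finally show ?thesis unfolding s(4) using B by simp
qed

context circle_metric
begin

text \<open>This is the invariance of the distance under inversion: the transpose of the left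
  argument is A (A^T B) A^T, a conjugate of the right one.\<close>

lemma \<delta>_mult_transpose:
  assumes A: "A \<in> O_group n" and B: "B \<in> O_group n"
  shows "\<delta> (A * B\<^sup>T) = \<delta> (A\<^sup>T * B)"
proof -
  note a = O_groupD[OF A] and b = O_groupD[OF B]
  have AB: "A\<^sup>T * B \<in> O_group n" by (intro O_group_mult O_group_transpose A B)
  have BA: "B * A\<^sup>T \<in> O_group n" by (intro O_group_mult O_group_transpose A B)
  have "(B * A\<^sup>T)\<^sup>T = A * B\<^sup>T"
    using transpose_mult[OF b(1) a(2)] by simp
  then have "\<delta> (A * B\<^sup>T) = \<delta> (B * A\<^sup>T)" using \<delta>_transpose[OF BA] by simp
  also have "B * A\<^sup>T = A * (A\<^sup>T * B) * A\<^sup>T"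
  proof -
    have "A * (A\<^sup>T * B) = A * A\<^sup>T * B" by (rule assoc_mult_mat[OF a(1,2) b(1), symmetric])
    then show ?thesis unfolding a(3) using b by simp
  qed
  also have "\<delta> \<dots> = \<delta> (A\<^sup>T * B)" by (rule \<delta>_conj[OF AB A])
  finally show ?thesis .
qed

lemma d_Nf_twisted:
  assumes P: "P \<in> O_group n" and Q: "Q \<in> O_group n" and E: "E \<in> O_group n" and F: "F \<in> O_group n"
  shows "d_Nf N f (P * Q * E * Q\<^sup>T) (P * Q * F * Q\<^sup>T) = \<delta> (E\<^sup>T * F)"
proof -
  note q = O_groupD[OF Q] and e = O_groupD[OF E] and f = O_groupD[OF F]
  have PQ: "P * Q \<in> O_group n" by (rule O_group_mult[OF P Q])
  have EQ: "E * Q\<^sup>T \<in> carrier_mat n n" "F * Q\<^sup>T \<in> carrier_mat n n" using q e f by auto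
  have EF: "E\<^sup>T * F \<in> O_group n" by (intro O_group_mult O_group_transpose E F)
  have s: "P * Q * G * Q\<^sup>T = P * Q * (G * Q\<^sup>T)" if "G \<in> carrier_mat n n" for G
    by (rule assoc_mult_mat[OF O_groupD(1)[OF PQ] that q(2)])
  have O: "P * Q * E * Q\<^sup>T \<in> O_group n"
    by (intro O_group_mult O_group_transpose P Q E)
  have "(P * Q * (E * Q\<^sup>T))\<^sup>T * (P * Q * (F * Q\<^sup>T)) =
      (E * Q\<^sup>T)\<^sup>T * (F * Q\<^sup>T)"
    by (rule transpose_left_cancel[OF PQ EQ])
  also have "(E * Q\<^sup>T)\<^sup>T = Q * E\<^sup>T"
    using transpose_mult[OF e(1) q(2)] by simp
  also have "Q * E\<^sup>T * (F * Q\<^sup>T) = Q * (E\<^sup>T * F) * Q\<^sup>T"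
  proof -
    have QE: "Q * E\<^sup>T \<in> carrier_mat n n" using q e by auto
    have "Q * E\<^sup>T * (F * Q\<^sup>T) = Q * E\<^sup>T * F * Q\<^sup>T"
      by (rule assoc_mult_mat[OF QE f(1) q(2), symmetric])
    also have "Q * E\<^sup>T * F = Q * (E\<^sup>T * F)" by (rule assoc_mult_mat[OF q(1) e(2) f(1)])
    finally show ?thesis .
  qed
  finally show ?thesis
    unfolding d_Nf_\<delta>[OF O] unfolding s[OF e(1)] s[OF f(1)] using \<delta>_conj[OF EF Q] by simp
qed

lemma isometry_forms:
  assumes \<phi>: "\<phi> \<in> SO_group n \<rightarrow> SO_group n"
    and iso: "\<And>A B. A \<in> SO_group n ==> B \<in> SO_group n ==> d_Nf N f (\<phi> A) (\<phi> B) = d_Nf N f A B"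
  shows "\<exists>Q \<in> O_group n.
      (\<forall>A \<in> SO_group n. \<phi> A = \<phi> (1\<^sub>m n) * Q * A * inv_mat Q)
    \<or> (\<forall>A \<in> SO_group n. \<phi> A = \<phi> (1\<^sub>m n) * Q * inv_mat A * inv_mat Q)
    \<or> (n = 4 \<and> (\<forall>A \<in> SO_group 4. \<forall>X \<in> skew_mats 4. exp_mat X = A -->
          \<phi> A = \<phi> (1\<^sub>m n) * Q * exp_mat (tilde_mat X) * inv_mat Q))
    \<or> (n = 4 \<and> (\<forall>A \<in> SO_group 4. \<forall>X \<in> skew_mats 4. exp_mat X = A -->
          \<phi> A = \<phi> (1\<^sub>m n) * Q * exp_mat (- tilde_mat X) * inv_mat Q))"
proof -
  let ?P = "\<phi> (1\<^sub>m n)"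
  have S: "\<phi> A \<in> SO_group n" if "A \<in> SO_group n" for A using \<phi> that by (rule funcset_mem)
  note PS = S[OF SO_group_one]
  note p = O_groupD[OF SO_O[OF PS]]
  define \<psi> where "\<psi> A = ?P\<^sup>T * \<phi> A" for A
  have \<psi>S: "\<psi> A \<in> SO_group n" if "A \<in> SO_group n" for A
    unfolding \<psi>_def by (intro SO_group_mult SO_group_transpose PS S that)
  have \<psi>1: "\<psi> (1\<^sub>m n) = 1\<^sub>m n" by (simp add: \<psi>_def p(4))
  have \<psi>d: "d_Nf N f (\<psi> A) (\<psi> B) = d_Nf N f A B" if A: "A \<in> SO_group n" and B: "B \<in> SO_group n" for A B
  proof -
    have "d_Nf N f (\<psi> A) (\<psi> B) = \<delta> ((\<phi> A)\<^sup>T * \<phi> B)"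
      unfolding d_Nf_\<delta>[OF SO_O[OF \<psi>S[OF A]]] unfolding \<psi>_def
      using transpose_left_cancel[OF O_group_transpose[OF SO_O[OF PS]] SO_carrier[OF S[OF A]] SO_carrier[OF S[OF B]]] by simp
    also have "\<dots> = d_Nf N f (\<phi> A) (\<phi> B)" unfolding d_Nf_\<delta>[OF SO_O[OF S[OF A]]] ..
    finally show ?thesis using iso[OF A B] by simp
  qed
  have \<phi>\<psi>: "\<phi> A = ?P * \<psi> A" if "A \<in> SO_group n" for A
  proof -
    note c = SO_carrier[OF S[OF that]]
    have "?P * \<psi> A = ?P * ?P\<^sup>T * \<phi> A" unfolding \<psi>_def by (rule assoc_mult_mat[OF p(1,2) c, symmetric])
    then show ?thesis unfolding p(3) using c by simp
  qed
  have "\<exists>Q\<in>O_group n.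
    (\<forall>X\<in>skew_mats n. \<psi> (exp_mat X) = exp_mat (Q * X * Q\<^sup>T)) \<or>
    (\<forall>X\<in>skew_mats n. \<psi> (exp_mat X) = exp_mat (Q * (- X) * Q\<^sup>T)) \<or>
    (n = 4 \<and> (\<forall>X\<in>skew_mats n. \<psi> (exp_mat X) = exp_mat (Q * tilde_mat X * Q\<^sup>T))) \<or>
    (n = 4 \<and> (\<forall>X\<in>skew_mats n. \<psi> (exp_mat X) = exp_mat (Q * (- tilde_mat X) * Q\<^sup>T)))" (is "\<exists>Q\<in>_. ?c Q")
    by (rule isometry_conj_part) (use \<psi>S \<psi>d \<psi>1 in auto)
  then obtain Q where Q: "Q \<in> O_group n" and cs:
    "?c Q" by (rule bexE)
  note q = O_groupD[OF Q]
  have tw: "\<phi> (exp_mat X) = ?P * Q * exp_mat Y * inv_mat Q"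
    if X: "X \<in> skew_mats n" and Y: "Y \<in> carrier_mat n n" and e: "\<psi> (exp_mat X) = exp_mat (Q * Y * Q\<^sup>T)" for X Y
  proof -
    note E = exp_mat_carrier[OF Y]
    have QE: "Q * exp_mat Y \<in> carrier_mat n n" using q(1) E by simp
    have "\<phi> (exp_mat X) = ?P * (Q * exp_mat Y * Q\<^sup>T)"
      unfolding \<phi>\<psi>[OF exp_mat_SO[OF X]] e exp_mat_conj[OF Q Y] ..
    also have "\<dots> = ?P * (Q * exp_mat Y) * Q\<^sup>T" by (rule assoc_mult_mat[OF p(1) QE q(2), symmetric])
    also have "?P * (Q * exp_mat Y) = ?P * Q * exp_mat Y" by (rule assoc_mult_mat[OF p(1) q(1) E, symmetric])
    finally show ?thesis unfolding inv_mat_O[OF Q] .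
  qed
  have surj: "\<exists>X\<in>skew_mats n. exp_mat X = A" if "A \<in> SO_group n" for A
    using exp_mat_surj[OF that] by (elim bexE conjE) (erule (1) bexI)
  from cs show ?thesis
  proof (elim disjE conjE)
    assume a: "\<forall>X\<in>skew_mats n. \<psi> (exp_mat X) = exp_mat (Q * X * Q\<^sup>T)"
    have "\<phi> A = ?P * Q * A * inv_mat Q" if A: "A \<in> SO_group n" for A
    proof -
      obtain X where X: "X \<in> skew_mats n" "exp_mat X = A" using surj[OF A] by (elim bexE)
      show ?thesis using tw[OF X(1) skew_carrier[OF X(1)] bspec[OF a X(1)]] unfolding X(2) .
    qed
    then have "\<forall>A\<in>SO_group n. \<phi> A = ?P * Q * A * inv_mat Q" by (rule ballI)
    then show ?thesis by (rule bexI[OF disjI1 Q])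
  next
    assume a: "\<forall>X\<in>skew_mats n. \<psi> (exp_mat X) = exp_mat (Q * (- X) * Q\<^sup>T)"
    have "\<phi> A = ?P * Q * inv_mat A * inv_mat Q" if A: "A \<in> SO_group n" for A
    proof -
      obtain X where X: "X \<in> skew_mats n" "exp_mat X = A" using surj[OF A] by (elim bexE)
      have "- X \<in> carrier_mat n n" using skew_carrier[OF X(1)] by simp
      from tw[OF X(1) this bspec[OF a X(1)]] show ?thesis
        unfolding exp_mat_uminus[OF X(1)] X(2) inv_mat_O[OF SO_O[OF A]] .
    qed
    then have "\<forall>A\<in>SO_group n. \<phi> A = ?P * Q * inv_mat A * inv_mat Q" by (rule ballI)
    then show ?thesis by (rule bexI[OF disjI2[OF disjI1] Q])
  next
    assume n4: "n = 4" and a: "\<forall>X\<in>skew_mats n. \<psi> (exp_mat X) = exp_mat (Q * tilde_mat X * Q\<^sup>T)"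
    have "\<phi> (exp_mat X) = ?P * Q * exp_mat (tilde_mat X) * inv_mat Q" if "X \<in> skew_mats n" for X
      by (rule tw[OF that _ bspec[OF a that]]) (simp add: n4)
    then have "\<forall>A\<in>SO_group 4. \<forall>X\<in>skew_mats 4. exp_mat X = A --> \<phi> A = ?P * Q * exp_mat (tilde_mat X) * inv_mat Q"
      by (auto simp: n4)
    then show ?thesis by (intro bexI[OF disjI2[OF disjI2[OF disjI1[OF conjI[OF n4]]]] Q])
  next
    assume n4: "n = 4" and a: "\<forall>X\<in>skew_mats n. \<psi> (exp_mat X) = exp_mat (Q * (- tilde_mat X) * Q\<^sup>T)"
    have "\<phi> (exp_mat X) = ?P * Q * exp_mat (- tilde_mat X) * inv_mat Q" if "X \<in> skew_mats n" for X
      by (rule tw[OF that _ bspec[OF a that]]) (simp add: n4)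
    then have "\<forall>A\<in>SO_group 4. \<forall>X\<in>skew_mats 4. exp_mat X = A --> \<phi> A = ?P * Q * exp_mat (- tilde_mat X) * inv_mat Q"
      by (auto simp: n4)
    then show ?thesis by (intro bexI[OF disjI2[OF disjI2[OF disjI2[OF conjI[OF n4]]]] Q])
  qed
qed

text \<open>The forms with \<open>tilde_mat\<close> prescribe the value for every logarithm of a
  matrix, so one logarithm of \<open>A\<close> and one of \<open>B\<close> may be chosen;
  \<open>exp_tilde_similar\<close> then shows that the quotient changes only by an orthogonal
  similarity.\<close>

lemma forms_isometry:
  assumes P: "\<phi> (1\<^sub>m n) \<in> O_group n" and Q: "Q \<in> O_group n"
    and forms: "(\<forall>A \<in> SO_group n. \<phi> A = \<phi> (1\<^sub>m n) * Q * A * inv_mat Q)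
    \<or> (\<forall>A \<in> SO_group n. \<phi> A = \<phi> (1\<^sub>m n) * Q * inv_mat A * inv_mat Q)
    \<or> (n = 4 \<and> (\<forall>A \<in> SO_group 4. \<forall>X \<in> skew_mats 4. exp_mat X = A -->
          \<phi> A = \<phi> (1\<^sub>m n) * Q * exp_mat (tilde_mat X) * inv_mat Q))
    \<or> (n = 4 \<and> (\<forall>A \<in> SO_group 4. \<forall>X \<in> skew_mats 4. exp_mat X = A -->
          \<phi> A = \<phi> (1\<^sub>m n) * Q * exp_mat (- tilde_mat X) * inv_mat Q))"
    and A: "A \<in> SO_group n" and B: "B \<in> SO_group n"
  shows "d_Nf N f (\<phi> A) (\<phi> B) = d_Nf N f A B"
proof -
  note ao = SO_O[OF A] and bo = SO_O[OF B]
  note tw = d_Nf_twisted[OF P Q] and inv = inv_mat_O[OF Q] inv_mat_O[OF ao] inv_mat_O[OF bo]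
  obtain X where X: "X \<in> skew_mats n" "exp_mat X = A" using exp_mat_surj[OF A] by (elim bexE conjE)
  obtain Y where Y: "Y \<in> skew_mats n" "exp_mat Y = B" using exp_mat_surj[OF B] by (elim bexE conjE)
  have AB: "A\<^sup>T * B \<in> O_group n" by (intro O_group_mult O_group_transpose ao bo)
  have tilde: "tilde_mat X \<in> skew_mats n" "tilde_mat Y \<in> skew_mats n"
    "\<delta> ((exp_mat (tilde_mat X))\<^sup>T * exp_mat (tilde_mat Y)) = \<delta> (A\<^sup>T * B)" if n4: "n = 4"
  proof -
    show "tilde_mat X \<in> skew_mats n" "tilde_mat Y \<in> skew_mats n" using tilde_skew X Y n4 by auto
    obtain C where C: "C \<in> O_group 4" "(exp_mat (tilde_mat X))\<^sup>T * exp_mat (tilde_mat Y) =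
        C * ((exp_mat X)\<^sup>T * exp_mat Y) * C\<^sup>T"
      using exp_tilde_similar[of X Y] X Y n4 by auto
    show "\<delta> ((exp_mat (tilde_mat X))\<^sup>T * exp_mat (tilde_mat Y)) = \<delta> (A\<^sup>T * B)"
      unfolding C(2) X(2) Y(2) by (rule \<delta>_conj[OF AB]) (simp add: C n4)
  qed
  from forms show ?thesis
  proof (elim disjE conjE)
    assume a: "\<forall>A \<in> SO_group n. \<phi> A = \<phi> (1\<^sub>m n) * Q * A * inv_mat Q"
    show ?thesis unfolding bspec[OF a A] bspec[OF a B] inv tw[OF ao bo] d_Nf_\<delta>[OF ao] ..
  next
    assume a: "\<forall>A \<in> SO_group n. \<phi> A = \<phi> (1\<^sub>m n) * Q * inv_mat A * inv_mat Q"
    have "\<phi> A = \<phi> (1\<^sub>m n) * Q * A\<^sup>T * Q\<^sup>T" "\<phi> B = \<phi> (1\<^sub>m n) * Q * B\<^sup>T * Q\<^sup>T"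
      using bspec[OF a A] bspec[OF a B] unfolding inv .
    then have "d_Nf N f (\<phi> A) (\<phi> B) = \<delta> ((A\<^sup>T)\<^sup>T * B\<^sup>T)"
      using tw[OF O_group_transpose[OF ao] O_group_transpose[OF bo]] by (simp only:)
    then show ?thesis unfolding d_Nf_\<delta>[OF ao] using \<delta>_mult_transpose[OF ao bo] by simp
  next
    assume n4: "n = 4" and a: "\<forall>A \<in> SO_group 4. \<forall>X \<in> skew_mats 4. exp_mat X = A -->
          \<phi> A = \<phi> (1\<^sub>m n) * Q * exp_mat (tilde_mat X) * inv_mat Q"
    note t = tilde[OF n4]
    have "\<phi> A = \<phi> (1\<^sub>m n) * Q * exp_mat (tilde_mat X) * Q\<^sup>T" "\<phi> B = \<phi> (1\<^sub>m n) * Q * exp_mat (tilde_mat Y) * Q\<^sup>T"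
      using a[rule_format, of A X] a[rule_format, of B Y] A B X Y unfolding inv by (simp_all add: n4)
    then have "d_Nf N f (\<phi> A) (\<phi> B) = \<delta> ((exp_mat (tilde_mat X))\<^sup>T * exp_mat (tilde_mat Y))"
      using tw[OF SO_O[OF exp_mat_SO[OF t(1)]] SO_O[OF exp_mat_SO[OF t(2)]]] by (simp only:)
    then show ?thesis unfolding t(3) d_Nf_\<delta>[OF ao] .
  next
    assume n4: "n = 4" and a: "\<forall>A \<in> SO_group 4. \<forall>X \<in> skew_mats 4. exp_mat X = A -->
          \<phi> A = \<phi> (1\<^sub>m n) * Q * exp_mat (- tilde_mat X) * inv_mat Q"
    note t = tilde[OF n4]
    note eo = SO_O[OF exp_mat_SO[OF t(1)]] SO_O[OF exp_mat_SO[OF t(2)]]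
    have "\<phi> A = \<phi> (1\<^sub>m n) * Q * exp_mat (- tilde_mat X) * Q\<^sup>T" "\<phi> B = \<phi> (1\<^sub>m n) * Q * exp_mat (- tilde_mat Y) * Q\<^sup>T"
      using a[rule_format, of A X] a[rule_format, of B Y] A B X Y unfolding inv by (simp_all add: n4)
    then have "d_Nf N f (\<phi> A) (\<phi> B) = \<delta> (((exp_mat (tilde_mat X))\<^sup>T)\<^sup>T * (exp_mat (tilde_mat Y))\<^sup>T)"
      unfolding exp_mat_uminus[OF t(1)] exp_mat_uminus[OF t(2)]
      using tw[OF O_group_transpose[OF eo(1)] O_group_transpose[OF eo(2)]] by (simp only:)
    also have "\<dots> = \<delta> ((exp_mat (tilde_mat X))\<^sup>T * exp_mat (tilde_mat Y))"
      using \<delta>_mult_transpose[OF eo] by simp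
    finally show ?thesis unfolding t(3) d_Nf_\<delta>[OF ao] .
  qed
qed

end

theorem theorem2p1:
  fixes n :: nat
    and N :: "complex mat \<Rightarrow> real"
    and f :: "complex \<Rightarrow> complex"
    and \<phi> :: "real mat \<Rightarrow> real mat"
  assumes "n > 0"
    and "unitary_invariant_norm n N"
    and "\<not> multiple_of_frobenius n N"
    and "bounded (f ` sphere 0 1)"
    and f1: "\<And>z. z \<in> sphere 0 1 \<Longrightarrow> f z = 0 \<longleftrightarrow> z = 1"
    and f2: "conformal_at_one f"
    and f3: "continuous_on (sphere 0 1 - {-1}) f"
    and f4: "((\<lambda>t. f (exp (\<i> * complex_of_real t))) \<longlongrightarrow> f (-1)) (at_left pi)"
    and f5: "\<exists>l. l \<noteq> 0 \<and> ((\<lambda>t. f (exp (\<i> * complex_of_real t))) \<longlongrightarrow> l) (at_right (- pi))"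
    and "\<phi> \<in> SO_group n \<rightarrow> SO_group n"
  shows "(\<forall>A \<in> SO_group n. \<forall>B \<in> SO_group n. d_Nf N f (\<phi> A) (\<phi> B) = d_Nf N f A B) \<longleftrightarrow>
    (\<exists>Q \<in> O_group n.
        (\<forall>A \<in> SO_group n. \<phi> A = \<phi> (1\<^sub>m n) * Q * A * inv_mat Q)
      \<or> (\<forall>A \<in> SO_group n. \<phi> A = \<phi> (1\<^sub>m n) * Q * inv_mat A * inv_mat Q)
      \<or> (n = 4 \<and> (\<forall>A \<in> SO_group 4. \<forall>X \<in> skew_mats 4. exp_mat X = A \<longrightarrow>
            \<phi> A = \<phi> (1\<^sub>m n) * Q * exp_mat (tilde_mat X) * inv_mat Q))
      \<or> (n = 4 \<and> (\<forall>A \<in> SO_group 4. \<forall>X \<in> skew_mats 4. exp_mat X = A \<longrightarrow>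
            \<phi> A = \<phi> (1\<^sub>m n) * Q * exp_mat (- tilde_mat X) * inv_mat Q)))"
    (is "?iso \<longleftrightarrow> (\<exists>Q\<in>_. ?form Q)")
proof -
  interpret circle_metric n N f
    by unfold_locales (fact assms(1) assms(2) assms(4) f1 f2 f3 f4 f5)+
  show ?thesis
  proof
    assume ?iso
    then show "\<exists>Q\<in>O_group n. ?form Q" by (intro isometry_forms[OF assms(10)]) (drule (1) bspec, drule (1) bspec)
  next
    assume "\<exists>Q\<in>O_group n. ?form Q"
    then obtain Q where Q: "Q \<in> O_group n" and forms: "?form Q" by (rule bexE)
    show ?iso
      using forms_isometry[OF SO_O[OF funcset_mem[OF assms(10) SO_group_one]] Q forms] by (intro ballI)
  qed
qed

end
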